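(* Let $n>1$ and $q=e^{\pi i/n}$. The Temperley-Lieb-Jones category $\mathrm{TLJ}(q)$ evaluated at $q$ is semisimple, with simple objects the Jones-Wenzl idempotents $p_i$ for $0\le i\le n-2$ (that is, these form a collection of disjoint simple objects and every object of $\mathrm{TLJ}(q)$ is isomorphic to a finite direct sum of them).
   Context: A simple Temperley-Lieb (TL) diagram from $x$ to $y$ points is a planar diagram in the unit square with $x$ marked points on the bottom edge and $y$ on the top edge, consisting of pairwise disjoint smooth arcs matching the marked points in pairs, together with finitely many disjoint closed loops, up to planar isotopy (there are none if $x+y$ is odd). For $q=e^{\pi i/n}$, $n>1$, let $[m]=\frac{q^m-q^{-m}}{q-q^{-1}}$. The category $\mathrm{TL}(q)$ has objects the non-negative integers, and $\mathrm{Hom}(x,y)$ is the $\mathbb{C}$-span of simple TL diagrams from $x$ to $y$ points modulo the relation that a diagram with a closed loop equals $d=q+q^{-1}$ times the diagram with the loop removed. Composition $g\circ f$ stacks $g$ on top of $f$; the tensor product is addition on objects and horizontal juxtaposition on diagrams; $\mathrm{id}_m$ is the diagram with $m$ vertical strands. The trace $\mathrm{tr}(f)$ of $f\in\mathrm{Hom}(x,x)$ is the element of $\mathrm{Hom}(0,0)=\mathbb{C}$ obtained by joining corresponding top and bottom points by disjoint arcs outside the square. A morphism $f\colon x\to y$ is negligible if $\mathrm{tr}(gf)=0$ for all $g\colon y\to x$; $\mathcal N$ denotes the collection of negligible morphisms (a tensor ideal), and $\mathrm{TL}(q)/\mathcal N$ is the quotient category, with hom-spaces $\mathrm{Hom}(x,y)/(\mathcal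 N\cap\mathrm{Hom}(x,y))$. The Jones-Wenzl idempotents $p_m\in\mathrm{Hom}(m,m)$, $0\le m\le n-1$, are defined by: $p_0$ is the empty diagram, $p_1=\mathrm{id}_1$, and $p_{m+1}=p_m\otimes \mathrm{id}_1-\frac{[m]}{[m+1]}(p_m\otimes\mathrm{id}_1)\,U_m\,(p_m\otimes\mathrm{id}_1)$ for $1\le m\le n-2$, where $U_m\in\mathrm{Hom}(m+1,m+1)$ has a cup joining the last two top points, a cap joining the last two bottom points and vertical strands elsewhere. ($p_{n-1}$ is negligible.) The Karoubi envelope $\mathrm{Kar}\,\mathcal{C}$ has as objects the idempotents $p\colon x\to x$ of $\mathcal C$; a morphism from $p\colon x\to x$ to $r\colon y\to y$ is a morphism $f\colon x\to y$ of $\mathcal{C}$ with $fp=f=rf$. The additive completion $\mathrm{Mat}\,\mathcal C$ has as objects formal finite direct sums of objects of $\mathcal C$ and as morphisms matrices of morphisms of $\mathcal C$. The tensor product extends to $\mathrm{Mat}\,\mathrm{Kar}(\mathrm{TL}(q)/\mathcal N)$, bilinearly over $\oplus$. The category $\mathrm{TLJ}(q)$ is the full subcategory of $\mathrm{Mat}\,\mathrm{Kar}(\mathrm{TL}(q)/\mathcal N)$ whose objects are the closure of $\{p_i: 0\le i\le n-2\}$ under direct sum and tensor product. An object $x$ of a $\mathbb{C}$-linear category is simple if $\mathrm{Hom}(x,x)=\mathrm{span}_{\mathbb C}\{1_x\}$; a collection $S$ of simple objects is a collection of disjoint simple objects if $\mathrm{Hom}(x,y)=0$ for all $x\ne y$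 in $S$. A $\mathbb{C}$-linear category with biproduct $\oplus$ is semisimple if there is a collection $S$ of disjoint simple objects such that every object is isomorphic to a finite biproduct of objects of $S$. *)

theory Defs
  imports
    "Jordan_Normal_Form.VS_Connect"
    "HOL-Algebra.AbelCoset"
    "HOL-Library.Poly_Mapping"
    "HOL-Library.Disjoint_Sets"
begin

section \<open>Linear categories\<close>

text \<open>
  Hom-spaces are complex vector spaces in the sense of the \<open>vectorspace\<close> locale; the
  ring multiplication and unit that the \<open>module\<close> record also carries are never used.
  Hom-spaces of different pairs of objects may overlap as sets, so composition takes the
  objects as arguments: \<open>Comp C x y z g f\<close> is the composite of \<open>f : x \<rightarrow> y\<close> with \<open>g : y \<rightarrow> z\<close>.
\<close>

record ('o, 'm) lin_cat =
  Obj :: "'o set"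
  Hom :: "'o \<Rightarrow> 'o \<Rightarrow> (complex, 'm) module"
  Ident :: "'o \<Rightarrow> 'm"
  Comp :: "'o \<Rightarrow> 'o \<Rightarrow> 'o \<Rightarrow> 'm \<Rightarrow> 'm \<Rightarrow> 'm"

abbreviation Mor :: "('o, 'm, 'z) lin_cat_scheme \<Rightarrow> 'o \<Rightarrow> 'o \<Rightarrow> 'm set" where
  "Mor C x y \<equiv> carrier (Hom C x y)"

locale linear_category =
  fixes C :: "('o, 'm, 'z) lin_cat_scheme"
  assumes hom_vectorspace:
      "\<lbrakk>x \<in> Obj C; y \<in> Obj C\<rbrakk> \<Longrightarrow> vectorspace class_ring (Hom C x y)"
    and ident_closed: "x \<in> Obj C \<Longrightarrow> Ident C x \<in> Mor C x x"
    and comp_closed: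
      "\<lbrakk>x \<in> Obj C; y \<in> Obj C; z \<in> Obj C; f \<in> Mor C x y; g \<in> Mor C y z\<rbrakk>
        \<Longrightarrow> Comp C x y z g f \<in> Mor C x z"
    and comp_ident_right:
      "\<lbrakk>x \<in> Obj C; y \<in> Obj C; f \<in> Mor C x y\<rbrakk> \<Longrightarrow> Comp C x x y f (Ident C x) = f"
    and comp_ident_left:
      "\<lbrakk>x \<in> Obj C; y \<in> Obj C; f \<in> Mor C x y\<rbrakk> \<Longrightarrow> Comp C x y y (Ident C y) f = f"
    and comp_assoc:
      "\<lbrakk>w \<in> Obj C; x \<in> Obj C; y \<in> Obj C; z \<in> Obj C;
        f \<in> Mor C w x; g \<in> Mor C x y; h \<in> Mor C y z\<rbrakk>
        \<Longrightarrow> Comp C w y z h (Comp C w x y g f) = Comp C w x z (Comp C x y z h g) f"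
    and comp_add_right:
      "\<lbrakk>x \<in> Obj C; y \<in> Obj C; z \<in> Obj C; f \<in> Mor C x y; f' \<in> Mor C x y; g \<in> Mor C y z\<rbrakk>
        \<Longrightarrow> Comp C x y z g (f \<oplus>\<^bsub>Hom C x y\<^esub> f')
            = Comp C x y z g f \<oplus>\<^bsub>Hom C x z\<^esub> Comp C x y z g f'"
    and comp_add_left:
      "\<lbrakk>x \<in> Obj C; y \<in> Obj C; z \<in> Obj C; f \<in> Mor C x y; g \<in> Mor C y z; g' \<in> Mor C y z\<rbrakk>
        \<Longrightarrow> Comp C x y z (g \<oplus>\<^bsub>Hom C y z\<^esub> g') f
            = Comp C x y z g f \<oplus>\<^bsub>Hom C x z\<^esub> Comp C x y z g' f"
    and comp_smult_right:
      "\<lbrakk>x \<in> Obj C; y \<in> Obj C; z \<in> Obj C; f \<in> Mor C x y; g \<in> Mor C y z\<rbrakk>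
        \<Longrightarrow> Comp C x y z g (c \<odot>\<^bsub>Hom C x y\<^esub> f) = c \<odot>\<^bsub>Hom C x z\<^esub> Comp C x y z g f"
    and comp_smult_left:
      "\<lbrakk>x \<in> Obj C; y \<in> Obj C; z \<in> Obj C; f \<in> Mor C x y; g \<in> Mor C y z\<rbrakk>
        \<Longrightarrow> Comp C x y z (c \<odot>\<^bsub>Hom C y z\<^esub> g) f = c \<odot>\<^bsub>Hom C x z\<^esub> Comp C x y z g f"

definition isomorphic :: "('o, 'm, 'z) lin_cat_scheme \<Rightarrow> 'o \<Rightarrow> 'o \<Rightarrow> bool" where
  "isomorphic C x y \<longleftrightarrow>
    (\<exists>f \<in> Mor C x y. \<exists>g \<in> Mor C y x.
      Comp C x y x g f = Ident C x \<and> Comp C y x y f g = Ident C y)"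

text \<open>The empty list is allowed: a biproduct of the empty list is a zero object.\<close>

definition is_biproduct :: "('o, 'm, 'z) lin_cat_scheme \<Rightarrow> 'o list \<Rightarrow> 'o \<Rightarrow> bool" where
  "is_biproduct C xs b \<longleftrightarrow>
    (\<exists>inj proj.
      (\<forall>i < length xs. inj i \<in> Mor C (xs ! i) b \<and> proj i \<in> Mor C b (xs ! i)) \<and>
      (\<forall>i < length xs. \<forall>j < length xs.
        Comp C (xs ! i) b (xs ! j) (proj j) (inj i)
          = (if i = j then Ident C (xs ! i) else \<zero>\<^bsub>Hom C (xs ! i) (xs ! j)\<^esub>)) \<and>
      (\<Oplus>\<^bsub>Hom C b b\<^esub>i\<in>{..<length xs}. Comp C b (xs ! i) b (inj i) (proj i)) = Ident C b)"

definition has_biproducts :: "('o, 'm, 'z) lin_cat_scheme \<Rightarrow> bool" where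
  "has_biproducts C \<longleftrightarrow> (\<forall>xs. set xs \<subseteq> Obj C \<longrightarrow> (\<exists>b \<in> Obj C. is_biproduct C xs b))"

definition simple_object :: "('o, 'm, 'z) lin_cat_scheme \<Rightarrow> 'o \<Rightarrow> bool" where
  "simple_object C x \<longleftrightarrow>
    x \<in> Obj C \<and> Mor C x x = LinearCombinations.module.span class_ring (Hom C x x) {Ident C x}"

definition disjoint_simple_objects :: "('o, 'm, 'z) lin_cat_scheme \<Rightarrow> 'o set \<Rightarrow> bool" where
  "disjoint_simple_objects C S \<longleftrightarrow>
    (\<forall>x \<in> S. simple_object C x) \<and>
    (\<forall>x \<in> S. \<forall>y \<in> S. x \<noteq> y \<longrightarrow> Mor C x y = {\<zero>\<^bsub>Hom C x y\<^esub>})"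

definition semisimple_with :: "('o, 'm, 'z) lin_cat_scheme \<Rightarrow> 'o set \<Rightarrow> bool" where
  "semisimple_with C S \<longleftrightarrow>
    disjoint_simple_objects C S \<and>
    (\<forall>x \<in> Obj C. \<exists>ss. set ss \<subseteq> S \<and>
      (\<exists>b \<in> Obj C. is_biproduct C ss b \<and> isomorphic C x b))"

definition semisimple :: "('o, 'm, 'z) lin_cat_scheme \<Rightarrow> bool" where
  "semisimple C \<longleftrightarrow> linear_category C \<and> has_biproducts C \<and> (\<exists>S. semisimple_with C S)"


section \<open>Quotients, Karoubi envelope and additive completion\<close>

text \<open>
  For \<open>f : x \<rightarrow> y\<close> and \<open>f' : x' \<rightarrow> y'\<close>, the tensor product of \<open>f\<close> and \<open>f'\<close> is
  \<open>TensorMor C x y x' y' f f'\<close>.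
\<close>

record ('o, 'm) tensor_cat = "('o, 'm) lin_cat" +
  TensorOb :: "'o \<Rightarrow> 'o \<Rightarrow> 'o"
  TensorMor :: "'o \<Rightarrow> 'o \<Rightarrow> 'o \<Rightarrow> 'o \<Rightarrow> 'm \<Rightarrow> 'm \<Rightarrow> 'm"

definition quot_space :: "(complex, 'm) module \<Rightarrow> 'm set \<Rightarrow> (complex, 'm set) module" where
  "quot_space V N =
    \<lparr>carrier = a_rcosets\<^bsub>V\<^esub> N, mult = undefined, one = undefined, zero = N, add = set_add V,
     smult = (\<lambda>c A. \<Union>a\<in>A. N +>\<^bsub>V\<^esub> (c \<odot>\<^bsub>V\<^esub> a))\<rparr>"

text \<open>
  Operations on cosets are unions over all choices of representatives, as in
  \<^const>\<open>set_mult\<close>; for an ideal \<open>N\<close> all these choices give the same coset.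
\<close>

definition quot_cat ::
    "('o, 'm) tensor_cat \<Rightarrow> ('o \<Rightarrow> 'o \<Rightarrow> 'm set) \<Rightarrow> ('o, 'm set) tensor_cat" where
  "quot_cat C N =
    \<lparr>Obj = Obj C,
     Hom = (\<lambda>x y. quot_space (Hom C x y) (N x y)),
     Ident = (\<lambda>x. N x x +>\<^bsub>Hom C x x\<^esub> Ident C x),
     Comp = (\<lambda>x y z G F. \<Union>g\<in>G. \<Union>f\<in>F. N x z +>\<^bsub>Hom C x z\<^esub> Comp C x y z g f),
     TensorOb = TensorOb C,
     TensorMor = (\<lambda>x y x' y' F F'. \<Union>f\<in>F. \<Union>f'\<in>F'.
       N (TensorOb C x x') (TensorOb C y y')
         +>\<^bsub>Hom C (TensorOb C x x') (TensorOb C y y')\<^esub> TensorMor C x y x' y' f f')\<rparr>"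

definition Kar :: "('o, 'm) tensor_cat \<Rightarrow> ('o \<times> 'm, 'm) tensor_cat" where
  "Kar C =
    \<lparr>Obj = {(x, p). x \<in> Obj C \<and> p \<in> Mor C x x \<and> Comp C x x x p p = p},
     Hom = (\<lambda>(x, p) (y, r).
       (Hom C x y)\<lparr>carrier := {f \<in> Mor C x y. Comp C x x y f p = f \<and> Comp C x y y r f = f}\<rparr>),
     Ident = snd,
     Comp = (\<lambda>a b c. Comp C (fst a) (fst b) (fst c)),
     TensorOb = (\<lambda>(x, p) (y, r). (TensorOb C x y, TensorMor C x x y y p r)),
     TensorMor = (\<lambda>a b a' b'. TensorMor C (fst a) (fst b) (fst a') (fst b'))\<rparr>"

text \<open>
  A formal direct sum is the list of its summands, and a morphism from \<open>xs\<close> to \<open>ys\<close> is a matrix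
  whose entry in row \<open>i\<close> and column \<open>j\<close> is a morphism from \<open>xs ! j\<close> to \<open>ys ! i\<close>.
\<close>

definition mat_hom ::
    "('o, 'm) tensor_cat \<Rightarrow> 'o list \<Rightarrow> 'o list \<Rightarrow> (complex, 'm mat) module" where
  "mat_hom C xs ys =
    \<lparr>carrier = {A \<in> carrier_mat (length ys) (length xs).
       \<forall>i < length ys. \<forall>j < length xs. A $$ (i, j) \<in> Mor C (xs ! j) (ys ! i)},
     mult = undefined, one = undefined,
     zero = mat (length ys) (length xs) (\<lambda>(i, j). \<zero>\<^bsub>Hom C (xs ! j) (ys ! i)\<^esub>),
     add = (\<lambda>A B. mat (length ys) (length xs)
       (\<lambda>(i, j). A $$ (i, j) \<oplus>\<^bsub>Hom C (xs ! j) (ys ! i)\<^esub> B $$ (i, j))),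
     smult = (\<lambda>c A. mat (length ys) (length xs)
       (\<lambda>(i, j). c \<odot>\<^bsub>Hom C (xs ! j) (ys ! i)\<^esub> A $$ (i, j)))\<rparr>"

text \<open>
  The summand of a tensor product of lists with index \<open>i * length xs' + i'\<close> is the product of the
  summands with indices \<open>i\<close> and \<open>i'\<close>; the tensor product of matrices is the Kronecker product.
\<close>

definition Mat :: "('o, 'm) tensor_cat \<Rightarrow> ('o list, 'm mat) tensor_cat" where
  "Mat C =
    \<lparr>Obj = {xs. set xs \<subseteq> Obj C},
     Hom = mat_hom C,
     Ident = (\<lambda>xs. mat (length xs) (length xs)
       (\<lambda>(i, j). if i = j then Ident C (xs ! j) else \<zero>\<^bsub>Hom C (xs ! j) (xs ! i)\<^esub>)),
     Comp = (\<lambda>xs ys zs B A. mat (length zs) (length xs)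
       (\<lambda>(i, j). \<Oplus>\<^bsub>Hom C (xs ! j) (zs ! i)\<^esub>k\<in>{..<length ys}.
         Comp C (xs ! j) (ys ! k) (zs ! i) (B $$ (i, k)) (A $$ (k, j)))),
     TensorOb = (\<lambda>xs xs'. [TensorOb C x x'. x \<leftarrow> xs, x' \<leftarrow> xs']),
     TensorMor = (\<lambda>xs ys xs' ys' A B.
       mat (length ys * length ys') (length xs * length xs')
         (\<lambda>(i, j). TensorMor C
           (xs ! (j div length xs')) (ys ! (i div length ys'))
           (xs' ! (j mod length xs')) (ys' ! (i mod length ys'))
           (A $$ (i div length ys', j div length xs'))
           (B $$ (i mod length ys', j mod length xs'))))\<rparr>"

definition full_subcat :: "('o, 'm) tensor_cat \<Rightarrow> 'o set \<Rightarrow> ('o, 'm) tensor_cat" where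
  "full_subcat C S = C\<lparr>Obj := S\<rparr>"


section \<open>Simple Temperley-Lieb diagrams\<close>

text \<open>
  A point is a pair (level, index): in a diagram from \<open>x\<close> to \<open>y\<close> points, level 0 is the bottom
  edge, level 1 the top edge, and indices count from the left starting at 0.
  The arcs of a diagram, up to planar isotopy, are determined by which points they join;
  disjoint arcs exist if and only if no two of the pairs separate each other in the
  cyclic order of the marked points along the boundary of the square (here: bottom edge
  from left to right, then top edge from right to left).
\<close>

type_synonym point = "nat \<times> nat"
type_synonym matching = "point set set"

definition points :: "nat \<Rightarrow> nat \<Rightarrow> point set" where
  "points x y = {0} \<times> {..<x} \<union> {1} \<times> {..<y}"

fun boundary_pos :: "nat \<Rightarrow> nat \<Rightarrow> point \<Rightarrow> nat" where
  "boundary_pos x y (l, i) = (if l = 0 then i else x + y - 1 - i)"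

definition perfect_matching :: "'v set \<Rightarrow> 'v set set \<Rightarrow> bool" where
  "perfect_matching V M \<longleftrightarrow> partition_on V M \<and> (\<forall>e \<in> M. card e = 2)"

definition crossing :: "('v \<Rightarrow> nat) \<Rightarrow> 'v set set \<Rightarrow> bool" where
  "crossing pos M \<longleftrightarrow>
    (\<exists>a b c d. {a, b} \<in> M \<and> {c, d} \<in> M \<and> pos a < pos c \<and> pos c < pos b \<and> pos b < pos d)"

definition planar_matchings :: "nat \<Rightarrow> nat \<Rightarrow> matching set" where
  "planar_matchings x y =
    {M. perfect_matching (points x y) M \<and> \<not> crossing (boundary_pos x y) M}"

text \<open>
  A simple diagram is recorded as a planar matching together with its number of closed loops.
  The positions of the loops are not recorded: they are irrelevant once a loop may be
  replaced by a scalar.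
\<close>

type_synonym diagram = "matching \<times> nat"

definition simple_diagrams :: "nat \<Rightarrow> nat \<Rightarrow> diagram set" where
  "simple_diagrams x y = planar_matchings x y \<times> UNIV"

definition joined :: "'v set set \<Rightarrow> ('v \<times> 'v) set" where
  "joined E = {(u, v). {u, v} \<in> E}\<^sup>*"

text \<open>
  Stacking \<open>N : y \<rightarrow> z\<close> on top of \<open>M : x \<rightarrow> y\<close> gives curves through the levels 0, 1 and 2, where
  level 1 consists of the \<open>y\<close> glued points. Curves that reach level 0 or 2 are the arcs of the
  composite; curves that stay in level 1 are closed loops.
\<close>

definition stack :: "matching \<Rightarrow> matching \<Rightarrow> matching" where
  "stack N M = M \<union> (\<lambda>e. (\<lambda>(l, i). (l + 1, i)) ` e) ` N"

definition stack_matching :: "nat \<Rightarrow> nat \<Rightarrow> matching \<Rightarrow> matching \<Rightarrow> matching" where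
  "stack_matching x z N M =
    {(\<lambda>(l, i). (l div 2, i)) ` {u, v} | u v.
      u \<in> {0} \<times> {..<x} \<union> {2} \<times> {..<z} \<and> v \<in> {0} \<times> {..<x} \<union> {2} \<times> {..<z} \<and>
      u \<noteq> v \<and> (u, v) \<in> joined (stack N M)}"

definition stack_loops :: "nat \<Rightarrow> matching \<Rightarrow> matching \<Rightarrow> nat" where
  "stack_loops y N M =
    card {c \<in> ({1} \<times> {..<y}) // joined (stack N M). c \<subseteq> {1} \<times> {..<y}}"

fun diagram_comp :: "nat \<Rightarrow> nat \<Rightarrow> nat \<Rightarrow> diagram \<Rightarrow> diagram \<Rightarrow> diagram" where
  "diagram_comp x y z (N, l) (M, k) = (stack_matching x z N M, k + l + stack_loops y N M)"

definition id_matching :: "nat \<Rightarrow> matching" where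
  "id_matching m = {{(0, i), (1, i)} | i. i < m}"

text \<open>Juxtaposition: \<open>M : x \<rightarrow> y\<close> is on the left.\<close>

fun diagram_tensor :: "nat \<Rightarrow> nat \<Rightarrow> diagram \<Rightarrow> diagram \<Rightarrow> diagram" where
  "diagram_tensor x y (M, k) (M', k') =
    (M \<union> (\<lambda>e. (\<lambda>(l, i). (l, i + (if l = 0 then x else y))) ` e) ` M', k + k')"

text \<open>
  Joining corresponding bottom and top points of a diagram from \<open>x\<close> to \<open>x\<close> points turns all
  arcs into closed loops, one for each connected component.
\<close>

fun diagram_closure :: "nat \<Rightarrow> diagram \<Rightarrow> diagram" where
  "diagram_closure x (M, k) = ({}, k + card (points x x // joined (M \<union> id_matching x)))"


section \<open>The Temperley-Lieb category\<close>

definition linear_ext ::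
    "('a \<Rightarrow> 'b) \<Rightarrow> ('a \<Rightarrow>\<^sub>0 complex) \<Rightarrow> ('b \<Rightarrow>\<^sub>0 complex)" where
  "linear_ext h f =
    (\<Sum>a \<in> Poly_Mapping.keys f. Poly_Mapping.single (h a) (Poly_Mapping.lookup f a))"

definition bilinear_ext ::
    "('a \<Rightarrow> 'b \<Rightarrow> 'c) \<Rightarrow> ('a \<Rightarrow>\<^sub>0 complex) \<Rightarrow> ('b \<Rightarrow>\<^sub>0 complex) \<Rightarrow> ('c \<Rightarrow>\<^sub>0 complex)" where
  "bilinear_ext h f g =
    (\<Sum>a \<in> Poly_Mapping.keys f. \<Sum>b \<in> Poly_Mapping.keys g.
      Poly_Mapping.single (h a b) (Poly_Mapping.lookup f a * Poly_Mapping.lookup g b))"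

definition free_space :: "'a set \<Rightarrow> (complex, 'a \<Rightarrow>\<^sub>0 complex) module" where
  "free_space B =
    \<lparr>carrier = {f. Poly_Mapping.keys f \<subseteq> B}, mult = undefined, one = undefined,
     zero = 0, add = (+), smult = (\<lambda>c. Poly_Mapping.map ((*) c))\<rparr>"

text \<open>Formal linear combinations of diagrams, before the loop relation is imposed.\<close>

definition free_TL :: "(nat, diagram \<Rightarrow>\<^sub>0 complex) tensor_cat" where
  "free_TL =
    \<lparr>Obj = UNIV,
     Hom = (\<lambda>x y. free_space (simple_diagrams x y)),
     Ident = (\<lambda>m. Poly_Mapping.single (id_matching m, 0) 1),
     Comp = (\<lambda>x y z. bilinear_ext (diagram_comp x y z)),
     TensorOb = (+),
     TensorMor = (\<lambda>x y x' y'. bilinear_ext (diagram_tensor x y))\<rparr>"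

definition loop_rel :: "complex \<Rightarrow> nat \<Rightarrow> nat \<Rightarrow> (diagram \<Rightarrow>\<^sub>0 complex) set" where
  "loop_rel q x y =
    LinearCombinations.module.span class_ring (Hom free_TL x y)
      {Poly_Mapping.single (M, Suc k) 1 - Poly_Mapping.single (M, k) (q + inverse q) | M k.
        (M, k) \<in> simple_diagrams x y}"

definition TL :: "complex \<Rightarrow> (nat, (diagram \<Rightarrow>\<^sub>0 complex) set) tensor_cat" where
  "TL q = quot_cat free_TL (loop_rel q)"

definition TL_diagram :: "complex \<Rightarrow> nat \<Rightarrow> nat \<Rightarrow> matching \<Rightarrow> (diagram \<Rightarrow>\<^sub>0 complex) set" where
  "TL_diagram q x y M = loop_rel q x y +>\<^bsub>Hom free_TL x y\<^esub> Poly_Mapping.single (M, 0) 1"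

text \<open>The trace takes values in \<open>Hom(0,0)\<close>.\<close>

definition TL_trace ::
    "complex \<Rightarrow> nat \<Rightarrow> (diagram \<Rightarrow>\<^sub>0 complex) set \<Rightarrow> (diagram \<Rightarrow>\<^sub>0 complex) set" where
  "TL_trace q x F =
    (\<Union>f\<in>F. loop_rel q 0 0 +>\<^bsub>Hom free_TL 0 0\<^esub> linear_ext (diagram_closure x) f)"

definition negligible :: "complex \<Rightarrow> nat \<Rightarrow> nat \<Rightarrow> (diagram \<Rightarrow>\<^sub>0 complex) set set" where
  "negligible q x y =
    {f \<in> Mor (TL q) x y. \<forall>g \<in> Mor (TL q) y x.
      TL_trace q x (Comp (TL q) x y x g f) = \<zero>\<^bsub>Hom (TL q) 0 0\<^esub>}"

definition TL_mod_negligible ::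
    "complex \<Rightarrow> (nat, (diagram \<Rightarrow>\<^sub>0 complex) set set) tensor_cat" where
  "TL_mod_negligible q = quot_cat (TL q) (negligible q)"


section \<open>Jones-Wenzl idempotents and the Temperley-Lieb-Jones category\<close>

definition qint :: "complex \<Rightarrow> nat \<Rightarrow> complex" where
  "qint q m = (q ^ m - inverse q ^ m) / (q - inverse q)"

text \<open>For \<open>m \<ge> 1\<close>, a matching from \<open>m + 1\<close> to \<open>m + 1\<close> points.\<close>

definition U_matching :: "nat \<Rightarrow> matching" where
  "U_matching m = {{(0, i), (1, i)} | i. i < m - 1} \<union> {{(0, m - 1), (0, m)}, {(1, m - 1), (1, m)}}"

text \<open>
  Only the values at \<open>m \<le> n - 1\<close> matter when \<open>q = exp (\<pi> \<i> / n)\<close>; the recursion is continued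
  beyond this range only because functions are total.
\<close>

fun jones_wenzl :: "complex \<Rightarrow> nat \<Rightarrow> (diagram \<Rightarrow>\<^sub>0 complex) set" where
  "jones_wenzl q 0 = Ident (TL q) 0"
| "jones_wenzl q (Suc 0) = Ident (TL q) 1"
| "jones_wenzl q (Suc (Suc k)) =
    (let m = k + 1;
         P = TensorMor (TL q) m m 1 1 (jones_wenzl q (Suc k)) (Ident (TL q) 1);
         U = TL_diagram q (m + 1) (m + 1) (U_matching m);
         mul = Comp (TL q) (m + 1) (m + 1) (m + 1)
     in P \<ominus>\<^bsub>Hom (TL q) (m + 1) (m + 1)\<^esub>
          (qint q m / qint q (m + 1)) \<odot>\<^bsub>Hom (TL q) (m + 1) (m + 1)\<^esub> mul P (mul U P))"

text \<open>The idempotent as an object of the Karoubi envelope, viewed as a one-term direct sum.\<close>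

definition JW_object :: "complex \<Rightarrow> nat \<Rightarrow> (nat \<times> (diagram \<Rightarrow>\<^sub>0 complex) set set) list" where
  "JW_object q m = [(m, negligible q m m +>\<^bsub>Hom (TL q) m m\<^esub> jones_wenzl q m)]"

inductive_set TLJ_objects ::
    "nat \<Rightarrow> complex \<Rightarrow> (nat \<times> (diagram \<Rightarrow>\<^sub>0 complex) set set) list set"
  for n :: nat and q :: complex where
  JW: "i \<le> n - 2 \<Longrightarrow> JW_object q i \<in> TLJ_objects n q"
| zero: "[] \<in> TLJ_objects n q"
| sum: "\<lbrakk>a \<in> TLJ_objects n q; b \<in> TLJ_objects n q\<rbrakk> \<Longrightarrow> a @ b \<in> TLJ_objects n q"
| tensor: "\<lbrakk>a \<in> TLJ_objects n q; b \<in> TLJ_objects n q\<rbrakk>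
    \<Longrightarrow> TensorOb (Mat (Kar (TL_mod_negligible q))) a b \<in> TLJ_objects n q"

text \<open>The category is meant for \<open>n > 1\<close> and \<open>q = exp (\<pi> \<i> / n)\<close>.\<close>

definition TLJ ::
    "nat \<Rightarrow> complex \<Rightarrow>
      ((nat \<times> (diagram \<Rightarrow>\<^sub>0 complex) set set) list, (diagram \<Rightarrow>\<^sub>0 complex) set set mat) tensor_cat" where
  "TLJ n q = full_subcat (Mat (Kar (TL_mod_negligible q))) (TLJ_objects n q)"

end

theory Submission
  imports Defs
begin

text \<open>
  The theorem has a combinatorial, an algebraic and a categorical part.

  \<^emph>\<open>Diagrams.\<close> Modulo the loop relation, the morphisms of the Temperley-Lieb category are the linear combinations of
  planar matchings; composition is stacking, weighted by \<open>d\<close> for each loop (\<open>loop_rel_eq\<close>, \<open>presented_TL\<close>).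
  Operations on matchings glue graphs along vertices and then forget these vertices. Forgetting vertices in
  steps gives the same result as at once, and the loops lost add up (\<open>contract_contract\<close>, \<open>loops_contract\<close>). This
  one principle yields associativity, the cyclicity of the trace, and the partial traces that make the
  negligible morphisms a tensor ideal. That composites are planar again is a matter of parity: two arcs cross
  if and only if the number of ascents between them is odd, and this number is additive (\<open>stack_matching_planar\<close>).

  \<^emph>\<open>Jones-Wenzl idempotents.\<close> By induction along their recursion, the \<open>p m\<close> with \<open>m < n\<close> are idempotent and are annihilated
  by diagrams that turn back, since the partial trace of \<open>p (m + 1)\<close> is a multiple of \<open>p m\<close> with just the
  factor that the recursion needs (\<open>jw_good\<close>). A diagram with \<open>m\<close> bottom and at most \<open>m\<close> top points turns back at
  the bottom unless it is the identity (\<open>no_turn_at_bottom\<close>). Consequently, endomorphisms of \<open>p m\<close> are scalars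
  (\<open>p_schur\<close>), and there are no maps between different ones (\<open>p_disjoint\<close>). The trace of \<open>p m\<close> is the quantum integer
  \<open>[m + 1]\<close>, and \<open>[n] = 0\<close>, so that \<open>p (n - 1)\<close> is negligible (\<open>p_last_negligible\<close>). The recursion writes \<open>p k \<otimes> id\<close> as
  \<open>p (k + 1)\<close> plus a map that factors through \<open>p (k - 1)\<close>; it follows that in the quotient the identity of every
  number of strands is a sum of maps through the \<open>p k\<close> with \<open>k \<le> n - 2\<close> (\<open>resolved_id\<close>).

  \<^emph>\<open>Categories.\<close> An idempotent \<open>E\<close> on \<open>x\<close> strands inherits such a sum from the identity of \<open>x\<close>, and an object whose
  identity is a sum of maps through disjoint simple objects is a biproduct of some of these, possibly repeated (\<open>split_identity\<close>). Hence every
  object of the Karoubi envelope is a biproduct of these \<open>p k\<close>. Formal direct sums preserve this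
  property, and the objects of the Temperley-Lieb-Jones category are among them.
\<close>

section \<open>Gluing graphs along vertices\<close>

lemma joined_refl [simp, intro]: "(u, u) \<in> joined E"
  by (simp add: joined_def)

lemma joined_edge: "{u, v} \<in> E \<Longrightarrow> (u, v) \<in> joined E"
  by (auto simp: joined_def)

lemma joined_trans: "(u, v) \<in> joined E \<Longrightarrow> (v, w) \<in> joined E \<Longrightarrow> (u, w) \<in> joined E"
  unfolding joined_def by (rule rtrancl_trans)

lemma joined_sym: "(u, v) \<in> joined E \<Longrightarrow> (v, u) \<in> joined E"
proof -
  have "sym {(u, v). {u, v} \<in> E}" by (auto simp: sym_def insert_commute)
  then have "sym (joined E)" unfolding joined_def by (rule sym_rtrancl)
  then show "(u, v) \<in> joined E \<Longrightarrow> (v, u) \<in> joined E" by (auto simp: sym_def)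
qed

lemma joined_mono: "E \<subseteq> F \<Longrightarrow> (u, v) \<in> joined E \<Longrightarrow> (u, v) \<in> joined F"
proof -
  assume "E \<subseteq> F"
  then have "joined E \<subseteq> joined F" unfolding joined_def by (intro rtrancl_mono) auto
  then show "(u, v) \<in> joined E \<Longrightarrow> (u, v) \<in> joined F" by auto
qed

lemma joined_induct [consumes 1, case_names refl step]:
  assumes "(u, v) \<in> joined E" and "P u"
    and "\<And>v w. (u, v) \<in> joined E \<Longrightarrow> {v, w} \<in> E \<Longrightarrow> P v \<Longrightarrow> P w"
  shows "P v"
  using assms(1) unfolding joined_def
  by (induct rule: rtrancl_induct) (use assms(2,3) in \<open>auto simp: joined_def\<close>)

lemma equiv_joined: "equiv UNIV (joined E)"
  by (auto simp: equiv_def refl_on_def sym_def trans_def intro: joined_sym joined_trans)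

lemma joined_class_eq: "(u, v) \<in> joined E \<Longrightarrow> joined E `` {u} = joined E `` {v}"
  by (rule equiv_class_eq[OF equiv_joined])

lemma joined_closed_set:
  assumes "(u, v) \<in> joined E" and "u \<in> S" and "\<And>a b. {a, b} \<in> E \<Longrightarrow> a \<in> S \<Longrightarrow> b \<in> S"
  shows "v \<in> S"
  using assms(1,2) by (induct rule: joined_induct) (use assms(3) in auto)

lemma joined_stays:
  assumes "(u, v) \<in> joined E" and "\<Union>E \<subseteq> V" and "u \<in> V"
  shows "v \<in> V"
  by (rule joined_closed_set[OF assms(1,3)]) (use assms(2) in auto)

lemma joined_Un_away:
  assumes "joined E `` {a} \<subseteq> S" and "\<Union>F \<inter> S = {}"
  shows "joined (E \<union> F) `` {a} = joined E `` {a}"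
proof
  show "joined E `` {a} \<subseteq> joined (E \<union> F) `` {a}"
    using joined_mono[of E "E \<union> F"] by auto
  have "(a, b) \<in> joined E" if "(a, b) \<in> joined (E \<union> F)" for b
    using that
  proof (induct rule: joined_induct)
    case (step v w)
    then have "v \<in> S" using assms(1) by auto
    then have "{v, w} \<in> E" using step(2) assms(2) by auto
    then show ?case using step(3) joined_edge joined_trans by metis
  qed auto
  then show "joined (E \<union> F) `` {a} \<subseteq> joined E `` {a}" by auto
qed

definition emap :: "('v \<Rightarrow> 'w) \<Rightarrow> 'v set set \<Rightarrow> 'w set set" where
  "emap f E = (`) f ` E"

lemma emap_emap: "emap f (emap g E) = emap (\<lambda>x. f (g x)) E"
  by (simp add: emap_def image_image)

lemma emap_Un: "emap f (E \<union> F) = emap f E \<union> emap f F"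
  by (auto simp: emap_def)

lemma emap_inj: "inj f \<Longrightarrow> emap f E = emap f F \<Longrightarrow> E = F"
  unfolding emap_def by (metis inj_image_eq_iff inj_def)

lemma emap_edge: "{u, v} \<in> E \<Longrightarrow> {f u, f v} \<in> emap f E"
  unfolding emap_def by (rule image_eqI[of _ _ "{u, v}"]) auto

lemma Union_emap: "\<Union>(emap f E) = f ` \<Union>E"
  by (auto simp: emap_def)

lemma emapE:
  assumes "e \<in> emap f E" obtains e' where "e' \<in> E" "e = f ` e'"
  using assms unfolding emap_def by (rule imageE)

lemma emap_cong: "(\<And>v. v \<in> \<Union>E \<Longrightarrow> f v = g v) \<Longrightarrow> emap f E = emap g E"
  unfolding emap_def by (intro image_cong refl) auto

lemma emap_edgeE:
  assumes "{f u, w} \<in> emap f E" and "inj f"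
  obtains v where "w = f v" "{u, v} \<in> E"
proof -
  obtain e where e: "e \<in> E" "f ` e = {f u, w}" using assms(1) by (auto simp: emap_def)
  then obtain v where v: "w = f v" "v \<in> e" by auto
  have "f ` e = f ` {u, v}" using e v by simp
  then have "e = {u, v}" by (simp only: inj_image_eq_iff[OF assms(2)])
  then show thesis using e v that by auto
qed

lemma joined_emapD:
  assumes "(f u, b) \<in> joined (emap f E)" and "inj f"
  shows "\<exists>v. b = f v \<and> (u, v) \<in> joined E"
  using assms(1)
proof (induct rule: joined_induct)
  case (step b c)
  then obtain v where v: "b = f v" "(u, v) \<in> joined E" by auto
  then obtain w where "c = f w" "{v, w} \<in> E" using step(2) assms(2) by (metis emap_edgeE)
  then show ?case using v joined_edge joined_trans by metis
qed auto

lemma joined_emapI: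
  assumes "(u, v) \<in> joined E" shows "(f u, f v) \<in> joined (emap f E)"
  using assms
proof (induct rule: joined_induct)
  case (step v w)
  then show ?case using emap_edge[of v w E f] joined_edge joined_trans by metis
qed auto

lemma joined_emap: "inj f \<Longrightarrow> (f u, f v) \<in> joined (emap f E) \<longleftrightarrow> (u, v) \<in> joined E"
  using joined_emapD[of f u "f v" E] joined_emapI[of u v E f] by (auto simp: inj_def)

lemma joined_class_emap: "inj f \<Longrightarrow> joined (emap f E) `` {f u} = f ` (joined E `` {u})"
  using joined_emapD[of f u _ E] joined_emapI[of u _ E f] by auto

text \<open>
  Forgetting all vertices of a graph outside \<open>B\<close>: what remains of it is the relation
  that its paths induce on \<open>B\<close>.
\<close>

definition contract :: "'v set set \<Rightarrow> 'v set \<Rightarrow> 'v set set" where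
  "contract E B = {{u, v} | u v. u \<in> B \<and> v \<in> B \<and> u \<noteq> v \<and> (u, v) \<in> joined E}"

text \<open>The number of components that are lost when the vertices in \<open>I\<close> are forgotten.\<close>

definition loops :: "'v set set \<Rightarrow> 'v set \<Rightarrow> nat" where
  "loops E I = card {c \<in> I // joined E. c \<subseteq> I}"

lemma contract_iff: "{u, v} \<in> contract E B \<longleftrightarrow> u \<in> B \<and> v \<in> B \<and> u \<noteq> v \<and> (u, v) \<in> joined E"
  by (auto simp: contract_def doubleton_eq_iff intro: joined_sym)

lemma contractE:
  assumes "e \<in> contract E B"
  obtains u v where "e = {u, v}" "u \<in> B" "v \<in> B" "u \<noteq> v" "(u, v) \<in> joined E"
  using assms by (auto simp: contract_def)

lemma Union_contract: "\<Union>(contract E B) \<subseteq> B"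
  by (auto simp: contract_def)

lemma contract_emap: "inj f \<Longrightarrow> contract (emap f E) (f ` B) = emap f (contract E B)"
proof (rule Set.set_eqI, rule iffI)
  fix e assume f: "inj f" and "e \<in> contract (emap f E) (f ` B)"
  then obtain u v where "e = {f u, f v}" "u \<in> B" "v \<in> B" "u \<noteq> v" "(f u, f v) \<in> joined (emap f E)"
    by (elim contractE) auto
  then have "e = {f u, f v}" "{u, v} \<in> contract E B" using f by (auto simp: joined_emap contract_iff)
  then show "e \<in> emap f (contract E B)" by (simp add: emap_edge)
next
  fix e assume f: "inj f" and "e \<in> emap f (contract E B)"
  then obtain e' where "e = f ` e'" "e' \<in> contract E B" by (auto simp: emap_def)
  then obtain u v where "e = {f u, f v}" "u \<in> B" "v \<in> B" "u \<noteq> v" "(u, v) \<in> joined E"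
    by (elim contractE) auto
  then show "e \<in> contract (emap f E) (f ` B)"
    using f by (auto simp: joined_emap contract_iff inj_eq)
qed

lemma loops_emap:
  assumes f: "inj f" shows "loops (emap f E) (f ` I) = loops E I"
proof -
  have "{c \<in> f ` I // joined (emap f E). c \<subseteq> f ` I} = (`) f ` {c \<in> I // joined E. c \<subseteq> I}"
  proof (intro equalityI subsetI)
    fix d assume "d \<in> {c \<in> f ` I // joined (emap f E). c \<subseteq> f ` I}"
    then obtain a where "a \<in> I" "d = f ` (joined E `` {a})" "d \<subseteq> f ` I"
      by (auto simp: quotient_def joined_class_emap[OF f])
    then show "d \<in> (`) f ` {c \<in> I // joined E. c \<subseteq> I}"
      by (auto simp: quotient_def inj_image_subset_iff[OF f])
  qed (auto simp: quotient_def joined_class_emap[OF f])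
  moreover have "inj_on ((`) f) X" for X using f by (auto simp: inj_on_def inj_image_eq_iff)
  ultimately show ?thesis unfolding loops_def by (simp add: card_image)
qed

lemma loops_eq_0I:
  assumes "\<And>a. a \<in> I \<Longrightarrow> \<exists>b. b \<notin> I \<and> (a, b) \<in> joined E"
  shows "loops E I = 0"
proof -
  have "{c \<in> I // joined E. c \<subseteq> I} = {}" using assms by (fastforce simp: quotient_def)
  then show ?thesis unfolding loops_def by (simp only: card.empty)
qed

text \<open>
  Vertices of \<open>I\<close> are met by edges of \<open>E\<^sub>1\<close> only, so a path between other vertices leaves and
  enters \<open>E\<^sub>1\<close> through \<open>B\<close>, and each of its passages through \<open>E\<^sub>1\<close> may be replaced by one edge.
\<close>

lemma joined_contract:
  assumes E1: "\<Union>E1 \<subseteq> I \<union> B" and IB: "I \<inter> B = {}" and E2: "\<Union>E2 \<inter> I = {}"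
    and u: "u \<notin> I" and v: "v \<notin> I"
  shows "(u, v) \<in> joined (E1 \<union> E2) \<longleftrightarrow> (u, v) \<in> joined (contract E1 B \<union> E2)" (is "_ \<longleftrightarrow> _ \<in> ?J")
proof
  assume "(u, v) \<in> joined (E1 \<union> E2)"
  then have "(v \<notin> I \<longrightarrow> (u, v) \<in> ?J) \<and> (v \<in> I \<longrightarrow> (\<exists>b \<in> B. (u, b) \<in> ?J \<and> (b, v) \<in> joined E1))"
  proof (induct rule: joined_induct)
    case refl then show ?case using u by auto
  next
    case (step v w)
    show ?case
    proof (cases "{v, w} \<in> E1")
      case True
      obtain b where b: "b \<in> B" "(u, b) \<in> ?J" "(b, v) \<in> joined E1"
        using step(3) True E1 by (cases "v \<in> I") auto
      then have bw: "(b, w) \<in> joined E1" using True joined_edge joined_trans by metis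
      show ?thesis
      proof (cases "w \<in> I")
        case False
        then have "w \<in> B" using True E1 by auto
        then have "(b, w) \<in> ?J" using b bw
          by (cases "b = w") (auto intro!: joined_edge simp: contract_iff)
        then show ?thesis using b(2) False joined_trans by metis
      qed (use b bw in auto)
    next
      case False
      then have "{v, w} \<in> E2" using step by auto
      then have "v \<notin> I" "w \<notin> I" "(v, w) \<in> ?J" using E2 by (auto intro: joined_edge)
      then show ?thesis using step(3) joined_trans by metis
    qed
  qed
  then show "(u, v) \<in> ?J" using v by auto
next
  assume "(u, v) \<in> ?J"
  then show "(u, v) \<in> joined (E1 \<union> E2)"
  proof (induct rule: joined_induct)
    case (step v w)
    then have "(v, w) \<in> joined (E1 \<union> E2)"
      using joined_mono[of E1 "E1 \<union> E2"] by (auto simp: contract_iff joined_edge)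
    then show ?case using step joined_trans by metis
  qed auto
qed

lemma contract_cong:
  assumes "\<And>u v. u \<in> D \<Longrightarrow> v \<in> D \<Longrightarrow> (u, v) \<in> joined E \<longleftrightarrow> (u, v) \<in> joined F"
  shows "contract E D = contract F D"
  unfolding contract_def using assms by (intro Collect_cong) auto

lemma contract_contract:
  assumes "\<Union>E1 \<subseteq> I \<union> B" "I \<inter> B = {}" "\<Union>E2 \<inter> I = {}" "D \<inter> I = {}"
  shows "contract (contract E1 B \<union> E2) D = contract (E1 \<union> E2) D"
proof (rule contract_cong)
  fix u v assume "u \<in> D" "v \<in> D"
  then have "u \<notin> I" "v \<notin> I" using assms(4) by auto
  then show "(u, v) \<in> joined (contract E1 B \<union> E2) \<longleftrightarrow> (u, v) \<in> joined (E1 \<union> E2)"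
    using joined_contract[OF assms(1-3)] by simp
qed

text \<open>
  Forgetting vertices in two steps loses the same components as forgetting them at once: a component
  inside \<open>I\<close> consists of edges of \<open>E1\<close> only, and any other component that is lost becomes, without
  its vertices in \<open>I\<close>, a component of the contracted graph.
\<close>

lemma loops_contract:
  assumes E1: "\<Union>E1 \<subseteq> I \<union> B" and IB: "I \<inter> B = {}" and E2: "\<Union>E2 \<inter> I = {}"
    and IJ: "I \<inter> J = {}" and fin: "finite I" "finite J"
  shows "loops (E1 \<union> E2) (I \<union> J) = loops E1 I + loops (contract E1 B \<union> E2) J"
proof -
  let ?E = "E1 \<union> E2" and ?G = "contract E1 B \<union> E2"
  let ?C = "{c \<in> (I \<union> J) // joined ?E. c \<subseteq> I \<union> J}"
  let ?X = "{c \<in> ?C. c \<subseteq> I}" and ?Y = "{c \<in> ?C. \<not> c \<subseteq> I}"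
  have cls: "joined ?E `` {v} - I = joined ?G `` {v}" if "v \<notin> I" for v
  proof -
    have "w \<notin> I" if "(v, w) \<in> joined ?G" for w
    proof -
      have "w \<in> - I"
        by (rule joined_closed_set[OF that])
          (use \<open>v \<notin> I\<close> E2 IB in \<open>auto simp: contract_iff\<close>)
      then show ?thesis by simp
    qed
    then show ?thesis using joined_contract[OF E1 IB E2 that] by auto
  qed
  have "?X = {c \<in> I // joined E1. c \<subseteq> I}"
  proof -
    have 1: "joined ?E `` {a} = joined E1 `` {a}" if "joined E1 `` {a} \<subseteq> I" for a
      by (rule joined_Un_away[OF that E2])
    have 2: "joined E1 `` {a} \<subseteq> joined ?E `` {a}" for a
      using joined_mono[of E1 ?E] by auto
    have 3: "a \<in> joined ?E `` {a}" for a by auto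
    have 4: "(\<exists>a \<in> I \<union> J. c = joined ?E `` {a}) \<and> c \<subseteq> I \<longleftrightarrow> (\<exists>a \<in> I. c = joined E1 `` {a}) \<and> c \<subseteq> I" for c
      using 1 2 3 by (smt (verit) UnCI subset_iff)
    have 5: "c \<in> A // joined F \<longleftrightarrow> (\<exists>a \<in> A. c = joined F `` {a})" for c A F
      by (auto simp: quotient_def)
    have "c \<in> (I \<union> J) // joined ?E \<and> c \<subseteq> I \<longleftrightarrow> c \<in> I // joined E1 \<and> c \<subseteq> I" for c
      unfolding 5 by (rule 4)
    then show ?thesis by auto
  qed
  then have X: "card ?X = loops E1 I" by (simp add: loops_def)
  have "bij_betw (\<lambda>c. c - I) ?Y {c \<in> J // joined ?G. c \<subseteq> J}"
  proof (rule bij_betw_imageI)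
    have rep: "\<exists>v. v \<in> J \<and> v \<notin> I \<and> c = joined ?E `` {v} \<and> c - I = joined ?G `` {v}" if c: "c \<in> ?Y" for c
    proof -
      obtain a where a: "c = joined ?E `` {a}" using c by (auto simp: quotient_def)
      have "c \<subseteq> I \<union> J" "\<not> c \<subseteq> I" using c by simp_all
      then obtain v where v: "v \<in> c" "v \<notin> I" "v \<in> J" by auto
      then have "c = joined ?E `` {v}" using a joined_class_eq[of a v ?E] by auto
      then show ?thesis using v cls by auto
    qed
    show "inj_on (\<lambda>c. c - I) ?Y"
    proof (rule inj_onI)
      fix c c' assume c: "c \<in> ?Y" "c' \<in> ?Y" "c - I = c' - I"
      obtain v where v: "v \<notin> I" "c = joined ?E `` {v}" using rep[OF c(1)] by auto
      obtain a where a: "c' = joined ?E `` {a}" using c(2) by (auto simp: quotient_def)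
      have "v \<in> c'" using v c(3) by auto
      then show "c = c'" using a v joined_class_eq[of a v ?E] by auto
    qed
    show "(\<lambda>c. c - I) ` ?Y = {c \<in> J // joined ?G. c \<subseteq> J}"
    proof (intro equalityI subsetI)
      fix d assume "d \<in> (\<lambda>c. c - I) ` ?Y"
      then obtain c where c: "c \<in> ?Y" "d = c - I" by auto
      obtain v where "v \<in> J" "c - I = joined ?G `` {v}" using rep[OF c(1)] by auto
      then show "d \<in> {c \<in> J // joined ?G. c \<subseteq> J}" using c by (auto simp: quotient_def)
    next
      fix d assume d: "d \<in> {c \<in> J // joined ?G. c \<subseteq> J}"
      then obtain v where v: "v \<in> J" "d = joined ?G `` {v}" "d \<subseteq> J" by (auto simp: quotient_def)
      then have "v \<notin> I" using IJ by auto
      then have "d = joined ?E `` {v} - I" using v cls by simp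
      then show "d \<in> (\<lambda>c. c - I) ` ?Y"
        using v \<open>v \<notin> I\<close> by (intro image_eqI[of _ _ "joined ?E `` {v}"]) (auto simp: quotient_def)
    qed
  qed
  then have Y: "card ?Y = loops ?G J" by (simp add: loops_def bij_betw_same_card)
  have "finite ?X" "finite ?Y" using fin by (auto intro: finite_subset[of _ "Pow (I \<union> J)"])
  then have "card (?X \<union> ?Y) = card ?X + card ?Y" by (intro card_Un_disjoint) auto
  moreover have "?C = ?X \<union> ?Y" by auto
  ultimately have "card ?C = card ?X + card ?Y" by metis
  then show ?thesis using X Y by (simp add: loops_def)
qed

lemma loops_Un_disjoint:
  assumes E: "\<Union>E \<subseteq> V" and F: "\<Union>F \<subseteq> W" and VW: "V \<inter> W = {}"
    and I: "I \<subseteq> V" and J: "J \<subseteq> W" and fin: "finite I" "finite J"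
  shows "loops (E \<union> F) (I \<union> J) = loops E I + loops F J"
proof -
  have sE: "joined E `` {a} \<subseteq> V" if "a \<in> I" for a
  proof
    fix b assume "b \<in> joined E `` {a}"
    then have "(a, b) \<in> joined E" by simp
    then show "b \<in> V" by (rule joined_stays[OF _ E]) (rule subsetD[OF I that])
  qed
  have sF: "joined F `` {a} \<subseteq> W" if "a \<in> J" for a
  proof
    fix b assume "b \<in> joined F `` {a}"
    then have "(a, b) \<in> joined F" by simp
    then show "b \<in> W" by (rule joined_stays[OF _ F]) (rule subsetD[OF J that])
  qed
  have "\<Union>F \<inter> V = {}" "\<Union>E \<inter> W = {}" using E F VW by blast+
  then have cE: "joined (E \<union> F) `` {a} = joined E `` {a}" if "a \<in> I" for a
    using joined_Un_away[OF sE[OF that]] by blast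
  have cF: "joined (E \<union> F) `` {a} = joined F `` {a}" if "a \<in> J" for a
    using joined_Un_away[OF sF[OF that], of E] \<open>\<Union>E \<inter> W = {}\<close> by (simp add: Un_commute)
  let ?X = "{c \<in> I // joined E. c \<subseteq> I}" and ?Y = "{c \<in> J // joined F. c \<subseteq> J}"
  have q: "c \<in> A // joined G \<longleftrightarrow> (\<exists>a \<in> A. c = joined G `` {a})" for c :: "'a set" and A G
    by (auto simp: quotient_def)
  have "c \<in> (I \<union> J) // joined (E \<union> F) \<and> c \<subseteq> I \<union> J \<longleftrightarrow> c \<in> ?X \<or> c \<in> ?Y" for c
  proof -
    have "joined E `` {a} \<subseteq> I \<union> J \<longleftrightarrow> joined E `` {a} \<subseteq> I" if "a \<in> I" for a
      using sE[OF that] J VW by blast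
    moreover have "joined F `` {a} \<subseteq> I \<union> J \<longleftrightarrow> joined F `` {a} \<subseteq> J" if "a \<in> J" for a
      using sF[OF that] I VW by blast
    ultimately have "(\<exists>a \<in> I \<union> J. c = joined (E \<union> F) `` {a} \<and> c \<subseteq> I \<union> J) \<longleftrightarrow>
      (\<exists>a \<in> I. c = joined E `` {a} \<and> c \<subseteq> I) \<or> (\<exists>a \<in> J. c = joined F `` {a} \<and> c \<subseteq> J)"
      using cE cF by (simp add: bex_Un cong: bex_cong conj_cong)
    then show ?thesis unfolding mem_Collect_eq q by simp
  qed
  then have "{c \<in> (I \<union> J) // joined (E \<union> F). c \<subseteq> I \<union> J} = ?X \<union> ?Y" by auto
  moreover have "?X \<inter> ?Y = {}"
  proof -
    have "c \<noteq> {}" if "c \<in> ?X" for c using that by (auto simp: q)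
    then show ?thesis using I J VW by blast
  qed
  moreover have "finite ?X" "finite ?Y"
    using fin by (auto intro: finite_subset[of _ "Pow I"] finite_subset[of _ "Pow J"])
  ultimately show ?thesis by (simp add: loops_def card_Un_disjoint)
qed

section \<open>Perfect matchings\<close>

lemma perfect_matching_iff:
  "perfect_matching V M \<longleftrightarrow>
    (\<forall>e \<in> M. \<exists>u v. e = {u, v} \<and> u \<noteq> v \<and> u \<in> V \<and> v \<in> V) \<and>
    (\<forall>u \<in> V. \<exists>v. {u, v} \<in> M) \<and>
    (\<forall>u v w. {u, v} \<in> M \<longrightarrow> {u, w} \<in> M \<longrightarrow> v = w)" (is "_ \<longleftrightarrow> ?R")
proof
  assume M: "perfect_matching V M"
  have 1: "\<exists>u v. e = {u, v} \<and> u \<noteq> v \<and> u \<in> V \<and> v \<in> V" if "e \<in> M" for e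
    using M that by (fastforce simp: perfect_matching_def card_2_iff partition_on_def)
  have "\<exists>v. {u, v} \<in> M" if "u \<in> V" for u
  proof -
    obtain e where "e \<in> M" "u \<in> e" using M \<open>u \<in> V\<close> by (auto simp: perfect_matching_def partition_on_def)
    then show ?thesis using 1[of e] by (auto simp: insert_commute)
  qed
  moreover have "v = w" if "{u, v} \<in> M" "{u, w} \<in> M" for u v w
  proof -
    have "disjoint M" using M by (simp add: perfect_matching_def partition_on_def)
    then have "{u, v} = {u, w}" using disjointD[of M "{u, v}" "{u, w}"] that by auto
    then show ?thesis by (auto simp: doubleton_eq_iff)
  qed
  ultimately show ?R using 1 by blast
next
  assume R: ?R
  have R1: "\<exists>u v. e = {u, v} \<and> u \<noteq> v \<and> u \<in> V \<and> v \<in> V" if "e \<in> M" for e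
    using R that by simp
  have R2: "\<exists>v. {u, v} \<in> M" if "u \<in> V" for u using R that by simp
  have R3: "v = w" if "{u, v} \<in> M" "{u, w} \<in> M" for u v w
    using conjunct2[OF conjunct2[OF R]] that by simp
  have "\<Union>M = V"
  proof (intro equalityI subsetI)
    fix u assume "u \<in> \<Union>M"
    then obtain e where "e \<in> M" "u \<in> e" by (rule UnionE)
    then show "u \<in> V" using R1[of e] by auto
  next
    fix u assume "u \<in> V"
    then obtain v where "{u, v} \<in> M" using R2 by auto
    then show "u \<in> \<Union>M" by (rule UnionI) simp
  qed
  moreover have "disjoint M"
  proof (rule disjointI)
    fix e f assume ef: "e \<in> M" "f \<in> M" "e \<noteq> f"
    obtain a b where ab: "e = {a, b}" using R1[OF ef(1)] by auto
    obtain c d where cd: "f = {c, d}" using R1[OF ef(2)] by auto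
    have "{a, b} \<in> M" "{b, a} \<in> M" "{c, d} \<in> M" "{d, c} \<in> M" using ef ab cd by (auto simp: insert_commute)
    then have "a = c \<longrightarrow> b = d" "a = d \<longrightarrow> b = c" "b = c \<longrightarrow> a = d" "b = d \<longrightarrow> a = c"
      using R3[of a b d] R3[of a b c] R3[of b a d] R3[of b a c] by blast+
    moreover have "\<not> (a = c \<and> b = d \<or> a = d \<and> b = c)" using ef(3) unfolding ab cd doubleton_eq_iff .
    ultimately have "\<not> (a = c \<or> a = d \<or> b = c \<or> b = d)" by blast
    then show "e \<inter> f = {}" unfolding ab cd by simp
  qed
  moreover have "{} \<notin> M" "\<forall>e \<in> M. card e = 2" using R1 by (force simp: card_2_iff)+
  ultimately show "perfect_matching V M" by (auto simp: perfect_matching_def partition_on_def)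
qed

lemma perfect_matching_arc:
  assumes "perfect_matching V M" "e \<in> M"
  obtains u v where "e = {u, v}" "u \<noteq> v" "u \<in> V" "v \<in> V"
  using assms unfolding perfect_matching_iff by metis

lemma perfect_matching_ends:
  "perfect_matching V M \<Longrightarrow> {u, v} \<in> M \<Longrightarrow> u \<in> V \<and> v \<in> V \<and> u \<noteq> v"
  by (erule (1) perfect_matching_arc) (auto simp: doubleton_eq_iff)

lemma perfect_matching_partner:
  assumes "perfect_matching V M" "u \<in> V" obtains v where "{u, v} \<in> M"
  using assms unfolding perfect_matching_iff by metis

lemma perfect_matching_unique:
  "perfect_matching V M \<Longrightarrow> {u, v} \<in> M \<Longrightarrow> {u, w} \<in> M \<Longrightarrow> v = w"
  unfolding perfect_matching_iff by metis

lemma perfect_matching_Union: "perfect_matching V M \<Longrightarrow> \<Union>M = V"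
  by (simp add: perfect_matching_def partition_on_def)

lemma perfect_matching_emap:
  assumes "inj_on f V" "perfect_matching V M" shows "perfect_matching (f ` V) (emap f M)"
proof -
  have arcs: "\<exists>u v. e = {f u, f v} \<and> {u, v} \<in> M \<and> u \<in> V \<and> v \<in> V \<and> f u \<noteq> f v" if e: "e \<in> emap f M" for e
  proof -
    obtain e' where e': "e' \<in> M" "e = f ` e'" using e by (rule emapE)
    then obtain u v where "e' = {u, v}" "u \<noteq> v" "u \<in> V" "v \<in> V"
      using perfect_matching_arc[OF assms(2)] by metis
    then show ?thesis using e' assms(1) by (intro exI[of _ u] exI[of _ v]) (auto simp: inj_on_eq_iff)
  qed
  show ?thesis unfolding perfect_matching_iff
  proof (intro conjI ballI allI impI)
    fix e assume "e \<in> emap f M"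
    then show "\<exists>u v. e = {u, v} \<and> u \<noteq> v \<and> u \<in> f ` V \<and> v \<in> f ` V" using arcs[of e] by blast
  next
    fix u assume "u \<in> f ` V"
    then obtain a where "u = f a" "a \<in> V" by auto
    then show "\<exists>v. {u, v} \<in> emap f M" using perfect_matching_partner[OF assms(2)] emap_edge by metis
  next
    fix u v w assume uv: "{u, v} \<in> emap f M" and uw: "{u, w} \<in> emap f M"
    obtain a b where ab: "u = f a" "v = f b" "{a, b} \<in> M" "a \<in> V"
      using arcs[OF uv] by (auto simp: doubleton_eq_iff insert_commute)
    obtain c d where cd: "u = f c" "w = f d" "{c, d} \<in> M" "c \<in> V"
      using arcs[OF uw] by (auto simp: doubleton_eq_iff insert_commute)
    have "a = c" using ab cd assms(1) by (auto simp: inj_on_def)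
    then have "{a, d} \<in> M" using cd by simp
    then show "v = w" using ab cd perfect_matching_unique[OF assms(2) ab(3)] by simp
  qed
qed

lemma joined_perfect_matching:
  assumes "perfect_matching V M" shows "(u, v) \<in> joined M \<longleftrightarrow> u = v \<or> {u, v} \<in> M"
proof
  assume "(u, v) \<in> joined M"
  then show "u = v \<or> {u, v} \<in> M"
  proof (induct rule: joined_induct)
    case (step v w)
    show ?case
    proof (cases "u = v")
      case False
      then have "{v, u} \<in> M" using step(3) by (simp add: insert_commute)
      then show ?thesis using perfect_matching_unique[OF assms _ step(2)] by simp
    qed (use step in simp)
  qed simp
next
  assume "u = v \<or> {u, v} \<in> M"
  then show "(u, v) \<in> joined M" using joined_edge by auto
qed

text \<open>
  Unions of components of a graph that contains the arcs of \<open>M\<close> have this property.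
\<close>

definition saturated :: "'v set set \<Rightarrow> 'v set \<Rightarrow> bool" where
  "saturated M P \<longleftrightarrow> (\<forall>e \<in> M. e \<inter> P \<noteq> {} \<longrightarrow> e \<subseteq> P)"

lemma saturated_Union:
  "perfect_matching V M \<Longrightarrow> saturated M P \<Longrightarrow> P \<inter> V = \<Union>{e \<in> M. e \<subseteq> P}"
  using perfect_matching_Union[of V M] unfolding saturated_def by blast

lemma saturated_card:
  assumes "perfect_matching V M" "saturated M P" "finite V"
  shows "card (P \<inter> V) = 2 * card {e \<in> M. e \<subseteq> P}"
proof -
  let ?F = "{e \<in> M. e \<subseteq> P}"
  have "pairwise disjnt ?F" using assms(1)
    by (auto simp: perfect_matching_def partition_on_def disjoint_def pairwise_def disjnt_def)
  moreover have "finite e" if "e \<in> ?F" for e using that assms(1) by (auto elim!: perfect_matching_arc)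
  ultimately have "card (\<Union>?F) = sum card ?F" by (rule card_Union_disjoint)
  also have "\<dots> = 2 * card ?F" using assms(1) by (simp add: perfect_matching_def)
  finally show ?thesis using saturated_Union[OF assms(1,2)] by simp
qed

lemma saturated_class:
  assumes "perfect_matching V A" "A \<subseteq> E" shows "saturated A (joined E `` {u})"
  unfolding saturated_def
proof (intro ballI impI)
  fix e assume e: "e \<in> A" "e \<inter> joined E `` {u} \<noteq> {}"
  obtain a b where ab: "e = {a, b}" using perfect_matching_arc[OF assms(1) e(1)] by metis
  have "(a, b) \<in> joined E" "(b, a) \<in> joined E" using e ab assms(2) by (auto intro: joined_edge joined_sym)
  then show "e \<subseteq> joined E `` {u}" using e ab by (auto intro: joined_trans)
qed

text \<open>A component grows from a single vertex, one new vertex and one new edge at a time.\<close>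

lemma card_component:
  assumes "finite E" and "finite (joined E `` {u})"
  shows "card (joined E `` {u}) \<le> Suc (card {e \<in> E. e \<subseteq> joined E `` {u}})"
proof -
  let ?P = "joined E `` {u}"
  have grow: "\<exists>S \<subseteq> ?P. u \<in> S \<and> card S = Suc k \<and> k \<le> card {e \<in> E. e \<subseteq> S}" if "k < card ?P" for k
    using that
  proof (induct k)
    case 0
    then show ?case by (intro exI[of _ "{u}"]) auto
  next
    case (Suc k)
    then obtain S where S: "S \<subseteq> ?P" "u \<in> S" "card S = Suc k" "k \<le> card {e \<in> E. e \<subseteq> S}" by auto
    have "S \<noteq> ?P" using S Suc.prems by auto
    then obtain v where v: "(u, v) \<in> joined E" "v \<notin> S" using S by auto
    obtain a b where ab: "{a, b} \<in> E" "a \<in> S" "b \<notin> S"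
      using joined_closed_set[OF v(1) S(2)] v(2) by blast
    have "b \<in> ?P" using ab S(1) by (auto intro: joined_trans joined_edge)
    have "{e \<in> E. e \<subseteq> insert b S} \<supseteq> insert {a, b} {e \<in> E. e \<subseteq> S}" using ab by auto
    then have "card (insert {a, b} {e \<in> E. e \<subseteq> S}) \<le> card {e \<in> E. e \<subseteq> insert b S}"
      using assms(1) by (intro card_mono) auto
    moreover have "card (insert {a, b} {e \<in> E. e \<subseteq> S}) = Suc (card {e \<in> E. e \<subseteq> S})"
      using assms(1) ab by (subst card_insert_disjoint) auto
    moreover have "finite S" using S(1) assms(2) finite_subset by blast
    ultimately show ?case using S \<open>b \<in> ?P\<close> ab by (intro exI[of _ "insert b S"]) auto
  qed
  have "card ?P > 0" using assms(2) by (subst card_gt_0_iff) auto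
  then obtain S where S: "S \<subseteq> ?P" "card S = Suc (card ?P - 1)" "card ?P - 1 \<le> card {e \<in> E. e \<subseteq> S}"
    using grow[of "card ?P - 1"] by auto
  then have "S = ?P" using card_subset_eq[OF assms(2) S(1)] \<open>card ?P > 0\<close> by simp
  then show ?thesis using S(3) by simp
qed

text \<open>
  Glueing two matchings along the points that they share gives a graph in which shared points have
  two neighbours and the others have one. By counting edges, a component contains at
  most two of the others, and by parity it contains none or two.
\<close>

lemma component_boundary_card:
  assumes A: "perfect_matching V A" and B: "perfect_matching W B" and fin: "finite V" "finite W"
    and u: "u \<in> (V - W) \<union> (W - V)"
  shows "card (joined (A \<union> B) `` {u} \<inter> ((V - W) \<union> (W - V))) = 2"
proof -
  let ?E = "A \<union> B" and ?D = "(V - W) \<union> (W - V)"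
  let ?P = "joined ?E `` {u}"
  have U: "\<Union>?E \<subseteq> V \<union> W" using perfect_matching_Union[OF A] perfect_matching_Union[OF B] by auto
  have P: "?P \<subseteq> V \<union> W" using joined_stays[OF _ U] u by auto
  then have finP: "finite ?P" using fin finite_subset by blast
  have "finite (Pow (V \<union> W))" using fin by auto
  moreover have "?E \<subseteq> Pow (V \<union> W)" using U by blast
  ultimately have finE: "finite ?E" using finite_subset by blast
  have cA: "card (?P \<inter> V) = 2 * card {e \<in> A. e \<subseteq> ?P}"
    by (rule saturated_card[OF A saturated_class[OF A] fin(1)]) auto
  have cB: "card (?P \<inter> W) = 2 * card {e \<in> B. e \<subseteq> ?P}"
    by (rule saturated_card[OF B saturated_class[OF B] fin(2)]) auto
  have "{e \<in> ?E. e \<subseteq> ?P} = {e \<in> A. e \<subseteq> ?P} \<union> {e \<in> B. e \<subseteq> ?P}" by auto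
  then have "card {e \<in> ?E. e \<subseteq> ?P} \<le> card {e \<in> A. e \<subseteq> ?P} + card {e \<in> B. e \<subseteq> ?P}"
    by (simp only: card_Un_le)
  moreover have "card ?P \<le> Suc (card {e \<in> ?E. e \<subseteq> ?P})" by (rule card_component[OF finE finP])
  ultimately have 1: "2 * card ?P \<le> 2 + card (?P \<inter> V) + card (?P \<inter> W)" using cA cB by simp
  have 2: "card (?P \<inter> V) = card (?P \<inter> (V - W)) + card (?P \<inter> V \<inter> W)"
    using finP by (subst card_Un_disjoint[symmetric]) (auto intro: arg_cong[where f = card])
  have 3: "card (?P \<inter> W) = card (?P \<inter> (W - V)) + card (?P \<inter> V \<inter> W)"
    using finP by (subst card_Un_disjoint[symmetric]) (auto intro: arg_cong[where f = card])
  have 4: "card (?P \<inter> ?D) = card (?P \<inter> (V - W)) + card (?P \<inter> (W - V))"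
    using finP by (subst card_Un_disjoint[symmetric]) (auto intro: arg_cong[where f = card])
  have 5: "card ?P = card (?P \<inter> ?D) + card (?P \<inter> V \<inter> W)"
    using finP P by (subst card_Un_disjoint[symmetric]) (auto intro!: arg_cong[where f = card])
  have "card (?P \<inter> ?D) \<le> 2" using 1 2 3 4 5 by linarith
  moreover have "even (card (?P \<inter> ?D))" using 2 3 4 cA cB by presburger
  moreover have "card (?P \<inter> ?D) > 0" using finP u by (subst card_gt_0_iff) auto
  ultimately show ?thesis by presburger
qed

lemma perfect_matching_glue:
  assumes A: "perfect_matching V A" and B: "perfect_matching W B" and fin: "finite V" "finite W"
  shows "perfect_matching ((V - W) \<union> (W - V)) (contract (A \<union> B) ((V - W) \<union> (W - V)))"
    (is "perfect_matching ?D ?C")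
  unfolding perfect_matching_iff
proof (intro conjI ballI allI impI)
  fix e assume "e \<in> ?C"
  then show "\<exists>u v. e = {u, v} \<and> u \<noteq> v \<and> u \<in> ?D \<and> v \<in> ?D" by (elim contractE) blast
next
  fix u assume u: "u \<in> ?D"
  have "card (joined (A \<union> B) `` {u} \<inter> ?D) = 2" by (rule component_boundary_card[OF A B fin u])
  moreover have "u \<in> joined (A \<union> B) `` {u} \<inter> ?D" using u by auto
  ultimately obtain v where "v \<noteq> u" "v \<in> joined (A \<union> B) `` {u} \<inter> ?D"
    by (metis card_2_iff insertI1 insertI2 singletonD insertE)
  then show "\<exists>v. {u, v} \<in> ?C" using u by (intro exI[of _ v]) (auto simp: contract_iff)
next
  fix u v w assume "{u, v} \<in> ?C" "{u, w} \<in> ?C"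
  then have uvw: "u \<in> ?D" "v \<noteq> u" "w \<noteq> u" "{u, v, w} \<subseteq> joined (A \<union> B) `` {u} \<inter> ?D"
    by (auto simp: contract_iff)
  have two: "card (joined (A \<union> B) `` {u} \<inter> ?D) = 2" by (rule component_boundary_card[OF A B fin uvw(1)])
  then have "finite (joined (A \<union> B) `` {u} \<inter> ?D)" by (rule_tac card_ge_0_finite) simp
  then have "card {u, v, w} \<le> 2" using card_mono[OF _ uvw(4)] two by simp
  then show "v = w" using uvw(2,3) by (cases "v = w") auto
qed

text \<open>
  Counting arguments about a glued matching use the whole component that carries an arc: both
  given matchings decompose it into arcs.
\<close>

lemma glue_arc_component:
  assumes A: "perfect_matching V A" and B: "perfect_matching W B" and fin: "finite V" "finite W"
    and e: "e \<in> contract (A \<union> B) ((V - W) \<union> (W - V))"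
  obtains P u where "saturated A P" "saturated B P" "finite P" "P \<inter> ((V - W) \<union> (W - V)) = e"
    "u \<in> e" "P = joined (A \<union> B) `` {u}"
proof -
  let ?D = "(V - W) \<union> (W - V)"
  obtain u v where uv: "e = {u, v}" "u \<in> ?D" "v \<in> ?D" "u \<noteq> v" "(u, v) \<in> joined (A \<union> B)"
    using e by (rule contractE)
  let ?P = "joined (A \<union> B) `` {u}"
  have "card (?P \<inter> ?D) = 2" by (rule component_boundary_card[OF A B fin uv(2)])
  moreover have "finite (?P \<inter> ?D)" using fin by simp
  moreover have "e \<subseteq> ?P \<inter> ?D" using uv by simp
  ultimately have "?P \<inter> ?D = e" using uv(1,4) by (intro card_subset_eq[symmetric]) simp_all
  moreover have "?P \<subseteq> V \<union> W"
  proof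
    fix b assume "b \<in> ?P"
    then have "(u, b) \<in> joined (A \<union> B)" by simp
    then show "b \<in> V \<union> W"
      by (rule joined_stays) (use perfect_matching_Union[OF A] perfect_matching_Union[OF B] uv(2) in auto)
  qed
  then have "finite ?P" by (rule finite_subset) (simp add: fin)
  moreover have "saturated A ?P" "saturated B ?P"
    by (rule saturated_class[OF A] saturated_class[OF B]; simp)+
  moreover have "u \<in> e" using uv(1) by simp
  ultimately show thesis using that by blast
qed

lemma joined_classes_disjoint:
  assumes "P = joined E `` {u}" "Q = joined E `` {v}" "u \<in> e" "P \<inter> D = e" "Q \<inter> D = f" "e \<inter> f = {}"
  shows "P \<inter> Q = {}"
proof (rule ccontr)
  assume "P \<inter> Q \<noteq> {}"
  then obtain a where "a \<in> P" "a \<in> Q" by auto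
  then have "P = Q" using joined_class_eq[of u a] joined_class_eq[of v a] assms(1,2) by simp
  then show False using assms by auto
qed

section \<open>Non-crossing matchings\<close>

text \<open>
  Two disjoint pairs separate each other exactly if the number of increasing pairs with one member
  in each is odd. This number is additive, which turns planarity into a statement about parity.
\<close>

definition ascents :: "('v \<Rightarrow> nat) \<Rightarrow> 'v set \<Rightarrow> 'v set \<Rightarrow> nat" where
  "ascents pos P Q = (\<Sum>a \<in> P. \<Sum>c \<in> Q. if pos a < pos c then 1 else 0)"

lemma ascents_Un_left:
  "finite P \<Longrightarrow> finite P' \<Longrightarrow> P \<inter> P' = {} \<Longrightarrow> ascents pos (P \<union> P') Q = ascents pos P Q + ascents pos P' Q"
  by (simp add: ascents_def sum.union_disjoint)

lemma ascents_Un_right: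
  "finite Q \<Longrightarrow> finite Q' \<Longrightarrow> Q \<inter> Q' = {} \<Longrightarrow> ascents pos P (Q \<union> Q') = ascents pos P Q + ascents pos P Q'"
  by (simp add: ascents_def sum.union_disjoint sum.distrib)

lemma ascents_all:
  "(\<And>a c. a \<in> P \<Longrightarrow> c \<in> Q \<Longrightarrow> pos a < pos c) \<Longrightarrow> ascents pos P Q = card P * card Q"
  by (simp add: ascents_def)

lemma ascents_none:
  "(\<And>a c. a \<in> P \<Longrightarrow> c \<in> Q \<Longrightarrow> \<not> pos a < pos c) \<Longrightarrow> ascents pos P Q = 0"
  by (simp add: ascents_def)

lemma ascents_cong:
  "(\<And>a c. a \<in> P \<Longrightarrow> c \<in> Q \<Longrightarrow> pos a < pos c \<longleftrightarrow> pos' a < pos' c) \<Longrightarrow> ascents pos P Q = ascents pos' P Q"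
  unfolding ascents_def by (intro sum.cong refl if_cong) auto

lemma ascents_opposite:
  assumes "\<And>a c. a \<in> P \<Longrightarrow> c \<in> Q \<Longrightarrow> pos' a < pos' c \<longleftrightarrow> \<not> pos a < pos c"
  shows "ascents pos P Q + ascents pos' P Q = card P * card Q"
proof -
  have "ascents pos P Q + ascents pos' P Q
      = (\<Sum>a\<in>P. \<Sum>c\<in>Q. (if pos a < pos c then 1 else 0) + (if pos' a < pos' c then 1 else 0))"
    by (simp add: ascents_def sum.distrib)
  also have "\<dots> = (\<Sum>a\<in>P. \<Sum>c\<in>Q. 1)"
    using assms by (intro sum.cong refl) auto
  finally show ?thesis by simp
qed

lemma even_ascents_left:
  assumes "\<And>a. a \<in> P \<Longrightarrow> (\<forall>c \<in> Q. pos a < pos c) \<or> (\<forall>c \<in> Q. pos c < pos a)" and "even (card Q)"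
  shows "even (ascents pos P Q)"
  unfolding ascents_def
proof (rule dvd_sum)
  fix a assume "a \<in> P"
  then consider "\<forall>c \<in> Q. pos a < pos c" | "\<forall>c \<in> Q. pos c < pos a" using assms(1) by blast
  then show "even (\<Sum>c\<in>Q. if pos a < pos c then 1 else 0 :: nat)"
  proof cases
    case 1
    then show ?thesis using assms(2) by simp
  next
    case 2
    then have "(\<Sum>c\<in>Q. if pos a < pos c then 1 else 0 :: nat) = 0" by (intro sum.neutral) auto
    then show ?thesis by simp
  qed
qed

lemma even_ascents_right:
  assumes "\<And>c. c \<in> Q \<Longrightarrow> (\<forall>a \<in> P. pos a < pos c) \<or> (\<forall>a \<in> P. pos c < pos a)" and "even (card P)"
  shows "even (ascents pos P Q)"
  unfolding ascents_def
proof (subst sum.swap, rule dvd_sum)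
  fix c assume "c \<in> Q"
  then consider "\<forall>a \<in> P. pos a < pos c" | "\<forall>a \<in> P. pos c < pos a" using assms(1) by blast
  then show "even (\<Sum>a\<in>P. if pos a < pos c then 1 else 0 :: nat)"
  proof cases
    case 1
    then show ?thesis using assms(2) by simp
  next
    case 2
    then have "(\<Sum>a\<in>P. if pos a < pos c then 1 else 0 :: nat) = 0" by (intro sum.neutral) auto
    then show ?thesis by simp
  qed
qed

text \<open>
  Arcs that do not cross are nested or side by side, with two, four or no ascents between them.
\<close>

lemma even_ascents_pair:
  assumes M: "perfect_matching V M" and inj: "inj_on pos V" and nc: "\<not> crossing pos M"
    and e: "e \<in> M" and f: "f \<in> M" and ef: "e \<inter> f = {}"
  shows "even (ascents pos e f)"
proof -
  have ordered: "\<exists>a b. e = {a, b} \<and> pos a < pos b \<and> a \<in> V \<and> b \<in> V" if e: "e \<in> M" for e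
  proof -
    obtain a b where ab: "e = {a, b}" "a \<noteq> b" "a \<in> V" "b \<in> V" using perfect_matching_arc[OF M e] by metis
    then have "pos a \<noteq> pos b" using inj by (simp add: inj_on_eq_iff)
    then show ?thesis
    proof (cases "pos a < pos b")
      case False
      then show ?thesis using ab \<open>pos a \<noteq> pos b\<close>
        by (intro exI[of _ b] exI[of _ a]) (simp add: insert_commute)
    qed (use ab in auto)
  qed
  obtain a b where ab: "e = {a, b}" "pos a < pos b" "a \<in> V" "b \<in> V" using ordered[OF e] by auto
  obtain c d where cd: "f = {c, d}" "pos c < pos d" "c \<in> V" "d \<in> V" using ordered[OF f] by auto
  have "a \<noteq> c" "a \<noteq> d" "b \<noteq> c" "b \<noteq> d" using ef ab cd by auto
  then have ne: "pos a \<noteq> pos c" "pos a \<noteq> pos d" "pos b \<noteq> pos c" "pos b \<noteq> pos d"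
    using inj ab cd by (simp_all add: inj_on_eq_iff)
  have "\<not> (pos a < pos c \<and> pos c < pos b \<and> pos b < pos d)"
    "\<not> (pos c < pos a \<and> pos a < pos d \<and> pos d < pos b)"
    using nc e f unfolding crossing_def ab(1) cd(1) by blast+
  moreover have "ascents pos e f = (if pos a < pos c then 1 else 0) + (if pos a < pos d then 1 else 0)
     + ((if pos b < pos c then 1 else 0) + (if pos b < pos d then 1 else 0))"
  proof -
    have "a \<noteq> b" "c \<noteq> d" using ab(2) cd(2) by auto
    then show ?thesis unfolding ab(1) cd(1) by (simp add: ascents_def)
  qed
  moreover have "pos a < pos c \<or> pos c < pos a" "pos a < pos d \<or> pos d < pos a"
    "pos b < pos c \<or> pos c < pos b" "pos b < pos d \<or> pos d < pos b" using ne by linarith+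
  ultimately show ?thesis using ab(2) cd(2) by (elim disjE) simp_all
qed

text \<open>By additivity, ascents are counted between single arcs.\<close>

lemma even_ascents:
  assumes M: "perfect_matching V M" and inj: "inj_on pos V"
    and nc: "\<not> crossing pos M" and P: "saturated M P" and Q: "saturated M Q" and PQ: "P \<inter> Q = {}"
  shows "even (ascents pos (P \<inter> V) (Q \<inter> V))"
proof -
  have dis: "\<forall>A \<in> {e \<in> M. e \<subseteq> R}. \<forall>B \<in> {e \<in> M. e \<subseteq> R}. A \<noteq> B \<longrightarrow> A \<inter> B = {}" for R
    using M disjointD[of M] by (auto simp: perfect_matching_def partition_on_def)
  have fine: "\<forall>A \<in> {e \<in> M. e \<subseteq> R}. finite A" for R using M by (auto elim!: perfect_matching_arc)
  have "ascents pos (P \<inter> V) (Q \<inter> V)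
    = (\<Sum>e | e \<in> M \<and> e \<subseteq> P. \<Sum>a \<in> e. \<Sum>f | f \<in> M \<and> f \<subseteq> Q. \<Sum>c \<in> f. if pos a < pos c then 1 else 0)"
    unfolding ascents_def saturated_Union[OF M P] saturated_Union[OF M Q]
      sum.Union_disjoint[OF fine dis] comp_apply ..
  also have "\<dots> = (\<Sum>e | e \<in> M \<and> e \<subseteq> P. \<Sum>f | f \<in> M \<and> f \<subseteq> Q. ascents pos e f)"
    unfolding ascents_def by (intro sum.cong refl sum.swap)
  also have "even \<dots>"
  proof (intro dvd_sum)
    fix e f assume "e \<in> {e \<in> M. e \<subseteq> P}" "f \<in> {e \<in> M. e \<subseteq> Q}"
    then have "e \<in> M" "f \<in> M" "e \<inter> f = {}" using PQ by auto
    then show "even (ascents pos e f)" by (rule even_ascents_pair[OF M inj nc])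
  qed
  finally show ?thesis .
qed

text \<open>
  Between arcs that cross there is an odd number of ascents: three or one, according to the
  order in which they are taken.
\<close>

lemma not_crossingI:
  assumes M: "perfect_matching V M"
    and ev: "\<And>e f. e \<in> M \<Longrightarrow> f \<in> M \<Longrightarrow> e \<inter> f = {} \<Longrightarrow> even (ascents pos e f)"
  shows "\<not> crossing pos M"
proof
  assume "crossing pos M"
  then obtain a b c d where *: "{a, b} \<in> M" "{c, d} \<in> M" "pos a < pos c" "pos c < pos b" "pos b < pos d"
    by (auto simp: crossing_def)
  have "a \<noteq> b" "c \<noteq> d" "{a, b} \<inter> {c, d} = {}" using * by auto
  moreover from this have "ascents pos {a, b} {c, d} = 3" using * by (simp add: ascents_def)
  ultimately show False using ev[OF *(1,2)] by simp
qed

text \<open>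
  Filling a region of a planar picture leaves it planar, if the boundary of the region is not
  mixed with the remaining boundary: a component meets the former in an even number of points, and
  from a point of the latter all of them are on the same side, or the same holds with the two boundaries
  exchanged. Either way the ascents between them come in pairs.
\<close>

lemma glue_inside:
  assumes A: "perfect_matching V A" and B: "perfect_matching W B" and fin: "finite V" and WV: "W \<subseteq> V"
    and inj: "inj_on pos V" and ncA: "\<not> crossing pos A" and ncB: "\<not> crossing pos B"
    and separated: "(\<forall>a \<in> V - W. (\<forall>c \<in> W. pos a < pos c) \<or> (\<forall>c \<in> W. pos c < pos a)) \<or>
      (\<forall>c \<in> W. (\<forall>a \<in> V - W. pos a < pos c) \<or> (\<forall>a \<in> V - W. pos c < pos a))"
  shows "perfect_matching (V - W) (contract (A \<union> B) (V - W))"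
    and "\<not> crossing pos (contract (A \<union> B) (V - W))"
proof -
  have finW: "finite W" using fin WV finite_subset by blast
  have D: "(V - W) \<union> (W - V) = V - W" using WV by auto
  show pC: "perfect_matching (V - W) (contract (A \<union> B) (V - W))"
    using perfect_matching_glue[OF A B fin finW] unfolding D .
  show "\<not> crossing pos (contract (A \<union> B) (V - W))"
  proof (rule not_crossingI[OF pC])
    fix e f assume e: "e \<in> contract (A \<union> B) (V - W)" and f: "f \<in> contract (A \<union> B) (V - W)" and ef: "e \<inter> f = {}"
    have e': "e \<in> contract (A \<union> B) ((V - W) \<union> (W - V))" and f': "f \<in> contract (A \<union> B) ((V - W) \<union> (W - V))"
      using e f by (simp_all only: D)
    obtain P u where P: "saturated A P" "saturated B P" "finite P" "P \<inter> (V - W) = e" "u \<in> e" "P = joined (A \<union> B) `` {u}"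
      using glue_arc_component[OF A B fin finW e'] unfolding D by metis
    obtain Q v where Q: "saturated A Q" "saturated B Q" "finite Q" "Q \<inter> (V - W) = f" "v \<in> f" "Q = joined (A \<union> B) `` {v}"
      using glue_arc_component[OF A B fin finW f'] unfolding D by metis
    have PQ: "P \<inter> Q = {}" by (rule joined_classes_disjoint[OF P(6) Q(6) P(5) P(4) Q(4) ef])
    have "P \<inter> V = e \<union> (P \<inter> W)" "Q \<inter> V = f \<union> (Q \<inter> W)" using P(4) Q(4) WV by auto
    moreover have "e \<inter> (P \<inter> W) = {}" "f \<inter> (Q \<inter> W) = {}" "finite e" "finite f" using P Q by auto
    ultimately have "ascents pos (P \<inter> V) (Q \<inter> V) = ascents pos e f + ascents pos e (Q \<inter> W)
        + (ascents pos (P \<inter> W) f + ascents pos (P \<inter> W) (Q \<inter> W))"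
      using finW by (simp add: ascents_Un_left ascents_Un_right)
    moreover have "even (ascents pos (P \<inter> V) (Q \<inter> V))" by (rule even_ascents[OF A inj ncA P(1) Q(1) PQ])
    moreover have "even (ascents pos (P \<inter> W) (Q \<inter> W))"
      by (rule even_ascents[OF B inj_on_subset[OF inj WV] ncB P(2) Q(2) PQ])
    moreover have cards: "even (card (P \<inter> W))" "even (card (Q \<inter> W))" "even (card e)" "even (card f)"
      using saturated_card[OF B P(2) finW] saturated_card[OF B Q(2) finW] pC e f
      by (simp_all add: perfect_matching_def)
    have sub: "e \<subseteq> V - W" "f \<subseteq> V - W" using P(4) Q(4) by auto
    from separated have "even (ascents pos e (Q \<inter> W)) \<and> even (ascents pos (P \<inter> W) f)"
    proof
      assume s: "\<forall>a \<in> V - W. (\<forall>c \<in> W. pos a < pos c) \<or> (\<forall>c \<in> W. pos c < pos a)"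
      have "even (ascents pos e (Q \<inter> W))" by (rule even_ascents_left) (use s sub cards in blast)+
      moreover have "even (ascents pos (P \<inter> W) f)" by (rule even_ascents_right) (use s sub cards in blast)+
      ultimately show ?thesis by simp
    next
      assume s: "\<forall>c \<in> W. (\<forall>a \<in> V - W. pos a < pos c) \<or> (\<forall>a \<in> V - W. pos c < pos a)"
      have "even (ascents pos e (Q \<inter> W))" by (rule even_ascents_right) (use s sub cards in blast)+
      moreover have "even (ascents pos (P \<inter> W) f)" by (rule even_ascents_left) (use s sub cards in blast)+
      ultimately show ?thesis by simp
    qed
    ultimately show "even (ascents pos e f)" by simp
  qed
qed

lemma perfect_matching_cover_eq:
  assumes N: "perfect_matching V N" and "M \<subseteq> N" and "V \<subseteq> \<Union>M"
  shows "M = N"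
proof
  show "N \<subseteq> M"
  proof
    fix e assume e: "e \<in> N"
    obtain u v where uv: "e = {u, v}" "u \<in> V" using perfect_matching_arc[OF N e] by metis
    then obtain e' where e': "e' \<in> M" "u \<in> e'" using assms(3) by auto
    then have "e' \<in> N" using assms(2) by auto
    moreover have "disjoint N" using N by (simp add: perfect_matching_def partition_on_def)
    moreover have "e \<inter> e' \<noteq> {}" using uv e' by auto
    ultimately have "e = e'" using e disjointD by metis
    then show "e \<in> M" using e' by simp
  qed
qed (rule assms(2))

lemma perfect_matching_Un:
  assumes A: "perfect_matching V A" and B: "perfect_matching W B" and VW: "V \<inter> W = {}"
  shows "perfect_matching (V \<union> W) (A \<union> B)"
proof -
  have "disjoint (A \<union> B)"
  proof (rule disjointI)
    fix e f assume ef: "e \<in> A \<union> B" "f \<in> A \<union> B" "e \<noteq> f"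
    have "disjoint A" "disjoint B" using A B by (simp_all add: perfect_matching_def partition_on_def)
    moreover have "e \<subseteq> V" if "e \<in> A" for e using perfect_matching_Union[OF A] that by auto
    moreover have "e \<subseteq> W" if "e \<in> B" for e using perfect_matching_Union[OF B] that by auto
    ultimately show "e \<inter> f = {}" using ef VW disjointD[of A e f] disjointD[of B e f] by fast
  qed
  then have "partition_on (V \<union> W) (A \<union> B)"
    using A B by (auto simp: perfect_matching_def partition_on_def)
  then show ?thesis using A B by (auto simp: perfect_matching_def)
qed

section \<open>Composition of planar matchings\<close>

abbreviation level :: "nat \<Rightarrow> nat \<Rightarrow> point set" where
  "level l x \<equiv> {l} \<times> {..<x}"

definition raise :: "point \<Rightarrow> point" where
  "raise = (\<lambda>(l, i). (l + 1, i))"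

definition halve_level :: "point \<Rightarrow> point" where
  "halve_level = (\<lambda>(l, i). (l div 2, i))"

text \<open>Moves the bottom and the top of a diagram to the outer levels of a stack.\<close>

definition double_level :: "point \<Rightarrow> point" where
  "double_level = (\<lambda>(l, i). (2 * l, i))"

lemma raise_simp [simp]: "raise (l, i) = (Suc l, i)"
  by (simp add: raise_def)

lemma double_level_simp [simp]: "double_level (l, i) = (2 * l, i)"
  by (simp add: double_level_def)

lemma halve_level_simp [simp]: "halve_level (l, i) = (l div 2, i)"
  by (simp add: halve_level_def)

lemma inj_raise: "inj raise" and inj_double_level: "inj double_level"
  by (auto simp: inj_def)

lemma points_iff: "(l, i) \<in> points x y \<longleftrightarrow> l = 0 \<and> i < x \<or> l = 1 \<and> i < y"
  by (auto simp: points_def)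

lemma finite_points [simp]: "finite (points x y)"
  by (simp add: points_def)

lemma image_level: "(\<And>i. f (l, i) = (l', i)) \<Longrightarrow> f ` level l n = level l' n"
  by (auto simp: image_iff)

lemma raise_points: "raise ` points x y = level 1 x \<union> level 2 y"
  unfolding points_def image_Un by (simp add: image_level[of raise _ "Suc _"] numeral_2_eq_2)

lemma planar_matchings_iff:
  "M \<in> planar_matchings x y \<longleftrightarrow> perfect_matching (points x y) M \<and> \<not> crossing (boundary_pos x y) M"
  by (simp add: planar_matchings_def)

lemma inj_boundary_pos: "inj_on (boundary_pos x y) (points x y)"
  by (auto simp: inj_on_def points_iff)

lemma Union_planar: "M \<in> planar_matchings x y \<Longrightarrow> \<Union>M = points x y"
  by (simp add: planar_matchings_iff perfect_matching_Union)

lemma stack_alt: "stack N M = M \<union> emap raise N"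
  by (simp add: stack_def emap_def raise_def)

lemma stack_matching_alt:
  "stack_matching x z N M = emap halve_level (contract (stack N M) (level 0 x \<union> level 2 z))"
proof (intro equalityI subsetI)
  fix e assume "e \<in> stack_matching x z N M"
  then obtain u v where "e = halve_level ` {u, v}" "u \<in> level 0 x \<union> level 2 z" "v \<in> level 0 x \<union> level 2 z"
      "u \<noteq> v" "(u, v) \<in> joined (stack N M)"
    unfolding stack_matching_def halve_level_def by blast
  then show "e \<in> emap halve_level (contract (stack N M) (level 0 x \<union> level 2 z))"
    unfolding emap_def by (intro image_eqI[of _ _ "{u, v}"]) (simp_all only: contract_iff, simp)
next
  fix e assume "e \<in> emap halve_level (contract (stack N M) (level 0 x \<union> level 2 z))"
  then obtain e' where e': "e' \<in> contract (stack N M) (level 0 x \<union> level 2 z)" "e = halve_level ` e'"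
    by (rule emapE)
  then obtain u v where "e' = {u, v}" "u \<in> level 0 x \<union> level 2 z" "v \<in> level 0 x \<union> level 2 z"
      "u \<noteq> v" "(u, v) \<in> joined (stack N M)" by (elim contractE)
  then show "e \<in> stack_matching x z N M"
    unfolding stack_matching_def e'(2) halve_level_def by blast
qed

lemma emap_double_stack_matching:
  "emap double_level (stack_matching x z N M) = contract (stack N M) (level 0 x \<union> level 2 z)"
proof -
  have "emap double_level (stack_matching x z N M)
    = emap (\<lambda>v. v) (contract (stack N M) (level 0 x \<union> level 2 z))"
    unfolding stack_matching_alt emap_emap
    by (rule emap_cong) (use Union_contract[of "stack N M" "level 0 x \<union> level 2 z"] in force)
  then show ?thesis by (simp add: emap_def)
qed

lemma stack_matching_iff:
  "{a, b} \<in> stack_matching x z N M \<longleftrightarrow>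
    a \<in> points x z \<and> b \<in> points x z \<and> a \<noteq> b \<and> (double_level a, double_level b) \<in> joined (stack N M)"
proof -
  have "{a, b} \<in> stack_matching x z N M \<longleftrightarrow>
      {double_level a, double_level b} \<in> contract (stack N M) (level 0 x \<union> level 2 z)"
  proof
    assume "{a, b} \<in> stack_matching x z N M"
    then show "{double_level a, double_level b} \<in> contract (stack N M) (level 0 x \<union> level 2 z)"
      unfolding emap_double_stack_matching[symmetric] by (rule emap_edge)
  next
    assume "{double_level a, double_level b} \<in> contract (stack N M) (level 0 x \<union> level 2 z)"
    then obtain v where "double_level b = double_level v" "{a, v} \<in> stack_matching x z N M"
      unfolding emap_double_stack_matching[symmetric] by (rule emap_edgeE[OF _ inj_double_level])
    then show "{a, b} \<in> stack_matching x z N M" using inj_double_level by (simp add: inj_eq)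
  qed
  moreover have "double_level v \<in> level 0 x \<union> level 2 z \<longleftrightarrow> v \<in> points x z" for v
    by (cases v) (auto simp: points_iff)
  ultimately show ?thesis using inj_double_level by (simp add: contract_iff inj_eq)
qed

lemma Union_stack_matching: "\<Union>(stack_matching x z N M) \<subseteq> points x z"
proof -
  have "double_level ` \<Union>(stack_matching x z N M) \<subseteq> level 0 x \<union> level 2 z"
    unfolding Union_emap[symmetric] emap_double_stack_matching by (rule Union_contract)
  then show ?thesis by (force simp: points_iff)
qed

lemma stack_loops_alt: "stack_loops y N M = loops (stack N M) (level 1 y)"
  by (simp add: stack_loops_def loops_def)

lemma Union_stack:
  assumes "\<Union>M \<subseteq> points x y" "\<Union>N \<subseteq> points y z"
  shows "\<Union>(stack N M) \<subseteq> level 1 y \<union> (level 0 x \<union> level 2 z)"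
proof -
  have "\<Union>(emap raise N) \<subseteq> raise ` points y z" unfolding Union_emap using assms(2) by (rule image_mono)
  then show ?thesis using assms(1) unfolding stack_alt raise_points points_def by auto
qed

text \<open>
  Both ways of composing three matchings are contractions of the three-storey graph \<open>T\<close>; they
  forget its two inner levels in different orders.
\<close>

lemma triple_stack_left:
  assumes M: "\<Union>M \<subseteq> points w x" and N: "\<Union>N \<subseteq> points x y" and P: "\<Union>P \<subseteq> points y z"
  defines "T \<equiv> M \<union> emap raise N \<union> emap (\<lambda>v. raise (raise v)) P"
  shows "emap (\<lambda>(l, i). (3 * l, i)) (stack_matching w z P (stack_matching w y N M)) = contract T (level 0 w \<union> level 3 z)"
    and "stack_loops x N M + stack_loops y P (stack_matching w y N M) = loops T (level 1 x \<union> level 2 y)"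
proof -
  \<comment> \<open>\<open>\<phi>\<close> reopens the level that the first composition has forgotten.\<close>
  define \<phi> :: "point \<Rightarrow> point" where "\<phi> = (\<lambda>(l, i). (if l = 0 then 0 else l + 1, i))"
  have \<phi>: "inj \<phi>" by (auto simp: inj_def \<phi>_def split: if_splits)
  let ?S = "stack_matching w y N M"
  have "emap \<phi> ?S = emap double_level ?S"
    by (rule emap_cong) (use Union_stack_matching[of w y N M] in \<open>force simp: \<phi>_def points_iff\<close>)
  moreover have "emap \<phi> (emap raise P) = emap (\<lambda>v. raise (raise v)) P"
    unfolding emap_emap by (rule emap_cong) (auto simp: \<phi>_def raise_def)
  ultimately have st: "emap \<phi> (stack P ?S)
    = contract (stack N M) (level 0 w \<union> level 2 y) \<union> emap (\<lambda>v. raise (raise v)) P"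
    by (simp add: stack_alt emap_Un emap_double_stack_matching[unfolded stack_alt])
  have "\<Union>(emap (\<lambda>v. raise (raise v)) P) \<subseteq> (\<lambda>v. raise (raise v)) ` points y z"
    unfolding Union_emap using P by (rule image_mono)
  then have E2: "\<Union>(emap (\<lambda>v. raise (raise v)) P) \<inter> level 1 x = {}" by (auto simp: raise_def)
  have I: "level 1 x \<inter> (level 0 w \<union> level 2 y) = {}" by auto
  have T: "stack N M \<union> emap (\<lambda>v. raise (raise v)) P = T" by (simp add: T_def stack_alt)
  have "emap (\<lambda>(l, i). (3 * l, i)) (stack_matching w z P ?S)
    = emap \<phi> (emap double_level (stack_matching w z P ?S))"
    unfolding emap_emap
    by (rule emap_cong) (use Union_stack_matching[of w z P ?S] in \<open>force simp: \<phi>_def points_iff\<close>)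
  also have "\<dots> = contract (emap \<phi> (stack P ?S)) (\<phi> ` (level 0 w \<union> level 2 z))"
    by (simp only: emap_double_stack_matching contract_emap[OF \<phi>])
  also have "\<phi> ` (level 0 w \<union> level 2 z) = level 0 w \<union> level 3 z"
    by (force simp: \<phi>_def image_iff)
  also have "contract (emap \<phi> (stack P ?S)) (level 0 w \<union> level 3 z) = contract T (level 0 w \<union> level 3 z)"
    unfolding st T[symmetric] by (rule contract_contract[OF Union_stack[OF M N] I E2]) auto
  finally show "emap (\<lambda>(l, i). (3 * l, i)) (stack_matching w z P ?S) = contract T (level 0 w \<union> level 3 z)" .
  have "stack_loops y P ?S = loops (emap \<phi> (stack P ?S)) (\<phi> ` level 1 y)"
    by (simp add: stack_loops_alt loops_emap[OF \<phi>])
  also have "\<phi> ` level 1 y = level 2 y" by (force simp: \<phi>_def image_iff)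
  finally have "stack_loops y P ?S = loops (emap \<phi> (stack P ?S)) (level 2 y)" .
  moreover have "loops (stack N M \<union> emap (\<lambda>v. raise (raise v)) P) (level 1 x \<union> level 2 y)
     = loops (stack N M) (level 1 x) + loops (emap \<phi> (stack P ?S)) (level 2 y)"
    unfolding st by (rule loops_contract[OF Union_stack[OF M N] I E2]) auto
  ultimately show "stack_loops x N M + stack_loops y P ?S = loops T (level 1 x \<union> level 2 y)"
    unfolding T by (simp add: stack_loops_alt)
qed

lemma triple_stack_right:
  assumes M: "\<Union>M \<subseteq> points w x" and N: "\<Union>N \<subseteq> points x y" and P: "\<Union>P \<subseteq> points y z"
  defines "T \<equiv> M \<union> emap raise N \<union> emap (\<lambda>v. raise (raise v)) P"
  shows "emap (\<lambda>(l, i). (3 * l, i)) (stack_matching w z (stack_matching x z P N) M) = contract T (level 0 w \<union> level 3 z)"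
    and "stack_loops y P N + stack_loops x (stack_matching x z P N) M = loops T (level 1 x \<union> level 2 y)"
proof -
  \<comment> \<open>\<open>\<psi>\<close> reopens the level that the first composition has forgotten.\<close>
  define \<psi> :: "point \<Rightarrow> point" where "\<psi> = (\<lambda>(l, i). (if l \<le> 1 then l else l + 1, i))"
  have \<psi>: "inj \<psi>" by (auto simp: inj_def \<psi>_def split: if_splits)
  let ?S = "stack_matching x z P N" and ?E = "emap raise (stack P N)"
  have "emap \<psi> (emap raise ?S) = emap raise (emap double_level ?S)"
    unfolding emap_emap
    by (rule emap_cong) (use Union_stack_matching[of x z P N] in \<open>force simp: \<psi>_def points_iff\<close>)
  also have "\<dots> = contract ?E (raise ` (level 0 x \<union> level 2 z))"
    unfolding emap_double_stack_matching by (rule contract_emap[OF inj_raise, symmetric])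
  also have "raise ` (level 0 x \<union> level 2 z) = level 1 x \<union> level 3 z"
    by (force simp: image_iff)
  finally have S: "emap \<psi> (emap raise ?S) = contract ?E (level 1 x \<union> level 3 z)" .
  have "emap \<psi> M = emap (\<lambda>v. v) M"
    by (rule emap_cong) (use M in \<open>force simp: \<psi>_def points_iff\<close>)
  then have "emap \<psi> M = M" by (simp add: emap_def)
  then have st: "emap \<psi> (stack ?S M) = contract ?E (level 1 x \<union> level 3 z) \<union> M"
    using S by (simp add: stack_alt emap_Un Un_commute)
  have "\<Union>?E \<subseteq> raise ` (level 1 y \<union> (level 0 x \<union> level 2 z))"
    unfolding Union_emap using Union_stack[OF N P] by (rule image_mono)
  then have E1: "\<Union>?E \<subseteq> level 2 y \<union> (level 1 x \<union> level 3 z)" by auto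
  have I: "level 2 y \<inter> (level 1 x \<union> level 3 z) = {}" by auto
  have E2: "\<Union>M \<inter> level 2 y = {}" using M by (auto simp: points_def)
  have T: "?E \<union> M = T" by (simp add: T_def stack_alt emap_Un emap_emap Un_ac)
  have "emap (\<lambda>(l, i). (3 * l, i)) (stack_matching w z ?S M)
    = emap \<psi> (emap double_level (stack_matching w z ?S M))"
    unfolding emap_emap
    by (rule emap_cong) (use Union_stack_matching[of w z ?S M] in \<open>force simp: \<psi>_def points_iff\<close>)
  also have "\<dots> = contract (emap \<psi> (stack ?S M)) (\<psi> ` (level 0 w \<union> level 2 z))"
    by (simp only: emap_double_stack_matching contract_emap[OF \<psi>])
  also have "\<psi> ` (level 0 w \<union> level 2 z) = level 0 w \<union> level 3 z"
    by (force simp: \<psi>_def image_iff)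
  also have "contract (emap \<psi> (stack ?S M)) (level 0 w \<union> level 3 z) = contract T (level 0 w \<union> level 3 z)"
    unfolding st T[symmetric] by (rule contract_contract[OF E1 I E2]) auto
  finally show "emap (\<lambda>(l, i). (3 * l, i)) (stack_matching w z ?S M) = contract T (level 0 w \<union> level 3 z)" .
  have "stack_loops x ?S M = loops (emap \<psi> (stack ?S M)) (\<psi> ` level 1 x)"
    by (simp add: stack_loops_alt loops_emap[OF \<psi>])
  also have "\<psi> ` level 1 x = level 1 x" by (force simp: \<psi>_def image_iff)
  finally have 1: "stack_loops x ?S M = loops (emap \<psi> (stack ?S M)) (level 1 x)" .
  have "stack_loops y P N = loops ?E (raise ` level 1 y)"
    by (simp add: stack_loops_alt loops_emap[OF inj_raise])
  also have "raise ` level 1 y = level 2 y" by (force simp: image_iff)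
  finally have 2: "stack_loops y P N = loops ?E (level 2 y)" .
  have "loops (?E \<union> M) (level 2 y \<union> level 1 x) = loops ?E (level 2 y) + loops (emap \<psi> (stack ?S M)) (level 1 x)"
    unfolding st by (rule loops_contract[OF E1 I E2]) auto
  then show "stack_loops y P N + stack_loops x ?S M = loops T (level 1 x \<union> level 2 y)"
    unfolding T 1 2 by (simp add: Un_commute)
qed

lemma stack_matching_assoc:
  assumes "\<Union>M \<subseteq> points w x" "\<Union>N \<subseteq> points x y" "\<Union>P \<subseteq> points y z"
  shows "stack_matching w z P (stack_matching w y N M) = stack_matching w z (stack_matching x z P N) M"
    and "stack_loops x N M + stack_loops y P (stack_matching w y N M)
      = stack_loops y P N + stack_loops x (stack_matching x z P N) M"
proof -
  have "inj (\<lambda>(l, i). (3 * l, i) :: point)" by (auto simp: inj_def)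
  then show "stack_matching w z P (stack_matching w y N M) = stack_matching w z (stack_matching x z P N) M"
    by (rule emap_inj) (simp only: triple_stack_left(1)[OF assms] triple_stack_right(1)[OF assms])
  show "stack_loops x N M + stack_loops y P (stack_matching w y N M)
      = stack_loops y P N + stack_loops x (stack_matching x z P N) M"
    by (simp only: triple_stack_left(2)[OF assms] triple_stack_right(2)[OF assms])
qed

lemma crossing_emap: "inj f \<Longrightarrow> crossing pos (emap f M) \<longleftrightarrow> crossing (\<lambda>v. pos (f v)) M"
proof -
  assume f: "inj f"
  have arc: "{f a, f b} \<in> emap f M \<longleftrightarrow> {a, b} \<in> M" for a b
    using emap_edge[of a b M f] emap_edgeE[of f a "f b" M, OF _ f] f by (metis inj_eq)
  have onto: "\<exists>a' b'. a = f a' \<and> b = f b'" if "{a, b} \<in> emap f M" for a b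
    using that by (auto simp: emap_def)
  show ?thesis
  proof
    assume "crossing pos (emap f M)"
    then obtain a b c d where *: "{a, b} \<in> emap f M" "{c, d} \<in> emap f M"
        "pos a < pos c" "pos c < pos b" "pos b < pos d" by (auto simp: crossing_def)
    obtain a' b' c' d' where "a = f a'" "b = f b'" "c = f c'" "d = f d'"
      using onto[OF *(1)] onto[OF *(2)] by blast
    then show "crossing (\<lambda>v. pos (f v)) M" using * arc unfolding crossing_def by metis
  next
    assume "crossing (\<lambda>v. pos (f v)) M"
    then show "crossing pos (emap f M)" using arc unfolding crossing_def by metis
  qed
qed

lemma crossing_cong:
  assumes "\<And>a b. a \<in> \<Union>M \<Longrightarrow> b \<in> \<Union>M \<Longrightarrow> pos a < pos b \<longleftrightarrow> pos' a < pos' b"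
  shows "crossing pos M \<longleftrightarrow> crossing pos' M"
proof -
  have "a \<in> \<Union>M \<and> b \<in> \<Union>M" if "{a, b} \<in> M" for a b using that by blast
  then show ?thesis unfolding crossing_def using assms by metis
qed

text \<open>
  Let \<open>P\<close> and \<open>Q\<close> be components of the stacked graph with \<open>P0\<close>, \<open>P1\<close>, \<open>P2\<close> and \<open>Q0\<close>, \<open>Q1\<close>, \<open>Q2\<close>
  their points on the three levels. Both diagrams being planar, the ascents between \<open>P0 \<union> P1\<close> and
  \<open>Q0 \<union> Q1\<close> and those between \<open>P1 \<union> P2\<close> and \<open>Q1 \<union> Q2\<close> are even in number. The two boundaries run through the glued
  level in opposite directions, so that it contributes \<open>card P1 * card Q1\<close> to the sum. Up to even numbers,
  this leaves \<open>(card P0 + card P1) * (card Q1 + card Q2)\<close> ascents between the ends of \<open>P\<close> and of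
  \<open>Q\<close>; the first factor is even because arcs cover \<open>P0 \<union> P1\<close>.
\<close>

lemma stack_matching_planar:
  assumes M: "M \<in> planar_matchings x y" and N: "N \<in> planar_matchings y z"
  shows "stack_matching x z N M \<in> planar_matchings x z"
proof -
  let ?V = "points x y" and ?W = "raise ` points y z" and ?B = "emap raise N"
  let ?D = "level 0 x \<union> level 2 z"
  let ?C = "contract (stack N M) ?D"
  have pM: "perfect_matching ?V M" and cM: "\<not> crossing (boundary_pos x y) M"
    using M by (auto simp: planar_matchings_iff)
  have "perfect_matching (points y z) N" using N by (simp add: planar_matchings_iff)
  then have pB: "perfect_matching ?W ?B" using inj_raise
    by (intro perfect_matching_emap) (auto intro: inj_on_subset)
  have fin: "finite ?V" "finite ?W" by simp_all
  have D: "(?V - ?W) \<union> (?W - ?V) = ?D" unfolding raise_points by (auto simp: points_def)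
  have stk: "stack N M = M \<union> ?B" by (rule stack_alt)
  have pC: "perfect_matching ?D ?C" using perfect_matching_glue[OF pM pB fin] unfolding D stk .
  have injD: "inj_on halve_level ?D" by (auto simp: inj_on_def)
  have "halve_level ` ?D = points x z"
    unfolding image_Un points_def by (simp add: image_level[of halve_level])
  then have pS: "perfect_matching (points x z) (stack_matching x z N M)"
    using perfect_matching_emap[OF injD pC] by (simp add: stack_matching_alt)
  \<comment> \<open>\<open>posN\<close> is the boundary order of \<open>N\<close> in the raised position, and \<open>posC\<close> that of the composite.\<close>
  define posN :: "point \<Rightarrow> nat" where "posN = (\<lambda>(l, i). if l = 1 then i else y + z - 1 - i)"
  define posC :: "point \<Rightarrow> nat" where "posC = (\<lambda>(l, i). if l = 0 then i else x + z - 1 - i)"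
  have "\<not> crossing (boundary_pos y z) N" using N by (simp add: planar_matchings_iff)
  moreover have "posN (raise v) = boundary_pos y z v" for v by (cases v) (simp add: posN_def)
  ultimately have cB: "\<not> crossing posN ?B" by (simp add: crossing_emap[OF inj_raise])
  have injN: "inj_on posN ?W" unfolding raise_points by (auto simp: inj_on_def posN_def)
  have cC: "\<not> crossing posC ?C"
  proof (rule not_crossingI[OF pC])
    fix e f assume e: "e \<in> ?C" and f: "f \<in> ?C" and ef: "e \<inter> f = {}"
    obtain P u where P: "saturated M P" "saturated ?B P" "finite P" "P \<inter> ?D = e" "u \<in> e" "P = joined (M \<union> ?B) `` {u}"
      using glue_arc_component[OF pM pB fin] e unfolding D stk by metis
    obtain Q v where Q: "saturated M Q" "saturated ?B Q" "finite Q" "Q \<inter> ?D = f" "v \<in> f" "Q = joined (M \<union> ?B) `` {v}"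
      using glue_arc_component[OF pM pB fin] f unfolding D stk by metis
    have PQ: "P \<inter> Q = {}" by (rule joined_classes_disjoint[OF P(6) Q(6) P(5) P(4) Q(4) ef])
    define P0 P1 P2 Q0 Q1 Q2 where "P0 = P \<inter> level 0 x" and "P1 = P \<inter> level 1 y" and "P2 = P \<inter> level 2 z"
      and "Q0 = Q \<inter> level 0 x" and "Q1 = Q \<inter> level 1 y" and "Q2 = Q \<inter> level 2 z"
    note defs = this
    have fins: "finite P0" "finite P1" "finite P2" "finite Q0" "finite Q1" "finite Q2"
      using P(3) Q(3) by (simp_all add: defs)
    have PV: "P \<inter> ?V = P0 \<union> P1" "Q \<inter> ?V = Q0 \<union> Q1" "P \<inter> ?W = P1 \<union> P2" "Q \<inter> ?W = Q1 \<union> Q2"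
      "e = P0 \<union> P2" "f = Q0 \<union> Q2"
      unfolding raise_points unfolding points_def defs using P(4) Q(4) by (simp_all only: Int_Un_distrib)
    have dj: "P0 \<inter> P1 = {}" "P1 \<inter> P2 = {}" "P0 \<inter> P2 = {}" "Q0 \<inter> Q1 = {}" "Q1 \<inter> Q2 = {}" "Q0 \<inter> Q2 = {}"
      by (auto simp: defs)
    note split = ascents_Un_left ascents_Un_right fins dj
    have "even (ascents (boundary_pos x y) (P0 \<union> P1) (Q0 \<union> Q1))"
      using even_ascents[OF pM inj_boundary_pos cM P(1) Q(1) PQ] by (simp add: PV)
    moreover have "ascents (boundary_pos x y) P0 Q1 = card P0 * card Q1"
      by (rule ascents_all) (auto simp: defs)
    moreover have "ascents (boundary_pos x y) P1 Q0 = 0" by (rule ascents_none) (auto simp: defs)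
    moreover have "ascents (boundary_pos x y) (P0 \<union> P1) (Q0 \<union> Q1)
      = ascents (boundary_pos x y) P0 Q0 + ascents (boundary_pos x y) P0 Q1
        + (ascents (boundary_pos x y) P1 Q0 + ascents (boundary_pos x y) P1 Q1)" by (simp add: split)
    ultimately have 1: "even (ascents (boundary_pos x y) P0 Q0 + card P0 * card Q1 + ascents (boundary_pos x y) P1 Q1)"
      by (simp only: add_0_left)
    have "even (ascents posN (P1 \<union> P2) (Q1 \<union> Q2))"
      using even_ascents[OF pB injN cB P(2) Q(2) PQ] by (simp add: PV)
    moreover have "ascents posN P1 Q2 = card P1 * card Q2"
      by (rule ascents_all) (auto simp: defs posN_def)
    moreover have "ascents posN P2 Q1 = 0" by (rule ascents_none) (auto simp: defs posN_def)
    moreover have "ascents posN (P1 \<union> P2) (Q1 \<union> Q2)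
      = ascents posN P1 Q1 + ascents posN P1 Q2 + (ascents posN P2 Q1 + ascents posN P2 Q2)" by (simp add: split)
    ultimately have 2: "even (ascents posN P1 Q1 + card P1 * card Q2 + ascents posN P2 Q2)"
      by (simp only: add_0_left)
    have "ascents posC P0 Q2 = card P0 * card Q2" by (rule ascents_all) (auto simp: defs posC_def)
    moreover have "ascents posC P2 Q0 = 0" by (rule ascents_none) (auto simp: defs posC_def)
    moreover have "ascents posC P0 Q0 = ascents (boundary_pos x y) P0 Q0"
      by (rule ascents_cong) (auto simp: defs posC_def)
    moreover have "ascents posC P2 Q2 = ascents posN P2 Q2"
      by (rule ascents_cong) (auto simp: defs posC_def posN_def)
    ultimately have 3: "ascents posC e f = ascents (boundary_pos x y) P0 Q0 + card P0 * card Q2 + ascents posN P2 Q2"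
      by (simp add: split PV)
    have 4: "ascents (boundary_pos x y) P1 Q1 + ascents posN P1 Q1 = card P1 * card Q1"
    proof (rule ascents_opposite)
      fix a c assume ac: "a \<in> P1" "c \<in> Q1"
      then have "a \<noteq> c" using PQ by (auto simp: defs)
      then show "posN a < posN c \<longleftrightarrow> \<not> boundary_pos x y a < boundary_pos x y c"
        using ac by (auto simp: defs posN_def)
    qed
    have "even (card (P \<inter> ?V))" using saturated_card[OF pM P(1)] by simp
    then have 5: "even (card P0 + card P1)" by (simp add: PV card_Un_disjoint fins dj)
    show "even (ascents posC e f)" using 1 2 4 5 unfolding 3
      by (metis even_add even_mult_iff)
  qed
  have "\<not> crossing (boundary_pos x z) (stack_matching x z N M)"
  proof -
    have "posC (double_level v) = boundary_pos x z v" for v by (cases v) (simp add: posC_def)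
    then show ?thesis using cC
      unfolding emap_double_stack_matching[symmetric] crossing_emap[OF inj_double_level] by simp
  qed
  then show ?thesis using pS by (simp add: planar_matchings_iff)
qed

lemma id_matching_planar: "id_matching m \<in> planar_matchings m m"
proof -
  have arc: "{a, b} \<in> id_matching m \<longleftrightarrow> (\<exists>i < m. (a = (0, i) \<and> b = (1, i)) \<or> (a = (1, i) \<and> b = (0, i)))" for a b
    by (auto simp: id_matching_def doubleton_eq_iff)
  have p: "perfect_matching (points m m) (id_matching m)" unfolding perfect_matching_iff
  proof (intro conjI ballI allI impI)
    fix e assume "e \<in> id_matching m"
    then obtain i where "e = {(0, i), (1, i)}" "i < m" by (auto simp: id_matching_def)
    then show "\<exists>u v. e = {u, v} \<and> u \<noteq> v \<and> u \<in> points m m \<and> v \<in> points m m"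
      by (intro exI[of _ "(0, i)"] exI[of _ "(1, i)"]) (simp add: points_iff)
  next
    fix u assume "u \<in> points m m"
    then show "\<exists>v. {u, v} \<in> id_matching m" unfolding arc by (cases u) (auto simp: points_iff)
  qed (auto simp: arc)
  have "\<not> crossing (boundary_pos m m) (id_matching m)"
  proof
    assume "crossing (boundary_pos m m) (id_matching m)"
    then obtain a b c d where ab: "{a, b} \<in> id_matching m" and cd: "{c, d} \<in> id_matching m"
      and lt: "boundary_pos m m a < boundary_pos m m c" "boundary_pos m m c < boundary_pos m m b"
        "boundary_pos m m b < boundary_pos m m d" unfolding crossing_def by blast
    obtain i j where "i < m" "a = (0, i) \<and> b = (1, i) \<or> a = (1, i) \<and> b = (0, i)"
      "j < m" "c = (0, j) \<and> d = (1, j) \<or> c = (1, j) \<and> d = (0, j)" using ab cd unfolding arc by blast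
    then show False using lt by (elim disjE) simp_all
  qed
  then show ?thesis using p by (simp add: planar_matchings_iff)
qed

lemma id_matching_arc: "i < m \<Longrightarrow> {(0, i), (1, i)} \<in> id_matching m"
  by (auto simp: id_matching_def)

text \<open>
  Perfect matchings of the same points are equal if one contains the other, so composites can be
  identified by exhibiting paths.
\<close>

lemma planar_cover_eq:
  "N \<in> planar_matchings x y \<Longrightarrow> M \<subseteq> N \<Longrightarrow> points x y \<subseteq> \<Union>M \<Longrightarrow> M = N"
  unfolding planar_matchings_iff using perfect_matching_cover_eq by metis

lemma planar_subset_eq:
  "M \<in> planar_matchings x y \<Longrightarrow> N \<in> planar_matchings x y \<Longrightarrow> M \<subseteq> N \<Longrightarrow> M = N"
  using planar_cover_eq[of N x y M] Union_planar[of M x y] by blast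

lemma planar_subset_stackI:
  assumes M: "M \<in> planar_matchings x z"
    and joined: "\<And>u v. {u, v} \<in> M \<Longrightarrow> (double_level u, double_level v) \<in> joined (stack N L)"
  shows "M \<subseteq> stack_matching x z N L"
proof
  fix e assume e: "e \<in> M"
  have p: "perfect_matching (points x z) M" using M by (simp add: planar_matchings_iff)
  obtain u v where "e = {u, v}" "u \<noteq> v" "u \<in> points x z" "v \<in> points x z"
    using perfect_matching_arc[OF p e] by metis
  then show "e \<in> stack_matching x z N L" using joined[of u v] e by (simp add: stack_matching_iff)
qed

lemma joined_stack_lower: "(u, v) \<in> joined M \<Longrightarrow> (u, v) \<in> joined (stack N M)"
  by (rule joined_mono[of M]) (auto simp: stack_alt)

lemma joined_stack_upper: "(u, v) \<in> joined N \<Longrightarrow> (raise u, raise v) \<in> joined (stack N M)"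
  by (rule joined_mono[of "emap raise N"]) (auto simp: stack_alt intro: joined_emapI)

lemma stack_matching_id_left:
  assumes M: "M \<in> planar_matchings x y"
  shows "stack_matching x y (id_matching y) M = M" and "stack_loops y (id_matching y) M = 0"
proof -
  have up: "((1, i), (2, i)) \<in> joined (stack (id_matching y) M)" if "i < y" for i
    using joined_stack_upper[OF joined_edge[OF id_matching_arc[OF that]]]
    by (simp add: numeral_2_eq_2)
  have ends: "(u, double_level u) \<in> joined (stack (id_matching y) M)" if "u \<in> points x y" for u
    using up that by (cases u) (auto simp: points_iff)
  have "M \<subseteq> stack_matching x y (id_matching y) M"
  proof (rule planar_subset_stackI[OF M])
    fix u v assume uv: "{u, v} \<in> M"
    then have "u \<in> points x y" "v \<in> points x y" using Union_planar[OF M] by blast+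
    then show "(double_level u, double_level v) \<in> joined (stack (id_matching y) M)"
      using ends joined_stack_lower[OF joined_edge[OF uv]] by (meson joined_sym joined_trans)
  qed
  then show "stack_matching x y (id_matching y) M = M"
    using planar_subset_eq[OF M stack_matching_planar[OF M id_matching_planar]] by simp
  show "stack_loops y (id_matching y) M = 0" unfolding stack_loops_alt
  proof (rule loops_eq_0I)
    fix a assume "a \<in> level 1 y"
    then obtain i where "a = (1, i)" "i < y" by auto
    then show "\<exists>b. b \<notin> level 1 y \<and> (a, b) \<in> joined (stack (id_matching y) M)"
      using up by (intro exI[of _ "(2, i)"]) auto
  qed
qed

lemma stack_matching_id_right:
  assumes M: "M \<in> planar_matchings x y"
  shows "stack_matching x y M (id_matching x) = M" and "stack_loops x M (id_matching x) = 0"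
proof -
  have up: "((0, i), (1, i)) \<in> joined (stack M (id_matching x))" if "i < x" for i
    by (rule joined_stack_lower[OF joined_edge[OF id_matching_arc[OF that]]])
  have ends: "(double_level u, raise u) \<in> joined (stack M (id_matching x))" if "u \<in> points x y" for u
    using up that by (cases u) (auto simp: points_iff numeral_2_eq_2)
  have "M \<subseteq> stack_matching x y M (id_matching x)"
  proof (rule planar_subset_stackI[OF M])
    fix u v assume uv: "{u, v} \<in> M"
    then have "u \<in> points x y" "v \<in> points x y" using Union_planar[OF M] by blast+
    then show "(double_level u, double_level v) \<in> joined (stack M (id_matching x))"
      using ends joined_stack_upper[OF joined_edge[OF uv]] by (meson joined_sym joined_trans)
  qed
  then show "stack_matching x y M (id_matching x) = M"
    using planar_subset_eq[OF M stack_matching_planar[OF id_matching_planar M]] by simp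
  show "stack_loops x M (id_matching x) = 0" unfolding stack_loops_alt
  proof (rule loops_eq_0I)
    fix a assume "a \<in> level 1 x"
    then obtain i where "a = (1, i)" "i < x" by auto
    then show "\<exists>b. b \<notin> level 1 x \<and> (a, b) \<in> joined (stack M (id_matching x))"
      using joined_sym[OF up] by (intro exI[of _ "(0, i)"]) auto
  qed
qed

section \<open>Juxtaposition and reflection\<close>

definition shift :: "nat \<Rightarrow> nat \<Rightarrow> point \<Rightarrow> point" where
  "shift x y = (\<lambda>(l, i). (l, i + (if l = 0 then x else y)))"

definition tensor_matching :: "nat \<Rightarrow> nat \<Rightarrow> matching \<Rightarrow> matching \<Rightarrow> matching" where
  "tensor_matching x y M M' = M \<union> emap (shift x y) M'"

lemma shift_simp [simp]: "shift x y (l, i) = (l, i + (if l = 0 then x else y))"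
  by (simp add: shift_def)

lemma inj_shift: "inj (shift x y)"
  by (auto simp: inj_def split: if_splits)

lemma diagram_tensor_alt: "diagram_tensor x y (M, k) (M', k') = (tensor_matching x y M M', k + k')"
  by (simp add: tensor_matching_def emap_def shift_def)

lemma points_add: "points (x + x') (y + y') = points x y \<union> shift x y ` points x' y'"
proof (intro equalityI subsetI)
  fix v assume v: "v \<in> points (x + x') (y + y')"
  obtain l i where li: "v = (l, i)" by (cases v)
  show "v \<in> points x y \<union> shift x y ` points x' y'"
  proof (cases "i < (if l = 0 then x else y)")
    case False
    then have "v = shift x y (l, i - (if l = 0 then x else y))" using li by auto
    moreover have "(l, i - (if l = 0 then x else y)) \<in> points x' y'"
      using v li False by (auto simp: points_iff)
    ultimately show ?thesis by blast
  qed (use v li in \<open>auto simp: points_iff split: if_splits\<close>)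
qed (auto simp: points_iff)

lemma points_shift_disjoint: "points x y \<inter> shift x y ` points x' y' = {}"
  by (auto simp: points_iff)

lemma points_shift_disjoint': "shift x y ` points x' y' \<inter> points x y = {}"
  by (auto simp: points_iff)

lemma points_add_diff_right: "points (x + x') (y + y') - shift x y ` points x' y' = points x y"
  using points_shift_disjoint[of x y x' y'] by (auto simp: points_add)

lemma points_add_diff_left: "points (x + x') (y + y') - points x y = shift x y ` points x' y'"
  using points_shift_disjoint[of x y x' y'] by (auto simp: points_add)

lemma boundary_pos_left:
  "u \<in> points x y \<Longrightarrow> v \<in> points x y \<Longrightarrow>
    boundary_pos (x + x') (y + y') u < boundary_pos (x + x') (y + y') v \<longleftrightarrow> boundary_pos x y u < boundary_pos x y v"
  by (cases u; cases v) (auto simp: points_iff)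

lemma boundary_pos_right:
  "u \<in> points x' y' \<Longrightarrow> v \<in> points x' y' \<Longrightarrow>
    boundary_pos (x + x') (y + y') (shift x y u) < boundary_pos (x + x') (y + y') (shift x y v)
      \<longleftrightarrow> boundary_pos x' y' u < boundary_pos x' y' v"
  by (cases u; cases v) (auto simp: points_iff)

lemma boundary_pos_separated:
  assumes "u \<in> points x y"
  shows "(\<forall>c \<in> shift x y ` points x' y'. boundary_pos (x + x') (y + y') u < boundary_pos (x + x') (y + y') c) \<or>
    (\<forall>c \<in> shift x y ` points x' y'. boundary_pos (x + x') (y + y') c < boundary_pos (x + x') (y + y') u)"
  using assms by (cases u) (auto simp: points_iff)

lemma crossing_left:
  "M \<in> planar_matchings x y \<Longrightarrow> \<not> crossing (boundary_pos (x + x') (y + y')) M"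
  using crossing_cong[of M "boundary_pos (x + x') (y + y')" "boundary_pos x y"] boundary_pos_left
    Union_planar[of M x y] by (auto simp: planar_matchings_iff)

lemma crossing_right:
  "M \<in> planar_matchings x' y' \<Longrightarrow> \<not> crossing (boundary_pos (x + x') (y + y')) (emap (shift x y) M)"
  unfolding crossing_emap[OF inj_shift]
  using crossing_cong[of M "\<lambda>v. boundary_pos (x + x') (y + y') (shift x y v)" "boundary_pos x' y'"]
    boundary_pos_right Union_planar[of M x' y'] by (auto simp: planar_matchings_iff)

lemma perfect_matching_shift:
  "M \<in> planar_matchings x' y' \<Longrightarrow> perfect_matching (shift x y ` points x' y') (emap (shift x y) M)"
  by (rule perfect_matching_emap) (auto simp: planar_matchings_iff intro: inj_on_subset[OF inj_shift])

text \<open>The points of the right-hand diagram occupy an interval in the boundary order.\<close>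

lemma tensor_matching_planar:
  assumes M: "M \<in> planar_matchings x y" and M': "M' \<in> planar_matchings x' y'"
  shows "tensor_matching x y M M' \<in> planar_matchings (x + x') (y + y')"
proof -
  let ?pos = "boundary_pos (x + x') (y + y')" and ?A = M and ?B = "emap (shift x y) M'"
  have A: "perfect_matching (points x y) ?A" using M by (simp add: planar_matchings_iff)
  have B: "perfect_matching (shift x y ` points x' y') ?B" by (rule perfect_matching_shift[OF M'])
  have AB: "perfect_matching (points (x + x') (y + y')) (?A \<union> ?B)"
    unfolding points_add by (rule perfect_matching_Un[OF A B points_shift_disjoint])
  have inj: "inj_on ?pos (points x y)" "inj_on ?pos (shift x y ` points x' y')"
    by (rule inj_on_subset[OF inj_boundary_pos[of "x + x'" "y + y'"]]; simp add: points_add)+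
  have "\<not> crossing ?pos (?A \<union> ?B)"
  proof (rule not_crossingI[OF AB])
    fix e f assume e: "e \<in> ?A \<union> ?B" and f: "f \<in> ?A \<union> ?B" and ef: "e \<inter> f = {}"
    have cards: "even (card e)" "even (card f)" using e f AB by (simp_all add: perfect_matching_def)
    have sub: "a \<in> ?A \<Longrightarrow> v \<in> a \<Longrightarrow> v \<in> points x y" "b \<in> ?B \<Longrightarrow> v \<in> b \<Longrightarrow> v \<in> shift x y ` points x' y'" for a b v
      using perfect_matching_Union[OF A] perfect_matching_Union[OF B] by blast+
    consider "e \<in> ?A" "f \<in> ?A" | "e \<in> ?A" "f \<in> ?B" | "e \<in> ?B" "f \<in> ?A" | "e \<in> ?B" "f \<in> ?B" using e f by blast
    then show "even (ascents ?pos e f)"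
    proof cases
      case 1
      then show ?thesis using even_ascents_pair[OF A inj(1) crossing_left[OF M]] ef by blast
    next
      case 2
      show ?thesis
        by (rule even_ascents_left[OF _ cards(2)]) (use boundary_pos_separated 2 sub in meson)
    next
      case 3
      show ?thesis
        by (rule even_ascents_right[OF _ cards(1)]) (use boundary_pos_separated 3 sub in meson)
    next
      case 4
      then show ?thesis using even_ascents_pair[OF B inj(2) crossing_right[OF M']] ef by blast
    qed
  qed
  then show ?thesis using AB by (simp add: planar_matchings_iff tensor_matching_def)
qed

lemma tensor_matching_assoc:
  "tensor_matching (x + x') (y + y') (tensor_matching x y M M') M''
    = tensor_matching x y M (tensor_matching x' y' M' M'')"
proof -
  have "shift (x + x') (y + y') = (\<lambda>v. shift x y (shift x' y' v))" by (auto simp: fun_eq_iff)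
  then show ?thesis by (simp add: tensor_matching_def emap_Un emap_emap Un_assoc)
qed

lemma tensor_matching_empty [simp]: "tensor_matching x y M {} = M" "tensor_matching 0 0 {} M = M"
proof -
  have "shift 0 0 = (\<lambda>v. v)" by (auto simp: fun_eq_iff)
  then show "tensor_matching x y M {} = M" "tensor_matching 0 0 {} M = M"
    by (simp_all add: tensor_matching_def emap_def)
qed

lemma id_matching_0 [simp]: "id_matching 0 = {}"
  by (simp add: id_matching_def)

lemma tensor_id_matching: "tensor_matching m m (id_matching m) (id_matching k) = id_matching (m + k)"
proof (rule planar_subset_eq[symmetric])
  show "id_matching (m + k) \<subseteq> tensor_matching m m (id_matching m) (id_matching k)"
  proof
    fix e assume "e \<in> id_matching (m + k)"
    then obtain i where i: "e = {(0, i), (1, i)}" "i < m + k" by (auto simp: id_matching_def)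
    show "e \<in> tensor_matching m m (id_matching m) (id_matching k)"
    proof (cases "i < m")
      case True
      then show ?thesis using i by (auto simp: tensor_matching_def id_matching_def)
    next
      case False
      then have "{(0, i - m), (1, i - m)} \<in> id_matching k" using i by (intro id_matching_arc) simp
      then have "{shift m m (0, i - m), shift m m (1, i - m)} \<in> emap (shift m m) (id_matching k)"
        by (rule emap_edge)
      then show ?thesis using i False by (simp add: tensor_matching_def)
    qed
  qed
qed (rule id_matching_planar tensor_matching_planar)+

text \<open>
  The right-hand one of two juxtaposed stacks is displaced by a different amount on each level.
\<close>

definition shift3 :: "nat \<Rightarrow> nat \<Rightarrow> nat \<Rightarrow> point \<Rightarrow> point" where
  "shift3 x y z = (\<lambda>(l, i). (l, i + (if l = 0 then x else if l = 1 then y else z)))"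

lemma inj_shift3: "inj (shift3 x y z)"
  by (auto simp: inj_def shift3_def split: if_splits)

lemma stack_tensor:
  assumes "\<Union>M' \<subseteq> points x' y'" "\<Union>N' \<subseteq> points y' z'"
  shows "stack (tensor_matching y z N N') (tensor_matching x y M M') = stack N M \<union> emap (shift3 x y z) (stack N' M')"
proof -
  have "emap (shift x y) M' = emap (shift3 x y z) M'"
    by (rule emap_cong) (use assms(1) in \<open>force simp: points_iff shift3_def\<close>)
  moreover have "emap raise (emap (shift y z) N') = emap (shift3 x y z) (emap raise N')"
    unfolding emap_emap by (rule emap_cong) (use assms(2) in \<open>force simp: points_iff shift3_def\<close>)
  ultimately show ?thesis by (simp add: stack_alt tensor_matching_def emap_Un Un_ac)
qed

text \<open>Side by side stacks are disjoint graphs.\<close>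

lemma stack_matching_tensor:
  assumes M: "M \<in> planar_matchings x y" and M': "M' \<in> planar_matchings x' y'"
    and N: "N \<in> planar_matchings y z" and N': "N' \<in> planar_matchings y' z'"
  shows "stack_matching (x + x') (z + z') (tensor_matching y z N N') (tensor_matching x y M M')
      = tensor_matching x z (stack_matching x z N M) (stack_matching x' z' N' M')" (is "?L = ?R")
    and "stack_loops (y + y') (tensor_matching y z N N') (tensor_matching x y M M')
      = stack_loops y N M + stack_loops y' N' M'"
proof -
  let ?g = "shift3 x y z"
  have U: "\<Union>M \<subseteq> points x y" "\<Union>M' \<subseteq> points x' y'" "\<Union>N \<subseteq> points y z" "\<Union>N' \<subseteq> points y' z'"
    using assms by (simp_all add: Union_planar)
  have st: "stack (tensor_matching y z N N') (tensor_matching x y M M') = stack N M \<union> emap ?g (stack N' M')"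
    by (rule stack_tensor[OF U(2,4)])
  have R: "?R \<in> planar_matchings (x + x') (z + z')"
    by (rule tensor_matching_planar[OF stack_matching_planar[OF M N] stack_matching_planar[OF M' N']])
  have L: "?L \<in> planar_matchings (x + x') (z + z')"
    by (rule stack_matching_planar[OF tensor_matching_planar[OF M M'] tensor_matching_planar[OF N N']])
  have "?R \<subseteq> ?L"
  proof (rule planar_subset_stackI[OF R])
    fix u v assume "{u, v} \<in> ?R"
    then consider "{u, v} \<in> stack_matching x z N M" | "{u, v} \<in> emap (shift x z) (stack_matching x' z' N' M')"
      by (auto simp: tensor_matching_def)
    then show "(double_level u, double_level v) \<in> joined (stack (tensor_matching y z N N') (tensor_matching x y M M'))"
    proof cases
      case 1
      then show ?thesis unfolding st stack_matching_iff by (blast intro: joined_mono)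
    next
      case 2
      then obtain e where "{u, v} = shift x z ` e" by (rule emapE)
      then obtain a where a: "u = shift x z a" by blast
      then obtain b where ab: "u = shift x z a" "v = shift x z b" "{a, b} \<in> stack_matching x' z' N' M'"
        using emap_edgeE[OF 2[unfolded a] inj_shift] by metis
      then have "a \<in> points x' z'" "b \<in> points x' z'" "(double_level a, double_level b) \<in> joined (stack N' M')"
        by (simp_all add: stack_matching_iff)
      moreover have "double_level (shift x z w) = ?g (double_level w)" if "w \<in> points x' z'" for w
        using that by (cases w) (auto simp: points_iff shift3_def)
      ultimately have "(double_level u, double_level v) \<in> joined (emap ?g (stack N' M'))"
        using ab joined_emapI by metis
      then show ?thesis unfolding st by (rule joined_mono[rotated]) simp
    qed
  qed
  then show "?L = ?R" by (rule planar_subset_eq[OF R L, symmetric])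
  have lev: "level 1 (y + y') = level 1 y \<union> ?g ` level 1 y'"
  proof -
    have "?g ` level 1 y' = {1 :: nat} \<times> {y..<y + y'}"
    proof (intro equalityI subsetI)
      fix v assume "v \<in> {1 :: nat} \<times> {y..<y + y'}"
      then obtain i where "v = (1, i)" "y \<le> i" "i < y + y'" by auto
      then show "v \<in> ?g ` level 1 y'" by (intro image_eqI[of _ _ "(1, i - y)"]) (auto simp: shift3_def)
    qed (auto simp: shift3_def)
    then show ?thesis by auto
  qed
  let ?V = "level 1 y \<union> (level 0 x \<union> level 2 z)" and ?W = "level 1 y' \<union> (level 0 x' \<union> level 2 z')"
  have "loops (stack N M \<union> emap ?g (stack N' M')) (level 1 y \<union> ?g ` level 1 y')
    = loops (stack N M) (level 1 y) + loops (emap ?g (stack N' M')) (?g ` level 1 y')"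
  proof (rule loops_Un_disjoint[where V = ?V and W = "?g ` ?W"])
    show "\<Union>(stack N M) \<subseteq> ?V" by (rule Union_stack[OF U(1,3)])
    show "\<Union>(emap ?g (stack N' M')) \<subseteq> ?g ` ?W"
      unfolding Union_emap by (rule image_mono[OF Union_stack[OF U(2,4)]])
  qed (auto simp: shift3_def)
  then show "stack_loops (y + y') (tensor_matching y z N N') (tensor_matching x y M M')
      = stack_loops y N M + stack_loops y' N' M'"
    unfolding stack_loops_alt st lev by (simp only: loops_emap[OF inj_shift3])
qed

definition flip :: "point \<Rightarrow> point" where
  "flip = (\<lambda>(l, i). (if l = 0 then 1 else if l = 1 then 0 else l, i))"

lemma flip_simps [simp]: "flip (0, i) = (1, i)" "flip (1, i) = (0, i)" "flip (Suc 0, i) = (0, i)"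
  by (simp_all add: flip_def)

lemma inj_flip: "inj flip"
  by (auto simp: inj_def flip_def split: if_splits)

lemma flip_flip [simp]: "flip (flip v) = v"
  by (cases v) (simp add: flip_def)

lemma emap_flip_flip [simp]: "emap flip (emap flip M) = M"
  by (simp add: emap_emap) (simp add: emap_def)

lemma flip_points: "flip ` points x y = points y x"
  unfolding points_def image_Un by (simp add: image_level[of flip] Un_commute)

lemma crossing_reverse:
  assumes "\<And>a b. a \<in> \<Union>M \<Longrightarrow> b \<in> \<Union>M \<Longrightarrow> pos a < pos b \<longleftrightarrow> pos' b < pos' a" and "crossing pos M"
  shows "crossing pos' M"
proof -
  obtain a b c d where *: "{a, b} \<in> M" "{c, d} \<in> M" "pos a < pos c" "pos c < pos b" "pos b < pos d"
    using assms(2) unfolding crossing_def by blast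
  have "a \<in> \<Union>M" "b \<in> \<Union>M" "c \<in> \<Union>M" "d \<in> \<Union>M" using *(1,2) by blast+
  then have "pos' d < pos' b" "pos' b < pos' c" "pos' c < pos' a" using * assms(1) by blast+
  moreover have "{d, c} \<in> M" "{b, a} \<in> M" using *(1,2) by (simp_all add: insert_commute)
  ultimately show ?thesis unfolding crossing_def by blast
qed

text \<open>Reflection reverses the boundary order, and so does not create crossings.\<close>

lemma flip_planar:
  assumes "M \<in> planar_matchings x y" shows "emap flip M \<in> planar_matchings y x"
proof -
  have "perfect_matching (points y x) (emap flip M)"
    using perfect_matching_emap[of flip "points x y" M] assms inj_on_subset[OF inj_flip]
    by (simp add: planar_matchings_iff flip_points)
  moreover have "\<not> crossing (boundary_pos y x) (emap flip M)"
  proof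
    assume "crossing (boundary_pos y x) (emap flip M)"
    then have "crossing (\<lambda>v. boundary_pos y x (flip v)) M" by (simp add: crossing_emap[OF inj_flip])
    then have "crossing (boundary_pos x y) M"
    proof (rule crossing_reverse[rotated])
      fix a b assume "a \<in> \<Union>M" "b \<in> \<Union>M"
      then have "a \<in> points x y" "b \<in> points x y" using Union_planar[OF assms] by auto
      then show "boundary_pos y x (flip a) < boundary_pos y x (flip b) \<longleftrightarrow> boundary_pos x y b < boundary_pos x y a"
        by (cases a; cases b) (auto simp: points_iff)
    qed
    then show False using assms by (simp add: planar_matchings_iff)
  qed
  ultimately show ?thesis by (simp add: planar_matchings_iff)
qed

section \<open>Traces of matchings\<close>

definition closure_loops :: "nat \<Rightarrow> matching \<Rightarrow> nat" where
  "closure_loops x M = card (points x x // joined (M \<union> id_matching x))"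

lemma diagram_closure_alt: "diagram_closure x (M, k) = ({}, k + closure_loops x M)"
  by (simp add: closure_loops_def)

lemma closure_loops_alt:
  assumes "M \<in> planar_matchings x x" shows "closure_loops x M = loops (M \<union> id_matching x) (points x x)"
proof -
  have "c \<subseteq> points x x" if c: "c \<in> points x x // joined (M \<union> id_matching x)" for c
  proof
    fix b assume b: "b \<in> c"
    obtain a where a: "a \<in> points x x" "c = joined (M \<union> id_matching x) `` {a}" using c by (rule quotientE)
    then have "(a, b) \<in> joined (M \<union> id_matching x)" using b by simp
    then show "b \<in> points x x"
      by (rule joined_stays) (simp_all add: Union_planar[OF assms] Union_planar[OF id_matching_planar] a)
  qed
  then have "{c \<in> points x x // joined (M \<union> id_matching x). c \<subseteq> points x x} = points x x // joined (M \<union> id_matching x)"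
    by auto
  then show ?thesis by (simp add: closure_loops_def loops_def)
qed

text \<open>
  Closing up a composite glues the two diagrams along their whole boundary: the arcs of the closure
  only prolong the strands, so that the loops are those of one diagram glued to the
  reflection of the other. Both sides count the components of the same graph, in which either the
  glued level or the top level is forgotten first.
\<close>

lemma closure_loops_stack:
  assumes f: "f \<in> planar_matchings x y" and g: "g \<in> planar_matchings y x"
  shows "stack_loops y g f + closure_loops x (stack_matching x x g f) = loops (f \<union> emap flip g) (points x y)"
proof -
  let ?K = "emap double_level (id_matching x)"
  let ?S = "stack_matching x x g f"
  have Uf: "\<Union>f \<subseteq> points x y" and Ug: "\<Union>g \<subseteq> points y x" using f g by (simp_all add: Union_planar)
  have pK: "perfect_matching (level 0 x \<union> level 2 x) ?K"
  proof -
    have "double_level ` points x x = level 0 x \<union> level 2 x"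
      unfolding points_def image_Un by (simp add: image_level[of double_level])
    then show ?thesis
      using perfect_matching_emap[of double_level "points x x" "id_matching x"] id_matching_planar[of x]
        inj_on_subset[OF inj_double_level] by (simp add: planar_matchings_iff)
  qed
  have pg: "perfect_matching (level 1 y \<union> level 2 x) (emap raise g)"
    using perfect_matching_emap[of raise "points y x" g] g inj_on_subset[OF inj_raise]
    by (simp add: planar_matchings_iff raise_points)
  have UK: "\<Union>?K = level 0 x \<union> level 2 x" by (rule perfect_matching_Union[OF pK])
  have E1: "\<Union>(emap raise g \<union> ?K) \<subseteq> level 2 x \<union> points x y"
    using perfect_matching_Union[OF pg] UK by (auto simp: points_def)
  have "closure_loops x ?S = loops (emap double_level (?S \<union> id_matching x)) (double_level ` points x x)"
    using closure_loops_alt[OF stack_matching_planar[OF f g]] by (simp add: loops_emap[OF inj_double_level])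
  also have "double_level ` points x x = level 0 x \<union> level 2 x"
    unfolding points_def image_Un by (simp add: image_level[of double_level])
  also have "emap double_level (?S \<union> id_matching x) = contract (stack g f) (level 0 x \<union> level 2 x) \<union> ?K"
    by (simp add: emap_Un emap_double_stack_matching)
  finally have "stack_loops y g f + closure_loops x ?S = loops (stack g f) (level 1 y)
      + loops (contract (stack g f) (level 0 x \<union> level 2 x) \<union> ?K) (level 0 x \<union> level 2 x)"
    by (simp add: stack_loops_alt)
  also have "\<dots> = loops (stack g f \<union> ?K) (level 1 y \<union> (level 0 x \<union> level 2 x))"
    by (rule loops_contract[symmetric, OF Union_stack[OF Uf Ug]]) (auto simp: UK)
  also have "stack g f \<union> ?K = (emap raise g \<union> ?K) \<union> f" by (auto simp: stack_alt)
  also have "level 1 y \<union> (level 0 x \<union> level 2 x) = level 2 x \<union> points x y" by (auto simp: points_def)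
  also have "loops ((emap raise g \<union> ?K) \<union> f) (level 2 x \<union> points x y)
    = loops (emap raise g \<union> ?K) (level 2 x) + loops (contract (emap raise g \<union> ?K) (points x y) \<union> f) (points x y)"
    by (rule loops_contract[OF E1]) (use Uf in \<open>auto simp: points_def\<close>)
  also have K: "((2, i), (0, i)) \<in> joined (emap raise g \<union> ?K)" if "i < x" for i
  proof -
    have "{(2, i), (0, i)} \<in> ?K" using emap_edge[OF id_matching_arc[OF that], of double_level] by (simp add: insert_commute)
    then show ?thesis by (intro joined_edge) simp
  qed
  have "loops (emap raise g \<union> ?K) (level 2 x) = 0"
  proof (rule loops_eq_0I)
    fix a assume "a \<in> level 2 x"
    then obtain i where "a = (2, i)" "i < x" by auto
    then show "\<exists>b. b \<notin> level 2 x \<and> (a, b) \<in> joined (emap raise g \<union> ?K)"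
      using K by (intro exI[of _ "(0, i)"]) simp
  qed
  also have "contract (emap raise g \<union> ?K) (points x y) = emap flip g"
  proof (rule perfect_matching_cover_eq[symmetric])
    have "(level 1 y \<union> level 2 x - (level 0 x \<union> level 2 x)) \<union> (level 0 x \<union> level 2 x - (level 1 y \<union> level 2 x)) = points x y"
      by (auto simp: points_def)
    then show "perfect_matching (points x y) (contract (emap raise g \<union> ?K) (points x y))"
      using perfect_matching_glue[OF pg pK] by simp
    show "points x y \<subseteq> \<Union>(emap flip g)" by (simp add: Union_emap Union_planar[OF g] flip_points)
    show "emap flip g \<subseteq> contract (emap raise g \<union> ?K) (points x y)"
    proof
      fix e assume "e \<in> emap flip g"
      then obtain e' where e': "e' \<in> g" "e = flip ` e'" by (rule emapE)
      obtain u v where uv: "e' = {u, v}" "u \<noteq> v" "u \<in> points y x" "v \<in> points y x"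
        using g e'(1) perfect_matching_arc unfolding planar_matchings_iff by metis
      have fr: "(raise w, flip w) \<in> joined (emap raise g \<union> ?K)" if "w \<in> points y x" for w
        using that K by (cases w) (auto simp: points_iff numeral_2_eq_2)
      have "{raise u, raise v} \<in> emap raise g" using e'(1) uv(1) by (simp add: emap_edge)
      then have "(raise u, raise v) \<in> joined (emap raise g \<union> ?K)" by (intro joined_edge) simp
      then have "(flip u, flip v) \<in> joined (emap raise g \<union> ?K)"
        using fr[OF uv(3)] fr[OF uv(4)] by (meson joined_sym joined_trans)
      moreover have "flip u \<in> points x y" "flip v \<in> points x y" using uv flip_points[of y x] by auto
      moreover have "flip u \<noteq> flip v" using uv(2) inj_flip by (simp add: inj_eq)
      ultimately show "e \<in> contract (emap raise g \<union> ?K) (points x y)"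
        using e'(2) uv(1) by (simp add: contract_iff)
    qed
  qed
  finally show ?thesis by (simp add: Un_commute)
qed

text \<open>Gluing two diagrams along their whole boundary is symmetric up to reflection.\<close>

lemma closure_loops_cyclic:
  assumes f: "f \<in> planar_matchings x y" and g: "g \<in> planar_matchings y x"
  shows "stack_loops y g f + closure_loops x (stack_matching x x g f)
    = stack_loops x f g + closure_loops y (stack_matching y y f g)"
proof -
  have "loops (g \<union> emap flip f) (points y x) = loops (emap flip (f \<union> emap flip g)) (flip ` points x y)"
    by (simp add: emap_Un flip_points Un_commute)
  then show ?thesis
    unfolding closure_loops_stack[OF f g] closure_loops_stack[OF g f] by (simp only: loops_emap[OF inj_flip])
qed

text \<open>
  Gluing a diagram to part of the boundary of another leaves a diagram on the rest of the boundary, the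
  partial trace, together with the \<open>n\<close> loops that do not reach this rest.
\<close>

lemma partial_closure_right:
  assumes g: "g \<in> planar_matchings x' y'" and k: "k \<in> planar_matchings (x + x') (y + y')"
  obtains k' n where "k' \<in> planar_matchings x y"
    "\<And>f. f \<in> planar_matchings x y \<Longrightarrow>
      loops (tensor_matching x y f g \<union> k) (points (x + x') (y + y')) = n + loops (f \<union> k') (points x y)"
proof -
  let ?V = "points (x + x') (y + y')" and ?W = "shift x y ` points x' y'" and ?g = "emap (shift x y) g"
  let ?k = "contract (k \<union> ?g) (points x y)"
  have pk: "perfect_matching ?V k" "\<not> crossing (boundary_pos (x + x') (y + y')) k"
    using k by (simp_all add: planar_matchings_iff)
  note glue = glue_inside[OF pk(1) perfect_matching_shift[OF g] finite_points _ inj_boundary_pos pk(2) crossing_right[OF g],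
    unfolded points_add_diff_right]
  have WV: "?W \<subseteq> ?V" by (simp add: points_add)
  have pk': "perfect_matching (points x y) ?k"
    using glue(1)[OF WV] boundary_pos_separated by blast
  have "\<not> crossing (boundary_pos (x + x') (y + y')) ?k"
    using glue(2)[OF WV] boundary_pos_separated by blast
  moreover have "crossing (boundary_pos (x + x') (y + y')) ?k \<longleftrightarrow> crossing (boundary_pos x y) ?k"
    by (rule crossing_cong) (use boundary_pos_left perfect_matching_Union[OF pk'] in auto)
  ultimately have k': "?k \<in> planar_matchings x y" using pk' by (simp add: planar_matchings_iff)
  have "loops (tensor_matching x y f g \<union> k) ?V = loops (k \<union> ?g) ?W + loops (f \<union> ?k) (points x y)"
    if f: "f \<in> planar_matchings x y" for f
  proof -
    have "loops ((k \<union> ?g) \<union> f) (?W \<union> points x y) = loops (k \<union> ?g) ?W + loops (?k \<union> f) (points x y)"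
    proof (rule loops_contract)
      show "\<Union>(k \<union> ?g) \<subseteq> ?W \<union> points x y"
        by (auto simp: Union_planar[OF k] Union_emap Union_planar[OF g] points_add)
      show "\<Union>f \<inter> ?W = {}" unfolding Union_planar[OF f] by (rule points_shift_disjoint)
    qed (simp_all add: points_shift_disjoint points_shift_disjoint')
    moreover have "(k \<union> ?g) \<union> f = tensor_matching x y f g \<union> k" by (auto simp: tensor_matching_def)
    ultimately show ?thesis by (simp add: points_add Un_commute)
  qed
  then show thesis using that k' by blast
qed

lemma partial_closure_left:
  assumes g: "g \<in> planar_matchings x' y'" and k: "k \<in> planar_matchings (x' + x) (y' + y)"
  obtains k' n where "k' \<in> planar_matchings x y"
    "\<And>f. f \<in> planar_matchings x y \<Longrightarrow>
      loops (tensor_matching x' y' g f \<union> k) (points (x' + x) (y' + y)) = n + loops (f \<union> k') (points x y)"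
proof -
  let ?pos = "boundary_pos (x' + x) (y' + y)"
  let ?V = "points (x' + x) (y' + y)" and ?W = "points x' y'" and ?D = "shift x' y' ` points x y"
  let ?c = "contract (k \<union> g) ?D"
  define unshift :: "point \<Rightarrow> point" where "unshift = (\<lambda>(l, i). (l, i - (if l = 0 then x' else y')))"
  define k' where "k' = emap unshift ?c"
  have us: "unshift (shift x' y' v) = v" for v by (cases v) (simp add: unshift_def)
  have pk: "perfect_matching ?V k" "\<not> crossing ?pos k" and pg: "perfect_matching ?W g"
    using k g by (simp_all add: planar_matchings_iff)
  have WV: "?W \<subseteq> ?V" by (simp add: points_add)
  note glue = glue_inside[OF pk(1) pg finite_points WV inj_boundary_pos pk(2) crossing_left[OF g],
    unfolded points_add_diff_left]
  have pc: "perfect_matching ?D ?c" using glue(1) boundary_pos_separated by blast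
  have c: "\<not> crossing ?pos ?c" using glue(2) boundary_pos_separated by blast
  have sk: "emap (shift x' y') k' = ?c"
  proof -
    have "emap (shift x' y') k' = emap (\<lambda>v. v) ?c" unfolding k'_def emap_emap
      by (rule emap_cong) (use perfect_matching_Union[OF pc] us in auto)
    then show ?thesis by (simp add: emap_def)
  qed
  have "inj_on unshift ?D" using us by (auto simp: inj_on_def)
  moreover have "unshift ` ?D = points x y" using us by (simp add: image_image)
  ultimately have pk': "perfect_matching (points x y) k'"
    using perfect_matching_emap[OF _ pc, of unshift] by (simp add: k'_def)
  have "\<not> crossing (\<lambda>v. ?pos (shift x' y' v)) k'" using c unfolding sk[symmetric] crossing_emap[OF inj_shift] .
  moreover have "crossing (\<lambda>v. ?pos (shift x' y' v)) k' \<longleftrightarrow> crossing (boundary_pos x y) k'"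
    by (rule crossing_cong) (use boundary_pos_right perfect_matching_Union[OF pk'] in auto)
  ultimately have k': "k' \<in> planar_matchings x y" using pk' by (simp add: planar_matchings_iff)
  have "loops (tensor_matching x' y' g f \<union> k) ?V = loops (k \<union> g) ?W + loops (f \<union> k') (points x y)"
    if f: "f \<in> planar_matchings x y" for f
  proof -
    have "loops ((k \<union> g) \<union> emap (shift x' y') f) (?W \<union> ?D)
      = loops (k \<union> g) ?W + loops (?c \<union> emap (shift x' y') f) ?D"
    proof (rule loops_contract)
      show "\<Union>(k \<union> g) \<subseteq> ?W \<union> ?D" by (auto simp: Union_planar[OF k] Union_planar[OF g] points_add)
      show "\<Union>(emap (shift x' y') f) \<inter> ?W = {}" unfolding Union_emap Union_planar[OF f] using points_shift_disjoint by blast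
    qed (simp_all add: points_shift_disjoint points_shift_disjoint')
    moreover have "?c \<union> emap (shift x' y') f = emap (shift x' y') (f \<union> k')" by (simp add: emap_Un sk Un_commute)
    moreover have "(k \<union> g) \<union> emap (shift x' y') f = tensor_matching x' y' g f \<union> k" by (auto simp: tensor_matching_def)
    ultimately show ?thesis by (simp add: points_add loops_emap[OF inj_shift])
  qed
  then show thesis using that k' by blast
qed

lemma loops_edge:
  assumes "a \<noteq> b" shows "loops {{a, b}} {a, b} = 1"
proof -
  have "perfect_matching {a, b} {{a, b}}" using assms by (simp add: perfect_matching_def partition_on_def)
  from joined_perfect_matching[OF this] have "joined {{a, b}} `` {v} = {a, b}" if "v \<in> {a, b}" for v
    using that by (auto simp: doubleton_eq_iff)
  then have "{c \<in> {a, b} // joined {{a, b}}. c \<subseteq> {a, b}} = {{a, b}}"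
    unfolding quotient_def by auto
  then show ?thesis by (simp add: loops_def)
qed

lemma closure_loops_tensor_id:
  assumes M: "M \<in> planar_matchings x x"
  shows "closure_loops (x + 1) (tensor_matching x x M (id_matching 1)) = Suc (closure_loops x M)"
proof -
  let ?a = "(0, x) :: point" and ?b = "(1, x) :: point"
  have i1: "id_matching 1 = {{(0, 0), (1, 0)}}" by (auto simp: id_matching_def)
  then have s: "emap (shift x x) (id_matching 1) = {{?a, ?b}}" by (simp add: emap_def)
  have "id_matching (x + 1) = id_matching x \<union> {{?a, ?b}}"
    using tensor_id_matching[of x 1] s by (simp add: tensor_matching_def)
  then have E: "tensor_matching x x M (id_matching 1) \<union> id_matching (x + 1) = (M \<union> id_matching x) \<union> {{?a, ?b}}"
    using s by (auto simp: tensor_matching_def)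
  have P: "points (x + 1) (x + 1) = points x x \<union> {?a, ?b}" by (auto simp: points_def)
  have "loops ((M \<union> id_matching x) \<union> {{?a, ?b}}) (points x x \<union> {?a, ?b})
    = loops (M \<union> id_matching x) (points x x) + loops {{?a, ?b}} {?a, ?b}"
    by (rule loops_Un_disjoint[where V = "points x x" and W = "{?a, ?b}"])
      (auto simp: Union_planar[OF M] Union_planar[OF id_matching_planar] points_iff)
  also have "loops {{?a, ?b}} {?a, ?b} = 1"
    by (rule loops_edge) simp
  finally show ?thesis
    using closure_loops_alt[OF M] closure_loops_alt[OF tensor_matching_planar[OF M id_matching_planar[of 1]]]
    by (simp only: E P)
qed

section \<open>Hooks and turning points\<close>

text \<open>
  The point next to the left end of an arc is the end of a nested arc, which is shorter.
\<close>

lemma neighbours_joined: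
  assumes M: "M \<in> planar_matchings x y" and arc: "{(0, i), (0, j)} \<in> M" and ij: "i < j"
  shows "\<exists>k. Suc k < x \<and> {(0, k), (0, Suc k)} \<in> M"
  using arc ij
proof (induct "j - i" arbitrary: i j rule: less_induct)
  case less
  have pm: "perfect_matching (points x y) M" and nc: "\<not> crossing (boundary_pos x y) M"
    using M by (simp_all add: planar_matchings_iff)
  have jx: "j < x" using perfect_matching_ends[OF pm less(2)] by (simp add: points_iff)
  show ?case
  proof (cases "j = Suc i")
    case True
    then show ?thesis using less(2) jx by blast
  next
    case False
    then have sij: "Suc i < j" using less(3) by simp
    then have "(0, Suc i) \<in> points x y" using jx by (simp add: points_iff)
    then obtain p where p: "{(0, Suc i), p} \<in> M" using perfect_matching_partner[OF pm] by metis
    have pv: "p \<in> points x y" "p \<noteq> (0, Suc i)" using perfect_matching_ends[OF pm p] by auto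
    have "p \<noteq> (0, i)"
    proof
      assume "p = (0, i)"
      then have "{(0, i), (0, Suc i)} \<in> M" using p by (simp add: insert_commute)
      then show False using perfect_matching_unique[OF pm less(2)] sij by fastforce
    qed
    moreover have "p \<noteq> (0, j)"
    proof
      assume "p = (0, j)"
      then have "{(0, j), (0, Suc i)} \<in> M" "{(0, j), (0, i)} \<in> M" using p less(2) by (simp_all add: insert_commute)
      then show False using perfect_matching_unique[OF pm] by fastforce
    qed
    moreover have "\<not> boundary_pos x y (0, j) < boundary_pos x y p"
    proof
      assume "boundary_pos x y (0, j) < boundary_pos x y p"
      then have "crossing (boundary_pos x y) M" unfolding crossing_def
        by (intro exI[of _ "(0, i)"] exI[of _ "(0, j)"] exI[of _ "(0, Suc i)"] exI[of _ p])
          (use less(2) p sij in simp)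
      then show False using nc by simp
    qed
    moreover have "\<not> boundary_pos x y p < boundary_pos x y (0, i)"
    proof
      assume "boundary_pos x y p < boundary_pos x y (0, i)"
      then have "crossing (boundary_pos x y) M" unfolding crossing_def
        by (intro exI[of _ p] exI[of _ "(0, Suc i)"] exI[of _ "(0, i)"] exI[of _ "(0, j)"])
          (use less(2) p sij in \<open>simp add: insert_commute\<close>)
      then show False using nc by simp
    qed
    ultimately obtain k where k: "p = (0, k)" "i < k" "k < j"
      using pv jx by (cases p) (fastforce simp: points_iff)
    moreover have "Suc i \<noteq> k" using pv k by auto
    ultimately have "Suc i < k" by simp
    then show ?thesis using less(1)[of k "Suc i"] k p by simp
  qed
qed

text \<open>
  Without arcs between bottom points every bottom point is joined to the top, and by planarity in an
  order preserving way.
\<close>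

lemma no_turn_at_bottom:
  assumes M: "M \<in> planar_matchings x y" and none: "\<And>k. Suc k < x \<Longrightarrow> {(0, k), (0, Suc k)} \<notin> M"
  shows "x \<le> y" and "x = y \<Longrightarrow> M = id_matching x"
proof -
  have pm: "perfect_matching (points x y) M" and nc: "\<not> crossing (boundary_pos x y) M"
    using M by (simp_all add: planar_matchings_iff)
  have nb: "{(0, i), (0, j)} \<notin> M" for i j
  proof
    assume arc: "{(0, i), (0, j)} \<in> M"
    then have "i \<noteq> j" using perfect_matching_ends[OF pm arc] by auto
    then consider "i < j" | "j < i" by linarith
    then show False
      using neighbours_joined[OF M arc] neighbours_joined[OF M, of j i] arc none by cases (auto simp: insert_commute)
  qed
  have "\<exists>k < y. {(0, i), (1, k)} \<in> M" if i: "i < x" for i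
  proof -
    have "(0, i) \<in> points x y" using i by (simp add: points_iff)
    then obtain p where p: "{(0, i), p} \<in> M" using perfect_matching_partner[OF pm] by metis
    then have "p \<in> points x y" using perfect_matching_ends[OF pm] by blast
    then show ?thesis using p nb by (cases p) (auto simp: points_iff)
  qed
  then obtain f where f: "\<And>i. i < x \<Longrightarrow> f i < y \<and> {(0, i), (1, f i)} \<in> M" by metis
  have mono: "f i < f j" if "i < j" "j < x" for i j
  proof (rule ccontr)
    assume "\<not> f i < f j"
    moreover have "f i \<noteq> f j"
    proof
      assume "f i = f j"
      then have "{(1, f i), (0, i)} \<in> M" "{(1, f i), (0, j)} \<in> M" using f[of i] f[of j] that by (simp_all add: insert_commute)
      then show False using perfect_matching_unique[OF pm] that by fastforce
    qed
    ultimately have "f j < f i" by simp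
    then have "crossing (boundary_pos x y) M" unfolding crossing_def
      by (intro exI[of _ "(0, i)"] exI[of _ "(1, f i)"] exI[of _ "(0, j)"] exI[of _ "(1, f j)"])
        (use f[of i] f[of j] that in auto)
    then show False using nc by simp
  qed
  have "inj_on f {..<x}" using mono by (metis lessThan_iff linorder_inj_onI' nat_neq_iff)
  moreover have "f ` {..<x} \<subseteq> {..<y}" using f by auto
  ultimately show "x \<le> y" using card_inj_on_le[of f "{..<x}" "{..<y}"] by simp
  assume xy: "x = y"
  have gap: "f i + d \<le> f (i + d)" if "i + d < x" for i d
    using that
  proof (induct d)
    case (Suc d)
    then show ?case using mono[of "i + d" "i + Suc d"] by simp
  qed simp
  have "f i = i" if "i < x" for i
  proof -
    have "f (x - 1) < x" using f[of "x - 1"] that xy by simp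
    moreover have "f i + (x - 1 - i) \<le> f (x - 1)" using gap[of i "x - 1 - i"] that by simp
    moreover have "i \<le> f i" using gap[of 0 i] that by simp
    ultimately show ?thesis using that by linarith
  qed
  then have "id_matching x \<subseteq> M" using f by (auto simp: id_matching_def)
  then show "M = id_matching x"
    by (rule planar_subset_eq[OF id_matching_planar, symmetric, rotated]) (use M xy in simp)
qed

definition cup_matching :: matching where "cup_matching = {{(1, 0), (1, 1)}}"

definition cap_matching :: matching where "cap_matching = {{(0, 0), (0, 1)}}"

lemma cup_planar: "cup_matching \<in> planar_matchings 0 2"
proof -
  have "points 0 2 = {(1, 0), (1, 1)}" by (auto simp: points_def)
  then show ?thesis
    by (auto simp: planar_matchings_iff cup_matching_def perfect_matching_def partition_on_def
      crossing_def doubleton_eq_iff)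
qed

lemma cap_planar: "cap_matching \<in> planar_matchings 2 0"
proof -
  have "points 2 0 = {(0, 0), (0, 1)}" by (auto simp: points_def)
  then show ?thesis
    by (auto simp: planar_matchings_iff cap_matching_def perfect_matching_def partition_on_def
      crossing_def doubleton_eq_iff)
qed

lemma U_matching_1: "U_matching 1 = {{(0, 0), (0, 1)}, {(1, 0), (1, 1)}}"
  by (auto simp: U_matching_def)

lemma cup_cap: "stack_matching 2 2 cup_matching cap_matching = U_matching 1"
    "stack_loops 0 cup_matching cap_matching = 0"
proof (rule planar_cover_eq[symmetric])
  show "stack_matching 2 2 cup_matching cap_matching \<in> planar_matchings 2 2"
    by (rule stack_matching_planar[OF cap_planar cup_planar])
  show "points 2 2 \<subseteq> \<Union>(U_matching 1)" unfolding U_matching_1 by (auto simp: points_def less_2_cases_iff)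
  have "((0, 0), (0, 1)) \<in> joined (stack cup_matching cap_matching)"
    by (rule joined_stack_lower[OF joined_edge]) (simp add: cap_matching_def)
  moreover have "(raise (1, 0), raise (1, 1)) \<in> joined (stack cup_matching cap_matching)"
    by (rule joined_stack_upper[OF joined_edge]) (simp add: cup_matching_def)
  ultimately show "U_matching 1 \<subseteq> stack_matching 2 2 cup_matching cap_matching"
    unfolding U_matching_1 by (simp add: stack_matching_iff points_iff numeral_2_eq_2)
  show "stack_loops 0 cup_matching cap_matching = 0"
    unfolding stack_loops_alt by (rule loops_eq_0I) simp
qed

lemma U_matching_1_planar: "U_matching 1 \<in> planar_matchings 2 2"
  using stack_matching_planar[OF cap_planar cup_planar] by (simp only: cup_cap)

lemma cap_cup: "stack_matching 0 0 cap_matching cup_matching = {}"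
    "stack_loops 2 cap_matching cup_matching = 1"
proof -
  have "points 0 0 = {}" by (simp add: points_def)
  then show "stack_matching 0 0 cap_matching cup_matching = {}"
    using stack_matching_planar[OF cup_planar cap_planar]
    by (auto simp: planar_matchings_iff perfect_matching_def partition_on_def)
  have "stack cap_matching cup_matching = {{(1, 0), (1, 1)}}"
    by (simp add: stack_alt cap_matching_def cup_matching_def emap_def)
  moreover have "level 1 2 = {(1, 0), (1, 1)}" by auto
  ultimately show "stack_loops 2 cap_matching cup_matching = 1"
    unfolding stack_loops_alt using loops_edge[of "(1, 0) :: point" "(1, 1)"] by simp
qed

lemma U_matching_alt:
  assumes "m \<ge> 1"
  shows "U_matching m = tensor_matching (m - 1) (m - 1) (id_matching (m - 1)) (U_matching 1)"
proof -
  have "emap (shift (m - 1) (m - 1)) (U_matching 1) = {{(0, m - 1), (0, m)}, {(1, m - 1), (1, m)}}"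
    using assms unfolding U_matching_1 by (auto simp: emap_def)
  then show ?thesis
    unfolding tensor_matching_def by (simp add: U_matching_def id_matching_def)
qed

lemma shifted_id: "emap (shift x y) (id_matching k) = {{(0, x + i), (1, y + i)} | i. i < k}"
proof (intro equalityI subsetI)
  fix e assume "e \<in> emap (shift x y) (id_matching k)"
  then show "e \<in> {{(0, x + i), (1, y + i)} | i. i < k}"
    by (auto simp: emap_def id_matching_def add.commute)
next
  fix e :: "point set" assume "e \<in> {{(0, x + i), (1, y + i)} | i. i < k}"
  then obtain i where i: "e = {shift x y (0, i), shift x y (1, i)}" "i < k" by (auto simp: add.commute)
  show "e \<in> emap (shift x y) (id_matching k)"
    unfolding i(1) by (rule emap_edge[OF id_matching_arc[OF i(2)]])
qed

lemma zigzag_left: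
  "stack_matching 1 1 (tensor_matching 2 0 cap_matching (id_matching 1)) (tensor_matching 1 1 (id_matching 1) cup_matching)
    = id_matching 1" (is "stack_matching 1 1 ?N ?M = _")
  "stack_loops 3 (tensor_matching 2 0 cap_matching (id_matching 1)) (tensor_matching 1 1 (id_matching 1) cup_matching) = 0"
proof -
  have M: "?M = {{(0, 0), (1, 0)}, {(1, 1), (1, 2)}}"
    by (auto simp: tensor_matching_def id_matching_def cup_matching_def emap_def)
  have N: "?N = {{(0, 0), (0, 1)}, {(0, 2), (1, 0)}}"
    by (auto simp: tensor_matching_def shifted_id cap_matching_def)
  have pM: "?M \<in> planar_matchings 1 3" using tensor_matching_planar[OF id_matching_planar[of 1] cup_planar] by (simp add: numeral_3_eq_3)
  have pN: "?N \<in> planar_matchings 3 1" using tensor_matching_planar[OF cap_planar id_matching_planar[of 1]] by simp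
  let ?S = "stack ?N ?M"
  have S: "?S = {{(0, 0), (1, 0)}, {(1, 1), (1, 2)}, {(1, 0), (1, 1)}, {(1, 2), (2, 0)}}"
    unfolding M N stack_alt by (simp add: emap_def numeral_2_eq_2 insert_commute)
  have 1: "((1, 0), (0, 0)) \<in> joined ?S" "((1, 1), (1, 0)) \<in> joined ?S"
    "((1, 2), (1, 1)) \<in> joined ?S" "((2, 0), (1, 2)) \<in> joined ?S"
    by (rule joined_edge, simp only: S, simp add: doubleton_eq_iff)+
  have 2: "((1, 1), (0, 0)) \<in> joined ?S" using 1 joined_trans by metis
  have 3: "((1, 2), (0, 0)) \<in> joined ?S" using 1(3) 2 joined_trans by metis
  have 4: "((2, 0), (0, 0)) \<in> joined ?S" using 1(4) 3 joined_trans by metis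
  have "id_matching 1 \<subseteq> stack_matching 1 1 ?N ?M"
    using joined_sym[OF 4] by (auto simp: id_matching_def stack_matching_iff points_iff)
  then show "stack_matching 1 1 ?N ?M = id_matching 1"
    using planar_subset_eq[OF id_matching_planar stack_matching_planar[OF pM pN]] by simp
  show "stack_loops 3 ?N ?M = 0" unfolding stack_loops_alt
  proof (rule loops_eq_0I)
    fix a assume "a \<in> level 1 3"
    then have "a = (1, 0) \<or> a = (1, 1) \<or> a = (1, 2)" by auto
    then have "(a, (0, 0)) \<in> joined ?S" using 1(1) 2 3 by blast
    moreover have "(0, 0) \<notin> level 1 3" by simp
    ultimately show "\<exists>b. b \<notin> level 1 3 \<and> (a, b) \<in> joined ?S" by blast
  qed
qed

lemma zigzag_right:
  "stack_matching 1 1 (tensor_matching 1 1 (id_matching 1) cap_matching) (tensor_matching 0 2 cup_matching (id_matching 1))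
    = id_matching 1" (is "stack_matching 1 1 ?N ?M = _")
  "stack_loops 3 (tensor_matching 1 1 (id_matching 1) cap_matching) (tensor_matching 0 2 cup_matching (id_matching 1)) = 0"
proof -
  have M: "?M = {{(0, 0), (1, 2)}, {(1, 0), (1, 1)}}"
    by (auto simp: tensor_matching_def shifted_id cup_matching_def)
  have N: "?N = {{(0, 1), (0, 2)}, {(0, 0), (1, 0)}}"
    by (auto simp: tensor_matching_def id_matching_def cap_matching_def emap_def)
  have pM: "?M \<in> planar_matchings 1 3" using tensor_matching_planar[OF cup_planar id_matching_planar[of 1]] by simp
  have pN: "?N \<in> planar_matchings 3 1" using tensor_matching_planar[OF id_matching_planar[of 1] cap_planar] by (simp add: numeral_3_eq_3)
  let ?S = "stack ?N ?M"
  have S: "?S = {{(0, 0), (1, 2)}, {(1, 0), (1, 1)}, {(1, 1), (1, 2)}, {(1, 0), (2, 0)}}"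
    unfolding M N stack_alt by (simp add: emap_def numeral_2_eq_2 insert_commute)
  have 1: "((1, 2), (0, 0)) \<in> joined ?S" "((1, 1), (1, 2)) \<in> joined ?S"
    "((1, 0), (1, 1)) \<in> joined ?S" "((2, 0), (1, 0)) \<in> joined ?S"
    by (rule joined_edge, simp only: S, simp add: doubleton_eq_iff)+
  have 2: "((1, 1), (0, 0)) \<in> joined ?S" using 1 joined_trans by metis
  have 3: "((1, 0), (0, 0)) \<in> joined ?S" using 1(3) 2 joined_trans by metis
  have 4: "((2, 0), (0, 0)) \<in> joined ?S" using 1(4) 3 joined_trans by metis
  have "id_matching 1 \<subseteq> stack_matching 1 1 ?N ?M"
    using joined_sym[OF 4] by (auto simp: id_matching_def stack_matching_iff points_iff)
  then show "stack_matching 1 1 ?N ?M = id_matching 1"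
    using planar_subset_eq[OF id_matching_planar stack_matching_planar[OF pM pN]] by simp
  show "stack_loops 3 ?N ?M = 0" unfolding stack_loops_alt
  proof (rule loops_eq_0I)
    fix a assume "a \<in> level 1 3"
    then have "a = (1, 0) \<or> a = (1, 1) \<or> a = (1, 2)" by auto
    then have "(a, (0, 0)) \<in> joined ?S" using 1(1) 2 3 by blast
    moreover have "(0, 0) \<notin> level 1 3" by simp
    ultimately show "\<exists>b. b \<notin> level 1 3 \<and> (a, b) \<in> joined ?S" by blast
  qed
qed

text \<open>The generators of the Temperley-Lieb algebra on \<open>i + 2 + j\<close> strands.\<close>

definition hook :: "nat \<Rightarrow> nat \<Rightarrow> matching" where
  "hook i j = tensor_matching (i + 2) (i + 2) (tensor_matching i i (id_matching i) (U_matching 1)) (id_matching j)"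

lemma hook_planar: "hook i j \<in> planar_matchings (i + 2 + j) (i + 2 + j)"
  unfolding hook_def by (intro tensor_matching_planar id_matching_planar U_matching_1_planar)

lemma hook_turns: "{(0, i), (0, Suc i)} \<in> hook i j" "{(1, i), (1, Suc i)} \<in> hook i j"
  unfolding hook_def tensor_matching_def U_matching_1 by (auto simp: emap_def)

lemma hook_strand:
  assumes "k < i + 2 + j" "k \<noteq> i" "k \<noteq> Suc i" shows "{(0, k), (1, k)} \<in> hook i j"
proof (cases "k < i")
  case True
  then show ?thesis unfolding hook_def tensor_matching_def using id_matching_arc[OF True] by simp
next
  case False
  then have "{(0, i + 2 + (k - (i + 2))), (1, i + 2 + (k - (i + 2)))} \<in> emap (shift (i + 2) (i + 2)) (id_matching j)"
    unfolding shifted_id using assms by (intro CollectI exI[of _ "k - (i + 2)"]) auto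
  moreover have "i + 2 + (k - (i + 2)) = k" using False assms by simp
  ultimately have "{(0, k), (1, k)} \<in> emap (shift (i + 2) (i + 2)) (id_matching j)" by (simp only:)
  then show ?thesis unfolding hook_def tensor_matching_def[of "i + 2"] by (rule UnI2)
qed

text \<open>
  The edge between \<open>a\<close> and \<open>b\<close> is a component of its own, and no other component stays in \<open>I\<close>.
\<close>

lemma loops_one:
  assumes turn: "\<And>v. {a, v} \<in> E \<Longrightarrow> v = b" "\<And>v. {b, v} \<in> E \<Longrightarrow> v = a" and ab: "{a, b} \<in> E" "a \<in> I" "b \<in> I"
    and esc: "\<And>c. c \<in> I \<Longrightarrow> c \<noteq> a \<Longrightarrow> c \<noteq> b \<Longrightarrow> \<exists>d. d \<notin> I \<and> (c, d) \<in> joined E"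
  shows "loops E I = 1"
proof -
  have cl: "joined E `` {v} = {a, b}" if v: "v \<in> {a, b}" for v
  proof
    show "joined E `` {v} \<subseteq> {a, b}"
    proof
      fix w assume "w \<in> joined E `` {v}"
      then have "(v, w) \<in> joined E" by simp
      then show "w \<in> {a, b}" by (rule joined_closed_set) (use v turn in auto)
    qed
    show "{a, b} \<subseteq> joined E `` {v}"
      using v joined_edge[OF ab(1)] joined_sym[OF joined_edge[OF ab(1)]] by auto
  qed
  have "{c \<in> I // joined E. c \<subseteq> I} = {{a, b}}"
  proof (intro equalityI subsetI)
    fix c assume c: "c \<in> {c \<in> I // joined E. c \<subseteq> I}"
    then obtain v where v: "v \<in> I" "c = joined E `` {v}" by (auto elim: quotientE)
    then have "v = a \<or> v = b" using esc[of v] c by auto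
    then show "c \<in> {{a, b}}" using v cl by auto
  next
    fix c assume "c \<in> {{a, b}}"
    then have "c = joined E `` {a}" using cl by simp
    then show "c \<in> {c \<in> I // joined E. c \<subseteq> I}"
      using ab(2,3) \<open>c \<in> {{a, b}}\<close> quotientI[OF ab(2), of "joined E"] by simp
  qed
  then show ?thesis by (simp add: loops_def)
qed

text \<open>
  A hook placed on a diagram that turns at the same place forms one closed loop with it and puts an
  equal turn in its place.
\<close>

lemma hook_above:
  assumes M: "M \<in> planar_matchings x (i + 2 + j)" and turn: "{(1, i), (1, Suc i)} \<in> M"
  shows "stack_matching x (i + 2 + j) (hook i j) M = M" and "stack_loops (i + 2 + j) (hook i j) M = 1"
proof -
  let ?y = "i + 2 + j" and ?S = "stack (hook i j) M"
  have pm: "perfect_matching (points x ?y) M" and ph: "perfect_matching (points ?y ?y) (hook i j)"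
    using M hook_planar[of i j] by (simp_all add: planar_matchings_iff)
  have up: "((1, k), (2, k)) \<in> joined ?S" if "k < ?y" "k \<noteq> i" "k \<noteq> Suc i" for k
    using joined_stack_upper[OF joined_edge[OF hook_strand[OF that]]] by (simp add: numeral_2_eq_2)
  have top: "((2, i), (2, Suc i)) \<in> joined ?S"
    using joined_stack_upper[OF joined_edge[OF hook_turns(2)]] by (simp add: numeral_2_eq_2)
  have ends: "(u, double_level u) \<in> joined ?S" if "u \<in> points x ?y" "u \<noteq> (1, i)" "u \<noteq> (1, Suc i)" for u
    using up that by (cases u) (auto simp: points_iff)
  have "M \<subseteq> stack_matching x ?y (hook i j) M"
  proof (rule planar_subset_stackI[OF M])
    fix u v assume uv: "{u, v} \<in> M"
    then have p: "u \<in> points x ?y" "v \<in> points x ?y" using Union_planar[OF M] by blast+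
    have vu: "{v, u} \<in> M" using uv by (simp add: insert_commute)
    have turn': "{(1, Suc i), (1, i)} \<in> M" using turn by (simp add: insert_commute)
    show "(double_level u, double_level v) \<in> joined ?S"
    proof (cases "u = (1, i) \<or> u = (1, Suc i)")
      case True
      then show ?thesis
        using perfect_matching_unique[OF pm uv] turn turn' top joined_sym[OF top] by fastforce
    next
      case False
      moreover have "v \<noteq> (1, i)" "v \<noteq> (1, Suc i)"
        using perfect_matching_unique[OF pm vu] turn turn' False by blast+
      ultimately show ?thesis
        using ends p joined_stack_lower[OF joined_edge[OF uv]] by (meson joined_sym joined_trans)
    qed
  qed
  then show "stack_matching x ?y (hook i j) M = M"
    using planar_subset_eq[OF M stack_matching_planar[OF M hook_planar]] by simp
  show "stack_loops ?y (hook i j) M = 1" unfolding stack_loops_alt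
  proof (rule loops_one[of "(1, i)" _ "(1, Suc i)"])
    have lower: "w = (1, b)" if w: "{(1, a), w} \<in> emap raise (hook i j)" and b: "{(0, a), (0, b)} \<in> hook i j" for a b w
    proof -
      have "{raise (0, a), w} \<in> emap raise (hook i j)" using w by simp
      then obtain v where v: "w = raise v" "{(0, a), v} \<in> hook i j" by (rule emap_edgeE[OF _ inj_raise])
      have "v = (0, b)" by (rule perfect_matching_unique[OF ph v(2) b])
      then show ?thesis using v(1) by simp
    qed
    have cases: "{(1, a), v} \<in> M \<or> {(1, a), v} \<in> emap raise (hook i j)" if "{(1, a), v} \<in> ?S" for a v
      using that by (simp only: stack_alt Un_iff)
    fix v
    show "v = (1, Suc i)" if "{(1, i), v} \<in> ?S"
      using cases[OF that] perfect_matching_unique[OF pm _ turn] lower[OF _ hook_turns(1)] by blast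
    have turn': "{(1, Suc i), (1, i)} \<in> M" "{(0, Suc i), (0, i)} \<in> hook i j"
      using turn hook_turns(1)[of i j] by (simp_all add: insert_commute)
    then show "v = (1, i)" if "{(1, Suc i), v} \<in> ?S"
      using cases[OF that] perfect_matching_unique[OF pm _ turn'(1)] lower[OF _ turn'(2)] by blast
    show "{(1, i), (1, Suc i)} \<in> ?S" using turn by (simp add: stack_alt)
    fix c assume "c \<in> level 1 ?y" "c \<noteq> (1, i)" "c \<noteq> (1, Suc i)"
    then obtain k where k: "c = (1, k)" "k < ?y" "k \<noteq> i" "k \<noteq> Suc i" by auto
    then show "\<exists>d. d \<notin> level 1 ?y \<and> (c, d) \<in> joined ?S" using up[of k] by (intro exI[of _ "(2, k)"]) simp
  qed simp_all
qed

lemma hook_below: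
  assumes M: "M \<in> planar_matchings (i + 2 + j) y" and turn: "{(0, i), (0, Suc i)} \<in> M"
  shows "stack_matching (i + 2 + j) y M (hook i j) = M" and "stack_loops (i + 2 + j) M (hook i j) = 1"
proof -
  let ?x = "i + 2 + j" and ?S = "stack M (hook i j)"
  have pm: "perfect_matching (points ?x y) M" and ph: "perfect_matching (points ?x ?x) (hook i j)"
    using M hook_planar[of i j] by (simp_all add: planar_matchings_iff)
  have down: "((0, k), (1, k)) \<in> joined ?S" if "k < ?x" "k \<noteq> i" "k \<noteq> Suc i" for k
    by (rule joined_stack_lower[OF joined_edge[OF hook_strand[OF that]]])
  have bottom: "((0, i), (0, Suc i)) \<in> joined ?S"
    by (rule joined_stack_lower[OF joined_edge[OF hook_turns(1)]])
  have ends: "(double_level u, raise u) \<in> joined ?S" if "u \<in> points ?x y" "u \<noteq> (0, i)" "u \<noteq> (0, Suc i)" for u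
    using down that by (cases u) (auto simp: points_iff numeral_2_eq_2)
  have turn': "{(0, Suc i), (0, i)} \<in> M" using turn by (simp add: insert_commute)
  have "M \<subseteq> stack_matching ?x y M (hook i j)"
  proof (rule planar_subset_stackI[OF M])
    fix u v assume uv: "{u, v} \<in> M"
    then have p: "u \<in> points ?x y" "v \<in> points ?x y" using Union_planar[OF M] by blast+
    have vu: "{v, u} \<in> M" using uv by (simp add: insert_commute)
    show "(double_level u, double_level v) \<in> joined ?S"
    proof (cases "u = (0, i) \<or> u = (0, Suc i)")
      case True
      then show ?thesis
        using perfect_matching_unique[OF pm uv] turn turn' bottom joined_sym[OF bottom] by fastforce
    next
      case False
      moreover have "v \<noteq> (0, i)" "v \<noteq> (0, Suc i)"
        using perfect_matching_unique[OF pm vu] turn turn' False by blast+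
      ultimately show ?thesis
        using ends p joined_stack_upper[OF joined_edge[OF uv]] by (meson joined_sym joined_trans)
    qed
  qed
  then show "stack_matching ?x y M (hook i j) = M"
    using planar_subset_eq[OF M stack_matching_planar[OF hook_planar M]] by simp
  show "stack_loops ?x M (hook i j) = 1" unfolding stack_loops_alt
  proof (rule loops_one[of "(1, i)" _ "(1, Suc i)"])
    have upper: "w = (1, b)" if w: "{(1, a), w} \<in> emap raise M" and b: "{(0, a), (0, b)} \<in> M" for a b w
    proof -
      have "{raise (0, a), w} \<in> emap raise M" using w by simp
      then obtain v where v: "w = raise v" "{(0, a), v} \<in> M" by (rule emap_edgeE[OF _ inj_raise])
      have "v = (0, b)" by (rule perfect_matching_unique[OF pm v(2) b])
      then show ?thesis using v(1) by simp
    qed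
    have cases: "{(1, a), v} \<in> hook i j \<or> {(1, a), v} \<in> emap raise M" if "{(1, a), v} \<in> ?S" for a v
      using that by (simp only: stack_alt Un_iff)
    have hook': "{(1, Suc i), (1, i)} \<in> hook i j" using hook_turns(2)[of i j] by (simp add: insert_commute)
    fix v
    show "v = (1, Suc i)" if "{(1, i), v} \<in> ?S"
      using cases[OF that] perfect_matching_unique[OF ph _ hook_turns(2)] upper[OF _ turn] by blast
    show "v = (1, i)" if "{(1, Suc i), v} \<in> ?S"
      using cases[OF that] perfect_matching_unique[OF ph _ hook'] upper[OF _ turn'] by blast
    show "{(1, i), (1, Suc i)} \<in> ?S" using hook_turns(2) by (simp add: stack_alt)
    fix c assume "c \<in> level 1 ?x" "c \<noteq> (1, i)" "c \<noteq> (1, Suc i)"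
    then obtain k where k: "c = (1, k)" "k < ?x" "k \<noteq> i" "k \<noteq> Suc i" by auto
    then show "\<exists>d. d \<notin> level 1 ?x \<and> (c, d) \<in> joined ?S"
      using joined_sym[OF down[of k]] by (intro exI[of _ "(0, k)"]) simp
  qed simp_all
qed

section \<open>Linear extension\<close>

abbreviation scale :: "complex \<Rightarrow> ('a \<Rightarrow>\<^sub>0 complex) \<Rightarrow> ('a \<Rightarrow>\<^sub>0 complex)" where
  "scale c \<equiv> Poly_Mapping.map ((*) c)"

abbreviation basis :: "'a \<Rightarrow> ('a \<Rightarrow>\<^sub>0 complex)" where
  "basis a \<equiv> Poly_Mapping.single a 1"

lemma lookup_scale [simp]: "Poly_Mapping.lookup (scale c f) a = c * Poly_Mapping.lookup f a"
  by transfer (simp add: when_def)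

global_interpretation scale: vector_space scale
  by unfold_locales (auto intro!: poly_mapping_eqI simp: lookup_add algebra_simps)

lemma scale_basis: "scale c (Poly_Mapping.single a b) = Poly_Mapping.single a (c * b)"
  by (rule poly_mapping_eqI) (simp add: lookup_single when_def)

text \<open>The linear extension of a map that sends basis elements to vectors.\<close>

definition lin :: "('a \<Rightarrow> ('b \<Rightarrow>\<^sub>0 complex)) \<Rightarrow> ('a \<Rightarrow>\<^sub>0 complex) \<Rightarrow> ('b \<Rightarrow>\<^sub>0 complex)" where
  "lin L f = (\<Sum>a \<in> Poly_Mapping.keys f. scale (Poly_Mapping.lookup f a) (L a))"

lemma lin_superset:
  assumes "finite A" "Poly_Mapping.keys f \<subseteq> A"
  shows "lin L f = (\<Sum>a \<in> A. scale (Poly_Mapping.lookup f a) (L a))"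
  unfolding lin_def
  by (rule sum.mono_neutral_left[OF assms]) (simp add: in_keys_iff)

lemma lin_add: "lin L (f + g) = lin L f + lin L g"
proof -
  let ?A = "Poly_Mapping.keys f \<union> Poly_Mapping.keys g"
  have "lin L (f + g) = (\<Sum>a \<in> ?A. scale (Poly_Mapping.lookup (f + g) a) (L a))"
    by (rule lin_superset) (auto dest: subsetD[OF keys_add])
  moreover have "lin L f = (\<Sum>a \<in> ?A. scale (Poly_Mapping.lookup f a) (L a))" by (rule lin_superset) auto
  moreover have "lin L g = (\<Sum>a \<in> ?A. scale (Poly_Mapping.lookup g a) (L a))" by (rule lin_superset) auto
  ultimately show ?thesis by (simp add: lookup_add scale.scale_left_distrib sum.distrib)
qed

lemma keys_scale: "Poly_Mapping.keys (scale c f) \<subseteq> Poly_Mapping.keys f"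
  by (auto simp: in_keys_iff)

lemma lin_scale: "lin L (scale c f) = scale c (lin L f)"
proof -
  have "lin L (scale c f) = (\<Sum>a \<in> Poly_Mapping.keys f. scale (Poly_Mapping.lookup (scale c f) a) (L a))"
    by (rule lin_superset) (simp_all add: keys_scale)
  then show ?thesis by (simp add: lin_def scale.scale_sum_right)
qed

lemma lin_single [simp]: "lin L (Poly_Mapping.single a c) = scale c (L a)"
  by (cases "c = 0") (simp_all add: lin_def)

lemma lin_zero [simp]: "lin L 0 = 0"
  by (simp add: lin_def)

lemma lin_uminus: "lin L (- f) = - lin L f"
  using lin_add[of L f "- f"] by (simp add: eq_neg_iff_add_eq_0 add.commute)

lemma lin_diff: "lin L (f - g) = lin L f - lin L g"
  using lin_add[of L f "- g"] by (simp add: lin_uminus)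

lemma lin_sum: "lin L (\<Sum>i \<in> I. f i) = (\<Sum>i \<in> I. lin L (f i))"
  by (induct I rule: infinite_finite_induct) (simp_all add: lin_add)

lemma lin_cong: "(\<And>a. a \<in> Poly_Mapping.keys f \<Longrightarrow> L a = L' a) \<Longrightarrow> lin L f = lin L' f"
  by (simp add: lin_def)

lemma lin_lin: "lin L (lin K f) = lin (\<lambda>a. lin L (K a)) f"
  by (subst (2) lin_def) (simp add: lin_sum lin_scale lin_def[of "\<lambda>a. lin L (K a)"])

lemma lin_basis [simp]: "lin basis f = f"
proof (rule poly_mapping_eqI)
  fix a
  have "Poly_Mapping.lookup (lin basis f) a
    = (\<Sum>b \<in> Poly_Mapping.keys f. if b = a then Poly_Mapping.lookup f b else 0)"
    by (simp add: lin_def lookup_sum lookup_single when_def if_distrib cong: if_cong)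
  then show "Poly_Mapping.lookup (lin basis f) a = Poly_Mapping.lookup f a"
    by (simp add: sum.delta in_keys_iff)
qed

lemma lin_fun_add: "lin (\<lambda>a. L a + L' a) f = lin L f + lin L' f"
  by (simp add: lin_def scale.scale_right_distrib sum.distrib)

lemma lin_fun_scale: "lin (\<lambda>a. scale c (L a)) f = scale c (lin L f)"
  by (simp add: lin_def scale.scale_sum_right mult.commute)

lemma lin_fun_zero [simp]: "lin (\<lambda>a. 0) f = 0"
  by (simp add: lin_def)

lemma lin_swap: "lin (\<lambda>a. lin (\<lambda>b. B a b) g) f = lin (\<lambda>b. lin (\<lambda>a. B a b) f) g"
proof -
  have "lin (\<lambda>a. lin (\<lambda>b. B a b) g) f = (\<Sum>a \<in> Poly_Mapping.keys f. \<Sum>b \<in> Poly_Mapping.keys g.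
      scale (Poly_Mapping.lookup f a) (scale (Poly_Mapping.lookup g b) (B a b)))"
    unfolding lin_def scale.scale_sum_right ..
  also have "\<dots> = (\<Sum>b \<in> Poly_Mapping.keys g. \<Sum>a \<in> Poly_Mapping.keys f.
      scale (Poly_Mapping.lookup g b) (scale (Poly_Mapping.lookup f a) (B a b)))"
    by (subst sum.swap) (simp add: mult.commute)
  also have "\<dots> = lin (\<lambda>b. lin (\<lambda>a. B a b) f) g"
    unfolding lin_def scale.scale_sum_right ..
  finally show ?thesis .
qed

definition supported :: "'a set \<Rightarrow> ('a \<Rightarrow>\<^sub>0 complex) set" where
  "supported B = {f. Poly_Mapping.keys f \<subseteq> B}"

lemma supported_0 [simp]: "0 \<in> supported B"
  by (simp add: supported_def)

lemma supported_add: "f \<in> supported B \<Longrightarrow> g \<in> supported B \<Longrightarrow> f + g \<in> supported B"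
  using keys_add[of f g] by (auto simp: supported_def)

lemma supported_scale: "f \<in> supported B \<Longrightarrow> scale c f \<in> supported B"
  using keys_scale[of c f] by (auto simp: supported_def)

lemma supported_diff: "f \<in> supported B \<Longrightarrow> g \<in> supported B \<Longrightarrow> f - g \<in> supported B"
  using supported_add[of f B "scale (- 1) g"] supported_scale[of g B "- 1"] by simp

lemma supported_single: "a \<in> B \<Longrightarrow> Poly_Mapping.single a c \<in> supported B"
  by (simp add: supported_def)

lemma supported_sum: "(\<And>i. i \<in> I \<Longrightarrow> f i \<in> supported B) \<Longrightarrow> (\<Sum>i \<in> I. f i) \<in> supported B"
  by (induct I rule: infinite_finite_induct) (simp_all add: supported_add)

lemma supported_lin:
  "f \<in> supported A \<Longrightarrow> (\<And>a. a \<in> A \<Longrightarrow> L a \<in> supported B) \<Longrightarrow> lin L f \<in> supported B"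
  unfolding lin_def by (rule supported_sum) (auto simp: supported_def[of A] intro: supported_scale)

lemma lin_eqI:
  "f \<in> supported A \<Longrightarrow> (\<And>a. a \<in> A \<Longrightarrow> L a = L' a) \<Longrightarrow> lin L f = lin L' f"
  by (rule lin_cong) (auto simp: supported_def)

section \<open>Linear combinations of planar matchings\<close>

text \<open>
  Modulo the loop relation every diagram is a multiple of one without loops, so that the morphisms of
  the Temperley-Lieb category are the linear combinations of planar matchings, with composition
  weighted by the loops it creates.
\<close>

type_synonym tl = "matching \<Rightarrow>\<^sub>0 complex"

abbreviation tl_hom :: "nat \<Rightarrow> nat \<Rightarrow> tl set" where
  "tl_hom x y \<equiv> supported (planar_matchings x y)"

abbreviation tl_id :: "nat \<Rightarrow> tl" where
  "tl_id m \<equiv> basis (id_matching m)"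

definition tl_comp :: "complex \<Rightarrow> nat \<Rightarrow> nat \<Rightarrow> nat \<Rightarrow> tl \<Rightarrow> tl \<Rightarrow> tl" where
  "tl_comp d x y z g f =
    lin (\<lambda>N. lin (\<lambda>M. Poly_Mapping.single (stack_matching x z N M) (d ^ stack_loops y N M)) f) g"

definition tl_tensor :: "nat \<Rightarrow> nat \<Rightarrow> tl \<Rightarrow> tl \<Rightarrow> tl" where
  "tl_tensor x y f f' = lin (\<lambda>M. lin (\<lambda>M'. basis (tensor_matching x y M M')) f') f"

text \<open>The trace is the coefficient of the empty diagram.\<close>

definition tl_trace :: "complex \<Rightarrow> nat \<Rightarrow> tl \<Rightarrow> complex" where
  "tl_trace d x f = Poly_Mapping.lookup (lin (\<lambda>M. Poly_Mapping.single () (d ^ closure_loops x M)) f) ()"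

lemma tl_comp_add_left: "tl_comp d x y z (g + g') f = tl_comp d x y z g f + tl_comp d x y z g' f"
  by (simp add: tl_comp_def lin_add)

lemma tl_comp_add_right: "tl_comp d x y z g (f + f') = tl_comp d x y z g f + tl_comp d x y z g f'"
  by (simp add: tl_comp_def lin_add lin_fun_add)

lemma tl_comp_scale_left: "tl_comp d x y z (scale c g) f = scale c (tl_comp d x y z g f)"
  by (simp add: tl_comp_def lin_scale)

lemma tl_comp_scale_right: "tl_comp d x y z g (scale c f) = scale c (tl_comp d x y z g f)"
  by (simp add: tl_comp_def lin_scale lin_fun_scale)

lemma tl_comp_0 [simp]: "tl_comp d x y z 0 f = 0" "tl_comp d x y z g 0 = 0"
  by (simp_all add: tl_comp_def)

lemma tl_comp_diff_left: "tl_comp d x y z (g - g') f = tl_comp d x y z g f - tl_comp d x y z g' f"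
  by (simp add: tl_comp_def lin_diff)

lemma tl_comp_diff_right: "tl_comp d x y z g (f - f') = tl_comp d x y z g f - tl_comp d x y z g f'"
  using tl_comp_add_right[of d x y z g "f - f'" f'] by (simp add: algebra_simps)

lemma tl_comp_sum_left: "tl_comp d x y z (\<Sum>i \<in> I. g i) f = (\<Sum>i \<in> I. tl_comp d x y z (g i) f)"
  by (simp add: tl_comp_def lin_sum)

lemma tl_comp_sum_right: "tl_comp d x y z g (\<Sum>i \<in> I. f i) = (\<Sum>i \<in> I. tl_comp d x y z g (f i))"
  by (induct I rule: infinite_finite_induct) (simp_all add: tl_comp_add_right)

lemmas tl_comp_linear = tl_comp_add_left tl_comp_add_right tl_comp_scale_left tl_comp_scale_right
  tl_comp_diff_left tl_comp_diff_right

lemma tl_comp_closed: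
  "f \<in> tl_hom x y \<Longrightarrow> g \<in> tl_hom y z \<Longrightarrow> tl_comp d x y z g f \<in> tl_hom x z"
  unfolding tl_comp_def by (intro supported_lin supported_single stack_matching_planar)

lemma tl_id_closed [simp]: "tl_id m \<in> tl_hom m m"
  by (simp add: supported_single id_matching_planar)

lemma tl_comp_id_left: "f \<in> tl_hom x y \<Longrightarrow> tl_comp d x y y (tl_id y) f = f"
  unfolding tl_comp_def using lin_eqI[of f "planar_matchings x y" _ basis]
  by (simp add: stack_matching_id_left)

lemma tl_comp_id_right: "f \<in> tl_hom x y \<Longrightarrow> tl_comp d x x y f (tl_id x) = f"
  unfolding tl_comp_def using lin_eqI[of f "planar_matchings x y" _ basis]
  by (simp add: stack_matching_id_right)

lemma tl_comp_assoc:
  assumes f: "f \<in> tl_hom w x" and g: "g \<in> tl_hom x y" and h: "h \<in> tl_hom y z"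
  shows "tl_comp d w y z h (tl_comp d w x y g f) = tl_comp d w x z (tl_comp d x y z h g) f"
proof -
  let ?A = "\<lambda>P N M. Poly_Mapping.single (stack_matching w z P (stack_matching w y N M))
      (d ^ (stack_loops x N M + stack_loops y P (stack_matching w y N M)))"
  let ?B = "\<lambda>P N M. Poly_Mapping.single (stack_matching w z (stack_matching x z P N) M)
      (d ^ (stack_loops y P N + stack_loops x (stack_matching x z P N) M))"
  have "tl_comp d w y z h (tl_comp d w x y g f) = lin (\<lambda>P. lin (\<lambda>N. lin (\<lambda>M. ?A P N M) f) g) h"
    by (simp add: tl_comp_def lin_lin scale_basis power_add)
  also have "\<dots> = lin (\<lambda>P. lin (\<lambda>N. lin (\<lambda>M. ?B P N M) f) g) h"
  proof (rule lin_eqI[OF h], rule lin_eqI[OF g], rule lin_eqI[OF f])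
    fix P N M assume "P \<in> planar_matchings y z" "N \<in> planar_matchings x y" "M \<in> planar_matchings w x"
    then have "\<Union>M \<subseteq> points w x" "\<Union>N \<subseteq> points x y" "\<Union>P \<subseteq> points y z" by (simp_all add: Union_planar)
    from stack_matching_assoc[OF this] show "?A P N M = ?B P N M" by (simp only:)
  qed
  also have "\<dots> = tl_comp d w x z (tl_comp d x y z h g) f"
    by (simp add: tl_comp_def lin_lin lin_scale lin_fun_scale[symmetric] scale_basis power_add)
  finally show ?thesis .
qed

lemma tl_tensor_add_left: "tl_tensor x y (f + g) f' = tl_tensor x y f f' + tl_tensor x y g f'"
  by (simp add: tl_tensor_def lin_add)

lemma tl_tensor_add_right: "tl_tensor x y f (f' + g') = tl_tensor x y f f' + tl_tensor x y f g'"
  by (simp add: tl_tensor_def lin_add lin_fun_add)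

lemma tl_tensor_scale_left: "tl_tensor x y (scale c f) f' = scale c (tl_tensor x y f f')"
  by (simp add: tl_tensor_def lin_scale)

lemma tl_tensor_scale_right: "tl_tensor x y f (scale c f') = scale c (tl_tensor x y f f')"
  by (simp add: tl_tensor_def lin_scale lin_fun_scale)

lemma tl_tensor_diff_left: "tl_tensor x y (f - g) f' = tl_tensor x y f f' - tl_tensor x y g f'"
  by (simp add: tl_tensor_def lin_diff)

lemma tl_tensor_diff_right: "tl_tensor x y f (f' - g') = tl_tensor x y f f' - tl_tensor x y f g'"
  using tl_tensor_add_right[of x y f "f' - g'" g'] by (simp add: algebra_simps)

lemma tl_tensor_0 [simp]: "tl_tensor x y 0 f' = 0" "tl_tensor x y f 0 = 0"
  by (simp_all add: tl_tensor_def)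

lemma tl_tensor_basis [simp]: "tl_tensor x y (basis M) (basis M') = basis (tensor_matching x y M M')"
  by (simp add: tl_tensor_def)

lemma tl_tensor_closed:
  "f \<in> tl_hom x y \<Longrightarrow> f' \<in> tl_hom x' y' \<Longrightarrow> tl_tensor x y f f' \<in> tl_hom (x + x') (y + y')"
  unfolding tl_tensor_def by (intro supported_lin supported_single tensor_matching_planar)

lemma tl_tensor_id: "tl_tensor m m (tl_id m) (tl_id k) = tl_id (m + k)"
  by (simp add: tensor_id_matching)

lemma tl_tensor_unit_left [simp]: "tl_tensor 0 0 (tl_id 0) f = f"
  by (simp add: tl_tensor_def)

lemma tl_tensor_unit_right [simp]: "tl_tensor x y f (tl_id 0) = f"
  by (simp add: tl_tensor_def)

lemma tl_tensor_assoc: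
  "tl_tensor (x + x') (y + y') (tl_tensor x y f f') f'' = tl_tensor x y f (tl_tensor x' y' f' f'')"
  by (simp add: tl_tensor_def lin_lin tensor_matching_assoc)

lemma tl_interchange:
  assumes f: "f \<in> tl_hom x y" and f': "f' \<in> tl_hom x' y'" and g: "g \<in> tl_hom y z" and g': "g' \<in> tl_hom y' z'"
  shows "tl_comp d (x + x') (y + y') (z + z') (tl_tensor y z g g') (tl_tensor x y f f')
    = tl_tensor x z (tl_comp d x y z g f) (tl_comp d x' y' z' g' f')"
proof -
  let ?A = "\<lambda>N N' M M'. Poly_Mapping.single
      (stack_matching (x + x') (z + z') (tensor_matching y z N N') (tensor_matching x y M M'))
      (d ^ stack_loops (y + y') (tensor_matching y z N N') (tensor_matching x y M M'))"
  let ?B = "\<lambda>N N' M M'. Poly_Mapping.single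
      (tensor_matching x z (stack_matching x z N M) (stack_matching x' z' N' M'))
      (d ^ stack_loops y N M * d ^ stack_loops y' N' M')"
  have "tl_comp d (x + x') (y + y') (z + z') (tl_tensor y z g g') (tl_tensor x y f f')
     = lin (\<lambda>N. lin (\<lambda>N'. lin (\<lambda>M. lin (\<lambda>M'. ?A N N' M M') f') f) g') g"
    by (simp add: tl_comp_def tl_tensor_def lin_lin)
  also have "\<dots> = lin (\<lambda>N. lin (\<lambda>N'. lin (\<lambda>M. lin (\<lambda>M'. ?B N N' M M') f') f) g') g"
    by (rule lin_eqI[OF g], rule lin_eqI[OF g'], rule lin_eqI[OF f], rule lin_eqI[OF f'])
      (simp add: stack_matching_tensor power_add)
  also have "\<dots> = lin (\<lambda>N. lin (\<lambda>M. lin (\<lambda>N'. lin (\<lambda>M'. ?B N N' M M') f') g') f) g"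
    by (subst lin_swap) (rule refl)
  also have "\<dots> = tl_tensor x z (tl_comp d x y z g f) (tl_comp d x' y' z' g' f')"
    by (simp add: tl_comp_def tl_tensor_def lin_lin lin_scale lin_fun_scale[symmetric] scale_basis mult.commute)
  finally show ?thesis .
qed

lemma tl_trace_add: "tl_trace d x (f + g) = tl_trace d x f + tl_trace d x g"
  by (simp add: tl_trace_def lin_add lookup_add)

lemma tl_trace_scale: "tl_trace d x (scale c f) = c * tl_trace d x f"
  by (simp add: tl_trace_def lin_scale)

lemma tl_trace_diff: "tl_trace d x (f - g) = tl_trace d x f - tl_trace d x g"
  by (simp add: tl_trace_def lin_diff lookup_minus)

lemma tl_trace_0 [simp]: "tl_trace d x 0 = 0"
  by (simp add: tl_trace_def)

lemma tl_trace_sum: "tl_trace d x (\<Sum>i \<in> I. f i) = (\<Sum>i \<in> I. tl_trace d x (f i))"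
  by (induct I rule: infinite_finite_induct) (simp_all add: tl_trace_add)

lemma tl_trace_comp:
  "tl_trace d x (tl_comp d x y x g f) = Poly_Mapping.lookup
    (lin (\<lambda>N. lin (\<lambda>M. Poly_Mapping.single ()
      (d ^ (stack_loops y N M + closure_loops x (stack_matching x x N M)))) f) g) ()"
  by (simp add: tl_trace_def tl_comp_def lin_lin scale_basis power_add)

lemma tl_trace_pairing:
  assumes f: "f \<in> tl_hom x y" and g: "g \<in> tl_hom y x"
  shows "tl_trace d x (tl_comp d x y x g f) = Poly_Mapping.lookup
    (lin (\<lambda>N. lin (\<lambda>M. Poly_Mapping.single () (d ^ loops (M \<union> emap flip N) (points x y))) f) g) ()"
  unfolding tl_trace_comp
  by (rule arg_cong[where f = "\<lambda>p. Poly_Mapping.lookup p ()"], rule lin_eqI[OF g], rule lin_eqI[OF f])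
    (simp add: closure_loops_stack)

lemma tl_trace_cyclic:
  assumes f: "f \<in> tl_hom x y" and g: "g \<in> tl_hom y x"
  shows "tl_trace d x (tl_comp d x y x g f) = tl_trace d y (tl_comp d y x y f g)"
proof -
  have "lin (\<lambda>N. lin (\<lambda>M. Poly_Mapping.single () (d ^ (stack_loops y N M + closure_loops x (stack_matching x x N M)))) f) g
    = lin (\<lambda>N. lin (\<lambda>M. Poly_Mapping.single () (d ^ (stack_loops x M N + closure_loops y (stack_matching y y M N)))) f) g"
    by (rule lin_eqI[OF g], rule lin_eqI[OF f]) (simp add: closure_loops_cyclic)
  then show ?thesis unfolding tl_trace_comp by (subst (2) lin_swap) simp
qed

lemma tl_trace_tensor_id:
  assumes "f \<in> tl_hom x x" shows "tl_trace d (x + 1) (tl_tensor x x f (tl_id 1)) = d * tl_trace d x f"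
proof -
  have "lin (\<lambda>M. Poly_Mapping.single () (d ^ closure_loops (x + 1) (tensor_matching x x M (id_matching 1)))) f
    = lin (\<lambda>M. scale d (Poly_Mapping.single () (d ^ closure_loops x M))) f"
    by (rule lin_eqI[OF assms]) (simp only: closure_loops_tensor_id scale_basis power_Suc)
  also have "\<dots> = scale d (lin (\<lambda>M. Poly_Mapping.single () (d ^ closure_loops x M)) f)"
    by (rule lin_fun_scale)
  finally show ?thesis by (simp add: tl_trace_def tl_tensor_def lin_lin)
qed

section \<open>Negligible combinations\<close>

definition tl_negligible :: "complex \<Rightarrow> nat \<Rightarrow> nat \<Rightarrow> tl set" where
  "tl_negligible d x y = {f \<in> tl_hom x y. \<forall>g \<in> tl_hom y x. tl_trace d x (tl_comp d x y x g f) = 0}"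

lemma tl_negligible_hom: "f \<in> tl_negligible d x y \<Longrightarrow> f \<in> tl_hom x y"
  by (simp add: tl_negligible_def)

lemma tl_negligible_0 [simp]: "0 \<in> tl_negligible d x y"
  by (simp add: tl_negligible_def)

lemma tl_negligible_add: "f \<in> tl_negligible d x y \<Longrightarrow> g \<in> tl_negligible d x y \<Longrightarrow> f + g \<in> tl_negligible d x y"
  by (simp add: tl_negligible_def supported_add tl_comp_add_right tl_trace_add)

lemma tl_negligible_scale: "f \<in> tl_negligible d x y \<Longrightarrow> scale c f \<in> tl_negligible d x y"
  by (simp add: tl_negligible_def supported_scale tl_comp_scale_right tl_trace_scale)

lemma tl_negligible_comp_left:
  assumes f: "f \<in> tl_negligible d x y" and h: "h \<in> tl_hom y z"
  shows "tl_comp d x y z h f \<in> tl_negligible d x z"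
  unfolding tl_negligible_def
proof (intro CollectI conjI ballI)
  note fh = tl_negligible_hom[OF f]
  show "tl_comp d x y z h f \<in> tl_hom x z" by (rule tl_comp_closed[OF fh h])
  fix g assume g: "g \<in> tl_hom z x"
  then show "tl_trace d x (tl_comp d x z x g (tl_comp d x y z h f)) = 0"
    using f tl_comp_closed[OF h g] by (simp add: tl_comp_assoc[OF fh h g] tl_negligible_def)
qed

text \<open>The trace is cyclic, so a factor on the right may be moved to the left.\<close>

lemma tl_negligible_comp_right:
  assumes f: "f \<in> tl_negligible d x y" and h: "h \<in> tl_hom w x"
  shows "tl_comp d w x y f h \<in> tl_negligible d w y"
  unfolding tl_negligible_def
proof (intro CollectI conjI ballI)
  note fh = tl_negligible_hom[OF f]
  show "tl_comp d w x y f h \<in> tl_hom w y" by (rule tl_comp_closed[OF h fh])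
  fix g assume g: "g \<in> tl_hom y w"
  have "tl_trace d w (tl_comp d w y w g (tl_comp d w x y f h)) = tl_trace d w (tl_comp d w x w (tl_comp d x y w g f) h)"
    by (simp add: tl_comp_assoc[OF h fh g])
  also have "\<dots> = tl_trace d x (tl_comp d x w x h (tl_comp d x y w g f))"
    by (rule tl_trace_cyclic[OF h tl_comp_closed[OF fh g]])
  also have "\<dots> = 0" using f tl_comp_closed[OF g h] by (simp add: tl_comp_assoc[OF fh g h] tl_negligible_def)
  finally show "tl_trace d w (tl_comp d w y w g (tl_comp d w x y f h)) = 0" .
qed

lemma tl_negligible_basisI:
  assumes f: "f \<in> tl_hom x y"
    and tr: "\<And>N. N \<in> planar_matchings y x \<Longrightarrow> tl_trace d x (tl_comp d x y x (basis N) f) = 0"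
  shows "f \<in> tl_negligible d x y"
  unfolding tl_negligible_def
proof (intro CollectI conjI ballI f)
  fix g assume g: "g \<in> tl_hom y x"
  have "g = (\<Sum>N \<in> Poly_Mapping.keys g. scale (Poly_Mapping.lookup g N) (basis N))"
    using lin_basis[of g, symmetric] unfolding lin_def .
  then have "tl_trace d x (tl_comp d x y x g f) = tl_trace d x (tl_comp d x y x
      (\<Sum>N \<in> Poly_Mapping.keys g. scale (Poly_Mapping.lookup g N) (basis N)) f)" by (simp only:)
  also have "\<dots> = (\<Sum>N \<in> Poly_Mapping.keys g. Poly_Mapping.lookup g N * tl_trace d x (tl_comp d x y x (basis N) f))"
    by (simp only: tl_comp_sum_left tl_comp_scale_left tl_trace_sum tl_trace_scale)
  also have "\<dots> = 0" using g tr by (intro sum.neutral) (auto simp: supported_def)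
  finally show "tl_trace d x (tl_comp d x y x g f) = 0" .
qed

text \<open>
  Pairing \<open>f \<otimes> g\<close> with a diagram amounts to pairing \<open>f\<close> with the diagram obtained by a partial
  trace over \<open>g\<close>, which is why the negligible combinations form a tensor ideal.
\<close>

lemma tl_negligible_tensor_basis:
  assumes f: "f \<in> tl_negligible d x y" and M': "M' \<in> planar_matchings x' y'"
  shows "tl_tensor x y f (basis M') \<in> tl_negligible d (x + x') (y + y')"
    and "tl_tensor x' y' (basis M') f \<in> tl_negligible d (x' + x) (y' + y)"
proof -
  have fh: "f \<in> tl_hom x y" by (rule tl_negligible_hom[OF f])
  have zero: "Poly_Mapping.lookup (lin (\<lambda>M. Poly_Mapping.single () (d ^ (n + loops (M \<union> K) (points x y)))) f) () = 0"
    if K: "K \<in> planar_matchings x y" for K n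
  proof -
    have "basis (emap flip K) \<in> tl_hom y x" by (rule supported_single[OF flip_planar[OF K]])
    then have "0 = tl_trace d x (tl_comp d x y x (basis (emap flip K)) f)" using f by (simp add: tl_negligible_def)
    also have "\<dots> = Poly_Mapping.lookup (lin (\<lambda>M. Poly_Mapping.single () (d ^ loops (M \<union> K) (points x y))) f) ()"
      using tl_trace_pairing[OF fh supported_single[OF flip_planar[OF K]], of d 1] by simp
    finally have "Poly_Mapping.lookup (scale (d ^ n)
        (lin (\<lambda>M. Poly_Mapping.single () (d ^ loops (M \<union> K) (points x y))) f)) () = 0" by simp
    then show ?thesis by (simp only: lin_fun_scale[symmetric] scale_basis power_add)
  qed
  show "tl_tensor x y f (basis M') \<in> tl_negligible d (x + x') (y + y')"
  proof (rule tl_negligible_basisI)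
    show t: "tl_tensor x y f (basis M') \<in> tl_hom (x + x') (y + y')"
      by (rule tl_tensor_closed[OF fh supported_single[OF M']])
    fix N assume N: "N \<in> planar_matchings (y + y') (x + x')"
    obtain K n where K: "K \<in> planar_matchings x y"
      "\<And>M. M \<in> planar_matchings x y \<Longrightarrow> loops (tensor_matching x y M M' \<union> emap flip N) (points (x + x') (y + y'))
        = n + loops (M \<union> K) (points x y)"
      using partial_closure_right[OF M' flip_planar[OF N]] by metis
    have "tl_trace d (x + x') (tl_comp d (x + x') (y + y') (x + x') (basis N) (tl_tensor x y f (basis M')))
      = Poly_Mapping.lookup (lin (\<lambda>M. Poly_Mapping.single ()
          (d ^ loops (tensor_matching x y M M' \<union> emap flip N) (points (x + x') (y + y')))) f) ()"
      using tl_trace_pairing[OF t supported_single[OF N], of d 1] by (simp add: tl_tensor_def lin_lin)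
    also have "lin (\<lambda>M. Poly_Mapping.single ()
          (d ^ loops (tensor_matching x y M M' \<union> emap flip N) (points (x + x') (y + y')))) f
       = lin (\<lambda>M. Poly_Mapping.single () (d ^ (n + loops (M \<union> K) (points x y)))) f"
      by (rule lin_eqI[OF fh]) (simp only: K(2))
    finally show "tl_trace d (x + x') (tl_comp d (x + x') (y + y') (x + x') (basis N) (tl_tensor x y f (basis M'))) = 0"
      using zero[OF K(1)] by simp
  qed
  show "tl_tensor x' y' (basis M') f \<in> tl_negligible d (x' + x) (y' + y)"
  proof (rule tl_negligible_basisI)
    show t: "tl_tensor x' y' (basis M') f \<in> tl_hom (x' + x) (y' + y)"
      by (rule tl_tensor_closed[OF supported_single[OF M'] fh])
    fix N assume N: "N \<in> planar_matchings (y' + y) (x' + x)"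
    obtain K n where K: "K \<in> planar_matchings x y"
      "\<And>M. M \<in> planar_matchings x y \<Longrightarrow> loops (tensor_matching x' y' M' M \<union> emap flip N) (points (x' + x) (y' + y))
        = n + loops (M \<union> K) (points x y)"
      using partial_closure_left[OF M' flip_planar[OF N]] by metis
    have "tl_trace d (x' + x) (tl_comp d (x' + x) (y' + y) (x' + x) (basis N) (tl_tensor x' y' (basis M') f))
      = Poly_Mapping.lookup (lin (\<lambda>M. Poly_Mapping.single ()
          (d ^ loops (tensor_matching x' y' M' M \<union> emap flip N) (points (x' + x) (y' + y)))) f) ()"
      using tl_trace_pairing[OF t supported_single[OF N], of d 1] by (simp add: tl_tensor_def lin_lin)
    also have "lin (\<lambda>M. Poly_Mapping.single ()
          (d ^ loops (tensor_matching x' y' M' M \<union> emap flip N) (points (x' + x) (y' + y)))) f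
       = lin (\<lambda>M. Poly_Mapping.single () (d ^ (n + loops (M \<union> K) (points x y)))) f"
      by (rule lin_eqI[OF fh]) (simp only: K(2))
    finally show "tl_trace d (x' + x) (tl_comp d (x' + x) (y' + y) (x' + x) (basis N) (tl_tensor x' y' (basis M') f)) = 0"
      using zero[OF K(1)] by simp
  qed
qed

lemma tl_negligible_sum: "(\<And>i. i \<in> I \<Longrightarrow> f i \<in> tl_negligible d x y) \<Longrightarrow> (\<Sum>i \<in> I. f i) \<in> tl_negligible d x y"
  by (induct I rule: infinite_finite_induct) (simp_all add: tl_negligible_add)

lemma tl_negligible_tensor:
  assumes f: "f \<in> tl_negligible d x y" and g: "g \<in> tl_hom x' y'"
  shows "tl_tensor x y f g \<in> tl_negligible d (x + x') (y + y')"
    and "tl_tensor x' y' g f \<in> tl_negligible d (x' + x) (y' + y)"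
proof -
  have "tl_tensor x y f g = lin (\<lambda>M'. tl_tensor x y f (basis M')) g"
    unfolding tl_tensor_def by (subst lin_swap) simp
  then show "tl_tensor x y f g \<in> tl_negligible d (x + x') (y + y')"
    using g tl_negligible_tensor_basis(1)[OF f] unfolding lin_def
    by (auto simp: supported_def intro!: tl_negligible_sum tl_negligible_scale)
  have "tl_tensor x' y' g f = lin (\<lambda>M'. tl_tensor x' y' (basis M') f) g"
    by (simp add: tl_tensor_def)
  then show "tl_tensor x' y' g f \<in> tl_negligible d (x' + x) (y' + y)"
    using g tl_negligible_tensor_basis(2)[OF f] unfolding lin_def
    by (auto simp: supported_def intro!: tl_negligible_sum tl_negligible_scale)
qed

section \<open>Jones-Wenzl idempotents\<close>

text \<open>The recursion for the Jones-Wenzl idempotents, in coordinates.\<close>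

fun tl_jw :: "complex \<Rightarrow> (nat \<Rightarrow> complex) \<Rightarrow> nat \<Rightarrow> tl" where
  "tl_jw d r 0 = tl_id 0"
| "tl_jw d r (Suc 0) = tl_id 1"
| "tl_jw d r (Suc (Suc k)) =
    (let m = k + 1;
         P = tl_tensor m m (tl_jw d r (Suc k)) (tl_id 1);
         U = basis (U_matching m);
         mul = tl_comp d (m + 1) (m + 1) (m + 1)
     in P - scale (r m / r (m + 1)) (mul P (mul U P)))"

text \<open>
  The sequence \<open>r\<close> stands for the quantum integers; only their recursion and the position of
  their first zero matter.
\<close>

locale quantum_numbers =
  fixes d :: complex and r :: "nat \<Rightarrow> complex" and n :: nat
  assumes n_gt_1: "n > 1" and r_0: "r 0 = 0" and r_1: "r 1 = 1"
    and r_step: "r (m + 2) = d * r (m + 1) - r m"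
    and r_nonzero: "1 \<le> m \<Longrightarrow> m < n \<Longrightarrow> r m \<noteq> 0" and r_n: "r n = 0"
begin

abbreviation cmp :: "nat \<Rightarrow> nat \<Rightarrow> nat \<Rightarrow> tl \<Rightarrow> tl \<Rightarrow> tl" where
  "cmp \<equiv> tl_comp d"

abbreviation p :: "nat \<Rightarrow> tl" where
  "p \<equiv> tl_jw d r"

definition pad :: "nat \<Rightarrow> tl" where
  "pad k = tl_tensor (k + 1) (k + 1) (p (k + 1)) (tl_id 1)"

definition cup :: "nat \<Rightarrow> tl" where
  "cup k = tl_tensor k k (tl_id k) (basis cup_matching)"

definition cap :: "nat \<Rightarrow> tl" where
  "cap k = tl_tensor k k (tl_id k) (basis cap_matching)"

definition turn :: "nat \<Rightarrow> tl" where
  "turn k = basis (U_matching (k + 1))"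

lemma p_0: "p 0 = tl_id 0" and p_1: "p 1 = tl_id 1"
  by simp_all

lemma p_step: "p (k + 2) = pad k - scale (r (k + 1) / r (k + 2))
    (cmp (k + 2) (k + 2) (k + 2) (pad k) (cmp (k + 2) (k + 2) (k + 2) (turn k) (pad k)))"
  by (simp add: pad_def turn_def Let_def)

lemma cup_hom: "cup k \<in> tl_hom k (k + 2)"
  using tl_tensor_closed[OF tl_id_closed[of k] supported_single[OF cup_planar, of 1]] by (simp add: cup_def)

lemma cap_hom: "cap k \<in> tl_hom (k + 2) k"
  using tl_tensor_closed[OF tl_id_closed[of k] supported_single[OF cap_planar, of 1]] by (simp add: cap_def)

lemma basis_comp: "cmp x y z (basis N) (basis M) = Poly_Mapping.single (stack_matching x z N M) (d ^ stack_loops y N M)"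
  by (simp add: tl_comp_def)

lemma cup_basis: "basis cup_matching \<in> tl_hom 0 2"
  and cap_basis: "basis cap_matching \<in> tl_hom 2 0"
  and U_basis: "basis (U_matching 1) \<in> tl_hom 2 2"
  by (rule supported_single, rule cup_planar cap_planar U_matching_1_planar)+

lemma turn_alt: "turn k = tl_tensor k k (tl_id k) (basis (U_matching 1))"
  unfolding turn_def using U_matching_alt[of "k + 1"] by simp

lemma turn_hom: "turn k \<in> tl_hom (k + 2) (k + 2)"
  unfolding turn_alt by (rule tl_tensor_closed[OF tl_id_closed U_basis])

lemma cup_after_cap: "cmp (k + 2) k (k + 2) (cup k) (cap k) = turn k"
proof -
  have "cmp (k + 2) (k + 0) (k + 2) (tl_tensor k k (tl_id k) (basis cup_matching)) (tl_tensor k k (tl_id k) (basis cap_matching))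
     = tl_tensor k k (cmp k k k (tl_id k) (tl_id k)) (cmp 2 0 2 (basis cup_matching) (basis cap_matching))"
    by (rule tl_interchange[OF tl_id_closed cap_basis tl_id_closed cup_basis])
  also have "\<dots> = turn k"
    by (simp only: tl_comp_id_left[OF tl_id_closed] basis_comp cup_cap power_0 turn_alt)
  finally show ?thesis by (simp only: cup_def cap_def add_0_right)
qed

lemma p_hom: "p m \<in> tl_hom m m"
proof -
  have "p m \<in> tl_hom m m \<and> p (m + 1) \<in> tl_hom (m + 1) (m + 1)"
  proof (induct m)
    case 0
    show ?case using tl_id_closed[of 0] tl_id_closed[of 1] by (simp only: p_0 p_1 add_0_left)
  next
    case (Suc m)
    have "pad m \<in> tl_hom (m + 1 + 1) (m + 1 + 1)"
      unfolding pad_def by (rule tl_tensor_closed[OF _ tl_id_closed]) (use Suc in simp)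
    then have "pad m \<in> tl_hom (m + 2) (m + 2)" by simp
    then have "p (m + 2) \<in> tl_hom (m + 2) (m + 2)"
      unfolding p_step by (intro supported_diff supported_scale tl_comp_closed turn_hom)
    then show ?case using Suc by simp
  qed
  then show ?thesis ..
qed

lemma pad_hom: "pad k \<in> tl_hom (k + 2) (k + 2)"
  using tl_tensor_closed[OF p_hom[of "k + 1"] tl_id_closed[of 1]] by (simp add: pad_def)

lemma comp_hom: "f \<in> tl_hom x y \<Longrightarrow> g \<in> tl_hom y z \<Longrightarrow> cmp x y z g f \<in> tl_hom x z"
  by (rule tl_comp_closed)

lemmas assoc = tl_comp_assoc[symmetric]

text \<open>By the interchange law, as \<open>f\<close> and the turn act on different strands.\<close>

lemma slide_cup:
  assumes f: "f \<in> tl_hom k k"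
  shows "cmp k (k + 2) (k + 2) (tl_tensor k k f (tl_id 2)) (cup k) = cmp k k (k + 2) (cup k) f"
proof -
  have "cmp (k + 0) (k + 2) (k + 2) (tl_tensor k k f (tl_id 2)) (tl_tensor k k (tl_id k) (basis cup_matching))
      = tl_tensor k k (cmp k k k f (tl_id k)) (cmp 0 2 2 (tl_id 2) (basis cup_matching))"
    by (rule tl_interchange[OF tl_id_closed cup_basis f tl_id_closed])
  moreover have "cmp (k + 0) (k + 0) (k + 2) (tl_tensor k k (tl_id k) (basis cup_matching)) (tl_tensor k k f (tl_id 0))
      = tl_tensor k k (cmp k k k (tl_id k) f) (cmp 0 0 2 (basis cup_matching) (tl_id 0))"
    by (rule tl_interchange[OF f tl_id_closed tl_id_closed cup_basis])
  ultimately show ?thesis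
    by (simp only: cup_def add_0_right tl_tensor_unit_right tl_comp_id_left[OF f] tl_comp_id_right[OF f]
      tl_comp_id_left[OF cup_basis] tl_comp_id_right[OF cup_basis])
qed

lemma slide_cap:
  assumes f: "f \<in> tl_hom k k"
  shows "cmp (k + 2) (k + 2) k (cap k) (tl_tensor k k f (tl_id 2)) = cmp (k + 2) k k f (cap k)"
proof -
  have "cmp (k + 2) (k + 2) (k + 0) (tl_tensor k k (tl_id k) (basis cap_matching)) (tl_tensor k k f (tl_id 2))
      = tl_tensor k k (cmp k k k (tl_id k) f) (cmp 2 2 0 (basis cap_matching) (tl_id 2))"
    by (rule tl_interchange[OF f tl_id_closed tl_id_closed cap_basis])
  moreover have "cmp (k + 2) (k + 0) (k + 0) (tl_tensor k k f (tl_id 0)) (tl_tensor k k (tl_id k) (basis cap_matching))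
      = tl_tensor k k (cmp k k k f (tl_id k)) (cmp 2 0 0 (tl_id 0) (basis cap_matching))"
    by (rule tl_interchange[OF tl_id_closed cap_basis f tl_id_closed])
  ultimately show ?thesis
    by (simp only: cap_def add_0_right tl_tensor_unit_right tl_comp_id_left[OF f] tl_comp_id_right[OF f]
      tl_comp_id_left[OF cap_basis] tl_comp_id_right[OF cap_basis])
qed

text \<open>Sliding \<open>f\<close> away leaves a cap on a cup, which is a closed loop.\<close>

lemma cap_cup_bubble:
  assumes f: "f \<in> tl_hom k k"
  shows "cmp k (k + 2) k (cap k) (cmp k (k + 2) (k + 2) (tl_tensor k k f (tl_id 2)) (cup k)) = scale d f"
proof -
  have "cmp (k + 0) (k + 2) (k + 0) (tl_tensor k k (tl_id k) (basis cap_matching)) (tl_tensor k k (tl_id k) (basis cup_matching))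
      = tl_tensor k k (cmp k k k (tl_id k) (tl_id k)) (cmp 0 2 0 (basis cap_matching) (basis cup_matching))"
    by (rule tl_interchange[OF tl_id_closed cup_basis tl_id_closed cap_basis])
  also have "cmp 0 2 0 (basis cap_matching) (basis cup_matching) = scale d (tl_id 0)"
    by (simp add: basis_comp cap_cup scale_basis)
  finally have bubble: "cmp k (k + 2) k (cap k) (cup k) = scale d (tl_id k)"
    by (simp only: cap_def cup_def add_0_right tl_comp_id_left[OF tl_id_closed] tl_tensor_scale_right tl_tensor_unit_right)
  have "cmp k (k + 2) k (cap k) (cmp k k (k + 2) (cup k) f) = cmp k k k (cmp k (k + 2) k (cap k) (cup k)) f"
    by (rule tl_comp_assoc[OF f cup_hom cap_hom])
  then show ?thesis
    by (simp only: slide_cup[OF f] bubble tl_comp_scale_left tl_comp_id_left[OF f])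
qed

text \<open>
  The turn is a cup on a cap. Each of them forms a zigzag with the outer cap or cup, and can be pulled
  straight.
\<close>

lemma zigzag:
  "cmp (k + 1) (k + 3) (k + 1) (cap (k + 1))
    (cmp (k + 1) (k + 3) (k + 3) (tl_tensor (k + 2) (k + 2) (turn k) (tl_id 1)) (cup (k + 1))) = tl_id (k + 1)"
proof -
  let ?cu = "tl_tensor 1 1 (tl_id 1) (basis cup_matching)" and ?ca = "tl_tensor 1 1 (tl_id 1) (basis cap_matching)"
  let ?U = "tl_tensor 2 2 (basis (U_matching 1)) (tl_id 1)"
  let ?cu' = "tl_tensor 0 2 (basis cup_matching) (tl_id 1)" and ?ca' = "tl_tensor 2 0 (basis cap_matching) (tl_id 1)"
  have cu: "?cu \<in> tl_hom 1 3" using tl_tensor_closed[OF tl_id_closed[of 1] cup_basis] by (simp add: numeral_3_eq_3)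
  have ca: "?ca \<in> tl_hom 3 1" using tl_tensor_closed[OF tl_id_closed[of 1] cap_basis] by (simp add: numeral_3_eq_3)
  have cu': "?cu' \<in> tl_hom 1 3" using tl_tensor_closed[OF cup_basis tl_id_closed[of 1]] by simp
  have ca': "?ca' \<in> tl_hom 3 1" using tl_tensor_closed[OF cap_basis tl_id_closed[of 1]] by simp
  have "cmp (2 + 1) (0 + 1) (2 + 1) ?cu' ?ca' = tl_tensor 2 2 (cmp 2 0 2 (basis cup_matching) (basis cap_matching)) (cmp 1 1 1 (tl_id 1) (tl_id 1))"
    by (rule tl_interchange[OF cap_basis tl_id_closed cup_basis tl_id_closed])
  moreover have "(2::nat) + 1 = 3" "(0::nat) + 1 = 1" by simp_all
  ultimately have U: "?U = cmp 3 1 3 ?cu' ?ca'"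
    by (simp only: tl_comp_id_left[OF tl_id_closed] basis_comp cup_cap power_0)
  have Uh: "?U \<in> tl_hom 3 3" unfolding U by (rule comp_hom[OF ca' cu'])
  have z1: "cmp 1 3 1 ?ca' ?cu = tl_id 1" and z2: "cmp 1 3 1 ?ca ?cu' = tl_id 1"
    by (simp_all only: tl_tensor_basis basis_comp zigzag_left zigzag_right power_0)
  have "cmp 1 3 1 ?ca (cmp 1 3 3 ?U ?cu) = cmp 1 3 1 ?ca (cmp 1 1 3 ?cu' (cmp 1 3 1 ?ca' ?cu))"
    unfolding U by (simp only: assoc[OF cu ca' cu'])
  also have "\<dots> = tl_id 1"
    by (simp only: z1 tl_comp_id_right[OF cu'] z2)
  finally have core: "cmp 1 3 1 ?ca (cmp 1 3 3 ?U ?cu) = tl_id 1" .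
  have "tl_tensor (k + 2) (k + 2) (turn k) (tl_id 1) = tl_tensor k k (tl_id k) ?U"
    unfolding turn_alt by (rule tl_tensor_assoc)
  moreover have "cup (k + 1) = tl_tensor k k (tl_id k) ?cu" "cap (k + 1) = tl_tensor k k (tl_id k) ?ca"
    unfolding cup_def cap_def tl_tensor_id[symmetric, of k 1] by (rule tl_tensor_assoc)+
  moreover have "cmp (k + 1) (k + 3) (k + 3) (tl_tensor k k (tl_id k) ?U) (tl_tensor k k (tl_id k) ?cu)
      = tl_tensor k k (cmp k k k (tl_id k) (tl_id k)) (cmp 1 3 3 ?U ?cu)"
    by (rule tl_interchange[OF tl_id_closed cu tl_id_closed Uh])
  moreover have "cmp (k + 1) (k + 3) (k + 1) (tl_tensor k k (tl_id k) ?ca) (tl_tensor k k (tl_id k) (cmp 1 3 3 ?U ?cu))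
      = tl_tensor k k (cmp k k k (tl_id k) (tl_id k)) (cmp 1 3 1 ?ca (cmp 1 3 3 ?U ?cu))"
    by (rule tl_interchange[OF tl_id_closed comp_hom[OF cu Uh] tl_id_closed ca])
  ultimately show ?thesis
    by (simp only: tl_comp_id_left[OF tl_id_closed] core tl_tensor_id)
qed

text \<open>
  The invariant of the recursion. The parts depend on each other: the partial trace of \<open>p (k + 1)\<close>
  determines the coefficient in the recursion for which \<open>p (k + 2)\<close> annihilates the last hook, absorption of
  \<open>p (k + 1)\<close> reduces the other hooks to those of the previous stage, and the next partial trace is computed
  from idempotence.
\<close>

definition jw_good :: "nat \<Rightarrow> bool" where
  "jw_good k \<longleftrightarrow>
    cmp (k + 1) (k + 1) (k + 1) (p (k + 1)) (p (k + 1)) = p (k + 1) \<and>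
    cmp (k + 1) (k + 1) (k + 1) (p (k + 1)) (tl_tensor k k (p k) (tl_id 1)) = p (k + 1) \<and>
    cmp (k + 1) (k + 1) (k + 1) (tl_tensor k k (p k) (tl_id 1)) (p (k + 1)) = p (k + 1) \<and>
    cmp k (k + 2) k (cap k) (cmp k (k + 2) (k + 2) (pad k) (cup k)) = scale (r (k + 2) / r (k + 1)) (p k) \<and>
    (\<forall>i j. i + 2 + j = k + 1 \<longrightarrow>
      cmp (k + 1) (k + 1) (k + 1) (p (k + 1)) (basis (hook i j)) = 0 \<and>
      cmp (k + 1) (k + 1) (k + 1) (basis (hook i j)) (p (k + 1)) = 0)"

lemma r_2: "r 2 = d"
  using r_step[of 0] r_0 r_1 by (simp add: numeral_2_eq_2)

lemma jw_good_0: "jw_good 0"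
proof -
  have "pad 0 = tl_id 2" unfolding pad_def using tl_tensor_id[of 1 1] by (simp add: numeral_2_eq_2)
  moreover have "cup 0 = basis cup_matching" "cap 0 = basis cap_matching" by (simp_all add: cup_def cap_def)
  moreover have "cmp 0 2 0 (basis cap_matching) (cmp 0 2 2 (tl_id 2) (basis cup_matching)) = scale d (tl_id 0)"
    unfolding tl_comp_id_left[OF cup_basis] by (simp add: basis_comp cap_cup scale_basis)
  moreover have "cmp 1 1 1 (tl_id 1) (tl_id 1) = tl_id 1" by (rule tl_comp_id_left[OF tl_id_closed])
  ultimately show ?thesis unfolding jw_good_def using r_2 r_1 p_0 p_1 by (simp add: numeral_2_eq_2)
qed

text \<open>
  Facts about a stage that hold because the previous stage is good. The partial trace formula for \<open>p (k + 1)\<close> says that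
  \<open>pad k \<circ> turn k \<circ> pad k\<close> is, up to the factor used in the recursion, idempotent.
\<close>

context
  fixes k assumes good: "jw_good k" and nz1: "r (k + 1) \<noteq> 0" and nz2: "r (k + 2) \<noteq> 0"
begin

lemma pad_idem: "cmp (k + 2) (k + 2) (k + 2) (pad k) (pad k) = pad k"
proof -
  have "cmp (k + 1 + 1) (k + 1 + 1) (k + 1 + 1) (pad k) (pad k) = pad k"
    unfolding pad_def tl_interchange[OF p_hom tl_id_closed p_hom tl_id_closed]
    using good tl_comp_id_left[OF tl_id_closed[of 1]] by (simp only: jw_good_def)
  then show ?thesis by simp
qed

lemma inner_pad: "cmp (k + 2) (k + 2) (k + 2) (tl_tensor k k (p k) (tl_id 2)) (pad k) = pad k"
    "cmp (k + 2) (k + 2) (k + 2) (pad k) (tl_tensor k k (p k) (tl_id 2)) = pad k"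
proof -
  have t: "tl_tensor k k (p k) (tl_id 1) \<in> tl_hom (k + 1) (k + 1)" by (rule tl_tensor_closed[OF p_hom tl_id_closed])
  have e: "tl_tensor k k (p k) (tl_id 2) = tl_tensor (k + 1) (k + 1) (tl_tensor k k (p k) (tl_id 1)) (tl_id 1)"
    using tl_tensor_assoc[of k 1 k 1 "p k" "tl_id 1" "tl_id 1"] tl_tensor_id[of 1 1] by (simp add: numeral_2_eq_2)
  have "cmp (k + 1 + 1) (k + 1 + 1) (k + 1 + 1) (tl_tensor k k (p k) (tl_id 2)) (pad k) = pad k"
    unfolding pad_def e tl_interchange[OF p_hom tl_id_closed t tl_id_closed]
    using good tl_comp_id_left[OF tl_id_closed[of 1]] by (simp only: jw_good_def)
  then show "cmp (k + 2) (k + 2) (k + 2) (tl_tensor k k (p k) (tl_id 2)) (pad k) = pad k" by simp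
  have "cmp (k + 1 + 1) (k + 1 + 1) (k + 1 + 1) (pad k) (tl_tensor k k (p k) (tl_id 2)) = pad k"
    unfolding pad_def e tl_interchange[OF t tl_id_closed p_hom tl_id_closed]
    using good tl_comp_id_left[OF tl_id_closed[of 1]] by (simp only: jw_good_def)
  then show "cmp (k + 2) (k + 2) (k + 2) (pad k) (tl_tensor k k (p k) (tl_id 2)) = pad k" by simp
qed

lemma inner_hom: "tl_tensor k k (p k) (tl_id 2) \<in> tl_hom (k + 2) (k + 2)"
  by (rule tl_tensor_closed[OF p_hom tl_id_closed])

lemma pad_cup: "cmp k (k + 2) (k + 2) (pad k) (cup k) = cmp k k (k + 2) (cmp k (k + 2) (k + 2) (pad k) (cup k)) (p k)"
proof -
  have "cmp k (k + 2) (k + 2) (pad k) (cup k)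
    = cmp k (k + 2) (k + 2) (cmp (k + 2) (k + 2) (k + 2) (pad k) (tl_tensor k k (p k) (tl_id 2))) (cup k)"
    by (simp only: inner_pad)
  also have "\<dots> = cmp k (k + 2) (k + 2) (pad k) (cmp k k (k + 2) (cup k) (p k))"
    by (simp only: assoc[OF cup_hom inner_hom pad_hom] slide_cup[OF p_hom])
  also have "\<dots> = cmp k k (k + 2) (cmp k (k + 2) (k + 2) (pad k) (cup k)) (p k)"
    by (rule tl_comp_assoc[OF p_hom cup_hom pad_hom])
  finally show ?thesis .
qed

lemma cap_pad: "cmp (k + 2) (k + 2) k (cap k) (pad k) = cmp (k + 2) k k (p k) (cmp (k + 2) (k + 2) k (cap k) (pad k))"
proof -
  have "cmp (k + 2) (k + 2) k (cap k) (pad k)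
    = cmp (k + 2) (k + 2) k (cap k) (cmp (k + 2) (k + 2) (k + 2) (tl_tensor k k (p k) (tl_id 2)) (pad k))"
    by (simp only: inner_pad)
  also have "\<dots> = cmp (k + 2) (k + 2) k (cmp (k + 2) k k (p k) (cap k)) (pad k)"
    by (simp only: tl_comp_assoc[OF pad_hom inner_hom cap_hom] slide_cap[OF p_hom])
  also have "\<dots> = cmp (k + 2) k k (p k) (cmp (k + 2) (k + 2) k (cap k) (pad k))"
    by (rule assoc[OF pad_hom cap_hom p_hom])
  finally show ?thesis .
qed

text \<open>The correction term of the recursion factors through \<open>k\<close> strands.\<close>

lemma pad_turn_pad: "cmp (k + 2) (k + 2) (k + 2) (pad k) (cmp (k + 2) (k + 2) (k + 2) (turn k) (pad k))
    = cmp (k + 2) k (k + 2) (cmp k (k + 2) (k + 2) (pad k) (cup k)) (cmp (k + 2) (k + 2) k (cap k) (pad k))"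
proof -
  have "cmp (k + 2) (k + 2) (k + 2) (turn k) (pad k) = cmp (k + 2) k (k + 2) (cup k) (cmp (k + 2) (k + 2) k (cap k) (pad k))"
    unfolding cup_after_cap[symmetric] by (rule assoc[OF pad_hom cap_hom cup_hom])
  then show ?thesis by (simp only: tl_comp_assoc[OF comp_hom[OF pad_hom cap_hom] cup_hom pad_hom])
qed

lemma partial_trace: "cmp k (k + 2) k (cap k) (cmp k (k + 2) (k + 2) (pad k) (cup k)) = scale (r (k + 2) / r (k + 1)) (p k)"
  using good by (simp only: jw_good_def)

text \<open>
  On the correction term the turn takes its value on the first term, up to the factor of the partial trace;
  this factor is inverse to the coefficient of the correction term.
\<close>

lemma turn_p: "cmp (k + 2) (k + 2) (k + 2) (turn k) (p (k + 2)) = 0"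
proof -
  let ?a = "cmp k (k + 2) (k + 2) (pad k) (cup k)" and ?b = "cmp (k + 2) (k + 2) k (cap k) (pad k)"
  have a: "?a \<in> tl_hom k (k + 2)" and b: "?b \<in> tl_hom (k + 2) k"
    by (rule comp_hom[OF cup_hom pad_hom] comp_hom[OF pad_hom cap_hom])+
  have 1: "cmp (k + 2) (k + 2) k (cap k) (cmp (k + 2) k (k + 2) ?a ?b) = scale (r (k + 2) / r (k + 1)) ?b"
    by (simp only: tl_comp_assoc[OF b a cap_hom] partial_trace tl_comp_scale_left cap_pad[symmetric])
  have 2: "r (k + 1) / r (k + 2) * (r (k + 2) / r (k + 1)) = 1" using nz1 nz2 by simp
  have "cmp (k + 2) (k + 2) k (cap k) (p (k + 2)) = 0"
    unfolding p_step pad_turn_pad tl_comp_diff_right tl_comp_scale_right 1 scale.scale_scale 2 by simp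
  then show ?thesis
    unfolding cup_after_cap[symmetric] assoc[OF p_hom cap_hom cup_hom] by simp
qed

lemma p_turn: "cmp (k + 2) (k + 2) (k + 2) (p (k + 2)) (turn k) = 0"
proof -
  let ?a = "cmp k (k + 2) (k + 2) (pad k) (cup k)" and ?b = "cmp (k + 2) (k + 2) k (cap k) (pad k)"
  have a: "?a \<in> tl_hom k (k + 2)" and b: "?b \<in> tl_hom (k + 2) k"
    by (rule comp_hom[OF cup_hom pad_hom] comp_hom[OF pad_hom cap_hom])+
  have "cmp k (k + 2) k ?b (cup k) = scale (r (k + 2) / r (k + 1)) (p k)"
    by (simp only: assoc[OF cup_hom pad_hom cap_hom] partial_trace)
  then have 1: "cmp k (k + 2) (k + 2) (cmp (k + 2) k (k + 2) ?a ?b) (cup k) = scale (r (k + 2) / r (k + 1)) ?a"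
    by (simp only: assoc[OF cup_hom b a] tl_comp_scale_right pad_cup[symmetric])
  have 2: "r (k + 1) / r (k + 2) * (r (k + 2) / r (k + 1)) = 1" using nz1 nz2 by simp
  have "cmp k (k + 2) (k + 2) (p (k + 2)) (cup k) = 0"
    unfolding p_step pad_turn_pad tl_comp_diff_left tl_comp_scale_left 1 scale.scale_scale 2 by simp
  then show ?thesis
    unfolding cup_after_cap[symmetric] tl_comp_assoc[OF cap_hom cup_hom p_hom] by simp
qed

lemma pad_p: "cmp (k + 2) (k + 2) (k + 2) (pad k) (p (k + 2)) = p (k + 2)"
proof -
  have "cmp (k + 2) (k + 2) (k + 2) (pad k) (cmp (k + 2) (k + 2) (k + 2) (pad k) (cmp (k + 2) (k + 2) (k + 2) (turn k) (pad k)))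
    = cmp (k + 2) (k + 2) (k + 2) (pad k) (cmp (k + 2) (k + 2) (k + 2) (turn k) (pad k))"
    by (simp only: tl_comp_assoc[OF comp_hom[OF pad_hom turn_hom] pad_hom pad_hom] pad_idem)
  then show ?thesis unfolding p_step tl_comp_diff_right tl_comp_scale_right pad_idem by (simp only:)
qed

lemma p_pad: "cmp (k + 2) (k + 2) (k + 2) (p (k + 2)) (pad k) = p (k + 2)"
proof -
  have "cmp (k + 2) (k + 2) (k + 2) (cmp (k + 2) (k + 2) (k + 2) (pad k) (cmp (k + 2) (k + 2) (k + 2) (turn k) (pad k))) (pad k)
    = cmp (k + 2) (k + 2) (k + 2) (pad k) (cmp (k + 2) (k + 2) (k + 2) (turn k) (pad k))"
    by (simp only: assoc[OF pad_hom comp_hom[OF pad_hom turn_hom] pad_hom] assoc[OF pad_hom pad_hom turn_hom] pad_idem)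
  then show ?thesis unfolding p_step tl_comp_diff_left tl_comp_scale_left pad_idem by (simp only:)
qed

lemma p_idem_step: "cmp (k + 2) (k + 2) (k + 2) (p (k + 2)) (p (k + 2)) = p (k + 2)"
proof -
  have "cmp (k + 2) (k + 2) (k + 2) (p (k + 2)) (cmp (k + 2) (k + 2) (k + 2) (pad k) (cmp (k + 2) (k + 2) (k + 2) (turn k) (pad k)))
     = cmp (k + 2) (k + 2) (k + 2) (cmp (k + 2) (k + 2) (k + 2) (p (k + 2)) (turn k)) (pad k)"
    by (simp only: tl_comp_assoc[OF comp_hom[OF pad_hom turn_hom] pad_hom p_hom] p_pad tl_comp_assoc[OF pad_hom turn_hom p_hom])
  then have "cmp (k + 2) (k + 2) (k + 2) (p (k + 2)) (cmp (k + 2) (k + 2) (k + 2) (pad k) (cmp (k + 2) (k + 2) (k + 2) (turn k) (pad k))) = 0"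
    by (simp only: p_turn tl_comp_0)
  then show ?thesis
    by (subst (2) p_step) (simp only: tl_comp_diff_right tl_comp_scale_right p_pad scale.scale_zero_right diff_zero)
qed

lemma hook_split: "i + 2 + Suc j = k + 2 \<Longrightarrow> basis (hook i (Suc j)) = tl_tensor (k + 1) (k + 1) (basis (hook i j)) (tl_id 1)"
proof -
  assume ij: "i + 2 + Suc j = k + 2"
  have "id_matching (Suc j) = tensor_matching j j (id_matching j) (id_matching 1)"
    using tensor_id_matching[of j 1] by simp
  then have "hook i (Suc j) = tensor_matching (i + 2 + j) (i + 2 + j) (hook i j) (id_matching 1)"
    unfolding hook_def
    using tensor_matching_assoc[of "i + 2" j "i + 2" j _ "id_matching j" "id_matching 1"] by (simp only:)
  moreover have "i + 2 + j = k + 1" using ij by simp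
  ultimately show ?thesis by (simp only: tl_tensor_basis)
qed

text \<open>Only the last hook is new: the others act on the first \<open>k + 1\<close> strands.\<close>

lemma hook_p_step:
  assumes ij: "i + 2 + j = k + 2"
  shows "cmp (k + 2) (k + 2) (k + 2) (p (k + 2)) (basis (hook i j)) = 0"
    and "cmp (k + 2) (k + 2) (k + 2) (basis (hook i j)) (p (k + 2)) = 0"
proof -
  have "cmp (k + 2) (k + 2) (k + 2) (p (k + 2)) (basis (hook i j)) = 0 \<and>
    cmp (k + 2) (k + 2) (k + 2) (basis (hook i j)) (p (k + 2)) = 0"
  proof (cases j)
    case 0
    then have "i = k" using ij by simp
    have "hook k 0 = U_matching (k + 1)" using U_matching_alt[of "k + 1"] by (simp add: hook_def)
    then have "basis (hook i j) = turn k" using 0 \<open>i = k\<close> by (simp add: turn_def)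
    then show ?thesis using p_turn turn_p by simp
  next
    case (Suc j')
    then have ij': "i + 2 + j' = k + 1" "i + 2 + Suc j' = k + 2" using ij by simp_all
    have h: "basis (hook i j') \<in> tl_hom (k + 1) (k + 1)" using hook_planar[of i j'] ij'(1) by (simp add: supported_single)
    have H: "basis (hook i j) = tl_tensor (k + 1) (k + 1) (basis (hook i j')) (tl_id 1)"
      unfolding Suc by (rule hook_split[OF ij'(2)])
    have Hh: "basis (hook i j) \<in> tl_hom (k + 2) (k + 2)" using hook_planar[of i j] ij by (simp add: supported_single)
    have z: "cmp (k + 1) (k + 1) (k + 1) (p (k + 1)) (basis (hook i j')) = 0"
      "cmp (k + 1) (k + 1) (k + 1) (basis (hook i j')) (p (k + 1)) = 0"
      using good ij'(1) by (simp_all only: jw_good_def)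
    have "cmp (k + 1 + 1) (k + 1 + 1) (k + 1 + 1) (pad k) (basis (hook i j)) = 0"
      unfolding pad_def H tl_interchange[OF h tl_id_closed p_hom tl_id_closed] z by simp
    then have 1: "cmp (k + 2) (k + 2) (k + 2) (pad k) (basis (hook i j)) = 0" by simp
    have "cmp (k + 1 + 1) (k + 1 + 1) (k + 1 + 1) (basis (hook i j)) (pad k) = 0"
      unfolding pad_def H tl_interchange[OF p_hom tl_id_closed h tl_id_closed] z by simp
    then have 2: "cmp (k + 2) (k + 2) (k + 2) (basis (hook i j)) (pad k) = 0" by simp
    have "cmp (k + 2) (k + 2) (k + 2) (cmp (k + 2) (k + 2) (k + 2) (p (k + 2)) (pad k)) (basis (hook i j)) = 0"
      by (simp only: assoc[OF Hh pad_hom p_hom] 1 tl_comp_0)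
    moreover have "cmp (k + 2) (k + 2) (k + 2) (basis (hook i j)) (cmp (k + 2) (k + 2) (k + 2) (pad k) (p (k + 2))) = 0"
      by (simp only: tl_comp_assoc[OF p_hom pad_hom Hh] 2 tl_comp_0)
    ultimately show ?thesis by (simp only: p_pad pad_p simp_thms)
  qed
  then show "cmp (k + 2) (k + 2) (k + 2) (p (k + 2)) (basis (hook i j)) = 0"
    and "cmp (k + 2) (k + 2) (k + 2) (basis (hook i j)) (p (k + 2)) = 0" by simp_all
qed

text \<open>
  In the first term of \<open>p (k + 2)\<close> the last strand closes to a loop, with value \<open>d\<close>. In the second one
  the closed strand is pulled straight, which leaves \<open>p (k + 1)\<close> with the coefficient of the recursion. The
  recursion of \<open>r\<close> adds the two up.
\<close>

lemma partial_trace_step: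
  "cmp (k + 1) (k + 3) (k + 1) (cap (k + 1)) (cmp (k + 1) (k + 3) (k + 3) (pad (k + 1)) (cup (k + 1)))
    = scale (r (k + 3) / r (k + 2)) (p (k + 1))"
proof -
  let ?P = "tl_tensor (k + 1) (k + 1) (p (k + 1)) (tl_id 2)" and ?T = "tl_tensor (k + 2) (k + 2) (turn k) (tl_id 1)"
  have k: "k + 1 + 2 = k + 3" "k + 2 + 1 = k + 3" "k + 1 + 1 = k + 2" by simp_all
  note cu = cup_hom[of "k + 1", unfolded k] and ca = cap_hom[of "k + 1", unfolded k]
  have P: "?P \<in> tl_hom (k + 3) (k + 3)"
    using tl_tensor_closed[OF p_hom[of "k + 1"] tl_id_closed[of 2]] by (simp only: k)
  have T: "?T \<in> tl_hom (k + 3) (k + 3)"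
    using tl_tensor_closed[OF turn_hom[of k] tl_id_closed[of 1]] by (simp only: k)
  have Pe: "?P = tl_tensor (k + 2) (k + 2) (pad k) (tl_id 1)"
    using tl_tensor_assoc[of "k + 1" 1 "k + 1" 1 "p (k + 1)" "tl_id 1" "tl_id 1"] tl_tensor_id[of 1 1]
    by (simp add: pad_def numeral_2_eq_2)
  have i1: "tl_tensor (k + 2) (k + 2) (cmp (k + 2) (k + 2) (k + 2) f g) (tl_id 1)
      = cmp (k + 3) (k + 3) (k + 3) (tl_tensor (k + 2) (k + 2) f (tl_id 1)) (tl_tensor (k + 2) (k + 2) g (tl_id 1))"
    if "f \<in> tl_hom (k + 2) (k + 2)" "g \<in> tl_hom (k + 2) (k + 2)" for f g
    using tl_interchange[OF that(2) tl_id_closed[of 1] that(1) tl_id_closed[of 1], of d]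
    by (simp only: k tl_comp_id_left[OF tl_id_closed])
  have pad: "pad (k + 1) = ?P - scale (r (k + 1) / r (k + 2)) (cmp (k + 3) (k + 3) (k + 3) ?P (cmp (k + 3) (k + 3) (k + 3) ?T ?P))"
    unfolding pad_def[of "k + 1"] k p_step tl_tensor_diff_left tl_tensor_scale_left
      i1[OF pad_hom comp_hom[OF pad_hom turn_hom]] i1[OF turn_hom pad_hom] Pe ..
  have sl: "cmp (k + 1) (k + 3) (k + 3) ?P (cup (k + 1)) = cmp (k + 1) (k + 1) (k + 3) (cup (k + 1)) (p (k + 1))"
    using slide_cup[OF p_hom[of "k + 1"]] by (simp only: k)
  have sr: "cmp (k + 3) (k + 3) (k + 1) (cap (k + 1)) ?P = cmp (k + 3) (k + 1) (k + 1) (p (k + 1)) (cap (k + 1))"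
    using slide_cap[OF p_hom[of "k + 1"]] by (simp only: k)
  have b: "cmp (k + 1) (k + 3) (k + 1) (cap (k + 1)) (cmp (k + 1) (k + 3) (k + 3) ?P (cup (k + 1))) = scale d (p (k + 1))"
    using cap_cup_bubble[OF p_hom[of "k + 1"]] by (simp only: k)
  have "cmp (k + 1) (k + 3) (k + 1) (cap (k + 1))
      (cmp (k + 1) (k + 3) (k + 3) (cmp (k + 3) (k + 3) (k + 3) ?P (cmp (k + 3) (k + 3) (k + 3) ?T ?P)) (cup (k + 1)))
    = cmp (k + 1) (k + 3) (k + 1) (cap (k + 1)) (cmp (k + 1) (k + 3) (k + 3) ?P
        (cmp (k + 1) (k + 3) (k + 3) ?T (cmp (k + 1) (k + 1) (k + 3) (cup (k + 1)) (p (k + 1)))))"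
    by (simp only: assoc[OF cu comp_hom[OF P T] P] assoc[OF cu P T] sl)
  also have "\<dots> = cmp (k + 1) (k + 3) (k + 1) (cmp (k + 3) (k + 3) (k + 1) (cap (k + 1)) ?P)
        (cmp (k + 1) (k + 3) (k + 3) ?T (cmp (k + 1) (k + 1) (k + 3) (cup (k + 1)) (p (k + 1))))"
    by (rule tl_comp_assoc[OF comp_hom[OF comp_hom[OF p_hom cu] T] P ca])
  also have "\<dots> = cmp (k + 1) (k + 1) (k + 1) (p (k + 1)) (cmp (k + 1) (k + 3) (k + 1) (cap (k + 1))
        (cmp (k + 1) (k + 3) (k + 3) ?T (cmp (k + 1) (k + 1) (k + 3) (cup (k + 1)) (p (k + 1)))))"
    unfolding sr by (rule assoc[OF comp_hom[OF comp_hom[OF p_hom cu] T] ca p_hom])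
  also have "cmp (k + 1) (k + 3) (k + 1) (cap (k + 1))
        (cmp (k + 1) (k + 3) (k + 3) ?T (cmp (k + 1) (k + 1) (k + 3) (cup (k + 1)) (p (k + 1))))
      = cmp (k + 1) (k + 1) (k + 1) (cmp (k + 1) (k + 3) (k + 1) (cap (k + 1)) (cmp (k + 1) (k + 3) (k + 3) ?T (cup (k + 1)))) (p (k + 1))"
    by (simp only: tl_comp_assoc[OF p_hom cu T] tl_comp_assoc[OF p_hom comp_hom[OF cu T] ca])
  also have "\<dots> = p (k + 1)" by (simp only: zigzag tl_comp_id_left[OF p_hom])
  also have "cmp (k + 1) (k + 1) (k + 1) (p (k + 1)) (p (k + 1)) = p (k + 1)" using good by (simp only: jw_good_def)
  finally have "cmp (k + 1) (k + 3) (k + 1) (cap (k + 1)) (cmp (k + 1) (k + 3) (k + 3) (pad (k + 1)) (cup (k + 1)))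
      = scale (d - r (k + 1) / r (k + 2)) (p (k + 1))"
    unfolding pad tl_comp_diff_left tl_comp_diff_right tl_comp_scale_left tl_comp_scale_right b
    by (simp only: scale.scale_left_diff_distrib)
  moreover have "r (k + 3) = d * r (k + 2) - r (k + 1)" using r_step[of "k + 1"] by (simp add: numeral_3_eq_3)
  then have "d - r (k + 1) / r (k + 2) = r (k + 3) / r (k + 2)" using nz2 by (simp add: field_simps)
  ultimately show ?thesis by (simp only:)
qed

lemma jw_good_step: "jw_good (k + 1)"
proof -
  have k: "k + 1 + 2 = k + 3" "k + 1 + 1 = k + 2" by simp_all
  show ?thesis unfolding jw_good_def k
    using p_idem_step p_pad[unfolded pad_def] pad_p[unfolded pad_def] partial_trace_step hook_p_step by blast
qed

end

lemma jw_good: "k + 1 < n \<Longrightarrow> jw_good k"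
proof (induct k)
  case 0 show ?case by (rule jw_good_0)
next
  case (Suc k)
  then show ?case using jw_good_step[of k] r_nonzero[of "k + 1"] r_nonzero[of "k + 2"] by simp
qed

end

context quantum_numbers
begin

lemma p_idem:
  assumes "m < n" shows "cmp m m m (p m) (p m) = p m"
proof (cases m)
  case 0
  then show ?thesis using tl_comp_id_left[OF tl_id_closed[of 0]] by simp
next
  case (Suc k)
  then show ?thesis using jw_good[of k] assms by (simp add: jw_good_def)
qed

lemma basis_expansion: "f = (\<Sum>M \<in> Poly_Mapping.keys f. scale (Poly_Mapping.lookup f M) (basis M))"
  using lin_basis[of f, symmetric] unfolding lin_def .

text \<open>
  An idempotent annihilates diagrams that turn back: these absorb a hook up to a loop, and hooks are annihilated.
  The loop value is nonzero as soon as there is room for a hook.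
\<close>

lemma d_nonzero: "2 \<le> m \<Longrightarrow> m < n \<Longrightarrow> d \<noteq> 0"
  using r_nonzero[of 2] r_2 by simp

lemma turn_below_p:
  assumes m: "m < n" and M: "M \<in> planar_matchings m y" and i: "Suc i < m" and arc: "{(0, i), (0, Suc i)} \<in> M"
  shows "cmp m m y (basis M) (p m) = 0"
proof -
  obtain k where k: "m = k + 1" using i by (metis Suc_eq_plus1 less_nat_zero_code not0_implies_Suc)
  obtain j where j: "i + 2 + j = m" using i less_eqE[of "i + 2" m] by auto
  have h: "basis (hook i j) \<in> tl_hom m m" using hook_planar[of i j] j by (simp add: supported_single)
  have Mh: "basis M \<in> tl_hom m y" by (rule supported_single[OF M])
  have "cmp m m y (basis M) (basis (hook i j)) = scale d (basis M)"
    using hook_below[of M i j y] M arc j by (simp add: basis_comp scale_basis)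
  then have "scale d (cmp m m y (basis M) (p m)) = cmp m m y (basis M) (cmp m m m (basis (hook i j)) (p m))"
    by (simp only: tl_comp_assoc[OF p_hom h Mh] tl_comp_scale_left)
  also have "cmp m m m (basis (hook i j)) (p m) = 0"
    using jw_good[of k] j m unfolding k by (simp add: jw_good_def)
  finally show ?thesis using d_nonzero[of m] i m by simp
qed

lemma p_below_turn:
  assumes m: "m < n" and M: "M \<in> planar_matchings x m" and i: "Suc i < m" and arc: "{(1, i), (1, Suc i)} \<in> M"
  shows "cmp x m m (p m) (basis M) = 0"
proof -
  obtain k where k: "m = k + 1" using i by (metis Suc_eq_plus1 less_nat_zero_code not0_implies_Suc)
  obtain j where j: "i + 2 + j = m" using i less_eqE[of "i + 2" m] by auto
  have h: "basis (hook i j) \<in> tl_hom m m" using hook_planar[of i j] j by (simp add: supported_single)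
  have Mh: "basis M \<in> tl_hom x m" by (rule supported_single[OF M])
  have "cmp x m m (basis (hook i j)) (basis M) = scale d (basis M)"
    using hook_above[of M x i j] M arc j by (simp add: basis_comp scale_basis)
  then have "scale d (cmp x m m (p m) (basis M)) = cmp x m m (cmp m m m (p m) (basis (hook i j))) (basis M)"
    by (simp only: assoc[OF Mh h p_hom] tl_comp_scale_right)
  also have "cmp m m m (p m) (basis (hook i j)) = 0"
    using jw_good[of k] j m unfolding k by (simp add: jw_good_def)
  finally show ?thesis using d_nonzero[of m] i m by simp
qed

lemma basis_p_0:
  assumes m: "m < n" and M: "M \<in> planar_matchings m y" and ne: "y < m \<or> (y = m \<and> M \<noteq> id_matching m)"
  shows "cmp m m y (basis M) (p m) = 0"
proof -
  obtain i where "Suc i < m" "{(0, i), (0, Suc i)} \<in> M"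
    using no_turn_at_bottom[OF M] ne by (metis not_le)
  then show ?thesis by (rule turn_below_p[OF m M])
qed

lemma p_basis_0:
  assumes m: "m < n" and M: "M \<in> planar_matchings x m" and ne: "x < m"
  shows "cmp x m m (p m) (basis M) = 0"
proof -
  obtain i where i: "Suc i < m" "{(0, i), (0, Suc i)} \<in> emap flip M"
    using no_turn_at_bottom(1)[OF flip_planar[OF M]] ne by (metis not_le)
  then have "{flip (0, i), flip (0, Suc i)} \<in> emap flip (emap flip M)" using emap_edge by metis
  then have "{(1, i), (1, Suc i)} \<in> M" by (simp only: flip_simps emap_flip_flip)
  then show ?thesis by (rule p_below_turn[OF m M i(1)])
qed

lemma comp_p_expand:
  "cmp m m y f (p m) = (\<Sum>M \<in> Poly_Mapping.keys f. scale (Poly_Mapping.lookup f M) (cmp m m y (basis M) (p m)))"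
  by (subst basis_expansion[of f]) (simp only: tl_comp_sum_left tl_comp_scale_left)

lemma p_comp_expand:
  "cmp x m m (p m) f = (\<Sum>M \<in> Poly_Mapping.keys f. scale (Poly_Mapping.lookup f M) (cmp x m m (p m) (basis M)))"
  by (subst basis_expansion[of f]) (simp only: tl_comp_sum_right tl_comp_scale_right)

text \<open>All diagrams but the identity turn back at the bottom.\<close>

lemma p_schur:
  assumes m: "m < n" and f: "f \<in> tl_hom m m"
  shows "cmp m m m f (p m) = scale (Poly_Mapping.lookup f (id_matching m)) (p m)"
proof -
  have sub: "Poly_Mapping.keys f \<subseteq> planar_matchings m m" using f by (simp add: supported_def)
  have "cmp m m m f (p m) = (\<Sum>M \<in> Poly_Mapping.keys f. if M = id_matching m
      then scale (Poly_Mapping.lookup f (id_matching m)) (p m) else 0)"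
  proof (subst comp_p_expand, rule sum.cong[OF refl])
    fix M assume "M \<in> Poly_Mapping.keys f"
    then have M: "M \<in> planar_matchings m m" using sub by auto
    show "scale (Poly_Mapping.lookup f M) (cmp m m m (basis M) (p m)) =
      (if M = id_matching m then scale (Poly_Mapping.lookup f (id_matching m)) (p m) else 0)"
      using basis_p_0[OF m M] tl_comp_id_left[OF p_hom, of d m] by simp
  qed
  also have "\<dots> = scale (Poly_Mapping.lookup f (id_matching m)) (p m)"
    by (simp add: sum.delta in_keys_iff)
  finally show ?thesis .
qed

text \<open>Diagrams between different numbers of points turn back on the side with more points.\<close>

lemma p_disjoint:
  assumes k: "k < n" and l: "l < n" and kl: "k \<noteq> l" and f: "f \<in> tl_hom k l"
    and fp: "cmp k k l f (p k) = f" and pf: "cmp k l l (p l) f = f"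
  shows "f = 0"
proof -
  have sub: "Poly_Mapping.keys f \<subseteq> planar_matchings k l" using f by (simp add: supported_def)
  consider "l < k" | "k < l" using kl by linarith
  then show ?thesis
  proof cases
    case 1
    have "cmp k k l f (p k) = 0"
      by (subst comp_p_expand, rule sum.neutral) (use basis_p_0[OF k] sub 1 in auto)
    then show ?thesis using fp by simp
  next
    case 2
    have "cmp k l l (p l) f = 0"
      by (subst p_comp_expand, rule sum.neutral) (use p_basis_0[OF l] sub 2 in auto)
    then show ?thesis using pf by simp
  qed
qed

lemma trace_id_0: "tl_trace d 0 (tl_id 0) = 1"
  by (simp add: tl_trace_def closure_loops_def points_def)

text \<open>
  By cyclicity, the trace of the correction term is that of the partial trace of the previous idempotent.
\<close>

lemma trace_p: "m < n \<Longrightarrow> tl_trace d m (p m) = r (m + 1)"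
proof (induct m rule: less_induct)
  case (less m)
  consider "m = 0" | "m = 1" | k where "m = k + 2"
    by (metis One_nat_def add_2_eq_Suc' not0_implies_Suc)
  then show ?case
  proof cases
    case 1
    then show ?thesis using trace_id_0 r_1 by simp
  next
    case 2
    have "tl_trace d (0 + 1) (tl_tensor 0 0 (tl_id 0) (tl_id 1)) = d * tl_trace d 0 (tl_id 0)"
      by (rule tl_trace_tensor_id[OF tl_id_closed])
    then have "tl_trace d 1 (tl_id 1) = r 2"
      by (simp only: tl_tensor_unit_left trace_id_0 r_2 add_0_left mult_1_right)
    then show ?thesis using 2 by (simp add: numeral_2_eq_2)
  next
    case 3
    let ?a = "cmp k (k + 2) (k + 2) (pad k) (cup k)" and ?b = "cmp (k + 2) (k + 2) k (cap k) (pad k)"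
    have a: "?a \<in> tl_hom k (k + 2)" and b: "?b \<in> tl_hom (k + 2) k"
      by (rule comp_hom[OF cup_hom pad_hom] comp_hom[OF pad_hom cap_hom])+
    have good: "jw_good k" using jw_good less(2) 3 by simp
    have nz: "r (k + 1) \<noteq> 0" "r (k + 2) \<noteq> 0" using r_nonzero less(2) 3 by simp_all
    have "tl_trace d (k + 1 + 1) (pad k) = d * tl_trace d (k + 1) (p (k + 1))"
      unfolding pad_def by (rule tl_trace_tensor_id[OF p_hom])
    also have "\<dots> = d * r (k + 2)" using less(1)[of "k + 1"] less(2) 3 by simp
    finally have 1: "tl_trace d (k + 2) (pad k) = d * r (k + 2)" by simp
    have "tl_trace d (k + 2) (cmp (k + 2) k (k + 2) ?a ?b) = tl_trace d k (cmp k (k + 2) k ?b ?a)"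
      by (rule tl_trace_cyclic[OF b a])
    also have "cmp k (k + 2) k ?b ?a = cmp k (k + 2) k (cap k) (cmp k (k + 2) (k + 2) (pad k) ?a)"
      by (rule assoc[OF a pad_hom cap_hom])
    also have "\<dots> = cmp k (k + 2) k (cap k) ?a"
      by (simp only: tl_comp_assoc[OF cup_hom pad_hom pad_hom] pad_idem[OF good nz])
    also have "\<dots> = scale (r (k + 2) / r (k + 1)) (p k)" by (rule partial_trace[OF good nz])
    also have "tl_trace d k \<dots> = r (k + 2)"
      using less(1)[of k] less(2) 3 nz by (simp add: tl_trace_scale)
    finally have 2: "tl_trace d (k + 2) (cmp (k + 2) k (k + 2) ?a ?b) = r (k + 2)" .
    have "tl_trace d (k + 2) (p (k + 2)) = d * r (k + 2) - r (k + 1)"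
      unfolding p_step pad_turn_pad[OF good nz] tl_trace_diff tl_trace_scale 1 2 using nz by simp
    then show ?thesis using 3 r_step[of "k + 1"] by (simp add: numeral_2_eq_2 numeral_3_eq_3)
  qed
qed

text \<open>
  All diagrams but the identity annihilate \<open>p (n - 1)\<close>, and the trace of \<open>p (n - 1)\<close> itself is \<open>r n = 0\<close>.
\<close>

lemma p_last_negligible: "p (n - 1) \<in> tl_negligible d (n - 1) (n - 1)"
proof (rule tl_negligible_basisI[OF p_hom])
  fix N assume N: "N \<in> planar_matchings (n - 1) (n - 1)"
  have n1: "n - 1 < n" using n_gt_1 by simp
  show "tl_trace d (n - 1) (cmp (n - 1) (n - 1) (n - 1) (basis N) (p (n - 1))) = 0"
  proof (cases "N = id_matching (n - 1)")
    case True
    have "tl_trace d (n - 1) (p (n - 1)) = r n" using trace_p[OF n1] n_gt_1 by simp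
    then show ?thesis unfolding True tl_comp_id_left[OF p_hom] using r_n by simp
  next
    case False
    then show ?thesis using basis_p_0[OF n1 N] by simp
  qed
qed

text \<open>
  An endomorphism is resolved if, up to negligible ones, it is a sum of maps that factor through
  some \<open>p k\<close> with \<open>k \<le> n - 2\<close>. The identity of \<open>x + 1\<close> strands is resolved because the recursion
  writes \<open>p k \<otimes> id\<close> as the sum of \<open>p (k + 1)\<close> and a map that factors through \<open>p (k - 1)\<close>, and
  the first idempotent that is not allowed here is negligible.
\<close>

definition factored :: "nat \<Rightarrow> nat \<times> tl \<times> tl \<Rightarrow> tl" where
  "factored x = (\<lambda>(k, u, v). cmp x k x u (cmp x k k (p k) v))"

definition resolved :: "nat \<Rightarrow> tl \<Rightarrow> bool" where
  "resolved x f \<longleftrightarrow> (\<exists>ts. (\<forall>(k, u, v) \<in> set ts. k \<le> n - 2 \<and> u \<in> tl_hom k x \<and> v \<in> tl_hom x k) \<and>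
    f - sum_list (map (factored x) ts) \<in> tl_negligible d x x)"

lemma resolved_negligible: "f \<in> tl_negligible d x x \<Longrightarrow> resolved x f"
  unfolding resolved_def by (intro exI[of _ "[]"]) simp

lemma resolved_add:
  assumes "resolved x f" "resolved x g" shows "resolved x (f + g)"
proof -
  obtain ts us where
    ts: "\<forall>(k, u, v) \<in> set ts. k \<le> n - 2 \<and> u \<in> tl_hom k x \<and> v \<in> tl_hom x k"
      "f - sum_list (map (factored x) ts) \<in> tl_negligible d x x" and
    us: "\<forall>(k, u, v) \<in> set us. k \<le> n - 2 \<and> u \<in> tl_hom k x \<and> v \<in> tl_hom x k"
      "g - sum_list (map (factored x) us) \<in> tl_negligible d x x"
    using assms unfolding resolved_def by blast
  have "(f + g) - sum_list (map (factored x) (ts @ us))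
    = (f - sum_list (map (factored x) ts)) + (g - sum_list (map (factored x) us))" by simp
  then have "(f + g) - sum_list (map (factored x) (ts @ us)) \<in> tl_negligible d x x"
    using tl_negligible_add[OF ts(2) us(2)] by (simp only:)
  moreover have "\<forall>(k, u, v) \<in> set (ts @ us). k \<le> n - 2 \<and> u \<in> tl_hom k x \<and> v \<in> tl_hom x k"
    using ts(1) us(1) by auto
  ultimately show ?thesis unfolding resolved_def by blast
qed

lemma resolved_factored:
  assumes "k \<le> n - 2" "u \<in> tl_hom k x" "v \<in> tl_hom x k"
  shows "resolved x (cmp x k x u (cmp x k k (p k) v))"
  unfolding resolved_def using assms by (intro exI[of _ "[(k, u, v)]"]) (simp add: factored_def)

lemma resolved_p:
  assumes m: "m < n" and u: "u \<in> tl_hom m x" and v: "v \<in> tl_hom x m"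
  shows "resolved x (cmp x m x u (cmp x m m (p m) v))"
proof (cases "m \<le> n - 2")
  case True
  then show ?thesis by (rule resolved_factored[OF _ u v])
next
  case False
  then have "m = n - 1" using m by simp
  then have "p m \<in> tl_negligible d m m" using p_last_negligible by simp
  then have "cmp x m m (p m) v \<in> tl_negligible d x m" by (rule tl_negligible_comp_right[OF _ v])
  then show ?thesis by (intro resolved_negligible tl_negligible_comp_left[OF _ u])
qed

lemma resolved_p_id:
  assumes k: "k \<le> n - 2" and u: "u \<in> tl_hom (k + 1) x" and v: "v \<in> tl_hom x (k + 1)"
  shows "resolved x (cmp x (k + 1) x u (cmp x (k + 1) (k + 1) (tl_tensor k k (p k) (tl_id 1)) v))"
proof (cases k)
  case 0
  then show ?thesis using resolved_p[of 1 u x v] n_gt_1 u v by simp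
next
  case (Suc l)
  then have kl: "k = l + 1" "k + 1 = l + 2" by simp_all
  note u = u[unfolded kl(2)] and v = v[unfolded kl(2)]
  have l: "l + 1 < n" using k kl n_gt_1 by auto
  have good: "jw_good l" using jw_good l by simp
  let ?a = "cmp l (l + 2) (l + 2) (pad l) (cup l)" and ?b = "cmp (l + 2) (l + 2) l (cap l) (pad l)"
  have a: "?a \<in> tl_hom l (l + 2)" and b: "?b \<in> tl_hom (l + 2) l"
    by (rule comp_hom[OF cup_hom pad_hom] comp_hom[OF pad_hom cap_hom])+
  have l2: "l + 2 < n" using k kl(1) n_gt_1 by linarith
  have nz: "r (l + 1) \<noteq> 0" "r (l + 2) \<noteq> 0" using r_nonzero l2 by simp_all
  let ?c = "r (l + 1) / r (l + 2)"
  have "pad l = p (l + 2) + scale ?c (cmp (l + 2) l (l + 2) ?a ?b)"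
    unfolding p_step pad_turn_pad[OF good nz] by simp
  moreover have "cmp (l + 2) l (l + 2) ?a ?b = cmp (l + 2) l (l + 2) ?a (cmp (l + 2) l l (p l) ?b)"
    using cap_pad[OF good nz] by (simp only:)
  ultimately have "pad l = p (l + 2) + scale ?c (cmp (l + 2) l (l + 2) ?a (cmp (l + 2) l l (p l) ?b))"
    by (simp only:)
  then have "cmp x (l + 2) x u (cmp x (l + 2) (l + 2) (pad l) v) = cmp x (l + 2) x u (cmp x (l + 2) (l + 2)
      (p (l + 2) + scale ?c (cmp (l + 2) l (l + 2) ?a (cmp (l + 2) l l (p l) ?b))) v)"
    by (rule arg_cong)
  also have "\<dots> = cmp x (l + 2) x u (cmp x (l + 2) (l + 2) (p (l + 2)) v)
      + scale ?c (cmp x (l + 2) x u (cmp x (l + 2) (l + 2) (cmp (l + 2) l (l + 2) ?a (cmp (l + 2) l l (p l) ?b)) v))"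
    by (simp only: tl_comp_add_left tl_comp_add_right tl_comp_scale_left tl_comp_scale_right)
  also have "scale ?c (cmp x (l + 2) x u (cmp x (l + 2) (l + 2) (cmp (l + 2) l (l + 2) ?a (cmp (l + 2) l l (p l) ?b)) v))
    = cmp x l x (scale ?c (cmp l (l + 2) x u ?a)) (cmp x l l (p l) (cmp x (l + 2) l ?b v))"
    by (simp only: tl_comp_scale_left assoc[OF v comp_hom[OF b p_hom] a] assoc[OF v b p_hom]
      tl_comp_assoc[OF comp_hom[OF comp_hom[OF v b] p_hom] a u])
  finally have "cmp x (l + 2) x u (cmp x (l + 2) (l + 2) (pad l) v)
    = cmp x (l + 2) x u (cmp x (l + 2) (l + 2) (p (l + 2)) v)
      + cmp x l x (scale ?c (cmp l (l + 2) x u ?a)) (cmp x l l (p l) (cmp x (l + 2) l ?b v))" .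
  moreover have "resolved x (cmp x (l + 2) x u (cmp x (l + 2) (l + 2) (p (l + 2)) v))"
    by (rule resolved_p[OF l2 u v])
  moreover have "resolved x (cmp x l x (scale ?c (cmp l (l + 2) x u ?a)) (cmp x l l (p l) (cmp x (l + 2) l ?b v)))"
    using k kl by (intro resolved_factored supported_scale comp_hom[OF a u] comp_hom[OF v b]) simp
  ultimately have "resolved x (cmp x (l + 2) x u (cmp x (l + 2) (l + 2) (pad l) v))"
    using resolved_add by (simp only:)
  then show ?thesis by (simp only: kl pad_def[symmetric]) (simp add: kl(1))
qed

lemma resolved_sum_list: "(\<And>t. t \<in> set ts \<Longrightarrow> resolved x (f t)) \<Longrightarrow> resolved x (sum_list (map f ts))"
  by (induct ts) (auto intro: resolved_add resolved_negligible)

lemma resolved_id: "resolved x (tl_id x)"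
proof (induct x)
  case 0
  have "resolved 0 (cmp 0 0 0 (tl_id 0) (cmp 0 0 0 (p 0) (tl_id 0)))"
    by (rule resolved_factored[OF _ tl_id_closed tl_id_closed]) simp
  then show ?case by (simp only: p_0 tl_comp_id_left[OF tl_id_closed])
next
  case (Suc x)
  obtain ts where ts: "\<forall>(k, u, v) \<in> set ts. k \<le> n - 2 \<and> u \<in> tl_hom k x \<and> v \<in> tl_hom x k"
      "tl_id x - sum_list (map (factored x) ts) \<in> tl_negligible d x x"
    using Suc unfolding resolved_def by blast
  let ?f = "\<lambda>g. tl_tensor x x g (tl_id 1)"
  have "tl_id x = (tl_id x - sum_list (map (factored x) ts)) + sum_list (map (factored x) ts)" by simp
  then have "?f (tl_id x) = ?f (tl_id x - sum_list (map (factored x) ts)) + ?f (sum_list (map (factored x) ts))"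
    by (metis tl_tensor_add_left)
  moreover have "?f (sum_list (map (factored x) ts)) = sum_list (map (\<lambda>t. ?f (factored x t)) ts)"
    by (induct ts) (simp_all add: tl_tensor_add_left)
  ultimately have "tl_id (x + 1) = ?f (tl_id x - sum_list (map (factored x) ts)) + sum_list (map (\<lambda>t. ?f (factored x t)) ts)"
    by (simp only: tl_tensor_id)
  moreover have "resolved (x + 1) (?f (tl_id x - sum_list (map (factored x) ts)))"
    by (rule resolved_negligible[OF tl_negligible_tensor(1)[OF ts(2) tl_id_closed]])
  moreover have "resolved (x + 1) (sum_list (map (\<lambda>t. ?f (factored x t)) ts))"
  proof (rule resolved_sum_list)
    fix t assume "t \<in> set ts"
    then obtain k u v where t: "t = (k, u, v)" "k \<le> n - 2" and u: "u \<in> tl_hom k x" and v: "v \<in> tl_hom x k"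
      using ts(1) by (cases t) auto
    note I = tl_id_closed[of 1]
    have "?f (factored x t) = cmp (x + 1) (k + 1) (x + 1) (tl_tensor k x u (tl_id 1))
        (cmp (x + 1) (k + 1) (k + 1) (tl_tensor k k (p k) (tl_id 1)) (tl_tensor x k v (tl_id 1)))"
    proof -
      have "cmp (x + 1) (k + 1) (k + 1) (tl_tensor k k (p k) (tl_id 1)) (tl_tensor x k v (tl_id 1))
          = tl_tensor x k (cmp x k k (p k) v) (tl_id 1)"
        unfolding tl_interchange[OF v I p_hom I] tl_comp_id_left[OF I] ..
      moreover have "cmp (x + 1) (k + 1) (x + 1) (tl_tensor k x u (tl_id 1)) (tl_tensor x k (cmp x k k (p k) v) (tl_id 1))
          = tl_tensor x x (cmp x k x u (cmp x k k (p k) v)) (tl_id 1)"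
        unfolding tl_interchange[OF comp_hom[OF v p_hom] I u I] tl_comp_id_left[OF I] ..
      ultimately show ?thesis by (simp only: t factored_def prod.case)
    qed
    then show "resolved (x + 1) (?f (factored x t))"
      using resolved_p_id[OF t(2) tl_tensor_closed[OF u I] tl_tensor_closed[OF v I]] by (simp only:)
  qed
  ultimately show ?case using resolved_add by (metis Suc_eq_plus1)
qed

end

section \<open>Linear categories\<close>

text \<open>Opposites are multiples by \<open>- 1\<close>.\<close>

lemma complex_vectorspaceI:
  fixes V :: "(complex, 'm) module"
  assumes add: "\<And>x y. x \<in> carrier V \<Longrightarrow> y \<in> carrier V \<Longrightarrow> x \<oplus>\<^bsub>V\<^esub> y \<in> carrier V"
    and zero: "\<zero>\<^bsub>V\<^esub> \<in> carrier V"
    and assoc: "\<And>x y z. x \<in> carrier V \<Longrightarrow> y \<in> carrier V \<Longrightarrow> z \<in> carrier V \<Longrightarrow> (x \<oplus>\<^bsub>V\<^esub> y) \<oplus>\<^bsub>V\<^esub> z = x \<oplus>\<^bsub>V\<^esub> (y \<oplus>\<^bsub>V\<^esub> z)"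
    and comm: "\<And>x y. x \<in> carrier V \<Longrightarrow> y \<in> carrier V \<Longrightarrow> x \<oplus>\<^bsub>V\<^esub> y = y \<oplus>\<^bsub>V\<^esub> x"
    and l_zero: "\<And>x. x \<in> carrier V \<Longrightarrow> \<zero>\<^bsub>V\<^esub> \<oplus>\<^bsub>V\<^esub> x = x"
    and smult: "\<And>c x. x \<in> carrier V \<Longrightarrow> c \<odot>\<^bsub>V\<^esub> x \<in> carrier V"
    and l_distr: "\<And>a b x. x \<in> carrier V \<Longrightarrow> (a + b) \<odot>\<^bsub>V\<^esub> x = a \<odot>\<^bsub>V\<^esub> x \<oplus>\<^bsub>V\<^esub> b \<odot>\<^bsub>V\<^esub> x"
    and r_distr: "\<And>c x y. x \<in> carrier V \<Longrightarrow> y \<in> carrier V \<Longrightarrow> c \<odot>\<^bsub>V\<^esub> (x \<oplus>\<^bsub>V\<^esub> y) = c \<odot>\<^bsub>V\<^esub> x \<oplus>\<^bsub>V\<^esub> c \<odot>\<^bsub>V\<^esub> y"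
    and smult_assoc: "\<And>a b x. x \<in> carrier V \<Longrightarrow> (a * b) \<odot>\<^bsub>V\<^esub> x = a \<odot>\<^bsub>V\<^esub> (b \<odot>\<^bsub>V\<^esub> x)"
    and one: "\<And>x. x \<in> carrier V \<Longrightarrow> 1 \<odot>\<^bsub>V\<^esub> x = x"
    and null: "\<And>x. x \<in> carrier V \<Longrightarrow> 0 \<odot>\<^bsub>V\<^esub> x = \<zero>\<^bsub>V\<^esub>"
  shows "vectorspace class_ring V"
proof -
  have "abelian_group V"
  proof (rule abelian_groupI)
    fix x assume x: "x \<in> carrier V"
    have "(- 1) \<odot>\<^bsub>V\<^esub> x \<oplus>\<^bsub>V\<^esub> x = (- 1 + 1) \<odot>\<^bsub>V\<^esub> x" using l_distr[OF x, of "- 1" 1] one[OF x] by simp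
    also have "\<dots> = \<zero>\<^bsub>V\<^esub>" using null[OF x] by simp
    finally show "\<exists>y \<in> carrier V. y \<oplus>\<^bsub>V\<^esub> x = \<zero>\<^bsub>V\<^esub>" using smult[OF x] by blast
  qed (use assms in auto)
  moreover have "cring (class_ring :: complex ring)" by (rule class_cring.is_cring)
  ultimately have "module class_ring V"
    by (intro moduleI) (use assms in auto)
  moreover have "field (class_ring :: complex ring)" by (rule class_field.field_axioms)
  ultimately show ?thesis by (rule vectorspace.intro)
qed

lemma span_singleton:
  fixes V :: "(complex, 'm) module"
  assumes V: "vectorspace class_ring V" and v: "v \<in> carrier V"
  shows "LinearCombinations.module.span class_ring V {v} = {c \<odot>\<^bsub>V\<^esub> v | c. True}"
proof -
  interpret V: vectorspace class_ring V by (rule V)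
  have "V.lincomb a {v} = a v \<odot>\<^bsub>V\<^esub> v" for a
    using v by (simp add: V.lincomb_def)
  then have "V.span {v} = {a v \<odot>\<^bsub>V\<^esub> v | a. a \<in> {v} \<rightarrow> UNIV}"
    using V.finite_span[of "{v}"] v by simp
  also have "\<dots> = {c \<odot>\<^bsub>V\<^esub> v | c. True}" by (auto intro: exI[of _ "\<lambda>_. _"])
  finally show ?thesis .
qed

lemma (in abelian_monoid) finsum_swap:
  assumes "finite A" "finite B" "\<And>i j. i \<in> A \<Longrightarrow> j \<in> B \<Longrightarrow> f i j \<in> carrier G"
  shows "(\<Oplus>i\<in>A. \<Oplus>j\<in>B. f i j) = (\<Oplus>j\<in>B. \<Oplus>i\<in>A. f i j)"
  using assms(1,3)
proof (induct A rule: finite_induct)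
  case empty
  then show ?case by (simp add: finsum_zero)
next
  case (insert a A)
  have 1: "(\<lambda>i. \<Oplus>j\<in>B. f i j) \<in> A \<rightarrow> carrier G" "(\<Oplus>j\<in>B. f a j) \<in> carrier G"
    using insert(4) by (auto intro!: finsum_closed)
  have 2: "(\<lambda>j. \<Oplus>i\<in>A. f i j) \<in> B \<rightarrow> carrier G" "(\<lambda>j. f a j) \<in> B \<rightarrow> carrier G"
    using insert(4) by (auto intro!: finsum_closed)
  have "(\<Oplus>i\<in>insert a A. \<Oplus>j\<in>B. f i j) = (\<Oplus>j\<in>B. f a j) \<oplus> (\<Oplus>j\<in>B. \<Oplus>i\<in>A. f i j)"
    using insert 1 by (simp add: finsum_insert)
  also have "\<dots> = (\<Oplus>j\<in>B. f a j \<oplus> (\<Oplus>i\<in>A. f i j))"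
    using 2 by (simp add: finsum_addf)
  also have "\<dots> = (\<Oplus>j\<in>B. \<Oplus>i\<in>insert a A. f i j)"
    using insert 2 by (intro finsum_cong') (auto intro!: finsum_insert[symmetric])
  finally show ?case .
qed

context linear_category
begin

lemma hom_module: "x \<in> Obj C \<Longrightarrow> y \<in> Obj C \<Longrightarrow> module class_ring (Hom C x y)"
  using hom_vectorspace by (simp add: vectorspace_def)

lemma hom_group: "x \<in> Obj C \<Longrightarrow> y \<in> Obj C \<Longrightarrow> abelian_group (Hom C x y)"
  using hom_module module.axioms by blast

lemma hom_monoid: "x \<in> Obj C \<Longrightarrow> y \<in> Obj C \<Longrightarrow> abelian_monoid (Hom C x y)"
  using hom_group abelian_group.axioms by blast

lemma hom_smult_closed: "x \<in> Obj C \<Longrightarrow> y \<in> Obj C \<Longrightarrow> f \<in> Mor C x y \<Longrightarrow> c \<odot>\<^bsub>Hom C x y\<^esub> f \<in> Mor C x y"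
  using module.smult_closed[OF hom_module] by auto

lemma hom_add_closed: "x \<in> Obj C \<Longrightarrow> y \<in> Obj C \<Longrightarrow> f \<in> Mor C x y \<Longrightarrow> g \<in> Mor C x y \<Longrightarrow> f \<oplus>\<^bsub>Hom C x y\<^esub> g \<in> Mor C x y"
  using abelian_monoid.a_closed[OF hom_monoid] by auto

lemma hom_zero_closed: "x \<in> Obj C \<Longrightarrow> y \<in> Obj C \<Longrightarrow> \<zero>\<^bsub>Hom C x y\<^esub> \<in> Mor C x y"
  using abelian_monoid.zero_closed[OF hom_monoid] by auto

lemma hom_null: "x \<in> Obj C \<Longrightarrow> y \<in> Obj C \<Longrightarrow> f \<in> Mor C x y \<Longrightarrow> 0 \<odot>\<^bsub>Hom C x y\<^esub> f = \<zero>\<^bsub>Hom C x y\<^esub>"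
  using module.smult_l_null[OF hom_module] by auto

lemma hom_smult_zero: "x \<in> Obj C \<Longrightarrow> y \<in> Obj C \<Longrightarrow> c \<odot>\<^bsub>Hom C x y\<^esub> \<zero>\<^bsub>Hom C x y\<^esub> = \<zero>\<^bsub>Hom C x y\<^esub>"
  using module.smult_r_null[OF hom_module] by auto

lemma hom_smult_assoc: "x \<in> Obj C \<Longrightarrow> y \<in> Obj C \<Longrightarrow> f \<in> Mor C x y \<Longrightarrow>
    a \<odot>\<^bsub>Hom C x y\<^esub> (b \<odot>\<^bsub>Hom C x y\<^esub> f) = (a * b) \<odot>\<^bsub>Hom C x y\<^esub> f"
  using module.smult_assoc1[OF hom_module] by auto

lemma hom_one: "x \<in> Obj C \<Longrightarrow> y \<in> Obj C \<Longrightarrow> f \<in> Mor C x y \<Longrightarrow> 1 \<odot>\<^bsub>Hom C x y\<^esub> f = f"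
  using module.smult_one[OF hom_module] by auto

lemma hom_distr: "x \<in> Obj C \<Longrightarrow> y \<in> Obj C \<Longrightarrow> f \<in> Mor C x y \<Longrightarrow>
    (a + b) \<odot>\<^bsub>Hom C x y\<^esub> f = a \<odot>\<^bsub>Hom C x y\<^esub> f \<oplus>\<^bsub>Hom C x y\<^esub> b \<odot>\<^bsub>Hom C x y\<^esub> f"
  using module.smult_l_distr[OF hom_module] by auto

lemma hom_cancel: "x \<in> Obj C \<Longrightarrow> y \<in> Obj C \<Longrightarrow> f \<in> Mor C x y \<Longrightarrow>
    f \<oplus>\<^bsub>Hom C x y\<^esub> (- 1) \<odot>\<^bsub>Hom C x y\<^esub> f = \<zero>\<^bsub>Hom C x y\<^esub>"
  using hom_distr[of x y f 1 "- 1"] hom_one[of x y f] hom_null[of x y f] by simp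

lemma hom_zero_left: "x \<in> Obj C \<Longrightarrow> y \<in> Obj C \<Longrightarrow> f \<in> Mor C x y \<Longrightarrow> \<zero>\<^bsub>Hom C x y\<^esub> \<oplus>\<^bsub>Hom C x y\<^esub> f = f"
  using abelian_monoid.l_zero[OF hom_monoid] by auto

lemma hom_zero_right: "x \<in> Obj C \<Longrightarrow> y \<in> Obj C \<Longrightarrow> f \<in> Mor C x y \<Longrightarrow> f \<oplus>\<^bsub>Hom C x y\<^esub> \<zero>\<^bsub>Hom C x y\<^esub> = f"
  using abelian_monoid.r_zero[OF hom_monoid] by auto

lemma comp_zero_right:
  assumes "x \<in> Obj C" "y \<in> Obj C" "z \<in> Obj C" "g \<in> Mor C y z"
  shows "Comp C x y z g \<zero>\<^bsub>Hom C x y\<^esub> = \<zero>\<^bsub>Hom C x z\<^esub>"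
proof -
  note z = hom_zero_closed[OF assms(1,2)]
  have "Comp C x y z g \<zero>\<^bsub>Hom C x y\<^esub> = Comp C x y z g (0 \<odot>\<^bsub>Hom C x y\<^esub> \<zero>\<^bsub>Hom C x y\<^esub>)"
    using hom_null[OF assms(1,2) z] by simp
  also have "\<dots> = \<zero>\<^bsub>Hom C x z\<^esub>"
    using comp_smult_right[OF assms(1-3) z assms(4)] hom_null[OF assms(1,3) comp_closed[OF assms(1-3) z assms(4)]] by simp
  finally show ?thesis .
qed

lemma comp_zero_left:
  assumes "x \<in> Obj C" "y \<in> Obj C" "z \<in> Obj C" "f \<in> Mor C x y"
  shows "Comp C x y z \<zero>\<^bsub>Hom C y z\<^esub> f = \<zero>\<^bsub>Hom C x z\<^esub>"
proof -
  note z = hom_zero_closed[OF assms(2,3)]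
  have "Comp C x y z \<zero>\<^bsub>Hom C y z\<^esub> f = Comp C x y z (0 \<odot>\<^bsub>Hom C y z\<^esub> \<zero>\<^bsub>Hom C y z\<^esub>) f"
    using hom_null[OF assms(2,3) z] by simp
  also have "\<dots> = \<zero>\<^bsub>Hom C x z\<^esub>"
    using comp_smult_left[OF assms(1-3) assms(4) z] hom_null[OF assms(1,3) comp_closed[OF assms(1-3) assms(4) z]] by simp
  finally show ?thesis .
qed

lemma comp_finsum_right:
  assumes o: "x \<in> Obj C" "y \<in> Obj C" "z \<in> Obj C" and g: "g \<in> Mor C y z" and "finite A"
    and "\<And>i. i \<in> A \<Longrightarrow> f i \<in> Mor C x y"
  shows "Comp C x y z g (\<Oplus>\<^bsub>Hom C x y\<^esub>i\<in>A. f i) = (\<Oplus>\<^bsub>Hom C x z\<^esub>i\<in>A. Comp C x y z g (f i))"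
proof -
  interpret XY: abelian_monoid "Hom C x y" by (rule hom_monoid[OF o(1,2)])
  interpret XZ: abelian_monoid "Hom C x z" by (rule hom_monoid[OF o(1,3)])
  show ?thesis using assms(5,6)
  proof (induct A rule: finite_induct)
    case empty
    then show ?case using comp_zero_right[OF o g] by simp
  next
    case (insert a A)
    then have f: "f a \<in> Mor C x y" "f \<in> A \<rightarrow> Mor C x y" "(\<lambda>i. Comp C x y z g (f i)) \<in> A \<rightarrow> Mor C x z"
      using comp_closed[OF o _ g] by auto
    then show ?case
      using insert comp_add_right[OF o _ _ g, of "f a" "\<Oplus>\<^bsub>Hom C x y\<^esub>i\<in>A. f i"] comp_closed[OF o f(1) g]
      by (simp add: XY.finsum_insert XZ.finsum_insert)
  qed
qed

lemma comp_finsum_left: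
  assumes o: "x \<in> Obj C" "y \<in> Obj C" "z \<in> Obj C" and f: "f \<in> Mor C x y" and "finite A"
    and "\<And>i. i \<in> A \<Longrightarrow> g i \<in> Mor C y z"
  shows "Comp C x y z (\<Oplus>\<^bsub>Hom C y z\<^esub>i\<in>A. g i) f = (\<Oplus>\<^bsub>Hom C x z\<^esub>i\<in>A. Comp C x y z (g i) f)"
proof -
  interpret YZ: abelian_monoid "Hom C y z" by (rule hom_monoid[OF o(2,3)])
  interpret XZ: abelian_monoid "Hom C x z" by (rule hom_monoid[OF o(1,3)])
  show ?thesis using assms(5,6)
  proof (induct A rule: finite_induct)
    case empty
    then show ?case using comp_zero_left[OF o f] by simp
  next
    case (insert a A)
    then have g: "g a \<in> Mor C y z" "g \<in> A \<rightarrow> Mor C y z" "(\<lambda>i. Comp C x y z (g i) f) \<in> A \<rightarrow> Mor C x z"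
      using comp_closed[OF o f] by auto
    then show ?case
      using insert comp_add_left[OF o f, of "g a" "\<Oplus>\<^bsub>Hom C y z\<^esub>i\<in>A. g i"] comp_closed[OF o f g(1)]
      by (simp add: YZ.finsum_insert XZ.finsum_insert)
  qed
qed

lemma finsum_mor_closed:
  "x \<in> Obj C \<Longrightarrow> y \<in> Obj C \<Longrightarrow> (\<And>i. i \<in> A \<Longrightarrow> f i \<in> Mor C x y) \<Longrightarrow> (\<Oplus>\<^bsub>Hom C x y\<^esub>i\<in>A. f i) \<in> Mor C x y"
  using abelian_monoid.finsum_closed[OF hom_monoid, of x y f A] by auto

lemma finsum_mor_cong:
  "x \<in> Obj C \<Longrightarrow> y \<in> Obj C \<Longrightarrow> (\<And>i. i \<in> A \<Longrightarrow> f i \<in> Mor C x y) \<Longrightarrow> (\<And>i. i \<in> A \<Longrightarrow> f i = g i) \<Longrightarrow>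
    (\<Oplus>\<^bsub>Hom C x y\<^esub>i\<in>A. f i) = (\<Oplus>\<^bsub>Hom C x y\<^esub>i\<in>A. g i)"
  by (rule abelian_monoid.finsum_cong'[OF hom_monoid]) auto

lemma finsum_mor_zero:
  assumes "x \<in> Obj C" "y \<in> Obj C" "\<And>i. i \<in> A \<Longrightarrow> f i = \<zero>\<^bsub>Hom C x y\<^esub>"
  shows "(\<Oplus>\<^bsub>Hom C x y\<^esub>i\<in>A. f i) = \<zero>\<^bsub>Hom C x y\<^esub>"
proof -
  have "(\<Oplus>\<^bsub>Hom C x y\<^esub>i\<in>A. f i) = (\<Oplus>\<^bsub>Hom C x y\<^esub>i\<in>A. \<zero>\<^bsub>Hom C x y\<^esub>)"
    by (rule finsum_mor_cong[OF assms(1,2)]) (simp_all add: assms hom_zero_closed)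
  then show ?thesis using abelian_monoid.finsum_zero[OF hom_monoid[OF assms(1,2)]] by simp
qed

lemma finsum_mor_single:
  assumes o: "x \<in> Obj C" "y \<in> Obj C" and A: "finite A" "a \<in> A" and f: "f \<in> Mor C x y"
    and "\<And>i. i \<in> A \<Longrightarrow> g i = (if i = a then f else \<zero>\<^bsub>Hom C x y\<^esub>)"
  shows "(\<Oplus>\<^bsub>Hom C x y\<^esub>i\<in>A. g i) = f"
proof -
  have "(\<Oplus>\<^bsub>Hom C x y\<^esub>i\<in>A. g i) = (\<Oplus>\<^bsub>Hom C x y\<^esub>i\<in>A. if a = i then f else \<zero>\<^bsub>Hom C x y\<^esub>)"
    by (rule finsum_mor_cong[OF o]) (use assms hom_zero_closed[OF o] in auto)
  then show ?thesis using abelian_monoid.finsum_singleton[OF hom_monoid[OF o] A(2,1), of "\<lambda>_. f"] f by simp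
qed

lemma simple_endo:
  assumes "simple_object C s" "f \<in> Mor C s s"
  obtains c where "f = c \<odot>\<^bsub>Hom C s s\<^esub> Ident C s"
  using assms span_singleton[OF hom_vectorspace ident_closed, of s] unfolding simple_object_def by auto

text \<open>
  Idempotents are split greedily. Let \<open>e\<close> be the part of the identity that remains to be
  decomposed. If \<open>e \<circ> u k\<close> is not zero, some \<open>v a \<circ> e \<circ> u k\<close> is not zero either, as the \<open>u a \<circ> v a\<close> add up to the
  identity. As a nonzero map between objects of \<open>S\<close>, it is an invertible scalar. Hence \<open>e \<circ> u k\<close> has
  a left inverse \<open>w\<close> and embeds a copy of \<open>s k\<close> in the image of \<open>e\<close>; what remains is the complement
  \<open>e - (e \<circ> u k) \<circ> w\<close>, which annihilates \<open>u k\<close> in addition to all earlier ones. Once every \<open>u i\<close> is annihilated, nothing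
  remains.
\<close>

lemma split_identity:
  fixes r :: nat
  assumes S: "disjoint_simple_objects C S" and b: "b \<in> Obj C"
    and s: "\<And>i. i < r \<Longrightarrow> s i \<in> S" and u: "\<And>i. i < r \<Longrightarrow> u i \<in> Mor C (s i) b" and v: "\<And>i. i < r \<Longrightarrow> v i \<in> Mor C b (s i)"
    and sum: "Ident C b = (\<Oplus>\<^bsub>Hom C b b\<^esub>i\<in>{..<r}. Comp C b (s i) b (u i) (v i))"
  shows "\<exists>ss. set ss \<subseteq> S \<and> is_biproduct C ss b"
proof -
  have SO: "t \<in> S \<Longrightarrow> t \<in> Obj C" for t using S by (simp add: disjoint_simple_objects_def simple_object_def)
  have so: "s i \<in> Obj C" if "i < r" for i using SO s that by simp
  \<comment> \<open>\<open>e\<close> is a sum of mutually orthogonal copies of simple objects inside its image.\<close>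
  let ?split = "\<lambda>e ss inj proj. set ss \<subseteq> S \<and>
      (\<forall>i < length ss. inj i \<in> Mor C (ss ! i) b \<and> proj i \<in> Mor C b (ss ! i) \<and>
        Comp C (ss ! i) b b e (inj i) = inj i \<and> Comp C b b (ss ! i) (proj i) e = proj i) \<and>
      (\<forall>i < length ss. \<forall>j < length ss. Comp C (ss ! i) b (ss ! j) (proj j) (inj i)
          = (if i = j then Ident C (ss ! i) else \<zero>\<^bsub>Hom C (ss ! i) (ss ! j)\<^esub>)) \<and>
      (\<Oplus>\<^bsub>Hom C b b\<^esub>i\<in>{..<length ss}. Comp C b (ss ! i) b (inj i) (proj i)) = e"
  have expand: "f = (\<Oplus>\<^bsub>Hom C x b\<^esub>i\<in>{..<r}. Comp C x (s i) b (u i) (Comp C x b (s i) (v i) f))"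
    if x: "x \<in> Obj C" and f: "f \<in> Mor C x b" for x f
  proof -
    have "f = Comp C x b b (Ident C b) f" by (rule comp_ident_left[OF x b f, symmetric])
    also have "\<dots> = (\<Oplus>\<^bsub>Hom C x b\<^esub>i\<in>{..<r}. Comp C x b b (Comp C b (s i) b (u i) (v i)) f)"
      unfolding sum by (rule comp_finsum_left[OF x b b f]) (use comp_closed[OF b so b v u] in auto)
    also have "\<dots> = (\<Oplus>\<^bsub>Hom C x b\<^esub>i\<in>{..<r}. Comp C x (s i) b (u i) (Comp C x b (s i) (v i) f))"
    proof (rule finsum_mor_cong[OF x b])
      fix i assume "i \<in> {..<r}"
      then have i: "i < r" by simp
      show "Comp C x b b (Comp C b (s i) b (u i) (v i)) f \<in> Mor C x b"
        by (rule comp_closed[OF x b b f comp_closed[OF b so[OF i] b v[OF i] u[OF i]]])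
      show "Comp C x b b (Comp C b (s i) b (u i) (v i)) f = Comp C x (s i) b (u i) (Comp C x b (s i) (v i) f)"
        by (rule comp_assoc[OF x b so[OF i] b f v[OF i] u[OF i], symmetric])
    qed
    finally show ?thesis .
  qed
  \<comment> \<open>The maps \<open>u i\<close> with \<open>i < k\<close> have been dealt with.\<close>
  have step: "\<exists>ss inj proj. ?split e ss inj proj"
    if "k \<le> r" "e \<in> Mor C b b" "Comp C b b b e e = e" "\<And>i. i < k \<Longrightarrow> Comp C (s i) b b e (u i) = \<zero>\<^bsub>Hom C (s i) b\<^esub>" for k e
    using that
  proof (induct "r - k" arbitrary: k e)
    case 0
    then have k: "k = r" by simp
    note e = 0(3) and kill = 0(5)[unfolded k]
    have "e = Comp C b b b e (Ident C b)" by (rule comp_ident_right[OF b b e, symmetric])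
    also have "\<dots> = (\<Oplus>\<^bsub>Hom C b b\<^esub>i\<in>{..<r}. Comp C b b b e (Comp C b (s i) b (u i) (v i)))"
      unfolding sum by (rule comp_finsum_right[OF b b b e]) (use comp_closed[OF b so b v u] in auto)
    also have "\<dots> = \<zero>\<^bsub>Hom C b b\<^esub>"
    proof (rule finsum_mor_zero[OF b b])
      fix i assume "i \<in> {..<r}"
      then have i: "i < r" by simp
      show "Comp C b b b e (Comp C b (s i) b (u i) (v i)) = \<zero>\<^bsub>Hom C b b\<^esub>"
        unfolding comp_assoc[OF b so[OF i] b b v[OF i] u[OF i] e] kill[OF i]
        by (rule comp_zero_left[OF b so[OF i] b v[OF i]])
    qed
    finally have "e = \<zero>\<^bsub>Hom C b b\<^esub>" .
    then show ?case
      using abelian_monoid.finsum_empty[OF hom_monoid[OF b b]] by (intro exI[of _ "[]"] exI[of _ "\<lambda>_. e"]) simp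
  next
    case (Suc m)
    note e = Suc(4) and ee = Suc(5) and kill = Suc(6)
    have k: "k < r" using Suc(2) by simp
    note sk = so[OF k]
    let ?eu = "Comp C (s k) b b e (u k)"
    have eu: "?eu \<in> Mor C (s k) b" by (rule comp_closed[OF sk b b u[OF k] e])
    show ?case
    proof (cases "?eu = \<zero>\<^bsub>Hom C (s k) b\<^esub>")
      case True
      show ?thesis
      proof (rule Suc(1)[of "Suc k" e])
        fix i assume "i < Suc k"
        then show "Comp C (s i) b b e (u i) = \<zero>\<^bsub>Hom C (s i) b\<^esub>" using kill True less_Suc_eq by metis
      qed (use Suc(2) k e ee in auto)
    next
      case False
      have "\<exists>a < r. Comp C (s k) b (s a) (v a) ?eu \<noteq> \<zero>\<^bsub>Hom C (s k) (s a)\<^esub>"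
      proof (rule ccontr)
        assume "\<not> ?thesis"
        then have z: "Comp C (s k) b (s a) (v a) ?eu = \<zero>\<^bsub>Hom C (s k) (s a)\<^esub>" if "a < r" for a using that by auto
        have "(\<Oplus>\<^bsub>Hom C (s k) b\<^esub>i\<in>{..<r}. Comp C (s k) (s i) b (u i) (Comp C (s k) b (s i) (v i) ?eu)) = \<zero>\<^bsub>Hom C (s k) b\<^esub>"
        proof (rule finsum_mor_zero[OF sk b])
          fix i assume "i \<in> {..<r}"
          then have i: "i < r" by simp
          show "Comp C (s k) (s i) b (u i) (Comp C (s k) b (s i) (v i) ?eu) = \<zero>\<^bsub>Hom C (s k) b\<^esub>"
            unfolding z[OF i] by (rule comp_zero_right[OF sk so[OF i] b u[OF i]])
        qed
        then show False using expand[OF sk eu] False by metis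
      qed
      then obtain a where a: "a < r" and nz: "Comp C (s k) b (s a) (v a) ?eu \<noteq> \<zero>\<^bsub>Hom C (s k) (s a)\<^esub>" by blast
      have veu: "Comp C (s k) b (s a) (v a) ?eu \<in> Mor C (s k) (s a)" by (rule comp_closed[OF sk b so[OF a] eu v[OF a]])
      have sa: "s a = s k"
      proof (rule ccontr)
        assume "s a \<noteq> s k"
        then have "Mor C (s k) (s a) = {\<zero>\<^bsub>Hom C (s k) (s a)\<^esub>}"
          using S s[OF a] s[OF k] unfolding disjoint_simple_objects_def by metis
        then show False using veu nz by simp
      qed
      have "simple_object C (s k)" using S s[OF k] by (simp add: disjoint_simple_objects_def)
      then obtain c where c: "Comp C (s k) b (s k) (v a) ?eu = c \<odot>\<^bsub>Hom C (s k) (s k)\<^esub> Ident C (s k)"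
        using veu simple_endo unfolding sa by metis
      have "c \<noteq> 0" using c nz hom_null[OF sk sk ident_closed[OF sk]] unfolding sa by metis
      have va: "v a \<in> Mor C b (s k)" using v[OF a] sa by simp
      let ?w = "inverse c \<odot>\<^bsub>Hom C b (s k)\<^esub> Comp C b b (s k) (v a) e"
      have vae: "Comp C b b (s k) (v a) e \<in> Mor C b (s k)" by (rule comp_closed[OF b b sk e va])
      have w: "?w \<in> Mor C b (s k)" by (rule hom_smult_closed[OF b sk vae])
      have e_eu: "Comp C (s k) b b e ?eu = ?eu"
        unfolding comp_assoc[OF sk b b b u[OF k] e e] ee ..
      have w_e: "Comp C b b (s k) ?w e = ?w"
        unfolding comp_smult_left[OF b b sk e vae] comp_assoc[OF b b b sk e e va, symmetric] ee ..
      have w_eu: "Comp C (s k) b (s k) ?w ?eu = Ident C (s k)"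
        unfolding comp_smult_left[OF sk b sk eu vae] comp_assoc[OF sk b b sk eu e va, symmetric] e_eu c
          hom_smult_assoc[OF sk sk ident_closed[OF sk]]
        using \<open>c \<noteq> 0\<close> hom_one[OF sk sk ident_closed[OF sk]] by simp
      let ?uw = "Comp C b (s k) b ?eu ?w"
      have uw: "?uw \<in> Mor C b b" by (rule comp_closed[OF b sk b w eu])
      have muw: "(- 1) \<odot>\<^bsub>Hom C b b\<^esub> ?uw \<in> Mor C b b" by (rule hom_smult_closed[OF b b uw])
      let ?e' = "e \<oplus>\<^bsub>Hom C b b\<^esub> (- 1) \<odot>\<^bsub>Hom C b b\<^esub> ?uw"
      have e': "?e' \<in> Mor C b b" by (rule hom_add_closed[OF b b e muw])
      have e'_left: "Comp C x b b ?e' f = Comp C x b b e f \<oplus>\<^bsub>Hom C x b\<^esub>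
          (- 1) \<odot>\<^bsub>Hom C x b\<^esub> Comp C x (s k) b ?eu (Comp C x b (s k) ?w f)"
        if x: "x \<in> Obj C" and f: "f \<in> Mor C x b" for x f
        unfolding comp_add_left[OF x b b f e muw] comp_smult_left[OF x b b f uw] comp_assoc[OF x b sk b f w eu] ..
      have e'_right: "Comp C b b x f ?e' = Comp C b b x f e \<oplus>\<^bsub>Hom C b x\<^esub>
          (- 1) \<odot>\<^bsub>Hom C b x\<^esub> Comp C b (s k) x (Comp C (s k) b x f ?eu) ?w"
        if x: "x \<in> Obj C" and f: "f \<in> Mor C b x" for x f
        unfolding comp_add_right[OF b b x e muw f] comp_smult_right[OF b b x uw f] comp_assoc[OF b sk b x w eu f] ..
      have e'_eu: "Comp C (s k) b b ?e' ?eu = \<zero>\<^bsub>Hom C (s k) b\<^esub>"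
        unfolding e'_left[OF sk eu] w_eu comp_ident_right[OF sk b eu] e_eu by (rule hom_cancel[OF sk b eu])
      have w_e': "Comp C b b (s k) ?w ?e' = \<zero>\<^bsub>Hom C b (s k)\<^esub>"
        unfolding e'_right[OF sk w] w_eu comp_ident_left[OF b sk w] w_e by (rule hom_cancel[OF b sk w])
      have e'_e: "Comp C b b b ?e' e = ?e'"
        unfolding e'_left[OF b e] ee w_e ..
      have e_e': "Comp C b b b e ?e' = ?e'"
        unfolding e'_right[OF b e] ee e_eu ..
      have e'e': "Comp C b b b ?e' ?e' = ?e'"
      proof -
        have "Comp C b b b ?e' ?e' = Comp C b b b e ?e' \<oplus>\<^bsub>Hom C b b\<^esub>
          (- 1) \<odot>\<^bsub>Hom C b b\<^esub> Comp C b (s k) b ?eu (Comp C b b (s k) ?w ?e')" by (rule e'_left[OF b e'])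
        also have "\<dots> = ?e'"
          unfolding w_e' e_e' comp_zero_right[OF b sk b eu] hom_smult_zero[OF b b] by (rule hom_zero_right[OF b b e'])
        finally show ?thesis .
      qed
      have kill': "Comp C (s i) b b ?e' (u i) = \<zero>\<^bsub>Hom C (s i) b\<^esub>" if i: "i < Suc k" for i
      proof (cases "i = k")
        case True
        have "Comp C (s k) b b ?e' (u k) = Comp C (s k) b b (Comp C b b b ?e' e) (u k)" by (simp only: e'_e)
        also have "\<dots> = \<zero>\<^bsub>Hom C (s k) b\<^esub>"
          unfolding comp_assoc[OF sk b b b u[OF k] e e', symmetric] by (rule e'_eu)
        finally show ?thesis using True by simp
      next
        case False
        then have ik: "i < k" "i < r" using i k by simp_all
        note si = so[OF ik(2)] and ui = u[OF ik(2)]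
        have "Comp C (s i) b b ?e' (u i) = Comp C (s i) b b (Comp C b b b ?e' e) (u i)" by (simp only: e'_e)
        also have "\<dots> = \<zero>\<^bsub>Hom C (s i) b\<^esub>"
          unfolding comp_assoc[OF si b b b ui e e', symmetric] kill[OF ik(1)] by (rule comp_zero_right[OF si b b e'])
        finally show ?thesis .
      qed
      have "\<exists>ss inj proj. ?split ?e' ss inj proj"
        by (rule Suc(1)[of "Suc k" ?e']) (use Suc(2) k e' e'e' kill' in auto)
      then obtain ss inj proj where sp: "?split ?e' ss inj proj" by blast
      let ?l = "length ss"
      define inj' where "inj' = (\<lambda>i. if i = ?l then ?eu else inj i)"
      define proj' where "proj' = (\<lambda>i. if i = ?l then ?w else proj i)"
      let ?ss = "ss @ [s k]"
      have tO: "ss ! i \<in> Obj C" if "i < ?l" for i using sp that SO by (meson nth_mem subsetD)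
      have inj: "inj i \<in> Mor C (ss ! i) b" and proj: "proj i \<in> Mor C b (ss ! i)"
        and e'i: "Comp C (ss ! i) b b ?e' (inj i) = inj i" and pe': "Comp C b b (ss ! i) (proj i) ?e' = proj i" if "i < ?l" for i
        using sp that by blast+
      have ei: "Comp C (ss ! i) b b e (inj i) = inj i" if i: "i < ?l" for i
      proof -
        have "Comp C (ss ! i) b b e (inj i) = Comp C (ss ! i) b b e (Comp C (ss ! i) b b ?e' (inj i))" by (simp only: e'i[OF i])
        also have "\<dots> = Comp C (ss ! i) b b (Comp C b b b e ?e') (inj i)"
          by (rule comp_assoc[OF tO[OF i] b b b inj[OF i] e' e])
        also have "\<dots> = inj i" by (simp only: e_e' e'i[OF i])
        finally show ?thesis .
      qed
      have pe: "Comp C b b (ss ! i) (proj i) e = proj i" if i: "i < ?l" for i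
      proof -
        have "Comp C b b (ss ! i) (proj i) e = Comp C b b (ss ! i) (Comp C b b (ss ! i) (proj i) ?e') e" by (simp only: pe'[OF i])
        also have "\<dots> = Comp C b b (ss ! i) (proj i) (Comp C b b b ?e' e)"
          by (rule comp_assoc[OF b b b tO[OF i] e e' proj[OF i], symmetric])
        also have "\<dots> = proj i" by (simp only: e'_e pe'[OF i])
        finally show ?thesis .
      qed
      have wi: "Comp C (ss ! i) b (s k) ?w (inj i) = \<zero>\<^bsub>Hom C (ss ! i) (s k)\<^esub>" if i: "i < ?l" for i
      proof -
        have "Comp C (ss ! i) b (s k) ?w (inj i) = Comp C (ss ! i) b (s k) ?w (Comp C (ss ! i) b b ?e' (inj i))" by (simp only: e'i[OF i])
        also have "\<dots> = Comp C (ss ! i) b (s k) (Comp C b b (s k) ?w ?e') (inj i)"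
          by (rule comp_assoc[OF tO[OF i] b b sk inj[OF i] e' w])
        also have "\<dots> = \<zero>\<^bsub>Hom C (ss ! i) (s k)\<^esub>"
          unfolding w_e' by (rule comp_zero_left[OF tO[OF i] b sk inj[OF i]])
        finally show ?thesis .
      qed
      have pu: "Comp C (s k) b (ss ! i) (proj i) ?eu = \<zero>\<^bsub>Hom C (s k) (ss ! i)\<^esub>" if i: "i < ?l" for i
      proof -
        have "Comp C (s k) b (ss ! i) (proj i) ?eu = Comp C (s k) b (ss ! i) (Comp C b b (ss ! i) (proj i) ?e') ?eu" by (simp only: pe'[OF i])
        also have "\<dots> = Comp C (s k) b (ss ! i) (proj i) (Comp C (s k) b b ?e' ?eu)"
          by (rule comp_assoc[OF sk b b tO[OF i] eu e' proj[OF i], symmetric])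
        also have "\<dots> = \<zero>\<^bsub>Hom C (s k) (ss ! i)\<^esub>"
          unfolding e'_eu by (rule comp_zero_right[OF sk b tO[OF i] proj[OF i]])
        finally show ?thesis .
      qed
      have "?split e ?ss inj' proj'"
      proof (intro conjI allI impI)
        show "set ?ss \<subseteq> S" using sp s[OF k] by simp
      next
        fix i assume "i < length ?ss"
        then have "i < ?l \<or> i = ?l" by auto
        then show "inj' i \<in> Mor C (?ss ! i) b" "proj' i \<in> Mor C b (?ss ! i)"
          "Comp C (?ss ! i) b b e (inj' i) = inj' i" "Comp C b b (?ss ! i) (proj' i) e = proj' i"
          using inj proj ei pe eu w e_eu w_e by (auto simp: inj'_def proj'_def nth_append)
      next
        fix i j assume "i < length ?ss" "j < length ?ss"
        then have "i < ?l \<or> i = ?l" "j < ?l \<or> j = ?l" by auto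
        moreover have "Comp C (ss ! i) b (ss ! j) (proj j) (inj i)
          = (if i = j then Ident C (ss ! i) else \<zero>\<^bsub>Hom C (ss ! i) (ss ! j)\<^esub>)" if "i < ?l" "j < ?l" for i j
          using sp that by blast
        ultimately show "Comp C (?ss ! i) b (?ss ! j) (proj' j) (inj' i)
          = (if i = j then Ident C (?ss ! i) else \<zero>\<^bsub>Hom C (?ss ! i) (?ss ! j)\<^esub>)"
          using wi pu w_eu by (auto simp: inj'_def proj'_def nth_append)
      next
        interpret B: abelian_group "Hom C b b" by (rule hom_group[OF b b])
        have m: "(\<lambda>i. Comp C b (ss ! i) b (inj i) (proj i)) \<in> {..<?l} \<rightarrow> Mor C b b"
          using comp_closed[OF b tO b proj inj] by auto
        have "(\<Oplus>\<^bsub>Hom C b b\<^esub>i\<in>{..<length ?ss}. Comp C b (?ss ! i) b (inj' i) (proj' i))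
          = (\<Oplus>\<^bsub>Hom C b b\<^esub>i\<in>insert ?l {..<?l}. Comp C b (?ss ! i) b (inj' i) (proj' i))"
          by (simp add: lessThan_Suc)
        also have "\<dots> = ?uw \<oplus>\<^bsub>Hom C b b\<^esub> (\<Oplus>\<^bsub>Hom C b b\<^esub>i\<in>{..<?l}. Comp C b (?ss ! i) b (inj' i) (proj' i))"
          using m uw by (subst B.finsum_insert) (auto simp: inj'_def proj'_def nth_append Pi_iff)
        also have "(\<Oplus>\<^bsub>Hom C b b\<^esub>i\<in>{..<?l}. Comp C b (?ss ! i) b (inj' i) (proj' i))
          = (\<Oplus>\<^bsub>Hom C b b\<^esub>i\<in>{..<?l}. Comp C b (ss ! i) b (inj i) (proj i))"
          using m by (intro B.finsum_cong') (auto simp: inj'_def proj'_def nth_append)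
        also have "\<dots> = ?e'" using sp by blast
        also have "?uw \<oplus>\<^bsub>Hom C b b\<^esub> ?e' = e \<oplus>\<^bsub>Hom C b b\<^esub> (?uw \<oplus>\<^bsub>Hom C b b\<^esub> (- 1) \<odot>\<^bsub>Hom C b b\<^esub> ?uw)"
          by (rule B.a_lcomm[OF uw e muw])
        also have "\<dots> = e" unfolding hom_cancel[OF b b uw] by (rule hom_zero_right[OF b b e])
        finally show "(\<Oplus>\<^bsub>Hom C b b\<^esub>i\<in>{..<length ?ss}. Comp C b (?ss ! i) b (inj' i) (proj' i)) = e" .
      qed
      then show ?thesis by blast
    qed
  qed
  have "\<exists>ss inj proj. ?split (Ident C b) ss inj proj"
    by (rule step[of 0]) (use ident_closed[OF b] comp_ident_left[OF b b ident_closed[OF b]] in auto)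
  then show ?thesis unfolding is_biproduct_def by blast
qed

lemma is_biproduct_single:
  assumes x: "x \<in> Obj C" shows "is_biproduct C [x] x"
proof -
  have "(\<Oplus>\<^bsub>Hom C x x\<^esub>i\<in>{..<length [x]}. Comp C x ([x] ! i) x (Ident C x) (Ident C x)) = Ident C x"
    by (rule finsum_mor_single[OF x x, of _ 0])
      (use ident_closed[OF x] comp_ident_left[OF x x ident_closed[OF x]] in auto)
  then show ?thesis unfolding is_biproduct_def
    using ident_closed[OF x] comp_ident_left[OF x x ident_closed[OF x]]
    by (intro exI[of _ "\<lambda>_. Ident C x"] conjI) simp_all
qed

text \<open>The structure maps are composites of those given.\<close>

lemma is_biproduct_append:
  assumes ss: "is_biproduct C ss x" and ts: "is_biproduct C ts y" and xy: "is_biproduct C [x, y] b"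
    and O: "set ss \<subseteq> Obj C" "set ts \<subseteq> Obj C" "x \<in> Obj C" "y \<in> Obj C" "b \<in> Obj C"
  shows "is_biproduct C (ss @ ts) b"
proof -
  note x = O(3) and y = O(4) and b = O(5)
  let ?m = "length ss" and ?n = "length ts"
  obtain i1 p1 where s: "\<And>i. i < ?m \<Longrightarrow> i1 i \<in> Mor C (ss ! i) x \<and> p1 i \<in> Mor C x (ss ! i)"
    "\<And>i j. i < ?m \<Longrightarrow> j < ?m \<Longrightarrow> Comp C (ss ! i) x (ss ! j) (p1 j) (i1 i)
          = (if i = j then Ident C (ss ! i) else \<zero>\<^bsub>Hom C (ss ! i) (ss ! j)\<^esub>)"
    "(\<Oplus>\<^bsub>Hom C x x\<^esub>i\<in>{..<?m}. Comp C x (ss ! i) x (i1 i) (p1 i)) = Ident C x"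
    using ss unfolding is_biproduct_def by blast
  obtain i2 p2 where t: "\<And>i. i < ?n \<Longrightarrow> i2 i \<in> Mor C (ts ! i) y \<and> p2 i \<in> Mor C y (ts ! i)"
    "\<And>i j. i < ?n \<Longrightarrow> j < ?n \<Longrightarrow> Comp C (ts ! i) y (ts ! j) (p2 j) (i2 i)
          = (if i = j then Ident C (ts ! i) else \<zero>\<^bsub>Hom C (ts ! i) (ts ! j)\<^esub>)"
    "(\<Oplus>\<^bsub>Hom C y y\<^esub>i\<in>{..<?n}. Comp C y (ts ! i) y (i2 i) (p2 i)) = Ident C y"
    using ts unfolding is_biproduct_def by blast
  obtain ib pb where bi: "\<forall>i < length [x, y]. ib i \<in> Mor C ([x, y] ! i) b \<and> pb i \<in> Mor C b ([x, y] ! i)"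
    "\<forall>i < length [x, y]. \<forall>j < length [x, y]. Comp C ([x, y] ! i) b ([x, y] ! j) (pb j) (ib i)
          = (if i = j then Ident C ([x, y] ! i) else \<zero>\<^bsub>Hom C ([x, y] ! i) ([x, y] ! j)\<^esub>)"
    "(\<Oplus>\<^bsub>Hom C b b\<^esub>i\<in>{..<length [x, y]}. Comp C b ([x, y] ! i) b (ib i) (pb i)) = Ident C b"
    using xy unfolding is_biproduct_def by blast
  define ix iy px py where "ix = ib 0" and "iy = ib 1" and "px = pb 0" and "py = pb 1"
  have ix: "ix \<in> Mor C x b" and iy: "iy \<in> Mor C y b" and px: "px \<in> Mor C b x" and py: "py \<in> Mor C b y"
    using bi(1)[rule_format, of 0] bi(1)[rule_format, of 1] by (simp_all add: ix_def iy_def px_def py_def)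
  have xx: "Comp C x b x px ix = Ident C x" and yy: "Comp C y b y py iy = Ident C y"
    and xy0: "Comp C x b y py ix = \<zero>\<^bsub>Hom C x y\<^esub>" and yx0: "Comp C y b x px iy = \<zero>\<^bsub>Hom C y x\<^esub>"
    using bi(2)[rule_format, of 0 0] bi(2)[rule_format, of 1 1] bi(2)[rule_format, of 0 1] bi(2)[rule_format, of 1 0]
    by (simp_all add: ix_def iy_def px_def py_def)
  interpret B: abelian_group "Hom C b b" by (rule hom_group[OF b b])
  have one: "Comp C b x b ix px \<oplus>\<^bsub>Hom C b b\<^esub> Comp C b y b iy py = Ident C b"
  proof -
    have c: "Comp C b x b ix px \<in> Mor C b b" "Comp C b y b iy py \<in> Mor C b b"
      by (rule comp_closed[OF b x b px ix] comp_closed[OF b y b py iy])+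
    have "{..<length [x, y]} = {0, 1}" by auto
    then have "Ident C b = (\<Oplus>\<^bsub>Hom C b b\<^esub>i\<in>{0, 1}. Comp C b ([x, y] ! i) b (ib i) (pb i))"
      using bi(3) by simp
    also have "\<dots> = Comp C b x b ix px \<oplus>\<^bsub>Hom C b b\<^esub> Comp C b y b iy py"
      using c by (simp add: ix_def iy_def px_def py_def B.finsum_insert)
    finally show ?thesis by simp
  qed
  have so: "ss ! i \<in> Obj C" if "i < ?m" for i using O(1) that by (meson nth_mem subsetD)
  have to: "ts ! i \<in> Obj C" if "i < ?n" for i using O(2) that by (meson nth_mem subsetD)
  define inj where "inj = (\<lambda>i. if i < ?m then Comp C (ss ! i) x b ix (i1 i) else Comp C (ts ! (i - ?m)) y b iy (i2 (i - ?m)))"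
  define proj where "proj = (\<lambda>i. if i < ?m then Comp C b x (ss ! i) (p1 i) px else Comp C b y (ts ! (i - ?m)) (p2 (i - ?m)) py)"
  have through: "Comp C p b q (Comp C b w q g k) (Comp C p z b h f) = Comp C p w q g (Comp C p z w (Comp C z b w k h) f)"
    if "p \<in> Obj C" "q \<in> Obj C" "z \<in> Obj C" "w \<in> Obj C" "f \<in> Mor C p z" "h \<in> Mor C z b" "k \<in> Mor C b w" "g \<in> Mor C w q" for p q z w f g h k
    unfolding comp_assoc[OF that(1) b that(4) that(2) comp_closed[OF that(1) that(3) b that(5,6)] that(7,8), symmetric]
      comp_assoc[OF that(1) that(3) b that(4) that(5,6,7)] ..
  show ?thesis unfolding is_biproduct_def
  proof (rule exI[of _ inj], rule exI[of _ proj], intro conjI allI impI)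
    fix i assume i: "i < length (ss @ ts)"
    show "inj i \<in> Mor C ((ss @ ts) ! i) b" "proj i \<in> Mor C b ((ss @ ts) ! i)"
      using i s(1)[of i] t(1)[of "i - ?m"] comp_closed[OF so x b _ ix] comp_closed[OF to y b _ iy]
        comp_closed[OF b x so px] comp_closed[OF b y to py]
      by (auto simp: inj_def proj_def nth_append)
  next
    fix i j assume ij: "i < length (ss @ ts)" "j < length (ss @ ts)"
    let ?i = "i - ?m" and ?j = "j - ?m"
    consider "i < ?m" "j < ?m" | "i < ?m" "\<not> j < ?m" "?j < ?n" | "\<not> i < ?m" "?i < ?n" "j < ?m"
      | "\<not> i < ?m" "?i < ?n" "\<not> j < ?m" "?j < ?n" using ij by fastforce
    then show "Comp C ((ss @ ts) ! i) b ((ss @ ts) ! j) (proj j) (inj i)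
      = (if i = j then Ident C ((ss @ ts) ! i) else \<zero>\<^bsub>Hom C ((ss @ ts) ! i) ((ss @ ts) ! j)\<^esub>)"
    proof cases
      case 1
      then have m: "i1 i \<in> Mor C (ss ! i) x" "p1 j \<in> Mor C x (ss ! j)" using s(1) by auto
      show ?thesis using 1 s(2)[OF 1] through[OF so[OF 1(1)] so[OF 1(2)] x x m(1) ix px m(2)]
        comp_ident_left[OF so[OF 1(1)] x m(1)] by (simp add: inj_def proj_def nth_append xx)
    next
      case 2
      then have m: "i1 i \<in> Mor C (ss ! i) x" "p2 ?j \<in> Mor C y (ts ! ?j)" using s(1) t(1) by auto
      show ?thesis using 2 through[OF so[OF 2(1)] to[OF 2(3)] x y m(1) ix py m(2)]
          comp_zero_left[OF so[OF 2(1)] x y m(1)] comp_zero_right[OF so[OF 2(1)] y to[OF 2(3)] m(2)]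
        by (auto simp: inj_def proj_def nth_append xy0)
    next
      case 3
      then have m: "i2 ?i \<in> Mor C (ts ! ?i) y" "p1 j \<in> Mor C x (ss ! j)" using s(1) t(1) by auto
      show ?thesis using 3 through[OF to[OF 3(2)] so[OF 3(3)] y x m(1) iy px m(2)]
          comp_zero_left[OF to[OF 3(2)] y x m(1)] comp_zero_right[OF to[OF 3(2)] x so[OF 3(3)] m(2)]
        by (auto simp: inj_def proj_def nth_append yx0)
    next
      case 4
      then have m: "i2 ?i \<in> Mor C (ts ! ?i) y" "p2 ?j \<in> Mor C y (ts ! ?j)" using t(1) by auto
      have "i = j \<longleftrightarrow> ?i = ?j" using 4 by auto
      then show ?thesis using 4 t(2)[OF 4(2) 4(4)] through[OF to[OF 4(2)] to[OF 4(4)] y y m(1) iy py m(2)]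
          comp_ident_left[OF to[OF 4(2)] y m(1)]
        by (auto simp: inj_def proj_def nth_append yy)
    qed
  next
    let ?f = "\<lambda>i. Comp C b ((ss @ ts) ! i) b (inj i) (proj i)"
    have sandwich: "Comp C b q b (Comp C q z b h f) (Comp C b z q g k) = Comp C b z b h (Comp C b z z (Comp C z q z f g) k)"
      if "q \<in> Obj C" "z \<in> Obj C" "k \<in> Mor C b z" "g \<in> Mor C z q" "f \<in> Mor C q z" "h \<in> Mor C z b" for q z f g h k
      unfolding comp_assoc[OF b that(1,2) b comp_closed[OF b that(2,1) that(3,4)] that(5,6), symmetric]
        comp_assoc[OF b that(2,1,2) that(3,4,5)] ..
    have f1: "?f i = Comp C b x b ix (Comp C b x x (Comp C x (ss ! i) x (i1 i) (p1 i)) px)" if "i < ?m" for i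
      using that s(1)[OF that] sandwich[OF so[OF that] x px _ _ ix] by (simp add: inj_def proj_def nth_append)
    have f2: "?f (i + ?m) = Comp C b y b iy (Comp C b y y (Comp C y (ts ! i) y (i2 i) (p2 i)) py)" if "i < ?n" for i
      using that t(1)[OF that] sandwich[OF to[OF that] y py _ _ iy] by (simp add: inj_def proj_def nth_append)
    have c1: "Comp C x (ss ! i) x (i1 i) (p1 i) \<in> Mor C x x" if "i < ?m" for i
      using s(1)[OF that] comp_closed[OF x so[OF that] x] by blast
    have c2: "Comp C y (ts ! i) y (i2 i) (p2 i) \<in> Mor C y y" if "i < ?n" for i
      using t(1)[OF that] comp_closed[OF y to[OF that] y] by blast
    have d1: "Comp C b x x (Comp C x (ss ! i) x (i1 i) (p1 i)) px \<in> Mor C b x" if "i < ?m" for i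
      by (rule comp_closed[OF b x x px c1[OF that]])
    have d2: "Comp C b y y (Comp C y (ts ! i) y (i2 i) (p2 i)) py \<in> Mor C b y" if "i < ?n" for i
      by (rule comp_closed[OF b y y py c2[OF that]])
    have m1: "?f i \<in> Mor C b b" if "i < ?m" for i unfolding f1[OF that] by (rule comp_closed[OF b x b d1[OF that] ix])
    have m2: "?f (i + ?m) \<in> Mor C b b" if "i < ?n" for i unfolding f2[OF that] by (rule comp_closed[OF b y b d2[OF that] iy])
    have "{..<length (ss @ ts)} = {..<?m} \<union> (\<lambda>i. i + ?m) ` {..<?n}"
    proof (intro equalityI subsetI)
      fix i assume "i \<in> {..<length (ss @ ts)}"
      then show "i \<in> {..<?m} \<union> (\<lambda>i. i + ?m) ` {..<?n}"
        by (cases "i < ?m") (auto intro!: image_eqI[of _ _ "i - ?m"])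
    qed auto
    then have "(\<Oplus>\<^bsub>Hom C b b\<^esub>i\<in>{..<length (ss @ ts)}. ?f i)
      = (\<Oplus>\<^bsub>Hom C b b\<^esub>i\<in>{..<?m} \<union> (\<lambda>i. i + ?m) ` {..<?n}. ?f i)" by (simp only:)
    also have "\<dots> = (\<Oplus>\<^bsub>Hom C b b\<^esub>i\<in>{..<?m}. ?f i) \<oplus>\<^bsub>Hom C b b\<^esub> (\<Oplus>\<^bsub>Hom C b b\<^esub>i\<in>(\<lambda>i. i + ?m) ` {..<?n}. ?f i)"
      using m1 m2 by (intro B.finsum_Un_disjoint) auto
    also have "(\<Oplus>\<^bsub>Hom C b b\<^esub>i\<in>(\<lambda>i. i + ?m) ` {..<?n}. ?f i) = (\<Oplus>\<^bsub>Hom C b b\<^esub>i\<in>{..<?n}. ?f (i + ?m))"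
      using m2 by (intro B.finsum_reindex) (auto simp: inj_on_def)
    also have "(\<Oplus>\<^bsub>Hom C b b\<^esub>i\<in>{..<?m}. ?f i)
      = (\<Oplus>\<^bsub>Hom C b b\<^esub>i\<in>{..<?m}. Comp C b x b ix (Comp C b x x (Comp C x (ss ! i) x (i1 i) (p1 i)) px))"
      using m1 f1 by (intro finsum_mor_cong[OF b b]) auto
    also have "\<dots> = Comp C b x b ix (\<Oplus>\<^bsub>Hom C b x\<^esub>i\<in>{..<?m}. Comp C b x x (Comp C x (ss ! i) x (i1 i) (p1 i)) px)"
      by (rule comp_finsum_right[OF b x b ix, symmetric]) (use d1 in auto)
    also have "(\<Oplus>\<^bsub>Hom C b x\<^esub>i\<in>{..<?m}. Comp C b x x (Comp C x (ss ! i) x (i1 i) (p1 i)) px) = Comp C b x x (\<Oplus>\<^bsub>Hom C x x\<^esub>i\<in>{..<?m}. Comp C x (ss ! i) x (i1 i) (p1 i)) px"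
      by (rule comp_finsum_left[OF b x x px, symmetric]) (use c1 in auto)
    also have "\<dots> = px" by (simp only: s(3) comp_ident_left[OF b x px])
    also have "(\<Oplus>\<^bsub>Hom C b b\<^esub>i\<in>{..<?n}. ?f (i + ?m))
      = (\<Oplus>\<^bsub>Hom C b b\<^esub>i\<in>{..<?n}. Comp C b y b iy (Comp C b y y (Comp C y (ts ! i) y (i2 i) (p2 i)) py))"
      using m2 f2 by (intro finsum_mor_cong[OF b b]) auto
    also have "\<dots> = Comp C b y b iy (\<Oplus>\<^bsub>Hom C b y\<^esub>i\<in>{..<?n}. Comp C b y y (Comp C y (ts ! i) y (i2 i) (p2 i)) py)"
      by (rule comp_finsum_right[OF b y b iy, symmetric]) (use d2 in auto)
    also have "(\<Oplus>\<^bsub>Hom C b y\<^esub>i\<in>{..<?n}. Comp C b y y (Comp C y (ts ! i) y (i2 i) (p2 i)) py) = Comp C b y y (\<Oplus>\<^bsub>Hom C y y\<^esub>i\<in>{..<?n}. Comp C y (ts ! i) y (i2 i) (p2 i)) py"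
      by (rule comp_finsum_left[OF b y y py, symmetric]) (use c2 in auto)
    also have "\<dots> = py" by (simp only: t(3) comp_ident_left[OF b y py])
    finally show "(\<Oplus>\<^bsub>Hom C b b\<^esub>i\<in>{..<length (ss @ ts)}. ?f i) = Ident C b" using one by simp
  qed
qed

end

section \<open>Idempotents and formal sums\<close>

lemma Obj_Kar: "(x, p) \<in> Obj (Kar C) \<longleftrightarrow> x \<in> Obj C \<and> p \<in> Mor C x x \<and> Comp C x x x p p = p"
  by (simp add: Kar_def)

lemma Mor_Kar: "f \<in> Mor (Kar C) (x, p) (y, r) \<longleftrightarrow> f \<in> Mor C x y \<and> Comp C x x y f p = f \<and> Comp C x y y r f = f"
  by (simp add: Kar_def)

lemma Hom_Kar:
  "add (Hom (Kar C) (x, p) (y, r)) = add (Hom C x y)" "zero (Hom (Kar C) (x, p) (y, r)) = zero (Hom C x y)"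
  "smult (Hom (Kar C) (x, p) (y, r)) = smult (Hom C x y)"
  by (simp_all add: Kar_def)

lemma Ident_Kar: "Ident (Kar C) (x, p) = p"
  by (simp add: Kar_def)

lemma Comp_Kar: "Comp (Kar C) (x, p) (y, r) (z, t) = Comp C x y z"
  by (simp add: Kar_def)

lemma linear_category_Kar:
  assumes C: "linear_category C" shows "linear_category (Kar C)"
proof -
  interpret C: linear_category C by (rule C)
  have vs: "vectorspace class_ring (Hom (Kar C) (x, p) (y, r))"
    if xp: "(x, p) \<in> Obj (Kar C)" and yr: "(y, r) \<in> Obj (Kar C)" for x p y r
  proof -
    have x: "x \<in> Obj C" "p \<in> Mor C x x" and y: "y \<in> Obj C" "r \<in> Mor C y y" using xp yr by (simp_all add: Obj_Kar)
    interpret V: vectorspace class_ring "Hom C x y" by (rule C.hom_vectorspace[OF x(1) y(1)])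
    show ?thesis
      by (rule complex_vectorspaceI)
        (auto simp: Mor_Kar Hom_Kar x y V.a_ac V.smult_l_distr[simplified] V.smult_r_distr[simplified]
          C.comp_add_left C.comp_add_right C.comp_smult_left C.comp_smult_right C.comp_zero_left C.comp_zero_right
          C.hom_smult_assoc C.hom_one C.hom_null C.hom_smult_closed C.hom_distr)
  qed
  have O: "x \<in> Obj C" if "(x, p) \<in> Obj (Kar C)" for x p using that by (simp add: Obj_Kar)
  show ?thesis
  proof (rule linear_category.intro)
    fix a b assume "a \<in> Obj (Kar C)" "b \<in> Obj (Kar C)"
    then show "vectorspace class_ring (Hom (Kar C) a b)" using vs by (cases a; cases b) simp
  next
    fix a assume "a \<in> Obj (Kar C)"
    then show "Ident (Kar C) a \<in> Mor (Kar C) a a" by (cases a) (simp add: Obj_Kar Mor_Kar Ident_Kar)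
  next
    fix a b c f g assume abc: "a \<in> Obj (Kar C)" "b \<in> Obj (Kar C)" "c \<in> Obj (Kar C)"
      and f: "f \<in> Mor (Kar C) a b" and g: "g \<in> Mor (Kar C) b c"
    obtain x p y r z t where e: "a = (x, p)" "b = (y, r)" "c = (z, t)" by (cases a; cases b; cases c)
    have o: "x \<in> Obj C" "y \<in> Obj C" "z \<in> Obj C" and p: "p \<in> Mor C x x" "t \<in> Mor C z z" using abc e by (simp_all add: Obj_Kar)
    have fg: "f \<in> Mor C x y" "g \<in> Mor C y z" "Comp C x x y f p = f" "Comp C y z z t g = g" using f g e by (simp_all add: Mor_Kar)
    have "Comp C x x z (Comp C x y z g f) p = Comp C x y z g f"
      using C.comp_assoc[OF o(1) o(1) o(2,3) p(1) fg(1,2)] fg(3) by simp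
    moreover have "Comp C x z z t (Comp C x y z g f) = Comp C x y z g f"
      using C.comp_assoc[OF o(1) o(2,3) o(3) fg(1,2) p(2)] fg(4) by simp
    ultimately show "Comp (Kar C) a b c g f \<in> Mor (Kar C) a c"
      using C.comp_closed[OF o fg(1,2)] by (simp add: e Comp_Kar Mor_Kar)
  next
    fix a b f assume "a \<in> Obj (Kar C)" "b \<in> Obj (Kar C)" "f \<in> Mor (Kar C) a b"
    then show "Comp (Kar C) a a b f (Ident (Kar C) a) = f" "Comp (Kar C) a b b (Ident (Kar C) b) f = f"
      by (cases a; cases b; simp add: Obj_Kar Mor_Kar Ident_Kar Comp_Kar)+
  next
    fix a b c d f g h assume "a \<in> Obj (Kar C)" "b \<in> Obj (Kar C)" "c \<in> Obj (Kar C)" "d \<in> Obj (Kar C)"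
      "f \<in> Mor (Kar C) a b" "g \<in> Mor (Kar C) b c" "h \<in> Mor (Kar C) c d"
    then show "Comp (Kar C) a c d h (Comp (Kar C) a b c g f) = Comp (Kar C) a b d (Comp (Kar C) b c d h g) f"
      by (cases a; cases b; cases c; cases d) (simp add: Obj_Kar Mor_Kar Comp_Kar C.comp_assoc)
  next
    fix a b c f f' g assume "a \<in> Obj (Kar C)" "b \<in> Obj (Kar C)" "c \<in> Obj (Kar C)"
      "f \<in> Mor (Kar C) a b" "f' \<in> Mor (Kar C) a b" "g \<in> Mor (Kar C) b c"
    then show "Comp (Kar C) a b c g (f \<oplus>\<^bsub>Hom (Kar C) a b\<^esub> f')
        = Comp (Kar C) a b c g f \<oplus>\<^bsub>Hom (Kar C) a c\<^esub> Comp (Kar C) a b c g f'"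
      by (cases a; cases b; cases c) (simp add: Obj_Kar Mor_Kar Comp_Kar Hom_Kar C.comp_add_right)
  next
    fix a b c f g g' assume "a \<in> Obj (Kar C)" "b \<in> Obj (Kar C)" "c \<in> Obj (Kar C)"
      "f \<in> Mor (Kar C) a b" "g \<in> Mor (Kar C) b c" "g' \<in> Mor (Kar C) b c"
    then show "Comp (Kar C) a b c (g \<oplus>\<^bsub>Hom (Kar C) b c\<^esub> g') f
        = Comp (Kar C) a b c g f \<oplus>\<^bsub>Hom (Kar C) a c\<^esub> Comp (Kar C) a b c g' f"
      by (cases a; cases b; cases c) (simp add: Obj_Kar Mor_Kar Comp_Kar Hom_Kar C.comp_add_left)
  next
    fix a b c f g and k :: complex assume "a \<in> Obj (Kar C)" "b \<in> Obj (Kar C)" "c \<in> Obj (Kar C)"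
      "f \<in> Mor (Kar C) a b" "g \<in> Mor (Kar C) b c"
    then show "Comp (Kar C) a b c g (k \<odot>\<^bsub>Hom (Kar C) a b\<^esub> f) = k \<odot>\<^bsub>Hom (Kar C) a c\<^esub> Comp (Kar C) a b c g f"
      "Comp (Kar C) a b c (k \<odot>\<^bsub>Hom (Kar C) b c\<^esub> g) f = k \<odot>\<^bsub>Hom (Kar C) a c\<^esub> Comp (Kar C) a b c g f"
      by (cases a; cases b; cases c; simp add: Obj_Kar Mor_Kar Comp_Kar Hom_Kar C.comp_smult_right C.comp_smult_left)+
  qed
qed

lemma Obj_Mat: "xs \<in> Obj (Mat C) \<longleftrightarrow> set xs \<subseteq> Obj C"
  by (simp add: Mat_def)

lemma Mor_Mat: "A \<in> Mor (Mat C) xs ys \<longleftrightarrow> dim_row A = length ys \<and> dim_col A = length xs \<and>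
    (\<forall>i < length ys. \<forall>j < length xs. A $$ (i, j) \<in> Mor C (xs ! j) (ys ! i))"
  by (auto simp: Mat_def mat_hom_def)

lemma Hom_Mat:
  "\<zero>\<^bsub>Hom (Mat C) xs ys\<^esub> = mat (length ys) (length xs) (\<lambda>(i, j). \<zero>\<^bsub>Hom C (xs ! j) (ys ! i)\<^esub>)"
  "A \<oplus>\<^bsub>Hom (Mat C) xs ys\<^esub> B = mat (length ys) (length xs) (\<lambda>(i, j). A $$ (i, j) \<oplus>\<^bsub>Hom C (xs ! j) (ys ! i)\<^esub> B $$ (i, j))"
  "c \<odot>\<^bsub>Hom (Mat C) xs ys\<^esub> A = mat (length ys) (length xs) (\<lambda>(i, j). c \<odot>\<^bsub>Hom C (xs ! j) (ys ! i)\<^esub> A $$ (i, j))"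
  by (simp_all add: Mat_def mat_hom_def)

lemma Ident_Mat: "Ident (Mat C) xs = mat (length xs) (length xs)
    (\<lambda>(i, j). if i = j then Ident C (xs ! j) else \<zero>\<^bsub>Hom C (xs ! j) (xs ! i)\<^esub>)"
  by (simp add: Mat_def)

lemma Comp_Mat: "Comp (Mat C) xs ys zs B A = mat (length zs) (length xs)
    (\<lambda>(i, j). \<Oplus>\<^bsub>Hom C (xs ! j) (zs ! i)\<^esub>k\<in>{..<length ys}. Comp C (xs ! j) (ys ! k) (zs ! i) (B $$ (i, k)) (A $$ (k, j)))"
  by (simp add: Mat_def)

lemma linear_category_Mat:
  assumes C: "linear_category C" shows "linear_category (Mat C)"
proof -
  interpret C: linear_category C by (rule C)
  have nth: "xs ! i \<in> Obj C" if "xs \<in> Obj (Mat C)" "i < length xs" for xs i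
    using that by (auto simp: Obj_Mat)
  have ent: "A $$ (i, j) \<in> Mor C (xs ! j) (ys ! i)" if "A \<in> Mor (Mat C) xs ys" "i < length ys" "j < length xs" for A xs ys i j
    using that by (simp add: Mor_Mat)
  show ?thesis
  proof (rule linear_category.intro)
    fix xs ys assume xs: "xs \<in> Obj (Mat C)" and ys: "ys \<in> Obj (Mat C)"
    note m = C.hom_module[OF nth[OF xs] nth[OF ys]] and g = C.hom_group[OF nth[OF xs] nth[OF ys]]
    show "vectorspace class_ring (Hom (Mat C) xs ys)"
    proof (rule complex_vectorspaceI)
      fix A B assume AB: "A \<in> Mor (Mat C) xs ys" "B \<in> Mor (Mat C) xs ys"
      show "A \<oplus>\<^bsub>Hom (Mat C) xs ys\<^esub> B = B \<oplus>\<^bsub>Hom (Mat C) xs ys\<^esub> A"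
        unfolding Hom_Mat by (rule eq_matI) (simp_all add: abelian_monoid.a_comm[OF C.hom_monoid[OF nth[OF xs] nth[OF ys]]] ent AB)
      fix D assume D: "D \<in> Mor (Mat C) xs ys"
      show "(A \<oplus>\<^bsub>Hom (Mat C) xs ys\<^esub> B) \<oplus>\<^bsub>Hom (Mat C) xs ys\<^esub> D = A \<oplus>\<^bsub>Hom (Mat C) xs ys\<^esub> (B \<oplus>\<^bsub>Hom (Mat C) xs ys\<^esub> D)"
        unfolding Hom_Mat by (rule eq_matI) (simp_all add: abelian_monoid.a_assoc[OF C.hom_monoid[OF nth[OF xs] nth[OF ys]]] ent AB D)
    next
      fix A B and c :: complex assume A: "A \<in> Mor (Mat C) xs ys" and B: "B \<in> Mor (Mat C) xs ys"
      show "A \<oplus>\<^bsub>Hom (Mat C) xs ys\<^esub> B \<in> Mor (Mat C) xs ys"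
        using A B unfolding Hom_Mat by (auto simp: Mor_Mat C.hom_add_closed nth[OF xs] nth[OF ys])
      show "c \<odot>\<^bsub>Hom (Mat C) xs ys\<^esub> (A \<oplus>\<^bsub>Hom (Mat C) xs ys\<^esub> B)
          = c \<odot>\<^bsub>Hom (Mat C) xs ys\<^esub> A \<oplus>\<^bsub>Hom (Mat C) xs ys\<^esub> c \<odot>\<^bsub>Hom (Mat C) xs ys\<^esub> B"
        unfolding Hom_Mat by (rule eq_matI) (simp_all add: module.smult_r_distr[OF m] ent A B)
    next
      fix A and a b :: complex assume A: "A \<in> Mor (Mat C) xs ys"
      show "\<zero>\<^bsub>Hom (Mat C) xs ys\<^esub> \<oplus>\<^bsub>Hom (Mat C) xs ys\<^esub> A = A"
        using A unfolding Hom_Mat by (intro eq_matI) (auto simp: Mor_Mat C.hom_zero_left nth[OF xs] nth[OF ys])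
      show "a \<odot>\<^bsub>Hom (Mat C) xs ys\<^esub> A \<in> Mor (Mat C) xs ys"
        using A unfolding Hom_Mat by (auto simp: Mor_Mat C.hom_smult_closed nth[OF xs] nth[OF ys])
      show "(a + b) \<odot>\<^bsub>Hom (Mat C) xs ys\<^esub> A = a \<odot>\<^bsub>Hom (Mat C) xs ys\<^esub> A \<oplus>\<^bsub>Hom (Mat C) xs ys\<^esub> b \<odot>\<^bsub>Hom (Mat C) xs ys\<^esub> A"
        using A unfolding Hom_Mat by (intro eq_matI) (auto simp: Mor_Mat C.hom_distr nth[OF xs] nth[OF ys])
      show "(a * b) \<odot>\<^bsub>Hom (Mat C) xs ys\<^esub> A = a \<odot>\<^bsub>Hom (Mat C) xs ys\<^esub> (b \<odot>\<^bsub>Hom (Mat C) xs ys\<^esub> A)"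
        using A unfolding Hom_Mat by (intro eq_matI) (auto simp: Mor_Mat C.hom_smult_assoc nth[OF xs] nth[OF ys])
      show "1 \<odot>\<^bsub>Hom (Mat C) xs ys\<^esub> A = A"
        using A unfolding Hom_Mat by (intro eq_matI) (auto simp: Mor_Mat C.hom_one nth[OF xs] nth[OF ys])
      show "0 \<odot>\<^bsub>Hom (Mat C) xs ys\<^esub> A = \<zero>\<^bsub>Hom (Mat C) xs ys\<^esub>"
        using A unfolding Hom_Mat by (intro eq_matI) (auto simp: Mor_Mat C.hom_null nth[OF xs] nth[OF ys])
    next
      show "\<zero>\<^bsub>Hom (Mat C) xs ys\<^esub> \<in> Mor (Mat C) xs ys"
        unfolding Hom_Mat by (auto simp: Mor_Mat C.hom_zero_closed nth[OF xs] nth[OF ys])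
    qed
  next
    fix xs assume xs: "xs \<in> Obj (Mat C)"
    show "Ident (Mat C) xs \<in> Mor (Mat C) xs xs"
      unfolding Ident_Mat by (auto simp: Mor_Mat C.ident_closed C.hom_zero_closed nth[OF xs])
  next
    fix xs ys zs A B assume xs: "xs \<in> Obj (Mat C)" and ys: "ys \<in> Obj (Mat C)" and zs: "zs \<in> Obj (Mat C)"
      and A: "A \<in> Mor (Mat C) xs ys" and B: "B \<in> Mor (Mat C) ys zs"
    have c: "Comp C (xs ! j) (ys ! k) (zs ! i) (B $$ (i, k)) (A $$ (k, j)) \<in> Mor C (xs ! j) (zs ! i)"
      if "j < length xs" "k < length ys" "i < length zs" for i j k
      by (rule C.comp_closed[OF nth[OF xs] nth[OF ys] nth[OF zs] ent[OF A] ent[OF B]]) (use that in auto)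
    then show "Comp (Mat C) xs ys zs B A \<in> Mor (Mat C) xs zs"
      unfolding Comp_Mat by (auto simp: Mor_Mat intro!: C.finsum_mor_closed nth[OF xs] nth[OF zs])
  next
    fix xs ys A assume xs: "xs \<in> Obj (Mat C)" and ys: "ys \<in> Obj (Mat C)" and A: "A \<in> Mor (Mat C) xs ys"
    have dim: "dim_row A = length ys" "dim_col A = length xs" using A by (simp_all add: Mor_Mat)
    show "Comp (Mat C) xs xs ys A (Ident (Mat C) xs) = A"
    proof (rule eq_matI)
      fix i j assume ij: "i < dim_row A" "j < dim_col A"
      note o = nth[OF xs, of j] nth[OF ys, of i] and a = ent[OF A, of i j]
      have "(\<Oplus>\<^bsub>Hom C (xs ! j) (ys ! i)\<^esub>k\<in>{..<length xs}. Comp C (xs ! j) (xs ! k) (ys ! i) (A $$ (i, k)) (Ident (Mat C) xs $$ (k, j))) = A $$ (i, j)"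
      proof (rule C.finsum_mor_single[of _ _ _ j])
        fix k assume "k \<in> {..<length xs}"
        then have k: "k < length xs" by simp
        show "Comp C (xs ! j) (xs ! k) (ys ! i) (A $$ (i, k)) (Ident (Mat C) xs $$ (k, j))
          = (if k = j then A $$ (i, j) else \<zero>\<^bsub>Hom C (xs ! j) (ys ! i)\<^esub>)"
          using C.comp_ident_right[OF o] C.comp_zero_right[OF nth[OF xs, of j] nth[OF xs k] nth[OF ys, of i] ent[OF A, of i k]] a ij k dim
          by (simp add: Ident_Mat)
      qed (use o a ij dim in auto)
      then show "Comp (Mat C) xs xs ys A (Ident (Mat C) xs) $$ (i, j) = A $$ (i, j)" using ij dim by (simp add: Comp_Mat)
    qed (simp_all add: Comp_Mat dim)
    show "Comp (Mat C) xs ys ys (Ident (Mat C) ys) A = A"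
    proof (rule eq_matI)
      fix i j assume ij: "i < dim_row A" "j < dim_col A"
      note o = nth[OF xs, of j] nth[OF ys, of i] and a = ent[OF A, of i j]
      have "(\<Oplus>\<^bsub>Hom C (xs ! j) (ys ! i)\<^esub>k\<in>{..<length ys}. Comp C (xs ! j) (ys ! k) (ys ! i) (Ident (Mat C) ys $$ (i, k)) (A $$ (k, j))) = A $$ (i, j)"
      proof (rule C.finsum_mor_single[of _ _ _ i])
        fix k assume "k \<in> {..<length ys}"
        then have k: "k < length ys" by simp
        show "Comp C (xs ! j) (ys ! k) (ys ! i) (Ident (Mat C) ys $$ (i, k)) (A $$ (k, j))
          = (if k = i then A $$ (i, j) else \<zero>\<^bsub>Hom C (xs ! j) (ys ! i)\<^esub>)"
          using C.comp_ident_left[OF o] C.comp_zero_left[OF nth[OF xs, of j] nth[OF ys k] nth[OF ys, of i] ent[OF A, of k j]] a ij k dim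
          by (simp add: Ident_Mat)
      qed (use o a ij dim in auto)
      then show "Comp (Mat C) xs ys ys (Ident (Mat C) ys) A $$ (i, j) = A $$ (i, j)" using ij dim by (simp add: Comp_Mat)
    qed (simp_all add: Comp_Mat dim)
  next
    fix ws xs ys zs A B D assume ws: "ws \<in> Obj (Mat C)" and xs: "xs \<in> Obj (Mat C)" and ys: "ys \<in> Obj (Mat C)" and zs: "zs \<in> Obj (Mat C)"
      and A: "A \<in> Mor (Mat C) ws xs" and B: "B \<in> Mor (Mat C) xs ys" and D: "D \<in> Mor (Mat C) ys zs"
    show "Comp (Mat C) ws ys zs D (Comp (Mat C) ws xs ys B A) = Comp (Mat C) ws xs zs (Comp (Mat C) xs ys zs D B) A"
    proof (rule eq_matI)
      fix i j assume "i < dim_row (Comp (Mat C) ws xs zs (Comp (Mat C) xs ys zs D B) A)"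
        "j < dim_col (Comp (Mat C) ws xs zs (Comp (Mat C) xs ys zs D B) A)"
      then have ij: "i < length zs" "j < length ws" by (simp_all add: Comp_Mat)
      let ?w = "ws ! j" and ?z = "zs ! i"
      note w = nth[OF ws ij(2)] and z = nth[OF zs ij(1)]
      have x: "xs ! k \<in> Obj C" "A $$ (k, j) \<in> Mor C ?w (xs ! k)" if "k < length xs" for k using nth[OF xs that] ent[OF A that ij(2)] by simp_all
      have y: "ys ! l \<in> Obj C" "D $$ (i, l) \<in> Mor C (ys ! l) ?z" if "l < length ys" for l using nth[OF ys that] ent[OF D ij(1) that] by simp_all
      note b = ent[OF B]
      have BA: "Comp C ?w (xs ! k) (ys ! l) (B $$ (l, k)) (A $$ (k, j)) \<in> Mor C ?w (ys ! l)" if "k < length xs" "l < length ys" for k l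
        by (rule C.comp_closed[OF w x(1)[OF that(1)] y(1)[OF that(2)] x(2)[OF that(1)] b[OF that(2,1)]])
      have DB: "Comp C (xs ! k) (ys ! l) ?z (D $$ (i, l)) (B $$ (l, k)) \<in> Mor C (xs ! k) ?z" if "k < length xs" "l < length ys" for k l
        by (rule C.comp_closed[OF x(1)[OF that(1)] y(1)[OF that(2)] z b[OF that(2,1)] y(2)[OF that(2)]])
      let ?t = "\<lambda>l k. Comp C ?w (ys ! l) ?z (D $$ (i, l)) (Comp C ?w (xs ! k) (ys ! l) (B $$ (l, k)) (A $$ (k, j)))"
      have t: "?t l k \<in> Mor C ?w ?z" if "k < length xs" "l < length ys" for k l
        by (rule C.comp_closed[OF w y(1)[OF that(2)] z BA[OF that] y(2)[OF that(2)]])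
      have "Comp (Mat C) ws ys zs D (Comp (Mat C) ws xs ys B A) $$ (i, j)
        = (\<Oplus>\<^bsub>Hom C ?w ?z\<^esub>l\<in>{..<length ys}. Comp C ?w (ys ! l) ?z (D $$ (i, l)) (Comp (Mat C) ws xs ys B A $$ (l, j)))"
        using ij by (subst Comp_Mat) simp
      also have "\<dots> = (\<Oplus>\<^bsub>Hom C ?w ?z\<^esub>l\<in>{..<length ys}. \<Oplus>\<^bsub>Hom C ?w ?z\<^esub>k\<in>{..<length xs}. ?t l k)"
      proof (rule C.finsum_mor_cong[OF w z])
        fix l assume "l \<in> {..<length ys}"
        then have l: "l < length ys" by simp
        show eq: "Comp C ?w (ys ! l) ?z (D $$ (i, l)) (Comp (Mat C) ws xs ys B A $$ (l, j)) = (\<Oplus>\<^bsub>Hom C ?w ?z\<^esub>k\<in>{..<length xs}. ?t l k)"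
          using ij l C.comp_finsum_right[OF w y(1)[OF l] z y(2)[OF l], of "{..<length xs}" "\<lambda>k. Comp C ?w (xs ! k) (ys ! l) (B $$ (l, k)) (A $$ (k, j))"] BA
          by (simp add: Comp_Mat)
        show "Comp C ?w (ys ! l) ?z (D $$ (i, l)) (Comp (Mat C) ws xs ys B A $$ (l, j)) \<in> Mor C ?w ?z"
          unfolding eq by (rule C.finsum_mor_closed[OF w z]) (use t l in simp)
      qed
      also have "\<dots> = (\<Oplus>\<^bsub>Hom C ?w ?z\<^esub>k\<in>{..<length xs}. \<Oplus>\<^bsub>Hom C ?w ?z\<^esub>l\<in>{..<length ys}. ?t l k)"
        by (rule abelian_monoid.finsum_swap[OF C.hom_monoid[OF w z]]) (use t in auto)
      also have "\<dots> = (\<Oplus>\<^bsub>Hom C ?w ?z\<^esub>k\<in>{..<length xs}. Comp C ?w (xs ! k) ?z (Comp (Mat C) xs ys zs D B $$ (i, k)) (A $$ (k, j)))"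
      proof (rule C.finsum_mor_cong[OF w z])
        fix k assume "k \<in> {..<length xs}"
        then have k: "k < length xs" by simp
        show "(\<Oplus>\<^bsub>Hom C ?w ?z\<^esub>l\<in>{..<length ys}. ?t l k) \<in> Mor C ?w ?z"
          by (rule C.finsum_mor_closed[OF w z]) (use t k in simp)
        have "(\<Oplus>\<^bsub>Hom C ?w ?z\<^esub>l\<in>{..<length ys}. ?t l k)
          = (\<Oplus>\<^bsub>Hom C ?w ?z\<^esub>l\<in>{..<length ys}. Comp C ?w (xs ! k) ?z (Comp C (xs ! k) (ys ! l) ?z (D $$ (i, l)) (B $$ (l, k))) (A $$ (k, j)))"
        proof (rule C.finsum_mor_cong[OF w z])
          fix l assume "l \<in> {..<length ys}"
          then have l: "l < length ys" by simp
          show "?t l k \<in> Mor C ?w ?z" by (rule t[OF k l])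
          show "?t l k = Comp C ?w (xs ! k) ?z (Comp C (xs ! k) (ys ! l) ?z (D $$ (i, l)) (B $$ (l, k))) (A $$ (k, j))"
            by (rule C.comp_assoc[OF w x(1)[OF k] y(1)[OF l] z x(2)[OF k] b[OF l k] y(2)[OF l]])
        qed
        also have "\<dots> = Comp C ?w (xs ! k) ?z (\<Oplus>\<^bsub>Hom C (xs ! k) ?z\<^esub>l\<in>{..<length ys}. Comp C (xs ! k) (ys ! l) ?z (D $$ (i, l)) (B $$ (l, k))) (A $$ (k, j))"
          by (rule C.comp_finsum_left[OF w x(1)[OF k] z x(2)[OF k], symmetric]) (use DB k in auto)
        also have "\<dots> = Comp C ?w (xs ! k) ?z (Comp (Mat C) xs ys zs D B $$ (i, k)) (A $$ (k, j))"
          using ij k by (simp add: Comp_Mat)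
        finally show "(\<Oplus>\<^bsub>Hom C ?w ?z\<^esub>l\<in>{..<length ys}. ?t l k) = Comp C ?w (xs ! k) ?z (Comp (Mat C) xs ys zs D B $$ (i, k)) (A $$ (k, j))" .
      qed
      also have "\<dots> = Comp (Mat C) ws xs zs (Comp (Mat C) xs ys zs D B) A $$ (i, j)"
        using ij by (subst (2) Comp_Mat) simp
      finally show "Comp (Mat C) ws ys zs D (Comp (Mat C) ws xs ys B A) $$ (i, j) = Comp (Mat C) ws xs zs (Comp (Mat C) xs ys zs D B) A $$ (i, j)" .
    qed (simp_all add: Comp_Mat)
  next
    fix xs ys zs A A' B assume xs: "xs \<in> Obj (Mat C)" and ys: "ys \<in> Obj (Mat C)" and zs: "zs \<in> Obj (Mat C)"
      and A: "A \<in> Mor (Mat C) xs ys" and A': "A' \<in> Mor (Mat C) xs ys" and B: "B \<in> Mor (Mat C) ys zs"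
    show "Comp (Mat C) xs ys zs B (A \<oplus>\<^bsub>Hom (Mat C) xs ys\<^esub> A') = Comp (Mat C) xs ys zs B A \<oplus>\<^bsub>Hom (Mat C) xs zs\<^esub> Comp (Mat C) xs ys zs B A'"
    proof (rule eq_matI)
      fix i j assume "i < dim_row (Comp (Mat C) xs ys zs B A \<oplus>\<^bsub>Hom (Mat C) xs zs\<^esub> Comp (Mat C) xs ys zs B A')"
        "j < dim_col (Comp (Mat C) xs ys zs B A \<oplus>\<^bsub>Hom (Mat C) xs zs\<^esub> Comp (Mat C) xs ys zs B A')"
      then have ij: "i < length zs" "j < length xs" by (simp_all add: Hom_Mat)
      note x = nth[OF xs ij(2)] and z = nth[OF zs ij(1)]
      note c = C.comp_closed[OF x nth[OF ys] z ent[OF A _ ij(2)] ent[OF B ij(1)]] C.comp_closed[OF x nth[OF ys] z ent[OF A' _ ij(2)] ent[OF B ij(1)]]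
      have "(\<Oplus>\<^bsub>Hom C (xs ! j) (zs ! i)\<^esub>k\<in>{..<length ys}. Comp C (xs ! j) (ys ! k) (zs ! i) (B $$ (i, k)) ((A \<oplus>\<^bsub>Hom (Mat C) xs ys\<^esub> A') $$ (k, j)))
        = (\<Oplus>\<^bsub>Hom C (xs ! j) (zs ! i)\<^esub>k\<in>{..<length ys}. Comp C (xs ! j) (ys ! k) (zs ! i) (B $$ (i, k)) (A $$ (k, j))
            \<oplus>\<^bsub>Hom C (xs ! j) (zs ! i)\<^esub> Comp C (xs ! j) (ys ! k) (zs ! i) (B $$ (i, k)) (A' $$ (k, j)))"
        by (rule abelian_monoid.finsum_cong'[OF C.hom_monoid[OF x z]])
          (auto simp: Hom_Mat ij C.comp_add_right[OF x nth[OF ys] z ent[OF A _ ij(2)] ent[OF A' _ ij(2)] ent[OF B ij(1)]] intro!: C.hom_add_closed[OF x z] c)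
      also have "\<dots> = (\<Oplus>\<^bsub>Hom C (xs ! j) (zs ! i)\<^esub>k\<in>{..<length ys}. Comp C (xs ! j) (ys ! k) (zs ! i) (B $$ (i, k)) (A $$ (k, j)))
            \<oplus>\<^bsub>Hom C (xs ! j) (zs ! i)\<^esub> (\<Oplus>\<^bsub>Hom C (xs ! j) (zs ! i)\<^esub>k\<in>{..<length ys}. Comp C (xs ! j) (ys ! k) (zs ! i) (B $$ (i, k)) (A' $$ (k, j)))"
        by (rule abelian_monoid.finsum_addf[OF C.hom_monoid[OF x z]]) (auto intro!: c)
      finally show "Comp (Mat C) xs ys zs B (A \<oplus>\<^bsub>Hom (Mat C) xs ys\<^esub> A') $$ (i, j) = (Comp (Mat C) xs ys zs B A \<oplus>\<^bsub>Hom (Mat C) xs zs\<^esub> Comp (Mat C) xs ys zs B A') $$ (i, j)"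
        using ij by (simp add: Comp_Mat Hom_Mat(2)[of C xs zs])
    qed (simp_all add: Comp_Mat Hom_Mat)
  next
    fix xs ys zs A B B' assume xs: "xs \<in> Obj (Mat C)" and ys: "ys \<in> Obj (Mat C)" and zs: "zs \<in> Obj (Mat C)"
      and A: "A \<in> Mor (Mat C) xs ys" and B: "B \<in> Mor (Mat C) ys zs" and B': "B' \<in> Mor (Mat C) ys zs"
    show "Comp (Mat C) xs ys zs (B \<oplus>\<^bsub>Hom (Mat C) ys zs\<^esub> B') A = Comp (Mat C) xs ys zs B A \<oplus>\<^bsub>Hom (Mat C) xs zs\<^esub> Comp (Mat C) xs ys zs B' A"
    proof (rule eq_matI)
      fix i j assume "i < dim_row (Comp (Mat C) xs ys zs B A \<oplus>\<^bsub>Hom (Mat C) xs zs\<^esub> Comp (Mat C) xs ys zs B' A)"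
        "j < dim_col (Comp (Mat C) xs ys zs B A \<oplus>\<^bsub>Hom (Mat C) xs zs\<^esub> Comp (Mat C) xs ys zs B' A)"
      then have ij: "i < length zs" "j < length xs" by (simp_all add: Hom_Mat)
      note x = nth[OF xs ij(2)] and z = nth[OF zs ij(1)]
      note c = C.comp_closed[OF x nth[OF ys] z ent[OF A _ ij(2)] ent[OF B ij(1)]] C.comp_closed[OF x nth[OF ys] z ent[OF A _ ij(2)] ent[OF B' ij(1)]]
      have "(\<Oplus>\<^bsub>Hom C (xs ! j) (zs ! i)\<^esub>k\<in>{..<length ys}. Comp C (xs ! j) (ys ! k) (zs ! i) ((B \<oplus>\<^bsub>Hom (Mat C) ys zs\<^esub> B') $$ (i, k)) (A $$ (k, j)))
        = (\<Oplus>\<^bsub>Hom C (xs ! j) (zs ! i)\<^esub>k\<in>{..<length ys}. Comp C (xs ! j) (ys ! k) (zs ! i) (B $$ (i, k)) (A $$ (k, j))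
            \<oplus>\<^bsub>Hom C (xs ! j) (zs ! i)\<^esub> Comp C (xs ! j) (ys ! k) (zs ! i) (B' $$ (i, k)) (A $$ (k, j)))"
        by (rule abelian_monoid.finsum_cong'[OF C.hom_monoid[OF x z]])
          (auto simp: Hom_Mat ij C.comp_add_left[OF x nth[OF ys] z ent[OF A _ ij(2)] ent[OF B ij(1)] ent[OF B' ij(1)]] intro!: C.hom_add_closed[OF x z] c)
      also have "\<dots> = (\<Oplus>\<^bsub>Hom C (xs ! j) (zs ! i)\<^esub>k\<in>{..<length ys}. Comp C (xs ! j) (ys ! k) (zs ! i) (B $$ (i, k)) (A $$ (k, j)))
            \<oplus>\<^bsub>Hom C (xs ! j) (zs ! i)\<^esub> (\<Oplus>\<^bsub>Hom C (xs ! j) (zs ! i)\<^esub>k\<in>{..<length ys}. Comp C (xs ! j) (ys ! k) (zs ! i) (B' $$ (i, k)) (A $$ (k, j)))"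
        by (rule abelian_monoid.finsum_addf[OF C.hom_monoid[OF x z]]) (auto intro!: c)
      finally show "Comp (Mat C) xs ys zs (B \<oplus>\<^bsub>Hom (Mat C) ys zs\<^esub> B') A $$ (i, j) = (Comp (Mat C) xs ys zs B A \<oplus>\<^bsub>Hom (Mat C) xs zs\<^esub> Comp (Mat C) xs ys zs B' A) $$ (i, j)"
        using ij by (simp add: Comp_Mat Hom_Mat(2)[of C xs zs])
    qed (simp_all add: Comp_Mat Hom_Mat)
  next
    fix xs ys zs A B and c :: complex assume xs: "xs \<in> Obj (Mat C)" and ys: "ys \<in> Obj (Mat C)" and zs: "zs \<in> Obj (Mat C)"
      and A: "A \<in> Mor (Mat C) xs ys" and B: "B \<in> Mor (Mat C) ys zs"
    let ?R = "c \<odot>\<^bsub>Hom (Mat C) xs zs\<^esub> Comp (Mat C) xs ys zs B A"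
    have entry: "?R $$ (i, j) = (\<Oplus>\<^bsub>Hom C (xs ! j) (zs ! i)\<^esub>k\<in>{..<length ys}. c \<odot>\<^bsub>Hom C (xs ! j) (zs ! i)\<^esub> Comp C (xs ! j) (ys ! k) (zs ! i) (B $$ (i, k)) (A $$ (k, j)))"
      if ij: "i < length zs" "j < length xs" for i j
      using module.finsum_smult_ldistr[OF C.hom_module[OF nth[OF xs ij(2)] nth[OF zs ij(1)]], of "{..<length ys}" c
          "\<lambda>k. Comp C (xs ! j) (ys ! k) (zs ! i) (B $$ (i, k)) (A $$ (k, j))"]
        C.comp_closed[OF nth[OF xs ij(2)] nth[OF ys] nth[OF zs ij(1)] ent[OF A _ ij(2)] ent[OF B ij(1)]] ij
      by (auto simp: Hom_Mat Comp_Mat)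
    have cl: "c \<odot>\<^bsub>Hom C (xs ! j) (zs ! i)\<^esub> Comp C (xs ! j) (ys ! k) (zs ! i) (B $$ (i, k)) (A $$ (k, j)) \<in> Mor C (xs ! j) (zs ! i)"
      if ij: "i < length zs" "j < length xs" "k < length ys" for i j k
      by (rule C.hom_smult_closed[OF nth[OF xs ij(2)] nth[OF zs ij(1)]
        C.comp_closed[OF nth[OF xs ij(2)] nth[OF ys ij(3)] nth[OF zs ij(1)] ent[OF A ij(3,2)] ent[OF B ij(1,3)]]])
    show "Comp (Mat C) xs ys zs B (c \<odot>\<^bsub>Hom (Mat C) xs ys\<^esub> A) = ?R"
    proof (rule eq_matI)
      fix i j assume "i < dim_row ?R" "j < dim_col ?R"
      then have ij: "i < length zs" "j < length xs" by (simp_all add: Hom_Mat)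
      have "(\<Oplus>\<^bsub>Hom C (xs ! j) (zs ! i)\<^esub>k\<in>{..<length ys}. Comp C (xs ! j) (ys ! k) (zs ! i) (B $$ (i, k)) ((c \<odot>\<^bsub>Hom (Mat C) xs ys\<^esub> A) $$ (k, j))) = ?R $$ (i, j)"
        unfolding entry[OF ij]
        by (rule abelian_monoid.finsum_cong'[OF C.hom_monoid[OF nth[OF xs ij(2)] nth[OF zs ij(1)]]])
          (auto simp: Hom_Mat ij C.comp_smult_right[OF nth[OF xs ij(2)] nth[OF ys] nth[OF zs ij(1)] ent[OF A _ ij(2)] ent[OF B ij(1)]] intro!: cl)
      then show "Comp (Mat C) xs ys zs B (c \<odot>\<^bsub>Hom (Mat C) xs ys\<^esub> A) $$ (i, j) = ?R $$ (i, j)" using ij by (simp add: Comp_Mat)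
    qed (simp_all add: Comp_Mat Hom_Mat)
    show "Comp (Mat C) xs ys zs (c \<odot>\<^bsub>Hom (Mat C) ys zs\<^esub> B) A = ?R"
    proof (rule eq_matI)
      fix i j assume "i < dim_row ?R" "j < dim_col ?R"
      then have ij: "i < length zs" "j < length xs" by (simp_all add: Hom_Mat)
      have "(\<Oplus>\<^bsub>Hom C (xs ! j) (zs ! i)\<^esub>k\<in>{..<length ys}. Comp C (xs ! j) (ys ! k) (zs ! i) ((c \<odot>\<^bsub>Hom (Mat C) ys zs\<^esub> B) $$ (i, k)) (A $$ (k, j))) = ?R $$ (i, j)"
        unfolding entry[OF ij]
        by (rule abelian_monoid.finsum_cong'[OF C.hom_monoid[OF nth[OF xs ij(2)] nth[OF zs ij(1)]]])
          (auto simp: Hom_Mat ij C.comp_smult_left[OF nth[OF xs ij(2)] nth[OF ys] nth[OF zs ij(1)] ent[OF A _ ij(2)] ent[OF B ij(1)]] intro!: cl)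
      then show "Comp (Mat C) xs ys zs (c \<odot>\<^bsub>Hom (Mat C) ys zs\<^esub> B) A $$ (i, j) = ?R $$ (i, j)" using ij by (simp add: Comp_Mat)
    qed (simp_all add: Comp_Mat Hom_Mat)
  qed
qed

lemma is_biproduct_full_subcat: "is_biproduct (full_subcat C S) xs b \<longleftrightarrow> is_biproduct C xs b"
  by (simp add: is_biproduct_def full_subcat_def)

lemma isomorphic_full_subcat: "isomorphic (full_subcat C S) x y \<longleftrightarrow> isomorphic C x y"
  by (simp add: isomorphic_def full_subcat_def)

lemma linear_category_full_subcat:
  assumes "linear_category C" "S \<subseteq> Obj C" shows "linear_category (full_subcat C S)"
  using assms unfolding linear_category_def full_subcat_def by (simp add: subset_iff)

lemma is_biproduct_Mat_Nil:
  assumes C: "linear_category C" shows "is_biproduct (Mat C) [] []"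
proof -
  interpret M: linear_category "Mat C" by (rule linear_category_Mat[OF C])
  have "[] \<in> Obj (Mat C)" by (simp add: Obj_Mat)
  note e = abelian_monoid.finsum_empty[OF M.hom_monoid[OF this this]]
  have "\<zero>\<^bsub>Hom (Mat C) [] []\<^esub> = Ident (Mat C) []" by (rule eq_matI) (simp_all add: Hom_Mat Ident_Mat)
  then show ?thesis by (simp add: is_biproduct_def e)
qed

text \<open>The structure maps are the block columns and the block rows of the identity matrix.\<close>

lemma is_biproduct_Mat_append:
  assumes C: "linear_category C" and xs: "xs \<in> Obj (Mat C)" and ys: "ys \<in> Obj (Mat C)"
  shows "is_biproduct (Mat C) [xs, ys] (xs @ ys)"
proof -
  interpret C: linear_category C by (rule C)
  interpret M: linear_category "Mat C" by (rule linear_category_Mat[OF C])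
  let ?zs = "xs @ ys" and ?m = "length xs" and ?n = "length ys"
  have zs: "?zs \<in> Obj (Mat C)" using xs ys by (simp add: Obj_Mat)
  have o: "?zs ! i \<in> Obj C" if "i < ?m + ?n" for i using zs that by (auto simp: Obj_Mat simp del: set_append)
  define \<delta> where "\<delta> = (\<lambda>i j. if i = j then Ident C (?zs ! j) else \<zero>\<^bsub>Hom C (?zs ! j) (?zs ! i)\<^esub>)"
  have d: "\<delta> i j \<in> Mor C (?zs ! j) (?zs ! i)" if "i < ?m + ?n" "j < ?m + ?n" for i j
    using o[OF that(1)] o[OF that(2)] by (simp add: \<delta>_def C.ident_closed C.hom_zero_closed)
  have dd: "Comp C (?zs ! j) (?zs ! k) (?zs ! i) (\<delta> i k) (\<delta> k j) = (if k = j \<and> k = i then Ident C (?zs ! k) else \<zero>\<^bsub>Hom C (?zs ! j) (?zs ! i)\<^esub>)"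
    if "i < ?m + ?n" "j < ?m + ?n" "k < ?m + ?n" for i j k
    using o[OF that(1)] o[OF that(2)] o[OF that(3)] d[OF that(1,3)] d[OF that(3,2)]
    by (auto simp: \<delta>_def C.comp_ident_left C.comp_ident_right C.comp_zero_left C.comp_zero_right C.ident_closed C.hom_zero_closed)
  \<comment> \<open>Both lists are segments of \<open>xs @ ys\<close>; \<open>off\<close> and \<open>len\<close> are the start and length of a segment.\<close>
  define off where "off = (\<lambda>a::nat. if a = 0 then 0 else ?m)"
  define len where "len = (\<lambda>a::nat. if a = 0 then ?m else ?n)"
  have seg: "[xs, ys] ! a ! i = ?zs ! (off a + i)" "length ([xs, ys] ! a) = len a" "off a + i < ?m + ?n" if "a < 2" "i < len a" for a i
    using that by (auto simp: less_2_cases_iff off_def len_def nth_append)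
  have ln: "length ([xs, ys] ! a) = len a" if "a < 2" for a using that by (auto simp: less_2_cases_iff len_def)
  have aO: "[xs, ys] ! a \<in> Obj (Mat C)" if "a < 2" for a using that xs ys by (auto simp: less_2_cases_iff)
  define inj where "inj = (\<lambda>a. mat (?m + ?n) (len a) (\<lambda>(i, j). \<delta> i (off a + j)))"
  define proj where "proj = (\<lambda>a. mat (len a) (?m + ?n) (\<lambda>(i, j). \<delta> (off a + i) j))"
  have inj: "inj a \<in> Mor (Mat C) ([xs, ys] ! a) ?zs" if a: "a < 2" for a
    using d seg[OF a] by (auto simp: Mor_Mat inj_def ln[OF a])
  have proj: "proj a \<in> Mor (Mat C) ?zs ([xs, ys] ! a)" if a: "a < 2" for a
    using d seg[OF a] by (auto simp: Mor_Mat proj_def ln[OF a])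
  have pi: "Comp (Mat C) ([xs, ys] ! a) ?zs ([xs, ys] ! b) (proj b) (inj a)
      = (if a = b then Ident (Mat C) ([xs, ys] ! a) else \<zero>\<^bsub>Hom (Mat C) ([xs, ys] ! a) ([xs, ys] ! b)\<^esub>)" (is "?L = ?R")
    if a: "a < 2" and b: "b < 2" for a b
  proof (rule eq_matI)
    fix i j assume "i < dim_row ?R" "j < dim_col ?R"
    then have ij: "i < len b" "j < len a" using ln a b by (auto simp: Ident_Mat Hom_Mat split: if_splits)
    note I = seg(3)[OF b ij(1)] and J = seg(3)[OF a ij(2)]
    have t: "Comp C (?zs ! (off a + j)) (?zs ! k) (?zs ! (off b + i)) (\<delta> (off b + i) k) (\<delta> k (off a + j))
        \<in> Mor C (?zs ! (off a + j)) (?zs ! (off b + i))" if "k < ?m + ?n" for k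
      by (rule C.comp_closed[OF o[OF J] o[OF that] o[OF I] d[OF that J] d[OF I that]])
    have "?L $$ (i, j) = (\<Oplus>\<^bsub>Hom C (?zs ! (off a + j)) (?zs ! (off b + i))\<^esub>k\<in>{..<?m + ?n}.
        Comp C (?zs ! (off a + j)) (?zs ! k) (?zs ! (off b + i)) (\<delta> (off b + i) k) (\<delta> k (off a + j)))"
      using ij a b ln seg[OF a ij(2)] seg[OF b ij(1)]
      by (simp add: Comp_Mat inj_def proj_def) (rule C.finsum_mor_cong[OF o[OF J] o[OF I]]; use t in simp)
    also have "\<dots> = \<delta> (off b + i) (off a + j)"
      by (rule C.finsum_mor_single[OF o[OF J] o[OF I], of _ "off a + j"])
        (use dd[OF I J] I J d in \<open>auto simp: \<delta>_def\<close>)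
    also have "\<dots> = ?R $$ (i, j)"
    proof -
      have "off b + i = off a + j \<longleftrightarrow> a = b \<and> i = j"
        using a b ij by (auto simp: less_2_cases_iff off_def len_def)
      then show ?thesis using ij a b ln seg[OF a ij(2)] seg[OF b ij(1)] by (auto simp: \<delta>_def Ident_Mat Hom_Mat)
    qed
    finally show "?L $$ (i, j) = ?R $$ (i, j)" .
  qed (use a b ln in \<open>auto simp: Comp_Mat Ident_Mat Hom_Mat\<close>)
  have ip: "Comp (Mat C) ?zs ([xs, ys] ! a) ?zs (inj a) (proj a) $$ (i, j)
      = (if i = j \<and> off a \<le> i \<and> i < off a + len a then Ident C (?zs ! j) else \<zero>\<^bsub>Hom C (?zs ! j) (?zs ! i)\<^esub>)"
    if a: "a < 2" and i: "i < ?m + ?n" and j: "j < ?m + ?n" for a i j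
  proof -
    have t: "Comp C (?zs ! j) (?zs ! (off a + k)) (?zs ! i) (\<delta> i (off a + k)) (\<delta> (off a + k) j) \<in> Mor C (?zs ! j) (?zs ! i)" if "k < len a" for k
      using C.comp_closed[OF o[OF j] o[OF seg(3)[OF a that]] o[OF i] d[OF seg(3)[OF a that] j] d[OF i seg(3)[OF a that]]] .
    have "Comp (Mat C) ?zs ([xs, ys] ! a) ?zs (inj a) (proj a) $$ (i, j)
      = (\<Oplus>\<^bsub>Hom C (?zs ! j) (?zs ! i)\<^esub>k\<in>{..<len a}. Comp C (?zs ! j) (?zs ! (off a + k)) (?zs ! i) (\<delta> i (off a + k)) (\<delta> (off a + k) j))"
      using a i j by (simp add: Comp_Mat inj_def proj_def ln)
        (rule C.finsum_mor_cong[OF o[OF j] o[OF i]]; use t seg[OF a] in simp)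
    also have "\<dots> = (if i = j \<and> off a \<le> i \<and> i < off a + len a then Ident C (?zs ! j) else \<zero>\<^bsub>Hom C (?zs ! j) (?zs ! i)\<^esub>)"
    proof (cases "i = j \<and> off a \<le> i \<and> i < off a + len a")
      case True
      then have "i - off a < len a" by auto
      have "(\<Oplus>\<^bsub>Hom C (?zs ! j) (?zs ! i)\<^esub>k\<in>{..<len a}. Comp C (?zs ! j) (?zs ! (off a + k)) (?zs ! i) (\<delta> i (off a + k)) (\<delta> (off a + k) j)) = Ident C (?zs ! j)"
        by (rule C.finsum_mor_single[OF o[OF j] o[OF i], of _ "i - off a"])
          (use True \<open>i - off a < len a\<close> dd[OF i j] seg(3)[OF a] C.ident_closed[OF o[OF j]] in auto)
      then show ?thesis using True by simp
    next
      case False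
      have "(\<Oplus>\<^bsub>Hom C (?zs ! j) (?zs ! i)\<^esub>k\<in>{..<len a}. Comp C (?zs ! j) (?zs ! (off a + k)) (?zs ! i) (\<delta> i (off a + k)) (\<delta> (off a + k) j)) = \<zero>\<^bsub>Hom C (?zs ! j) (?zs ! i)\<^esub>"
        by (rule C.finsum_mor_zero[OF o[OF j] o[OF i]])
          (use False dd[OF i j] seg(3)[OF a] in auto)
      then show ?thesis by (simp only: False if_False)
    qed
    finally show ?thesis .
  qed
  have c: "Comp (Mat C) ?zs ([xs, ys] ! a) ?zs (inj a) (proj a) \<in> Mor (Mat C) ?zs ?zs" if "a < 2" for a
    by (rule M.comp_closed[OF zs aO[OF that] zs proj[OF that] inj[OF that]])
  interpret Z: abelian_group "Hom (Mat C) ?zs ?zs" by (rule M.hom_group[OF zs zs])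
  have "{..<length [xs, ys]} = {0, 1}" by auto
  then have "(\<Oplus>\<^bsub>Hom (Mat C) ?zs ?zs\<^esub>a\<in>{..<length [xs, ys]}. Comp (Mat C) ?zs ([xs, ys] ! a) ?zs (inj a) (proj a))
    = Comp (Mat C) ?zs ([xs, ys] ! 0) ?zs (inj 0) (proj 0) \<oplus>\<^bsub>Hom (Mat C) ?zs ?zs\<^esub> Comp (Mat C) ?zs ([xs, ys] ! 1) ?zs (inj 1) (proj 1)"
    using c[of 0] c[of 1] by (simp add: Z.finsum_insert)
  also have "\<dots> = Ident (Mat C) ?zs" (is "?L = ?R")
  proof (rule eq_matI)
    fix i j assume "i < dim_row ?R" "j < dim_col ?R"
    then have ij: "i < ?m + ?n" "j < ?m + ?n" by (simp_all add: Ident_Mat)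
    show "?L $$ (i, j) = ?R $$ (i, j)"
      using ij ip[of 0 i j] ip[of 1 i j] C.hom_zero_left[OF o[OF ij(2)] o[OF ij(1)]] C.hom_zero_right[OF o[OF ij(2)] o[OF ij(1)]]
        C.ident_closed[OF o[OF ij(2)]] C.hom_zero_closed[OF o[OF ij(2)] o[OF ij(1)]]
      by (auto simp: Hom_Mat Ident_Mat off_def len_def)
  qed (simp_all add: Hom_Mat Ident_Mat)
  finally have sum: "(\<Oplus>\<^bsub>Hom (Mat C) ?zs ?zs\<^esub>a\<in>{..<length [xs, ys]}. Comp (Mat C) ?zs ([xs, ys] ! a) ?zs (inj a) (proj a)) = Ident (Mat C) ?zs" .
  have two: "length [xs, ys] = 2" by simp
  show ?thesis unfolding is_biproduct_def
    by (rule exI[of _ inj], rule exI[of _ proj]) (use inj proj pi sum in \<open>simp only: two; blast\<close>)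
qed

text \<open>
  The embedding of \<open>C\<close> as matrices of size one preserves the equations that define a biproduct.
\<close>

lemma is_biproduct_Mat_singleton:
  assumes C: "linear_category C" and ss: "is_biproduct C ss x" and O: "set ss \<subseteq> Obj C" "x \<in> Obj C"
  shows "is_biproduct (Mat C) (map (\<lambda>s. [s]) ss) [x]"
proof -
  interpret C: linear_category C by (rule C)
  interpret M: linear_category "Mat C" by (rule linear_category_Mat[OF C])
  note x = O(2)
  define one where "one = (\<lambda>f :: 'b. mat 1 1 (\<lambda>_. f))"
  have one_Mor: "one f \<in> Mor (Mat C) [a] [b]" if "f \<in> Mor C a b" for f a b
    using that by (simp add: Mor_Mat one_def)
  have one_Comp: "Comp (Mat C) [a] [b] [c] (one g) (one f) = one (Comp C a b c g f)"
    if "a \<in> Obj C" "b \<in> Obj C" "c \<in> Obj C" "f \<in> Mor C a b" "g \<in> Mor C b c" for a b c f g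
  proof -
    have "(\<Oplus>\<^bsub>Hom C a c\<^esub>k\<in>{..<1::nat}. Comp C a ([b] ! k) c (one g $$ (0, k)) (one f $$ (k, 0))) = Comp C a b c g f"
      by (rule C.finsum_mor_single[OF that(1,3), of _ 0]) (use C.comp_closed[OF that] in \<open>auto simp: one_def\<close>)
    then show ?thesis by (intro eq_matI) (simp_all add: Comp_Mat one_def)
  qed
  have one_Ident: "Ident (Mat C) [a] = one (Ident C a)" for a
    by (rule eq_matI) (simp_all add: Ident_Mat one_def)
  have one_zero: "\<zero>\<^bsub>Hom (Mat C) [a] [b]\<^esub> = one \<zero>\<^bsub>Hom C a b\<^esub>" for a b
    by (rule eq_matI) (simp_all add: Hom_Mat one_def)
  have one_sum: "(\<Oplus>\<^bsub>Hom (Mat C) [a] [b]\<^esub>i\<in>A. one (f i)) = one (\<Oplus>\<^bsub>Hom C a b\<^esub>i\<in>A. f i)"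
    if "finite A" "\<And>i. i \<in> A \<Longrightarrow> f i \<in> Mor C a b" and ab: "a \<in> Obj C" "b \<in> Obj C" for A :: "nat set" and f a b
    using that(1,2)
  proof (induct A rule: finite_induct)
    case empty
    have "[a] \<in> Obj (Mat C)" "[b] \<in> Obj (Mat C)" using ab by (simp_all add: Obj_Mat)
    then show ?case
      by (simp add: one_zero abelian_monoid.finsum_empty[OF C.hom_monoid[OF ab]] abelian_monoid.finsum_empty[OF M.hom_monoid])
  next
    case (insert i A)
    have "[a] \<in> Obj (Mat C)" "[b] \<in> Obj (Mat C)" using ab by (simp_all add: Obj_Mat)
    then have "(\<Oplus>\<^bsub>Hom (Mat C) [a] [b]\<^esub>i\<in>insert i A. one (f i)) = one (f i) \<oplus>\<^bsub>Hom (Mat C) [a] [b]\<^esub> one (\<Oplus>\<^bsub>Hom C a b\<^esub>i\<in>A. f i)"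
      using insert one_Mor by (subst abelian_monoid.finsum_insert[OF M.hom_monoid]) auto
    also have "\<dots> = one (f i \<oplus>\<^bsub>Hom C a b\<^esub> (\<Oplus>\<^bsub>Hom C a b\<^esub>i\<in>A. f i))"
      by (rule eq_matI) (simp_all add: Hom_Mat one_def)
    also have "f i \<oplus>\<^bsub>Hom C a b\<^esub> (\<Oplus>\<^bsub>Hom C a b\<^esub>i\<in>A. f i) = (\<Oplus>\<^bsub>Hom C a b\<^esub>i\<in>insert i A. f i)"
      using insert by (subst abelian_monoid.finsum_insert[OF C.hom_monoid[OF ab]]) auto
    finally show ?case .
  qed
  obtain inj proj where ip: "\<forall>i < length ss. inj i \<in> Mor C (ss ! i) x \<and> proj i \<in> Mor C x (ss ! i)"
    "\<forall>i < length ss. \<forall>j < length ss. Comp C (ss ! i) x (ss ! j) (proj j) (inj i)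
          = (if i = j then Ident C (ss ! i) else \<zero>\<^bsub>Hom C (ss ! i) (ss ! j)\<^esub>)"
    "(\<Oplus>\<^bsub>Hom C x x\<^esub>i\<in>{..<length ss}. Comp C x (ss ! i) x (inj i) (proj i)) = Ident C x"
    using ss unfolding is_biproduct_def by blast
  have so: "ss ! i \<in> Obj C" if "i < length ss" for i using O(1) that by (meson nth_mem subsetD)
  have c: "Comp C x (ss ! i) x (inj i) (proj i) \<in> Mor C x x" if "i < length ss" for i
    using C.comp_closed[OF x so[OF that] x] ip(1) that by blast
  show ?thesis unfolding is_biproduct_def
  proof (rule exI[of _ "\<lambda>i. one (inj i)"], rule exI[of _ "\<lambda>i. one (proj i)"], intro conjI allI impI)
    fix i assume "i < length (map (\<lambda>s. [s]) ss)"
    then show "one (inj i) \<in> Mor (Mat C) (map (\<lambda>s. [s]) ss ! i) [x]" "one (proj i) \<in> Mor (Mat C) [x] (map (\<lambda>s. [s]) ss ! i)"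
      using ip(1) one_Mor by simp_all
  next
    fix i j assume "i < length (map (\<lambda>s. [s]) ss)" "j < length (map (\<lambda>s. [s]) ss)"
    then have ij: "i < length ss" "j < length ss" by simp_all
    then show "Comp (Mat C) (map (\<lambda>s. [s]) ss ! i) [x] (map (\<lambda>s. [s]) ss ! j) (one (proj j)) (one (inj i))
      = (if i = j then Ident (Mat C) (map (\<lambda>s. [s]) ss ! i)
         else \<zero>\<^bsub>Hom (Mat C) (map (\<lambda>s. [s]) ss ! i) (map (\<lambda>s. [s]) ss ! j)\<^esub>)"
      using one_Comp[OF so[OF ij(1)] x so[OF ij(2)], of "inj i" "proj j"] ip(1,2) by (simp add: one_Ident one_zero)
  next
    have X: "[x] \<in> Obj (Mat C)" using x by (simp add: Obj_Mat)
    have "(\<Oplus>\<^bsub>Hom (Mat C) [x] [x]\<^esub>i\<in>{..<length (map (\<lambda>s. [s]) ss)}. Comp (Mat C) [x] (map (\<lambda>s. [s]) ss ! i) [x] (one (inj i)) (one (proj i)))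
      = (\<Oplus>\<^bsub>Hom (Mat C) [x] [x]\<^esub>i\<in>{..<length ss}. one (Comp C x (ss ! i) x (inj i) (proj i)))"
      using ip(1) so x c by (intro abelian_monoid.finsum_cong'[OF M.hom_monoid[OF X X]]) (auto simp: one_Comp intro!: one_Mor)
    also have "\<dots> = Ident (Mat C) [x]" using one_sum[OF _ _ x x, of "{..<length ss}"] c ip(3) by (simp add: one_Ident)
    finally show "(\<Oplus>\<^bsub>Hom (Mat C) [x] [x]\<^esub>i\<in>{..<length (map (\<lambda>s. [s]) ss)}. Comp (Mat C) [x] (map (\<lambda>s. [s]) ss ! i) [x] (one (inj i)) (one (proj i))) = Ident (Mat C) [x]" .
  qed
qed

section \<open>Presentations of linear categories\<close>

text \<open>
  A category whose morphisms are named by finitely supported functions: every morphism from \<open>x\<close> to \<open>y\<close>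
  is \<open>\<kappa> x y v\<close> for some \<open>v\<close> in the vector space \<open>H x y\<close>, and all operations are computed on names. Different
  names may denote the same morphism.
\<close>

locale presented_category =
  fixes C :: "('o, 'm) tensor_cat" and H :: "'o \<Rightarrow> 'o \<Rightarrow> ('b \<Rightarrow>\<^sub>0 complex) set"
    and \<kappa> :: "'o \<Rightarrow> 'o \<Rightarrow> ('b \<Rightarrow>\<^sub>0 complex) \<Rightarrow> 'm" and I :: "'o \<Rightarrow> 'b \<Rightarrow>\<^sub>0 complex"
    and cm :: "'o \<Rightarrow> 'o \<Rightarrow> 'o \<Rightarrow> ('b \<Rightarrow>\<^sub>0 complex) \<Rightarrow> ('b \<Rightarrow>\<^sub>0 complex) \<Rightarrow> ('b \<Rightarrow>\<^sub>0 complex)"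
    and tn :: "'o \<Rightarrow> 'o \<Rightarrow> 'o \<Rightarrow> 'o \<Rightarrow> ('b \<Rightarrow>\<^sub>0 complex) \<Rightarrow> ('b \<Rightarrow>\<^sub>0 complex) \<Rightarrow> ('b \<Rightarrow>\<^sub>0 complex)"
  assumes Obj: "Obj C = UNIV"
    and H_0: "0 \<in> H x y" and H_add: "\<lbrakk>v \<in> H x y; w \<in> H x y\<rbrakk> \<Longrightarrow> v + w \<in> H x y"
    and H_scale: "v \<in> H x y \<Longrightarrow> scale c v \<in> H x y" and H_I: "I x \<in> H x x"
    and H_cm: "\<lbrakk>f \<in> H x y; g \<in> H y z\<rbrakk> \<Longrightarrow> cm x y z g f \<in> H x z"
    and H_tn: "\<lbrakk>f \<in> H x y; f' \<in> H x' y'\<rbrakk> \<Longrightarrow> tn x y x' y' f f' \<in> H (TensorOb C x x') (TensorOb C y y')"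
    and Mor: "Mor C x y = \<kappa> x y ` H x y"
    and zero: "\<zero>\<^bsub>Hom C x y\<^esub> = \<kappa> x y 0"
    and add: "\<lbrakk>v \<in> H x y; w \<in> H x y\<rbrakk> \<Longrightarrow> \<kappa> x y v \<oplus>\<^bsub>Hom C x y\<^esub> \<kappa> x y w = \<kappa> x y (v + w)"
    and smult: "v \<in> H x y \<Longrightarrow> c \<odot>\<^bsub>Hom C x y\<^esub> \<kappa> x y v = \<kappa> x y (scale c v)"
    and Ident: "Ident C x = \<kappa> x x (I x)"
    and Comp: "\<lbrakk>f \<in> H x y; g \<in> H y z\<rbrakk> \<Longrightarrow> Comp C x y z (\<kappa> y z g) (\<kappa> x y f) = \<kappa> x z (cm x y z g f)"
    and Tensor: "\<lbrakk>f \<in> H x y; f' \<in> H x' y'\<rbrakk> \<Longrightarrow> TensorMor C x y x' y' (\<kappa> x y f) (\<kappa> x' y' f')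
        = \<kappa> (TensorOb C x x') (TensorOb C y y') (tn x y x' y' f f')"
begin

lemma Mor_\<kappa>: "v \<in> H x y \<Longrightarrow> \<kappa> x y v \<in> Mor C x y"
  by (simp add: Mor)

lemma H_uminus: "v \<in> H x y \<Longrightarrow> - v \<in> H x y"
  using H_scale[of v x y "- 1"] by simp

lemma H_diff: "v \<in> H x y \<Longrightarrow> w \<in> H x y \<Longrightarrow> v - w \<in> H x y"
  using H_add[of v x y "- w"] H_uminus by simp

lemma H_sum: "(\<And>i. i \<in> A \<Longrightarrow> f i \<in> H x y) \<Longrightarrow> (\<Sum>i \<in> A. f i) \<in> H x y"
  by (induct A rule: infinite_finite_induct) (simp_all add: H_0 H_add)

lemma linear_category:
  assumes assoc: "\<And>w x y z f g h. \<lbrakk>f \<in> H w x; g \<in> H x y; h \<in> H y z\<rbrakk> \<Longrightarrow> cm w y z h (cm w x y g f) = cm w x z (cm x y z h g) f"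
    and id_left: "\<And>x y f. f \<in> H x y \<Longrightarrow> cm x y y (I y) f = f"
    and id_right: "\<And>x y f. f \<in> H x y \<Longrightarrow> cm x x y f (I x) = f"
    and add_left: "\<And>x y z g g' f. cm x y z (g + g') f = cm x y z g f + cm x y z g' f"
    and add_right: "\<And>x y z g f f'. cm x y z g (f + f') = cm x y z g f + cm x y z g f'"
    and scale_left: "\<And>x y z c g f. cm x y z (scale c g) f = scale c (cm x y z g f)"
    and scale_right: "\<And>x y z c g f. cm x y z g (scale c f) = scale c (cm x y z g f)"
  shows "linear_category C"
proof (rule linear_category.intro)
  show "vectorspace class_ring (Hom C x y)" for x y
    by (rule complex_vectorspaceI)
      (auto simp: Mor zero add smult H_0 H_add H_scale add.assoc scale.scale_left_distrib scale.scale_right_distrib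
        add.commute add.left_commute)
qed (auto simp: Mor Ident Comp add smult H_I H_cm H_add H_scale assoc id_left id_right add_left add_right scale_left scale_right)

lemma coset:
  assumes N: "N = \<kappa> x y ` K" and K: "K \<subseteq> H x y" and v: "v \<in> H x y"
  shows "N +>\<^bsub>Hom C x y\<^esub> \<kappa> x y v = \<kappa> x y ` {w \<in> H x y. w - v \<in> K}"
proof -
  have "N +>\<^bsub>Hom C x y\<^esub> \<kappa> x y v = {\<kappa> x y (k + v) | k. k \<in> K}"
    unfolding a_r_coset_def' N using add K v by (auto simp: subset_iff)
  also have "\<dots> = \<kappa> x y ` {w \<in> H x y. w - v \<in> K}"
  proof (intro equalityI subsetI)
    fix a assume "a \<in> {\<kappa> x y (k + v) | k. k \<in> K}"
    then obtain k where "a = \<kappa> x y (k + v)" "k \<in> K" by auto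
    then show "a \<in> \<kappa> x y ` {w \<in> H x y. w - v \<in> K}" using K v H_add by (intro image_eqI[of _ _ "k + v"]) auto
  next
    fix a assume "a \<in> \<kappa> x y ` {w \<in> H x y. w - v \<in> K}"
    then obtain w where "a = \<kappa> x y w" "w - v \<in> K" by auto
    then show "a \<in> {\<kappa> x y (k + v) | k. k \<in> K}" by (intro CollectI exI[of _ "w - v"]) simp
  qed
  finally show ?thesis .
qed

text \<open>
  In terms of names, the cosets are the images of the sets of all \<open>w\<close> with \<open>w - emb u \<in> K x y\<close>, and the union over all
  representatives in the operations of a quotient runs over equal cosets. The names of the quotient may be
  chosen from another space \<open>H'\<close>, here the combinations of diagrams without loops, as long as every name is congruent to one of them.
\<close>

lemma quotient_presented:
  fixes N :: "'o \<Rightarrow> 'o \<Rightarrow> 'm set" and K :: "'o \<Rightarrow> 'o \<Rightarrow> ('b \<Rightarrow>\<^sub>0 complex) set"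
    and H' :: "'o \<Rightarrow> 'o \<Rightarrow> ('c \<Rightarrow>\<^sub>0 complex) set" and emb :: "('c \<Rightarrow>\<^sub>0 complex) \<Rightarrow> ('b \<Rightarrow>\<^sub>0 complex)"
  assumes N: "\<And>x y. N x y = \<kappa> x y ` K x y"
    and K: "\<And>x y. K x y \<subseteq> H x y" and K_0: "\<And>x y. 0 \<in> K x y"
    and K_add: "\<And>x y v w. v \<in> K x y \<Longrightarrow> w \<in> K x y \<Longrightarrow> v + w \<in> K x y"
    and K_scale: "\<And>x y c v. v \<in> K x y \<Longrightarrow> scale c v \<in> K x y"
    and H'_0: "\<And>x y. 0 \<in> H' x y" and H'_add: "\<And>x y v w. \<lbrakk>v \<in> H' x y; w \<in> H' x y\<rbrakk> \<Longrightarrow> v + w \<in> H' x y"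
    and H'_scale: "\<And>x y c v. v \<in> H' x y \<Longrightarrow> scale c v \<in> H' x y" and H'_I: "\<And>x. I' x \<in> H' x x"
    and H'_cm: "\<And>x y z f g. \<lbrakk>f \<in> H' x y; g \<in> H' y z\<rbrakk> \<Longrightarrow> cm' x y z g f \<in> H' x z"
    and H'_tn: "\<And>x y x' y' f f'. \<lbrakk>f \<in> H' x y; f' \<in> H' x' y'\<rbrakk> \<Longrightarrow> tn' x y x' y' f f' \<in> H' (TensorOb C x x') (TensorOb C y y')"
    and emb: "\<And>x y u. u \<in> H' x y \<Longrightarrow> emb u \<in> H x y" and emb_0: "emb 0 = 0"
    and emb_add: "\<And>u v. emb (u + v) = emb u + emb v" and emb_scale: "\<And>c u. emb (scale c u) = scale c (emb u)"
    and onto: "\<And>x y v. v \<in> H x y \<Longrightarrow> \<exists>u \<in> H' x y. v - emb u \<in> K x y"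
    and I': "\<And>x. I x - emb (I' x) \<in> K x x"
    and cm': "\<And>x y z f g f' g'. \<lbrakk>f \<in> H x y; g \<in> H y z; f' \<in> H' x y; g' \<in> H' y z; f - emb f' \<in> K x y; g - emb g' \<in> K y z\<rbrakk>
      \<Longrightarrow> cm x y z g f - emb (cm' x y z g' f') \<in> K x z"
    and tn': "\<And>x y x' y' f g f' g'. \<lbrakk>f \<in> H x y; g \<in> H x' y'; f' \<in> H' x y; g' \<in> H' x' y'; f - emb f' \<in> K x y; g - emb g' \<in> K x' y'\<rbrakk>
      \<Longrightarrow> tn x y x' y' f g - emb (tn' x y x' y' f' g') \<in> K (TensorOb C x x') (TensorOb C y y')"
  shows "presented_category (quot_cat C N) H' (\<lambda>x y u. N x y +>\<^bsub>Hom C x y\<^esub> \<kappa> x y (emb u)) I' cm' tn'"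
proof -
  define cls where "cls = (\<lambda>x y u. \<kappa> x y ` {w \<in> H x y. w - emb u \<in> K x y})"
  have K_diff: "v - w \<in> K x y" if "v \<in> K x y" "w \<in> K x y" for x y v w
    using K_add[OF that(1) K_scale[OF that(2), of "- 1"]] by simp
  have coset_cls: "N x y +>\<^bsub>Hom C x y\<^esub> \<kappa> x y v = cls x y u" if v: "v \<in> H x y" and u: "u \<in> H' x y" and vu: "v - emb u \<in> K x y" for x y u v
  proof -
    have "w - v \<in> K x y \<longleftrightarrow> w - emb u \<in> K x y" for w
      using K_add[OF _ vu, of "w - v"] K_diff[OF _ vu, of "w - emb u"] by auto
    then show ?thesis unfolding coset[OF N K v] cls_def by simp
  qed
  have cls: "N x y +>\<^bsub>Hom C x y\<^esub> \<kappa> x y (emb u) = cls x y u" if "u \<in> H' x y" for x y u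
    using coset_cls[OF emb[OF that] that] K_0 by simp
  have ne: "cls x y u \<noteq> {}" if "u \<in> H' x y" for x y u
  proof -
    have "\<kappa> x y (emb u) \<in> cls x y u" using emb[OF that] K_0 by (auto simp: cls_def)
    then show ?thesis by blast
  qed
  have const: "(\<Union>a\<in>A. F a) = B" if "A \<noteq> {}" "\<And>a. a \<in> A \<Longrightarrow> F a = B" for A F and B :: "'m set"
    using that by auto
  have const2: "(\<Union>a\<in>A. \<Union>a'\<in>A'. F a a') = B" if "A \<noteq> {}" "A' \<noteq> {}" "\<And>a a'. a \<in> A \<Longrightarrow> a' \<in> A' \<Longrightarrow> F a a' = B"
    for A A' F and B :: "'m set"
    using that by auto
  have c_add: "set_add (Hom C x y) (cls x y u) (cls x y v) = cls x y (u + v)" if u: "u \<in> H' x y" and v: "v \<in> H' x y" for x y u v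
  proof (intro equalityI subsetI)
    fix a assume "a \<in> set_add (Hom C x y) (cls x y u) (cls x y v)"
    then obtain s t where st: "s \<in> H x y" "t \<in> H x y" "s - emb u \<in> K x y" "t - emb v \<in> K x y"
      "a = \<kappa> x y s \<oplus>\<^bsub>Hom C x y\<^esub> \<kappa> x y t" by (auto simp: set_add_def' cls_def)
    have "(s - emb u) + (t - emb v) = (s + t) - emb (u + v)" by (simp add: emb_add)
    then have "(s + t) - emb (u + v) \<in> K x y" using K_add[OF st(3,4)] by (simp only:)
    then show "a \<in> cls x y (u + v)" using st add H_add by (simp add: cls_def)
  next
    fix a assume "a \<in> cls x y (u + v)"
    then obtain w where w: "w \<in> H x y" "w - emb (u + v) \<in> K x y" "a = \<kappa> x y w" by (auto simp: cls_def)
    have "w - emb v \<in> H x y" by (rule H_diff[OF w(1) emb[OF v]])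
    moreover have "(w - emb v) - emb u \<in> K x y" using w(2) by (simp add: emb_add algebra_simps)
    moreover have "a = \<kappa> x y (w - emb v) \<oplus>\<^bsub>Hom C x y\<^esub> \<kappa> x y (emb v)"
      using add[OF \<open>w - emb v \<in> H x y\<close> emb[OF v]] w(3) by simp
    moreover have "emb v \<in> H x y" "emb v - emb v \<in> K x y" using emb[OF v] K_0 by simp_all
    ultimately show "a \<in> set_add (Hom C x y) (cls x y u) (cls x y v)"
      unfolding set_add_def' cls_def by blast
  qed
  have c_smult: "(\<Union>a\<in>cls x y u. N x y +>\<^bsub>Hom C x y\<^esub> (c \<odot>\<^bsub>Hom C x y\<^esub> a)) = cls x y (scale c u)" if u: "u \<in> H' x y" for x y u c
  proof (rule const[OF ne[OF u]])
    fix a assume "a \<in> cls x y u"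
    then obtain w where w: "w \<in> H x y" "w - emb u \<in> K x y" "a = \<kappa> x y w" by (auto simp: cls_def)
    have "scale c w - emb (scale c u) \<in> K x y"
      using K_scale[OF w(2), of c] by (simp add: emb_scale scale.scale_right_diff_distrib)
    then show "N x y +>\<^bsub>Hom C x y\<^esub> (c \<odot>\<^bsub>Hom C x y\<^esub> a) = cls x y (scale c u)"
      using coset_cls[OF H_scale[OF w(1)] H'_scale[OF u]] smult[OF w(1)] w(3) by simp
  qed
  have c_comp: "(\<Union>g\<in>cls y z v. \<Union>f\<in>cls x y u. N x z +>\<^bsub>Hom C x z\<^esub> Comp C x y z g f) = cls x z (cm' x y z v u)"
    if u: "u \<in> H' x y" and v: "v \<in> H' y z" for x y z u v
  proof (rule const2[OF ne[OF v] ne[OF u]])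
    fix g f assume "g \<in> cls y z v" "f \<in> cls x y u"
    then obtain s t where st: "s \<in> H x y" "t \<in> H y z" "s - emb u \<in> K x y" "t - emb v \<in> K y z" "f = \<kappa> x y s" "g = \<kappa> y z t"
      by (auto simp: cls_def)
    show "N x z +>\<^bsub>Hom C x z\<^esub> Comp C x y z g f = cls x z (cm' x y z v u)"
      unfolding st(5,6) Comp[OF st(1,2)]
      by (rule coset_cls[OF H_cm[OF st(1,2)] H'_cm[OF u v] cm'[OF st(1,2) u v st(3,4)]])
  qed
  have c_tensor: "(\<Union>f\<in>cls x y u. \<Union>f'\<in>cls x' y' v.
        N (TensorOb C x x') (TensorOb C y y') +>\<^bsub>Hom C (TensorOb C x x') (TensorOb C y y')\<^esub> TensorMor C x y x' y' f f')
      = cls (TensorOb C x x') (TensorOb C y y') (tn' x y x' y' u v)"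
    if u: "u \<in> H' x y" and v: "v \<in> H' x' y'" for x y x' y' u v
  proof (rule const2[OF ne[OF u] ne[OF v]])
    fix f f' assume "f \<in> cls x y u" "f' \<in> cls x' y' v"
    then obtain s t where st: "s \<in> H x y" "t \<in> H x' y'" "s - emb u \<in> K x y" "t - emb v \<in> K x' y'" "f = \<kappa> x y s" "f' = \<kappa> x' y' t"
      by (auto simp: cls_def)
    show "N (TensorOb C x x') (TensorOb C y y') +>\<^bsub>Hom C (TensorOb C x x') (TensorOb C y y')\<^esub> TensorMor C x y x' y' f f'
      = cls (TensorOb C x x') (TensorOb C y y') (tn' x y x' y' u v)"
      unfolding st(5,6) Tensor[OF st(1,2)]
      by (rule coset_cls[OF H_tn[OF st(1,2)] H'_tn[OF u v] tn'[OF st(1,2) u v st(3,4)]])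
  qed
  have c_mor: "a_rcosets\<^bsub>Hom C x y\<^esub> (N x y) = cls x y ` H' x y" for x y
  proof -
    have "a_rcosets\<^bsub>Hom C x y\<^esub> (N x y) = (\<lambda>v. N x y +>\<^bsub>Hom C x y\<^esub> \<kappa> x y v) ` H x y"
      unfolding A_RCOSETS_def' Mor by auto
    also have "\<dots> = cls x y ` H' x y"
    proof (intro equalityI subsetI)
      fix a assume "a \<in> (\<lambda>v. N x y +>\<^bsub>Hom C x y\<^esub> \<kappa> x y v) ` H x y"
      then obtain v where v: "v \<in> H x y" "a = N x y +>\<^bsub>Hom C x y\<^esub> \<kappa> x y v" by auto
      obtain u where u: "u \<in> H' x y" "v - emb u \<in> K x y" using onto[OF v(1)] by auto
      then show "a \<in> cls x y ` H' x y" using coset_cls[OF v(1) u] v(2) by simp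
    next
      fix a assume "a \<in> cls x y ` H' x y"
      then obtain u where "u \<in> H' x y" "a = cls x y u" by auto
      then show "a \<in> (\<lambda>v. N x y +>\<^bsub>Hom C x y\<^esub> \<kappa> x y v) ` H x y" using cls[of u x y] emb[of u x y]
        by (intro image_eqI[of _ _ "emb u"]) simp_all
    qed
    finally show ?thesis .
  qed
  have c_zero: "cls x y 0 = N x y" for x y
    using K by (auto simp: cls_def N emb_0)
  show ?thesis
    by (rule presented_category.intro)
      (use H'_0 H'_add H'_scale H'_I H'_cm H'_tn in
        \<open>auto simp: quot_cat_def quot_space_def Obj cls c_mor c_zero c_add c_smult c_comp c_tensor Ident coset_cls[OF H_I H'_I I']\<close>)
qed

end

section \<open>The Temperley-Lieb category in coordinates\<close>

lemma linear_ext_lin: "linear_ext h f = lin (\<lambda>a. basis (h a)) f"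
  by (simp add: linear_ext_def lin_def scale_basis)

lemma bilinear_ext_lin: "bilinear_ext h f g = lin (\<lambda>a. lin (\<lambda>b. basis (h a b)) g) f"
  by (simp add: bilinear_ext_def lin_def scale.scale_sum_right scale_basis)

lemma diagram_comp_pair: "diagram_comp x y z a b
    = (stack_matching x z (fst a) (fst b), snd b + snd a + stack_loops y (fst a) (fst b))"
  by (cases a; cases b) simp

lemma diagram_tensor_pair: "diagram_tensor x y a b = (tensor_matching x y (fst a) (fst b), snd a + snd b)"
  by (cases a; cases b) (simp only: diagram_tensor_alt fst_conv snd_conv)

lemma diagram_closure_pair: "diagram_closure x a = ({}, snd a + closure_loops x (fst a))"
  by (cases a) (simp only: diagram_closure_alt fst_conv snd_conv)

lemma simple_diagrams_iff: "a \<in> simple_diagrams x y \<longleftrightarrow> fst a \<in> planar_matchings x y"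
  by (cases a) (simp add: simple_diagrams_def)

lemma presented_free_TL:
  "presented_category free_TL (\<lambda>x y. supported (simple_diagrams x y)) (\<lambda>x y v. v) (\<lambda>m. basis (id_matching m, 0))
    (\<lambda>x y z. bilinear_ext (diagram_comp x y z)) (\<lambda>x y x' y'. bilinear_ext (diagram_tensor x y))"
proof (rule presented_category.intro)
  show "bilinear_ext (diagram_comp x y z) g f \<in> supported (simple_diagrams x z)"
    if "f \<in> supported (simple_diagrams x y)" "g \<in> supported (simple_diagrams y z)" for x y z f g
    unfolding bilinear_ext_lin using that
    by (auto intro!: supported_lin supported_single stack_matching_planar simp: simple_diagrams_iff diagram_comp_pair)
  show "bilinear_ext (diagram_tensor x y) f f' \<in> supported (simple_diagrams (TensorOb free_TL x x') (TensorOb free_TL y y'))"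
    if "f \<in> supported (simple_diagrams x y)" "f' \<in> supported (simple_diagrams x' y')" for x y x' y' f f'
    unfolding bilinear_ext_lin using that
    by (auto intro!: supported_lin supported_single tensor_matching_planar simp: simple_diagrams_iff diagram_tensor_pair free_TL_def)
  show "basis (id_matching x, 0) \<in> supported (simple_diagrams x x)" for x
    by (rule supported_single) (simp add: simple_diagrams_iff id_matching_planar)
  show "Mor free_TL x y = (\<lambda>v. v) ` supported (simple_diagrams x y)" for x y
    by (simp add: free_TL_def free_space_def supported_def)
qed (simp_all add: free_TL_def free_space_def supported_add supported_scale)

text \<open>These two maps are inverse to each other modulo the loop relation.\<close>

definition eval_loops :: "complex \<Rightarrow> (diagram \<Rightarrow>\<^sub>0 complex) \<Rightarrow> tl" where
  "eval_loops d f = lin (\<lambda>a. Poly_Mapping.single (fst a) (d ^ snd a)) f"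

definition loopless :: "tl \<Rightarrow> (diagram \<Rightarrow>\<^sub>0 complex)" where
  "loopless u = lin (\<lambda>M. basis (M, 0)) u"

lemma eval_loopless [simp]: "eval_loops d (loopless u) = u"
  by (simp add: eval_loops_def loopless_def lin_lin)

lemma eval_loops_hom: "f \<in> supported (simple_diagrams x y) \<Longrightarrow> eval_loops d f \<in> tl_hom x y"
  unfolding eval_loops_def by (rule supported_lin) (auto intro: supported_single simp: simple_diagrams_iff)

lemma loopless_hom: "u \<in> tl_hom x y \<Longrightarrow> loopless u \<in> supported (simple_diagrams x y)"
  unfolding loopless_def by (rule supported_lin) (auto intro: supported_single simp: simple_diagrams_iff)

lemma eval_loops_comp: "eval_loops d (bilinear_ext (diagram_comp x y z) g f) = tl_comp d x y z (eval_loops d g) (eval_loops d f)"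
proof -
  have "tl_comp d x y z (eval_loops d g) (eval_loops d f) = lin (\<lambda>a. lin (\<lambda>b. Poly_Mapping.single
      (stack_matching x z (fst a) (fst b)) (d ^ snd a * (d ^ snd b * d ^ stack_loops y (fst a) (fst b)))) f) g"
    by (simp add: tl_comp_def eval_loops_def lin_lin lin_fun_scale[symmetric] scale_basis)
  also have "\<dots> = eval_loops d (bilinear_ext (diagram_comp x y z) g f)"
    by (simp add: eval_loops_def bilinear_ext_lin lin_lin diagram_comp_pair power_add mult_ac)
  finally show ?thesis by simp
qed

lemma eval_loops_tensor: "eval_loops d (bilinear_ext (diagram_tensor x y) f f') = tl_tensor x y (eval_loops d f) (eval_loops d f')"
proof -
  have "tl_tensor x y (eval_loops d f) (eval_loops d f') = lin (\<lambda>a. lin (\<lambda>b. Poly_Mapping.single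
      (tensor_matching x y (fst a) (fst b)) (d ^ snd a * d ^ snd b)) f') f"
    by (simp add: tl_tensor_def eval_loops_def lin_lin lin_fun_scale[symmetric] scale_basis)
  also have "\<dots> = eval_loops d (bilinear_ext (diagram_tensor x y) f f')"
    by (simp add: eval_loops_def bilinear_ext_lin lin_lin diagram_tensor_pair power_add)
  finally show ?thesis by simp
qed

lemma lin_collapse: "lin (\<lambda>M. Poly_Mapping.single a (c M)) f
    = Poly_Mapping.single a (Poly_Mapping.lookup (lin (\<lambda>M. Poly_Mapping.single () (c M)) f) ())"
proof -
  have unit: "w = Poly_Mapping.single () (Poly_Mapping.lookup w ())" for w :: "unit \<Rightarrow>\<^sub>0 complex"
    by (rule poly_mapping_eqI) simp
  let ?w = "lin (\<lambda>M. Poly_Mapping.single () (c M)) f"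
  have "lin (\<lambda>_. basis a) ?w = lin (\<lambda>M. Poly_Mapping.single a (c M)) f"
    by (simp add: lin_lin scale_basis)
  moreover have "lin (\<lambda>_. basis a) ?w = Poly_Mapping.single a (Poly_Mapping.lookup ?w ())"
  proof -
    have "lin (\<lambda>_. basis a) (Poly_Mapping.single () c) = Poly_Mapping.single a c" for c
      by (simp add: scale_basis)
    from this[of "Poly_Mapping.lookup ?w ()"] show ?thesis by (simp only: unit[symmetric])
  qed
  ultimately show ?thesis by simp
qed

lemma eval_loops_closure:
  "eval_loops d (linear_ext (diagram_closure x) f) = Poly_Mapping.single {} (tl_trace d x (eval_loops d f))"
proof -
  have "eval_loops d (linear_ext (diagram_closure x) f)
    = lin (\<lambda>M. Poly_Mapping.single {} (d ^ closure_loops x M)) (eval_loops d f)"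
    by (simp add: eval_loops_def linear_ext_lin lin_lin diagram_closure_pair scale_basis power_add)
  then show ?thesis unfolding tl_trace_def lin_collapse[of "{}"] .
qed

lemma vectorspace_free_space: "vectorspace class_ring (free_space B)"
proof (rule complex_vectorspaceI)
  have c: "carrier (free_space B) = supported B" by (simp add: free_space_def supported_def)
  show "x \<oplus>\<^bsub>free_space B\<^esub> y \<in> carrier (free_space B)" if "x \<in> carrier (free_space B)" "y \<in> carrier (free_space B)" for x y
    using that supported_add unfolding c by (simp add: free_space_def)
  show "a \<odot>\<^bsub>free_space B\<^esub> x \<in> carrier (free_space B)" if "x \<in> carrier (free_space B)" for a x
    using that supported_scale unfolding c by (simp add: free_space_def)
qed (simp_all add: free_space_def add.assoc add.commute scale.scale_left_distrib scale.scale_right_distrib)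

lemma lin_fun_diff: "lin (\<lambda>a. L a - L' a) f = lin L f - lin L' f"
  by (simp add: lin_def scale.scale_right_diff_distrib sum_subtractf)

text \<open>
  By the loop relation, a diagram with \<open>k\<close> loops equals \<open>d ^ k\<close> times its underlying
  matching; hence a combination is in its span if it vanishes when loops are evaluated.
\<close>

lemma loop_rel_eq: "loop_rel q x y = {f \<in> supported (simple_diagrams x y). eval_loops (q + inverse q) f = 0}"
proof -
  let ?d = "q + inverse q" and ?V = "free_space (simple_diagrams x y)"
  let ?G = "{Poly_Mapping.single (M, Suc k) 1 - Poly_Mapping.single (M, k) ?d | M k. (M, k) \<in> simple_diagrams x y}"
  let ?K = "{f \<in> supported (simple_diagrams x y). eval_loops ?d f = 0}"
  interpret V: vectorspace class_ring ?V by (rule vectorspace_free_space)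
  have V: "carrier ?V = supported (simple_diagrams x y)" "zero ?V = 0" "add ?V = (+)" "smult ?V = scale"
    by (simp_all add: free_space_def supported_def)
  have S: "(M, k') \<in> simple_diagrams x y \<longleftrightarrow> (M, k) \<in> simple_diagrams x y" for M k k'
    by (simp add: simple_diagrams_iff)
  have G: "?G \<subseteq> ?K"
  proof
    fix g assume "g \<in> ?G"
    then obtain M k where g: "g = Poly_Mapping.single (M, Suc k) 1 - Poly_Mapping.single (M, k) ?d" "(M, k) \<in> simple_diagrams x y" by auto
    have "g \<in> supported (simple_diagrams x y)"
      unfolding g by (intro supported_diff supported_single) (use g(2) S in blast)+
    moreover have "eval_loops ?d g = 0" unfolding g eval_loops_def by (simp add: lin_diff scale_basis mult.commute)
    ultimately show "g \<in> ?K" by simp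
  qed
  have subK: "submodule class_ring ?K ?V"
    by (rule submodule.intro)
      (auto simp: V V.module_axioms supported_add supported_scale eval_loops_def lin_add lin_scale)
  have "V.span ?G \<subseteq> ?K" by (rule V.span_is_subset[OF G subK])
  moreover have "?K \<subseteq> V.span ?G"
  proof
    have GV: "?G \<subseteq> carrier ?V" using G V by auto
    have sub: "submodule class_ring (V.span ?G) ?V" by (rule V.span_is_submodule[OF GV])
    have add: "v + w \<in> V.span ?G" if "v \<in> V.span ?G" "w \<in> V.span ?G" for v w
      using submodule.m_closed[OF sub that] by (simp add: V)
    have scl: "scale c v \<in> V.span ?G" if "v \<in> V.span ?G" for c v
      using submodule.smult_closed[OF sub _ that, of c] by (simp add: V)
    have zer: "0 \<in> V.span ?G" using submodule.zero_closed[OF sub] by (simp add: V)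
    have b: "basis (M, k) - scale (?d ^ k) (basis (M, 0)) \<in> V.span ?G" if "M \<in> planar_matchings x y" for M k
    proof (induct k)
      case 0
      then show ?case using zer by simp
    next
      case (Suc k)
      have "Poly_Mapping.single (M, Suc k) 1 - Poly_Mapping.single (M, k) ?d \<in> ?G"
        using that by (auto simp: simple_diagrams_iff)
      then have "Poly_Mapping.single (M, Suc k) 1 - Poly_Mapping.single (M, k) ?d \<in> V.span ?G"
        using V.in_own_span[OF GV] by blast
      from add[OF this scl[OF Suc, of ?d]] show ?case
        by (simp add: scale.scale_right_diff_distrib scale_basis mult.commute)
    qed
    fix f assume f: "f \<in> ?K"
    then have keys: "Poly_Mapping.keys f \<subseteq> simple_diagrams x y" by (simp add: supported_def)
    have "lin (\<lambda>a. basis a - scale (?d ^ snd a) (basis (fst a, 0))) f = f - loopless (eval_loops ?d f)"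
    proof -
      have "lin (\<lambda>a. scale (?d ^ snd a) (basis (fst a, 0))) f = loopless (eval_loops ?d f)"
        by (simp add: loopless_def eval_loops_def lin_lin scale_basis)
      then show ?thesis by (simp only: lin_fun_diff lin_basis)
    qed
    then have "f = lin (\<lambda>a. basis a - scale (?d ^ snd a) (basis (fst a, 0))) f"
      using f by (simp add: loopless_def)
    also have "\<dots> \<in> V.span ?G"
    proof -
      have "(\<Sum>a \<in> A. scale (Poly_Mapping.lookup f a) (basis a - scale (?d ^ snd a) (basis (fst a, 0)))) \<in> V.span ?G"
        if "finite A" "A \<subseteq> simple_diagrams x y" for A
        using that
      proof (induct A rule: finite_induct)
        case (insert a A)
        have "basis a - scale (?d ^ snd a) (basis (fst a, 0)) \<in> V.span ?G"
          using b[of "fst a" "snd a"] insert(4) by (simp add: simple_diagrams_iff)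
        then have "scale (Poly_Mapping.lookup f a) (basis a - scale (?d ^ snd a) (basis (fst a, 0))) \<in> V.span ?G"
          by (rule scl)
        moreover have "(\<Sum>a \<in> A. scale (Poly_Mapping.lookup f a) (basis a - scale (?d ^ snd a) (basis (fst a, 0)))) \<in> V.span ?G"
          using insert(3,4) by (simp only: insert_subset)
        ultimately show ?case unfolding sum.insert[OF insert(1,2)] by (rule add)
      qed (simp only: sum.empty zer)
      from this[OF finite_keys keys] show ?thesis by (simp only: lin_def)
    qed
    finally show "f \<in> V.span ?G" .
  qed
  ultimately show ?thesis unfolding loop_rel_def by (simp add: free_TL_def)
qed

abbreviation tl_class :: "complex \<Rightarrow> nat \<Rightarrow> nat \<Rightarrow> tl \<Rightarrow> (diagram \<Rightarrow>\<^sub>0 complex) set" where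
  "tl_class q x y u \<equiv> loop_rel q x y +>\<^bsub>Hom free_TL x y\<^esub> loopless u"

lemma TensorOb_free_TL: "TensorOb free_TL x y = x + y"
  by (simp add: free_TL_def)

lemma TensorOb_TL: "TensorOb (TL q) x y = x + y"
  by (simp add: TL_def quot_cat_def free_TL_def)

lemma TensorOb_mod: "TensorOb (TL_mod_negligible q) x y = x + y"
  by (simp add: TL_mod_negligible_def TL_def quot_cat_def free_TL_def)

lemma loopless_diff_loop_rel:
  assumes "u \<in> tl_hom x y" "f \<in> supported (simple_diagrams x y)"
  shows "f - loopless u \<in> loop_rel q x y \<longleftrightarrow> eval_loops (q + inverse q) f = u"
proof -
  have "eval_loops d (f - loopless u) = eval_loops d f - u" for d
    using eval_loopless[of d u] by (simp add: eval_loops_def lin_diff)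
  then show ?thesis using assms loopless_hom[OF assms(1)] by (simp add: loop_rel_eq supported_diff)
qed

lemma tl_class_eq:
  assumes f: "f \<in> supported (simple_diagrams x y)"
  shows "loop_rel q x y +>\<^bsub>Hom free_TL x y\<^esub> f = {g \<in> supported (simple_diagrams x y). eval_loops (q + inverse q) g = eval_loops (q + inverse q) f}"
proof -
  interpret F: presented_category free_TL "\<lambda>x y. supported (simple_diagrams x y)" "\<lambda>x y v. v" "\<lambda>m. basis (id_matching m, 0)"
    "\<lambda>x y z. bilinear_ext (diagram_comp x y z)" "\<lambda>x y x' y'. bilinear_ext (diagram_tensor x y)" by (rule presented_free_TL)
  have "eval_loops d (g - f) = eval_loops d g - eval_loops d f" for d g by (simp add: eval_loops_def lin_diff)
  then show ?thesis
    using F.coset[where N = "loop_rel q x y" and K = "loop_rel q x y" and x = x and y = y and v = f] f by (auto simp: loop_rel_eq supported_diff)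
qed

lemma presented_TL:
  "presented_category (TL q) tl_hom (tl_class q) tl_id (tl_comp (q + inverse q)) (\<lambda>x y x' y'. tl_tensor x y)"
proof -
  interpret F: presented_category free_TL "\<lambda>x y. supported (simple_diagrams x y)" "\<lambda>x y v. v" "\<lambda>m. basis (id_matching m, 0)"
    "\<lambda>x y z. bilinear_ext (diagram_comp x y z)" "\<lambda>x y x' y'. bilinear_ext (diagram_tensor x y)" by (rule presented_free_TL)
  let ?d = "q + inverse q"
  show ?thesis unfolding TL_def
  proof (rule F.quotient_presented[where K = "loop_rel q" and emb = loopless])
    show "\<And>x y. loop_rel q x y \<subseteq> supported (simple_diagrams x y)" by (auto simp: loop_rel_eq)
    show "\<And>x y. 0 \<in> loop_rel q x y" by (simp add: loop_rel_eq eval_loops_def)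
    show "\<And>x y v w. v \<in> loop_rel q x y \<Longrightarrow> w \<in> loop_rel q x y \<Longrightarrow> v + w \<in> loop_rel q x y"
      by (simp add: loop_rel_eq supported_add eval_loops_def lin_add)
    show "\<And>x y c v. v \<in> loop_rel q x y \<Longrightarrow> scale c v \<in> loop_rel q x y"
      by (simp add: loop_rel_eq supported_scale eval_loops_def lin_scale)
    show "\<And>x y u. u \<in> tl_hom x y \<Longrightarrow> loopless u \<in> supported (simple_diagrams x y)" by (rule loopless_hom)
    show "loopless 0 = 0" "\<And>u v. loopless (u + v) = loopless u + loopless v" "\<And>c u. loopless (scale c u) = scale c (loopless u)"
      by (simp_all add: loopless_def lin_add lin_scale)
    fix x y x' y' z
    show "\<exists>u \<in> tl_hom x y. v - loopless u \<in> loop_rel q x y" if "v \<in> supported (simple_diagrams x y)" for v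
      using loopless_diff_loop_rel[OF eval_loops_hom[OF that] that] eval_loops_hom[OF that] by blast
    show "basis (id_matching x, 0) - loopless (tl_id x) \<in> loop_rel q x x" by (simp add: loopless_def loop_rel_eq eval_loops_def)
    show "bilinear_ext (diagram_comp x y z) g f - loopless (tl_comp ?d x y z g' f') \<in> loop_rel q x z"
      if "f \<in> supported (simple_diagrams x y)" "g \<in> supported (simple_diagrams y z)" "f' \<in> tl_hom x y" "g' \<in> tl_hom y z"
        "f - loopless f' \<in> loop_rel q x y" "g - loopless g' \<in> loop_rel q y z" for f g f' g'
      using that loopless_diff_loop_rel[OF that(3,1)] loopless_diff_loop_rel[OF that(4,2)]
        loopless_diff_loop_rel[OF tl_comp_closed[OF that(3,4)] F.H_cm[OF that(1,2)]] by (simp add: eval_loops_comp)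
    show "bilinear_ext (diagram_tensor x y) f g - loopless (tl_tensor x y f' g') \<in> loop_rel q (TensorOb free_TL x x') (TensorOb free_TL y y')"
      if "f \<in> supported (simple_diagrams x y)" "g \<in> supported (simple_diagrams x' y')" "f' \<in> tl_hom x y" "g' \<in> tl_hom x' y'"
        "f - loopless f' \<in> loop_rel q x y" "g - loopless g' \<in> loop_rel q x' y'" for f g f' g'
      using that loopless_diff_loop_rel[OF that(3,1)] loopless_diff_loop_rel[OF that(4,2)]
        loopless_diff_loop_rel[OF tl_tensor_closed[OF that(3,4)] F.H_tn[OF that(1,2), unfolded TensorOb_free_TL]]
      by (simp add: eval_loops_tensor TensorOb_free_TL)
    show "tl_tensor x y f f' \<in> tl_hom (TensorOb free_TL x x') (TensorOb free_TL y y')" if "f \<in> tl_hom x y" "f' \<in> tl_hom x' y'" for f f'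
      using tl_tensor_closed[OF that] by (simp add: TensorOb_free_TL)
  qed (auto simp: supported_add supported_scale tl_comp_closed intro: tl_comp_closed)
qed

lemma linear_category_TL: "linear_category (TL q)"
  by (rule presented_category.linear_category[OF presented_TL])
    (simp_all add: tl_comp_assoc tl_comp_id_left tl_comp_id_right tl_comp_linear)

lemma tl_class_inj:
  assumes "u \<in> tl_hom x y" "v \<in> tl_hom x y" "tl_class q x y u = tl_class q x y v" shows "u = v"
proof -
  have "loopless u \<in> tl_class q x y u" using loopless_hom[OF assms(1)] by (simp add: tl_class_eq)
  then have "loopless u \<in> tl_class q x y v" by (simp only: assms(3))
  then show ?thesis using loopless_hom[OF assms(2)] by (simp add: tl_class_eq)
qed

lemma TL_trace_class:
  assumes u: "u \<in> tl_hom x x"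
  shows "TL_trace q x (tl_class q x x u) = tl_class q 0 0 (Poly_Mapping.single {} (tl_trace (q + inverse q) x u))"
proof -
  let ?d = "q + inverse q" and ?t = "Poly_Mapping.single {} (tl_trace (q + inverse q) x u) :: tl"
  have e: "{} \<in> planar_matchings 0 0" using id_matching_planar[of 0] by simp
  have t: "?t \<in> tl_hom 0 0" by (rule supported_single[OF e])
  have "loop_rel q 0 0 +>\<^bsub>Hom free_TL 0 0\<^esub> linear_ext (diagram_closure x) f = tl_class q 0 0 ?t" if "f \<in> tl_class q x x u" for f
  proof -
    have f: "f \<in> supported (simple_diagrams x x)" "eval_loops ?d f = u" using that loopless_hom[OF u] by (simp_all add: tl_class_eq)
    have "linear_ext (diagram_closure x) f \<in> supported (simple_diagrams 0 0)"
      unfolding linear_ext_lin by (rule supported_lin[OF f(1)]) (auto intro!: supported_single simp: simple_diagrams_iff diagram_closure_pair e)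
    then show ?thesis using loopless_hom[OF t] by (simp add: tl_class_eq eval_loops_closure f(2))
  qed
  moreover have "loopless u \<in> tl_class q x x u" using loopless_hom[OF u] by (simp add: tl_class_eq)
  ultimately show ?thesis unfolding TL_trace_def by blast
qed

text \<open>
  The trace of a class is the class of a multiple of the empty diagram, which determines this multiple.
\<close>

lemma negligible_eq: "negligible q x y = tl_class q x y ` tl_negligible (q + inverse q) x y"
proof -
  interpret T: presented_category "TL q" tl_hom "tl_class q" tl_id "tl_comp (q + inverse q)" "\<lambda>x y x' y'. tl_tensor x y"
    by (rule presented_TL)
  let ?d = "q + inverse q"
  have e: "{} \<in> planar_matchings 0 0" using id_matching_planar[of 0] by simp
  have key: "TL_trace q x (Comp (TL q) x y x (tl_class q y x g) (tl_class q x y u)) = \<zero>\<^bsub>Hom (TL q) 0 0\<^esub>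
      \<longleftrightarrow> tl_trace ?d x (tl_comp ?d x y x g u) = 0" if u: "u \<in> tl_hom x y" and g: "g \<in> tl_hom y x" for u g
  proof -
    have "Poly_Mapping.single {} t \<in> tl_hom 0 0" for t :: complex by (rule supported_single[OF e])
    then have "tl_class q 0 0 (Poly_Mapping.single {} t) = tl_class q 0 0 0 \<longleftrightarrow> t = 0" for t
      using tl_class_inj[of "Poly_Mapping.single {} t" 0 0 0 q] by (metis lookup_single_eq lookup_zero single_zero supported_0)
    then show ?thesis
      unfolding T.Comp[OF u g] TL_trace_class[OF tl_comp_closed[OF u g]] T.zero by simp
  qed
  have "F \<in> negligible q x y \<longleftrightarrow> (\<exists>u \<in> tl_negligible ?d x y. F = tl_class q x y u)" for F
    unfolding negligible_def tl_negligible_def T.Mor using key by auto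
  then show ?thesis by auto
qed

abbreviation mod_class :: "complex \<Rightarrow> nat \<Rightarrow> nat \<Rightarrow> tl \<Rightarrow> (diagram \<Rightarrow>\<^sub>0 complex) set set" where
  "mod_class q x y u \<equiv> negligible q x y +>\<^bsub>Hom (TL q) x y\<^esub> tl_class q x y u"

lemma presented_mod:
  "presented_category (TL_mod_negligible q) tl_hom (mod_class q) tl_id (tl_comp (q + inverse q)) (\<lambda>x y x' y'. tl_tensor x y)"
proof -
  interpret T: presented_category "TL q" tl_hom "tl_class q" tl_id "tl_comp (q + inverse q)" "\<lambda>x y x' y'. tl_tensor x y"
    by (rule presented_TL)
  let ?d = "q + inverse q"
  show ?thesis unfolding TL_mod_negligible_def
  proof (rule T.quotient_presented[where K = "tl_negligible ?d" and emb = "\<lambda>u. u"])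
    show "\<And>x y. negligible q x y = tl_class q x y ` tl_negligible ?d x y" by (rule negligible_eq)
    fix x y x' y' z :: nat
    show "\<exists>u \<in> tl_hom x y. v - u \<in> tl_negligible ?d x y" if "v \<in> tl_hom x y" for v
      by (rule bexI[OF _ that]) simp
    show "tl_comp ?d x y z g f - tl_comp ?d x y z g' f' \<in> tl_negligible ?d x z"
      if "f \<in> tl_hom x y" "g \<in> tl_hom y z" "f' \<in> tl_hom x y" "g' \<in> tl_hom y z"
        "f - f' \<in> tl_negligible ?d x y" "g - g' \<in> tl_negligible ?d y z" for f g f' g'
    proof -
      have "tl_comp ?d x y z g f - tl_comp ?d x y z g' f' = tl_comp ?d x y z (g - g') f + tl_comp ?d x y z g' (f - f')"
        by (simp add: tl_comp_linear)
      then show ?thesis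
        using tl_negligible_add[OF tl_negligible_comp_right[OF that(6,1)] tl_negligible_comp_left[OF that(5,4)]] by (simp only:)
    qed
    show "tl_tensor x y f g - tl_tensor x y f' g' \<in> tl_negligible ?d (TensorOb (TL q) x x') (TensorOb (TL q) y y')"
      if "f \<in> tl_hom x y" "g \<in> tl_hom x' y'" "f' \<in> tl_hom x y" "g' \<in> tl_hom x' y'"
        "f - f' \<in> tl_negligible ?d x y" "g - g' \<in> tl_negligible ?d x' y'" for f g f' g'
    proof -
      have "tl_tensor x y f g - tl_tensor x y f' g' = tl_tensor x y (f - f') g + tl_tensor x y f' (g - g')"
        by (simp add: tl_tensor_diff_left tl_tensor_diff_right)
      then show ?thesis unfolding TensorOb_TL
        using tl_negligible_add[OF tl_negligible_tensor(1)[OF that(5,2)] tl_negligible_tensor(2)[OF that(6,3)]] by (simp only:)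
    qed
    show "tl_negligible ?d x y \<subseteq> tl_hom x y" using tl_negligible_hom by blast
  qed (auto simp: T.H_tn tl_negligible_add tl_negligible_scale supported_add supported_scale intro: tl_comp_closed T.H_tn)
qed

lemma linear_category_mod: "linear_category (TL_mod_negligible q)"
  by (rule presented_category.linear_category[OF presented_mod])
    (simp_all add: tl_comp_assoc tl_comp_id_left tl_comp_id_right tl_comp_linear)

lemma mod_class_eqI:
  assumes "u \<in> tl_hom x y" "v \<in> tl_hom x y" "u - v \<in> tl_negligible (q + inverse q) x y"
  shows "mod_class q x y u = mod_class q x y v"
proof -
  interpret T: presented_category "TL q" tl_hom "tl_class q" tl_id "tl_comp (q + inverse q)" "\<lambda>x y x' y'. tl_tensor x y"
    by (rule presented_TL)
  let ?N = "tl_negligible (q + inverse q) x y"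
  have N: "?N \<subseteq> tl_hom x y" using tl_negligible_hom by blast
  have "w - u \<in> ?N \<longleftrightarrow> w - v \<in> ?N" for w
    using tl_negligible_add[OF _ assms(3), of "w - u"] tl_negligible_add[OF _ tl_negligible_scale[OF assms(3), of "- 1"], of "w - v"] by auto
  then show ?thesis unfolding T.coset[OF negligible_eq N assms(1)] T.coset[OF negligible_eq N assms(2)] by simp
qed

section \<open>Quantum integers at a root of unity\<close>

text \<open>
  The quantum integer \<open>qint q m\<close> is \<open>sin (m * pi / n) / sin (pi / n)\<close>.
\<close>

lemma quantum_numbers_root_of_unity:
  assumes n: "n > 1" and q: "q = exp (of_real pi * \<i> / of_nat n)"
  shows "quantum_numbers (q + inverse q) (qint q) n"
proof -
  have qc: "q = cis (pi / n)" unfolding q cis_conv_exp by (simp add: mult.commute)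
  have ic: "inverse q = cis (- (pi / n))" unfolding qc by (simp add: cis_inverse)
  have num: "q ^ m - inverse q ^ m = 2 * \<i> * of_real (sin (m * pi / n))" for m
    unfolding ic unfolding qc DeMoivre by (simp add: complex_eq_iff)
  have pos: "sin (m * pi / n) > 0" if "1 \<le> m" "m < n" for m :: nat
    using that by (intro sin_gt_zero) (simp_all add: field_simps)
  have den: "q - inverse q \<noteq> 0" using num[of 1] pos[of 1] n by simp
  have q0: "q \<noteq> 0" unfolding qc by simp
  have step: "q ^ (m + 2) - s ^ (m + 2) = (q + s) * (q ^ (m + 1) - s ^ (m + 1)) - (q ^ m - s ^ m)"
    if s: "q * s = 1" for m and s :: complex
  proof -
    have "q * (s * x) = x" "s * (q * x) = x" for x using s by (metis mult.left_commute mult.right_neutral mult.assoc mult.commute)+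
    note cancel = this
    show ?thesis by (simp add: algebra_simps cancel)
  qed
  show ?thesis
  proof
    show "n > 1" by (rule n)
    show "qint q 0 = 0" "qint q 1 = 1" using den by (simp_all add: qint_def)
    fix m
    have "q ^ (m + 2) - inverse q ^ (m + 2)
      = (q + inverse q) * (q ^ (m + 1) - inverse q ^ (m + 1)) - (q ^ m - inverse q ^ m)"
      by (rule step) (simp add: q0)
    then have "qint q (m + 2) = ((q + inverse q) * (q ^ (m + 1) - inverse q ^ (m + 1)) - (q ^ m - inverse q ^ m)) / (q - inverse q)"
      by (simp only: qint_def)
    also have "\<dots> = (q + inverse q) * qint q (m + 1) - qint q m"
      by (simp only: qint_def diff_divide_distrib[symmetric] times_divide_eq_right)
    finally show "qint q (m + 2) = (q + inverse q) * qint q (m + 1) - qint q m" .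
    show "qint q m \<noteq> 0" if "1 \<le> m" "m < n"
      using num[of m] pos[OF that] den by (simp add: qint_def)
  next
    show "qint q n = 0" using num[of n] n by (simp add: qint_def)
  qed
qed

section \<open>Simple objects of the additive completion\<close>

lemma simple_object_iff:
  assumes "linear_category C" "x \<in> Obj C"
  shows "simple_object C x \<longleftrightarrow> Mor C x x = {c \<odot>\<^bsub>Hom C x x\<^esub> Ident C x | c. True}"
proof -
  interpret linear_category C by (rule assms(1))
  show ?thesis using assms(2) span_singleton[OF hom_vectorspace ident_closed, of x] by (simp add: simple_object_def)
qed

lemma disjoint_simple_Mat:
  assumes C: "linear_category C" and S: "disjoint_simple_objects C S"
  shows "disjoint_simple_objects (Mat C) ((\<lambda>s. [s]) ` S)"
proof -
  have O: "s \<in> Obj C" if "s \<in> S" for s using S that by (simp add: disjoint_simple_objects_def simple_object_def)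
  have M: "[s] \<in> Obj (Mat C)" if "s \<in> S" for s using O[OF that] by (simp add: Obj_Mat)
  have Mor: "Mor (Mat C) [a] [b] = (\<lambda>f. mat 1 1 (\<lambda>_. f)) ` Mor C a b" for a b
  proof (intro equalityI subsetI)
    fix A assume "A \<in> Mor (Mat C) [a] [b]"
    then have "A = mat 1 1 (\<lambda>_. A $$ (0, 0))" "A $$ (0, 0) \<in> Mor C a b" by (auto simp: Mor_Mat)
    then show "A \<in> (\<lambda>f. mat 1 1 (\<lambda>_. f)) ` Mor C a b" by blast
  qed (auto simp: Mor_Mat)
  have zero: "\<zero>\<^bsub>Hom (Mat C) [a] [b]\<^esub> = mat 1 1 (\<lambda>_. \<zero>\<^bsub>Hom C a b\<^esub>)" for a b
    by (rule eq_matI) (simp_all add: Hom_Mat)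
  have smult: "c \<odot>\<^bsub>Hom (Mat C) [a] [a]\<^esub> Ident (Mat C) [a] = mat 1 1 (\<lambda>_. c \<odot>\<^bsub>Hom C a a\<^esub> Ident C a)" for a c
    by (rule eq_matI) (simp_all add: Hom_Mat Ident_Mat)
  have simple: "simple_object (Mat C) [s]" if s: "s \<in> S" for s
  proof -
    have "Mor C s s = {c \<odot>\<^bsub>Hom C s s\<^esub> Ident C s | c. True}"
      using S s simple_object_iff[OF C O[OF s]] by (simp add: disjoint_simple_objects_def)
    then show ?thesis unfolding simple_object_iff[OF linear_category_Mat[OF C] M[OF s]] Mor smult by auto
  qed
  have "Mor (Mat C) [s] [t] = {\<zero>\<^bsub>Hom (Mat C) [s] [t]\<^esub>}" if "s \<in> S" "t \<in> S" "s \<noteq> t" for s t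
  proof -
    have "Mor C s t = {\<zero>\<^bsub>Hom C s t\<^esub>}" using S that by (simp add: disjoint_simple_objects_def)
    then show ?thesis unfolding Mor zero by simp
  qed
  then show ?thesis using simple unfolding disjoint_simple_objects_def by auto
qed

lemma disjoint_simple_full_subcat:
  assumes "disjoint_simple_objects C S" "S \<subseteq> T"
  shows "disjoint_simple_objects (full_subcat C T) S"
  using assms by (auto simp: disjoint_simple_objects_def simple_object_def full_subcat_def)

lemma is_biproduct_Mat_concat:
  assumes C: "linear_category C" and xs: "set xs \<subseteq> Obj (Mat C)"
  shows "is_biproduct (Mat C) xs (concat xs)"
  using xs
proof (induct xs)
  case Nil
  then show ?case using is_biproduct_Mat_Nil[OF C] by simp
next
  case (Cons x xs)
  interpret M: linear_category "Mat C" by (rule linear_category_Mat[OF C])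
  have "set y \<subseteq> Obj C" if "y \<in> set xs" for y using subsetD[OF Cons(2), of y] that by (simp add: Obj_Mat)
  then have c: "concat xs \<in> Obj (Mat C)" by (auto simp: Obj_Mat)
  have x: "x \<in> Obj (Mat C)" and xs: "set xs \<subseteq> Obj (Mat C)" using Cons(2) by simp_all
  have "x @ concat xs \<in> Obj (Mat C)" using x c by (simp add: Obj_Mat)
  from M.is_biproduct_append[OF M.is_biproduct_single[OF x] Cons(1)[OF xs] is_biproduct_Mat_append[OF C x c] _ xs x c this]
  show ?case using x by simp
qed

text \<open>
  A formal sum is the biproduct of its one-term parts, so the decompositions of its summands can be concatenated.
\<close>

lemma decompose_Mat:
  assumes C: "linear_category C" and S: "S \<subseteq> Obj C"
    and dec: "\<And>x. x \<in> Obj C \<Longrightarrow> \<exists>ss. set ss \<subseteq> S \<and> is_biproduct C ss x"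
    and xs: "xs \<in> Obj (Mat C)"
  shows "\<exists>ss. set ss \<subseteq> (\<lambda>s. [s]) ` S \<and> is_biproduct (Mat C) ss xs"
  using xs
proof (induct xs)
  case Nil
  then show ?case using is_biproduct_Mat_Nil[OF C] by (intro exI[of _ "[]"]) simp
next
  case (Cons x xs)
  interpret M: linear_category "Mat C" by (rule linear_category_Mat[OF C])
  have x: "x \<in> Obj C" "[x] \<in> Obj (Mat C)" and xs: "xs \<in> Obj (Mat C)" and xxs: "[x] @ xs \<in> Obj (Mat C)"
    using Cons(2) by (simp_all add: Obj_Mat)
  obtain ss where ss: "set ss \<subseteq> S" "is_biproduct C ss x" using dec[OF x(1)] by blast
  obtain ts where ts: "set ts \<subseteq> (\<lambda>s. [s]) ` S" "is_biproduct (Mat C) ts xs" using Cons(1)[OF xs] by blast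
  have SO: "(\<lambda>s. [s]) ` S \<subseteq> Obj (Mat C)" using S by (auto simp: Obj_Mat)
  have sS: "set (map (\<lambda>s. [s]) ss) \<subseteq> (\<lambda>s. [s]) ` S" using ss(1) by auto
  have "is_biproduct (Mat C) (map (\<lambda>s. [s]) ss @ ts) ([x] @ xs)"
    by (rule M.is_biproduct_append[OF is_biproduct_Mat_singleton[OF C ss(2) order_trans[OF ss(1) S] x(1)] ts(2)
          is_biproduct_Mat_append[OF C x(2) xs] order_trans[OF sS SO] order_trans[OF ts(1) SO] x(2) xs xxs])
  then show ?case using sS ts(1) by (intro exI[of _ "map (\<lambda>s. [s]) ss @ ts"]) simp
qed

section \<open>The Temperley-Lieb-Jones category\<close>

locale root_of_unity =
  fixes n :: nat and q :: complex
  assumes n_gt: "n > 1" and q_def: "q = exp (of_real pi * \<i> / of_nat n)"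
begin

sublocale quantum_numbers "q + inverse q" "qint q" n
  by (rule quantum_numbers_root_of_unity[OF n_gt q_def])

sublocale TL: presented_category "TL q" tl_hom "tl_class q" tl_id "tl_comp (q + inverse q)" "\<lambda>x y x' y'. tl_tensor x y"
  by (rule presented_TL)

abbreviation C :: "(nat, (diagram \<Rightarrow>\<^sub>0 complex) set set) tensor_cat" where
  "C \<equiv> TL_mod_negligible q"

sublocale P: presented_category C tl_hom "mod_class q" tl_id "tl_comp (q + inverse q)" "\<lambda>x y x' y'. tl_tensor x y"
  by (rule presented_mod)

sublocale C: linear_category C
  by (rule linear_category_mod)

sublocale K: linear_category "Kar C"
  by (rule linear_category_Kar[OF linear_category_mod])

lemma tl_class_minus:
  assumes v: "v \<in> tl_hom x y" and w: "w \<in> tl_hom x y"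
  shows "tl_class q x y v \<ominus>\<^bsub>Hom (TL q) x y\<^esub> tl_class q x y w = tl_class q x y (v - w)"
proof -
  interpret L: linear_category "TL q" by (rule linear_category_TL)
  have "x \<in> Obj (TL q)" "y \<in> Obj (TL q)" by (simp_all add: TL.Obj)
  note G = L.hom_group[OF this]
  have "\<ominus>\<^bsub>Hom (TL q) x y\<^esub> tl_class q x y w = tl_class q x y (- w)"
    by (rule abelian_group.minus_equality[OF G])
      (simp_all only: TL.add[OF TL.H_uminus[OF w] w] TL.zero TL.Mor_\<kappa>[OF w] TL.Mor_\<kappa>[OF TL.H_uminus[OF w]] left_minus)
  then show ?thesis unfolding a_minus_def using TL.add[OF v TL.H_uminus[OF w]] by simp
qed

lemma jones_wenzl_class: "jones_wenzl q m = tl_class q m m (p m)"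
proof (induct m rule: induct_nat_012)
  case 0
  then show ?case by (simp only: jones_wenzl.simps TL.Ident tl_jw.simps)
next
  case 1
  then show ?case by (simp only: jones_wenzl.simps TL.Ident tl_jw.simps One_nat_def)
next
  case (ge2 k)
  have k: "k + 1 + 1 = k + 2" "Suc (Suc k) = k + 2" "Suc k = k + 1" by simp_all
  have P: "TensorMor (TL q) (k + 1) (k + 1) 1 1 (jones_wenzl q (k + 1)) (Ident (TL q) 1) = tl_class q (k + 2) (k + 2) (pad k)"
    using ge2(2) TL.Tensor[OF p_hom[of "k + 1"] tl_id_closed[of 1]] unfolding TensorOb_TL TL.Ident pad_def k by (simp only:)
  have U: "TL_diagram q (k + 2) (k + 2) (U_matching (k + 1)) = tl_class q (k + 2) (k + 2) (turn k)"
    by (simp add: TL_diagram_def loopless_def turn_def)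
  note UP = TL.H_cm[OF pad_hom turn_hom, of k]
  note PUP = TL.H_cm[OF UP pad_hom]
  show ?case
    unfolding k(2) unfolding p_step jones_wenzl.simps(3)[of q k, unfolded k(2)] Let_def k P U
      TL.Comp[OF pad_hom turn_hom] TL.Comp[OF UP pad_hom] TL.smult[OF PUP]
    by (rule tl_class_minus[OF pad_hom TL.H_scale[OF PUP]])
qed

abbreviation simple :: "nat \<Rightarrow> nat \<times> (diagram \<Rightarrow>\<^sub>0 complex) set set" where
  "simple i \<equiv> (i, mod_class q i i (p i))"

lemma JW_object_simple: "JW_object q i = [simple i]"
  by (simp only: JW_object_def jones_wenzl_class)

lemma Obj_C [simp]: "x \<in> Obj C"
  by (simp add: P.Obj)

lemma simple_Kar: "i < n \<Longrightarrow> simple i \<in> Obj (Kar C)"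
  unfolding Obj_Kar using P.Comp[OF p_hom p_hom] p_idem by (simp add: P.Mor_\<kappa>[OF p_hom])

text \<open>
  The equations that define morphisms between idempotents hold modulo negligible combinations. They hold
  exactly for the name that is obtained from a given one by composing with both idempotents.
\<close>

lemma Mor_simple:
  assumes k: "k < n" and l: "l < n" and F: "F \<in> Mor (Kar C) (simple k) (simple l)"
  obtains f where "f \<in> tl_hom k l" "F = mod_class q k l f" "cmp k k l f (p k) = f" "cmp k l l (p l) f = f"
proof -
  obtain f where f: "f \<in> tl_hom k l" "F = mod_class q k l f" using F unfolding Mor_Kar P.Mor by blast
  let ?fp = "cmp k k l f (p k)"
  have fp: "?fp \<in> tl_hom k l" by (rule P.H_cm[OF p_hom f(1)])
  have pfp: "cmp k l l (p l) ?fp \<in> tl_hom k l" by (rule P.H_cm[OF fp p_hom])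
  have "Comp C k k l F (mod_class q k k (p k)) = F" "Comp C k l l (mod_class q l l (p l)) F = F"
    using F unfolding Mor_Kar by blast+
  then have "F = mod_class q k l (cmp k l l (p l) ?fp)"
    unfolding f(2) P.Comp[OF p_hom f(1)] by (metis P.Comp[OF fp p_hom])
  moreover have "cmp k k l (cmp k l l (p l) ?fp) (p k) = cmp k l l (p l) ?fp"
    unfolding tl_comp_assoc[OF p_hom fp p_hom, symmetric] tl_comp_assoc[OF p_hom p_hom f(1), symmetric] p_idem[OF k] ..
  moreover have "cmp k l l (p l) (cmp k l l (p l) ?fp) = cmp k l l (p l) ?fp"
    using tl_comp_assoc[OF fp p_hom p_hom] p_idem[OF l] by simp
  ultimately show ?thesis using that pfp by blast
qed

lemma disjoint_simple: "disjoint_simple_objects (Kar C) (simple ` {..n - 2})"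
proof -
  have less: "i < n" if "i \<le> n - 2" for i using that n_gt by simp
  have "simple_object (Kar C) (simple i)" if "i \<le> n - 2" for i
    unfolding simple_object_iff[OF K.linear_category_axioms simple_Kar[OF less[OF that]]]
  proof (intro equalityI subsetI)
    note i = less[OF that]
    fix F assume "F \<in> Mor (Kar C) (simple i) (simple i)"
    then obtain f where f: "f \<in> tl_hom i i" "F = mod_class q i i f" "cmp i i i f (p i) = f"
      using Mor_simple[OF i i] by metis
    have "f = scale (Poly_Mapping.lookup f (id_matching i)) (p i)" using p_schur[OF i f(1)] f(3) by simp
    then have "F = Poly_Mapping.lookup f (id_matching i) \<odot>\<^bsub>Hom C i i\<^esub> mod_class q i i (p i)"
      unfolding f(2) P.smult[OF p_hom] by (rule arg_cong)
    then show "F \<in> {c \<odot>\<^bsub>Hom (Kar C) (simple i) (simple i)\<^esub> Ident (Kar C) (simple i) | c. True}"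
      unfolding Hom_Kar Ident_Kar by blast
  next
    fix F assume "F \<in> {c \<odot>\<^bsub>Hom (Kar C) (simple i) (simple i)\<^esub> Ident (Kar C) (simple i) | c. True}"
    then show "F \<in> Mor (Kar C) (simple i) (simple i)"
      using K.hom_smult_closed[OF _ _ K.ident_closed] simple_Kar[OF less[OF that]] by blast
  qed
  moreover have "Mor (Kar C) (simple k) (simple l) = {\<zero>\<^bsub>Hom (Kar C) (simple k) (simple l)\<^esub>}"
    if "k \<le> n - 2" "l \<le> n - 2" "k \<noteq> l" for k l
  proof (intro equalityI subsetI)
    note kl = less[OF that(1)] less[OF that(2)]
    fix F assume "F \<in> Mor (Kar C) (simple k) (simple l)"
    then obtain f where f: "f \<in> tl_hom k l" "F = mod_class q k l f" "cmp k k l f (p k) = f" "cmp k l l (p l) f = f"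
      using Mor_simple[OF kl] by metis
    then have "f = 0" using p_disjoint[OF kl that(3)] by blast
    then show "F \<in> {\<zero>\<^bsub>Hom (Kar C) (simple k) (simple l)\<^esub>}" unfolding f(2) Hom_Kar P.zero by simp
  qed (use K.hom_zero_closed simple_Kar less that in blast)
  ultimately show ?thesis unfolding disjoint_simple_objects_def by auto
qed

lemma finsum_mod_class:
  assumes e: "e \<in> Obj (Kar C)" "fst e = x" and A: "finite A"
    and f: "\<And>i. i \<in> A \<Longrightarrow> f i \<in> tl_hom x x" "\<And>i. i \<in> A \<Longrightarrow> mod_class q x x (f i) \<in> Mor (Kar C) e e"
  shows "(\<Oplus>\<^bsub>Hom (Kar C) e e\<^esub>i\<in>A. mod_class q x x (f i)) = mod_class q x x (\<Sum>i\<in>A. f i)"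
proof -
  obtain E where E: "e = (x, E)" using e(2) by (cases e) simp
  interpret V: abelian_monoid "Hom (Kar C) e e" by (rule K.hom_monoid[OF e(1,1)])
  show ?thesis using A f
  proof (induct A rule: finite_induct)
    case empty
    have "\<zero>\<^bsub>Hom (Kar C) e e\<^esub> = mod_class q x x 0" unfolding E Hom_Kar P.zero ..
    then show ?case by (simp only: V.finsum_empty sum.empty)
  next
    case (insert a A)
    have "(\<Oplus>\<^bsub>Hom (Kar C) e e\<^esub>i\<in>insert a A. mod_class q x x (f i))
      = mod_class q x x (f a) \<oplus>\<^bsub>Hom (Kar C) e e\<^esub> (\<Oplus>\<^bsub>Hom (Kar C) e e\<^esub>i\<in>A. mod_class q x x (f i))"
      using insert by (intro V.finsum_insert) auto
    also have "\<dots> = mod_class q x x (f a) \<oplus>\<^bsub>Hom C x x\<^esub> mod_class q x x (\<Sum>i\<in>A. f i)"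
      using insert unfolding E Hom_Kar by (metis insertCI)
    also have "\<dots> = mod_class q x x (f a + (\<Sum>i\<in>A. f i))"
    proof (rule P.add)
      show "f a \<in> tl_hom x x" using insert by simp
      show "(\<Sum>i\<in>A. f i) \<in> tl_hom x x" by (rule P.H_sum) (use insert in simp)
    qed
    finally show ?case unfolding sum.insert[OF insert(1,2)] .
  qed
qed

text \<open>
  Cutting the resolution of the identity of \<open>x\<close> on both sides by an idempotent \<open>E\<close> gives a
  resolution of \<open>E\<close>, which is the identity of the object \<open>(x, E)\<close>.
\<close>

lemma decompose_Kar:
  assumes e: "e \<in> Obj (Kar C)"
  shows "\<exists>ss. set ss \<subseteq> simple ` {..n - 2} \<and> is_biproduct (Kar C) ss e"
proof -
  obtain x E where xE: "e = (x, E)" by (cases e)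
  have EM: "E \<in> Mor C x x" and EE: "Comp C x x x E E = E" using e unfolding xE Obj_Kar by simp_all
  obtain a where a: "a \<in> tl_hom x x" "E = mod_class q x x a" using EM unfolding P.Mor by blast
  obtain ts where ts: "\<And>k u v. (k, u, v) \<in> set ts \<Longrightarrow> k \<le> n - 2 \<and> u \<in> tl_hom k x \<and> v \<in> tl_hom x k"
    and res: "tl_id x - sum_list (map (factored x) ts) \<in> tl_negligible (q + inverse q) x x"
    using resolved_id[of x] unfolding resolved_def by blast
  define s u v where "s i = fst (ts ! i)" and "u i = fst (snd (ts ! i))" and "v i = snd (snd (ts ! i))" for i
  have t: "s i \<le> n - 2" "s i < n" "u i \<in> tl_hom (s i) x" "v i \<in> tl_hom x (s i)" "factored x (ts ! i) \<in> tl_hom x x"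
    "factored x (ts ! i) = cmp x (s i) x (cmp (s i) (s i) x (u i) (p (s i))) (cmp x (s i) (s i) (p (s i)) (v i))"
    if "i < length ts" for i
  proof -
    have "(s i, u i, v i) \<in> set ts" using nth_mem[OF that] by (simp add: s_def u_def v_def)
    from ts[OF this] show s: "s i \<le> n - 2" "u i \<in> tl_hom (s i) x" "v i \<in> tl_hom x (s i)" by simp_all
    then show sn: "s i < n" using n_gt by simp
    have F: "factored x (ts ! i) = cmp x (s i) x (u i) (cmp x (s i) (s i) (p (s i)) (v i))"
      by (simp add: factored_def s_def u_def v_def case_prod_beta)
    show "factored x (ts ! i) \<in> tl_hom x x" unfolding F by (intro P.H_cm[OF _ s(2)] P.H_cm[OF s(3) p_hom])
    show "factored x (ts ! i) = cmp x (s i) x (cmp (s i) (s i) x (u i) (p (s i))) (cmp x (s i) (s i) (p (s i)) (v i))"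
      unfolding F tl_comp_assoc[OF P.H_cm[OF s(3) p_hom] p_hom s(2), symmetric]
        tl_comp_assoc[OF s(3) p_hom p_hom] p_idem[OF sn] ..
  qed
  define U V where "U i = Comp C (s i) x x E (mod_class q (s i) x (cmp (s i) (s i) x (u i) (p (s i))))"
    and "V i = Comp C x x (s i) (mod_class q x (s i) (cmp x (s i) (s i) (p (s i)) (v i))) E" for i
  have up: "cmp (s i) (s i) x (u i) (p (s i)) \<in> tl_hom (s i) x" and pv: "cmp x (s i) (s i) (p (s i)) (v i) \<in> tl_hom x (s i)"
    if "i < length ts" for i
    using t(3,4)[OF that] by (auto intro: P.H_cm p_hom)
  have U: "U i \<in> Mor (Kar C) (simple (s i)) e" if i: "i < length ts" for i
  proof -
    note M = P.Mor_\<kappa>[OF up[OF i]]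
    have "Comp C (s i) (s i) x (mod_class q (s i) x (cmp (s i) (s i) x (u i) (p (s i)))) (mod_class q (s i) (s i) (p (s i)))
      = mod_class q (s i) x (cmp (s i) (s i) x (u i) (p (s i)))"
      unfolding P.Comp[OF p_hom up[OF i]] tl_comp_assoc[OF p_hom p_hom t(3)[OF i], symmetric] p_idem[OF t(2)[OF i]] ..
    then show ?thesis
      unfolding xE Mor_Kar U_def
      using C.comp_closed[OF Obj_C Obj_C Obj_C M EM] C.comp_assoc[OF Obj_C Obj_C Obj_C Obj_C M EM EM]
        C.comp_assoc[OF Obj_C Obj_C Obj_C Obj_C P.Mor_\<kappa>[OF p_hom] M EM] by (simp add: EE)
  qed
  have V: "V i \<in> Mor (Kar C) e (simple (s i))" if i: "i < length ts" for i
  proof -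
    note M = P.Mor_\<kappa>[OF pv[OF i]]
    have "Comp C x (s i) (s i) (mod_class q (s i) (s i) (p (s i))) (mod_class q x (s i) (cmp x (s i) (s i) (p (s i)) (v i)))
      = mod_class q x (s i) (cmp x (s i) (s i) (p (s i)) (v i))"
      unfolding P.Comp[OF pv[OF i] p_hom] tl_comp_assoc[OF t(4)[OF i] p_hom p_hom] p_idem[OF t(2)[OF i]] ..
    then show ?thesis
      unfolding xE Mor_Kar V_def
      using C.comp_closed[OF Obj_C Obj_C Obj_C EM M] C.comp_assoc[OF Obj_C Obj_C Obj_C Obj_C EM EM M]
        C.comp_assoc[OF Obj_C Obj_C Obj_C Obj_C EM M P.Mor_\<kappa>[OF p_hom]] by (simp add: EE)
  qed
  let ?w = "\<lambda>i. cmp x x x a (cmp x x x (factored x (ts ! i)) a)"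
  have wH: "?w i \<in> tl_hom x x" if "i < length ts" for i
    by (intro P.H_cm[OF _ a(1)] P.H_cm[OF a(1)] t(5)[OF that])
  have UV: "Comp (Kar C) e (simple (s i)) e (U i) (V i) = mod_class q x x (?w i)" if i: "i < length ts" for i
  proof -
    note ua = P.H_cm[OF up[OF i] a(1)] and va = P.H_cm[OF a(1) pv[OF i]]
    have "cmp x (s i) x (cmp (s i) x x a (cmp (s i) (s i) x (u i) (p (s i)))) (cmp x x (s i) (cmp x (s i) (s i) (p (s i)) (v i)) a) = ?w i"
      unfolding t(6)[OF i] tl_comp_assoc[OF va up[OF i] a(1), symmetric] tl_comp_assoc[OF a(1) pv[OF i] up[OF i]] ..
    then show ?thesis
      unfolding xE Comp_Kar U_def V_def a(2) P.Comp[OF up[OF i] a(1)] P.Comp[OF a(1) pv[OF i]] P.Comp[OF va ua] by simp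
  qed
  let ?t = "sum_list (map (factored x) ts)"
  have t_sum: "?t = (\<Sum>i\<in>{..<length ts}. factored x (ts ! i))"
    by (simp add: sum_list_sum_nth atLeast0LessThan)
  have tH: "?t \<in> tl_hom x x" unfolding t_sum by (rule P.H_sum) (use t(5) in simp)
  have "(\<Oplus>\<^bsub>Hom (Kar C) e e\<^esub>i\<in>{..<length ts}. Comp (Kar C) e (simple (s i)) e (U i) (V i))
    = (\<Oplus>\<^bsub>Hom (Kar C) e e\<^esub>i\<in>{..<length ts}. mod_class q x x (?w i))"
    by (rule K.finsum_mor_cong[OF e e])
      (use UV K.comp_closed[OF e _ e V U] simple_Kar[OF t(2)] in auto)
  also have "\<dots> = mod_class q x x (\<Sum>i\<in>{..<length ts}. ?w i)"
  proof (rule finsum_mod_class[OF e])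
    fix i assume "i \<in> {..<length ts}"
    then have i: "i < length ts" by simp
    show "?w i \<in> tl_hom x x" by (rule wH[OF i])
    show "mod_class q x x (?w i) \<in> Mor (Kar C) e e"
      unfolding UV[OF i, symmetric] by (rule K.comp_closed[OF e simple_Kar[OF t(2)[OF i]] e V[OF i] U[OF i]])
  qed (simp_all add: xE)
  also have "(\<Sum>i\<in>{..<length ts}. ?w i) = cmp x x x a (cmp x x x ?t a)"
    unfolding t_sum tl_comp_sum_left tl_comp_sum_right ..
  also have "mod_class q x x (cmp x x x a (cmp x x x ?t a)) = Comp C x x x E (Comp C x x x (mod_class q x x ?t) E)"
    unfolding a(2) P.Comp[OF a(1) tH] P.Comp[OF P.H_cm[OF a(1) tH] a(1)] ..
  also have "mod_class q x x ?t = Ident C x"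
    unfolding P.Ident by (rule mod_class_eqI[OF tl_id_closed tH res, symmetric])
  also have "Comp C x x x E (Comp C x x x (Ident C x) E) = Ident (Kar C) e"
    unfolding C.comp_ident_left[OF Obj_C Obj_C EM] EE xE Ident_Kar ..
  finally have "Ident (Kar C) e = (\<Oplus>\<^bsub>Hom (Kar C) e e\<^esub>i\<in>{..<length ts}. Comp (Kar C) e (simple (s i)) e (U i) (V i))" by simp
  then show ?thesis by (intro K.split_identity[OF disjoint_simple e _ U V]) (use t(1) in auto)
qed

text \<open>By the interchange law, tensor products of idempotents are idempotent.\<close>

lemma TensorOb_Kar: "a \<in> Obj (Kar C) \<Longrightarrow> b \<in> Obj (Kar C) \<Longrightarrow> TensorOb (Kar C) a b \<in> Obj (Kar C)"
proof -
  assume "a \<in> Obj (Kar C)" "b \<in> Obj (Kar C)"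
  then obtain x y f g where ab: "a = (x, mod_class q x x f)" "b = (y, mod_class q y y g)"
    and f: "f \<in> tl_hom x x" "mod_class q x x (cmp x x x f f) = mod_class q x x f"
    and g: "g \<in> tl_hom y y" "mod_class q y y (cmp y y y g g) = mod_class q y y g"
    by (cases a; cases b) (auto simp: Obj_Kar P.Mor P.Comp)
  note ff = P.H_cm[OF f(1,1)] and gg = P.H_cm[OF g(1,1)] and fg = P.H_tn[OF f(1) g(1), unfolded TensorOb_mod]
  note T = P.Tensor[unfolded TensorOb_mod]
  have "Comp C (x + y) (x + y) (x + y) (mod_class q (x + y) (x + y) (tl_tensor x x f g)) (mod_class q (x + y) (x + y) (tl_tensor x x f g))
    = mod_class q (x + y) (x + y) (tl_tensor x x (cmp x x x f f) (cmp y y y g g))"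
    unfolding P.Comp[OF fg fg] tl_interchange[OF f(1) g(1) f(1) g(1)] ..
  also have "\<dots> = mod_class q (x + y) (x + y) (tl_tensor x x f g)"
    unfolding T[OF ff gg, symmetric] f(2) g(2) unfolding T[OF f(1) g(1)] ..
  finally have "(x + y, mod_class q (x + y) (x + y) (tl_tensor x x f g)) \<in> Obj (Kar C)"
    unfolding Obj_Kar using P.Mor_\<kappa>[OF fg] by simp
  moreover have "TensorOb (Kar C) a b = (x + y, mod_class q (x + y) (x + y) (tl_tensor x x f g))"
    unfolding ab Kar_def using T[OF f(1) g(1)] by (simp add: TensorOb_mod)
  ultimately show ?thesis by simp
qed

lemma TLJ_objects_Mat: "TLJ_objects n q \<subseteq> Obj (Mat (Kar C))"
proof
  fix x assume "x \<in> TLJ_objects n q"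
  then show "x \<in> Obj (Mat (Kar C))"
  proof induct
    case (JW i)
    then show ?case using simple_Kar[of i] n_gt by (simp add: JW_object_simple Obj_Mat)
  next
    case (tensor a b)
    then have "set a \<subseteq> Obj (Kar C)" "set b \<subseteq> Obj (Kar C)" by (simp_all add: Obj_Mat)
    then show ?case by (auto simp: Obj_Mat Mat_def intro!: TensorOb_Kar)
  qed (simp_all add: Obj_Mat)
qed

lemma Obj_TLJ: "Obj (TLJ n q) = TLJ_objects n q"
  by (simp add: TLJ_def full_subcat_def)

lemma concat_TLJ_objects: "set xs \<subseteq> TLJ_objects n q \<Longrightarrow> concat xs \<in> TLJ_objects n q"
  by (induct xs) (simp_all add: TLJ_objects.zero TLJ_objects.sum)

lemma simple_objects_TLJ: "{JW_object q i | i. i \<le> n - 2} = (\<lambda>s. [s]) ` simple ` {..n - 2}"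
  by (auto simp: JW_object_simple)

lemma semisimple_with_TLJ: "semisimple_with (TLJ n q) {JW_object q i | i. i \<le> n - 2}"
proof -
  let ?S = "{JW_object q i | i. i \<le> n - 2}"
  have S: "?S \<subseteq> TLJ_objects n q" by (auto intro: TLJ_objects.JW)
  have SK: "simple ` {..n - 2} \<subseteq> Obj (Kar C)" using simple_Kar n_gt by auto
  have "disjoint_simple_objects (TLJ n q) ?S"
    unfolding TLJ_def by (rule disjoint_simple_full_subcat[OF _ S])
      (simp only: simple_objects_TLJ disjoint_simple_Mat[OF K.linear_category_axioms disjoint_simple])
  moreover have "\<exists>ss. set ss \<subseteq> ?S \<and> (\<exists>b \<in> Obj (TLJ n q). is_biproduct (TLJ n q) ss b \<and> isomorphic (TLJ n q) x b)"
    if "x \<in> Obj (TLJ n q)" for x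
  proof -
    interpret M: linear_category "Mat (Kar C)" by (rule linear_category_Mat[OF K.linear_category_axioms])
    have x: "x \<in> TLJ_objects n q" "x \<in> Obj (Mat (Kar C))"
      using that TLJ_objects_Mat by (auto simp: Obj_TLJ)
    obtain ss where ss: "set ss \<subseteq> ?S" "is_biproduct (Mat (Kar C)) ss x"
      using decompose_Mat[OF K.linear_category_axioms SK decompose_Kar x(2)] unfolding simple_objects_TLJ by blast
    have "isomorphic (Mat (Kar C)) x x"
      unfolding isomorphic_def using M.ident_closed[OF x(2)] M.comp_ident_left[OF x(2,2) M.ident_closed[OF x(2)]] by blast
    then show ?thesis
      using ss that by (auto simp: TLJ_def is_biproduct_full_subcat isomorphic_full_subcat)
  qed
  ultimately show ?thesis unfolding semisimple_with_def by blast
qed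

lemma has_biproducts_TLJ: "has_biproducts (TLJ n q)"
  unfolding has_biproducts_def
proof (intro allI impI)
  fix xs assume "set xs \<subseteq> Obj (TLJ n q)"
  then have xs: "set xs \<subseteq> TLJ_objects n q" by (simp add: Obj_TLJ)
  then have "is_biproduct (Mat (Kar C)) xs (concat xs)"
    using is_biproduct_Mat_concat[OF K.linear_category_axioms] TLJ_objects_Mat by (meson order_trans)
  then show "\<exists>b \<in> Obj (TLJ n q). is_biproduct (TLJ n q) xs b"
    unfolding Obj_TLJ unfolding TLJ_def is_biproduct_full_subcat using concat_TLJ_objects[OF xs] by blast
qed

lemma linear_category_TLJ: "linear_category (TLJ n q)"
  unfolding TLJ_def
  by (rule linear_category_full_subcat[OF linear_category_Mat[OF K.linear_category_axioms] TLJ_objects_Mat])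

end

theorem theorem5p4p5:
  fixes n :: nat and q :: complex
  assumes "n > 1" and "q = exp (of_real pi * \<i> / of_nat n)"
  shows "semisimple (TLJ n q) \<and> semisimple_with (TLJ n q) {JW_object q i | i. i \<le> n - 2}"
proof -
  interpret root_of_unity n q by (rule root_of_unity.intro[OF assms])
  show ?thesis
    unfolding semisimple_def using linear_category_TLJ has_biproducts_TLJ semisimple_with_TLJ by blast
qed

end
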